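(* The Sex-Equal Stable Marriage (SESM) and Balanced Stable Marriage (BSM) problems are both solvable in time $2^{\mathtt{tw}}\cdot n^6$, where $\mathtt{tw}$ is the treewidth of the rotation digraph.
   Context: An instance of Stable Marriage (SM) consists of a set of men $M$ and a set of women $W$ (agents $A=M\cup W$, $n=|A|$), where each agent $a$ has a strict (injective) preference list $\mathsf{p}_a$ over a subset of agents of the opposite sex (smaller value = more preferred); acceptability is symmetric. A matching is stable if every matched pair is mutually acceptable and there is no blocking pair. For a stable matching $\mu$, $\mathsf{sat}_M(\mu)=\sum_{(m,w)\in\mu}\mathsf{p}_m(w)$ and $\mathsf{sat}_W(\mu)=\sum_{(m,w)\in\mu}\mathsf{p}_w(m)$. SESM: find a stable matching minimizing $|\mathsf{sat}_M(\mu)-\mathsf{sat}_W(\mu)|$. BSM: find a stable matching minimizing $\max\{\mathsf{sat}_M(\mu),\mathsf{sat}_W(\mu)\}$. Rotations are the standard operations of Irving and Leather transforming one stable matching into another (starting from the man-optimal stable matching); the rotation poset orders rotations by precedence, and the rotation digraph is the minimum-size DAG whose transitive closure is isomorphic to the rotation poset. The treewidth of the rotation digraph means the treewidth of its underlying undirected graph; a tree decomposition of that width is assumed given. *)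

theory Defs
  imports Complex_Main
begin

section \<open>Stable Marriage\<close>

text \<open>
  Men and women are numbered from \<open>0\<close>. The preference list of an agent enumerates the acceptable
  agents of the opposite sex, most preferred first.
\<close>

record sm =
  mprefs :: "nat list list"
  wprefs :: "nat list list"

type_synonym matching = "(nat \<times> nat) set"

definition num_men :: "sm \<Rightarrow> nat" where
  "num_men I = length (mprefs I)"

definition num_women :: "sm \<Rightarrow> nat" where
  "num_women I = length (wprefs I)"

definition num_agents :: "sm \<Rightarrow> nat" where
  "num_agents I = num_men I + num_women I"

definition sm_instance :: "sm \<Rightarrow> bool" where
  "sm_instance I \<longleftrightarrow>
     (\<forall>m < num_men I. distinct (mprefs I ! m) \<and> set (mprefs I ! m) \<subseteq> {..<num_women I}) \<and>
     (\<forall>w < num_women I. distinct (wprefs I ! w) \<and> set (wprefs I ! w) \<subseteq> {..<num_men I}) \<and>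
     (\<forall>m < num_men I. \<forall>w < num_women I. w \<in> set (mprefs I ! m) \<longleftrightarrow> m \<in> set (wprefs I ! w))"

text \<open>Positions are counted from \<open>1\<close>; the function is only meaningful for members of the list.\<close>

definition pos :: "nat list \<Rightarrow> nat \<Rightarrow> nat" where
  "pos xs x = length (takeWhile (\<lambda>y. y \<noteq> x) xs) + 1"

definition mpos :: "sm \<Rightarrow> nat \<Rightarrow> nat \<Rightarrow> nat" where
  "mpos I m w = pos (mprefs I ! m) w"

definition wpos :: "sm \<Rightarrow> nat \<Rightarrow> nat \<Rightarrow> nat" where
  "wpos I w m = pos (wprefs I ! w) m"

definition acceptable :: "sm \<Rightarrow> nat \<Rightarrow> nat \<Rightarrow> bool" where
  "acceptable I m w \<longleftrightarrow> m < num_men I \<and> w < num_women I \<and>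
     w \<in> set (mprefs I ! m) \<and> m \<in> set (wprefs I ! w)"

definition is_matching :: "matching \<Rightarrow> bool" where
  "is_matching \<mu> \<longleftrightarrow>
     (\<forall>(m, w) \<in> \<mu>. \<forall>(m', w') \<in> \<mu>. m = m' \<longleftrightarrow> w = w')"

text \<open>Every agent prefers any acceptable partner to being unmatched.\<close>

definition man_prefers :: "sm \<Rightarrow> matching \<Rightarrow> nat \<Rightarrow> nat \<Rightarrow> bool" where
  "man_prefers I \<mu> m w \<longleftrightarrow> (\<forall>w'. (m, w') \<in> \<mu> \<longrightarrow> mpos I m w < mpos I m w')"

definition woman_prefers :: "sm \<Rightarrow> matching \<Rightarrow> nat \<Rightarrow> nat \<Rightarrow> bool" where
  "woman_prefers I \<mu> w m \<longleftrightarrow> (\<forall>m'. (m', w) \<in> \<mu> \<longrightarrow> wpos I w m < wpos I w m')"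

definition blocking :: "sm \<Rightarrow> matching \<Rightarrow> nat \<Rightarrow> nat \<Rightarrow> bool" where
  "blocking I \<mu> m w \<longleftrightarrow> acceptable I m w \<and> man_prefers I \<mu> m w \<and> woman_prefers I \<mu> w m"

definition stable :: "sm \<Rightarrow> matching \<Rightarrow> bool" where
  "stable I \<mu> \<longleftrightarrow> is_matching \<mu> \<and> (\<forall>(m, w) \<in> \<mu>. acceptable I m w) \<and>
     \<not> (\<exists>m w. blocking I \<mu> m w)"

definition sat_M :: "sm \<Rightarrow> matching \<Rightarrow> nat" where
  "sat_M I \<mu> = (\<Sum>(m, w) \<in> \<mu>. mpos I m w)"

definition sat_W :: "sm \<Rightarrow> matching \<Rightarrow> nat" where
  "sat_W I \<mu> = (\<Sum>(m, w) \<in> \<mu>. wpos I w m)"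

definition sesm_cost :: "sm \<Rightarrow> matching \<Rightarrow> int" where
  "sesm_cost I \<mu> = \<bar>int (sat_M I \<mu>) - int (sat_W I \<mu>)\<bar>"

definition bsm_cost :: "sm \<Rightarrow> matching \<Rightarrow> int" where
  "bsm_cost I \<mu> = max (int (sat_M I \<mu>)) (int (sat_W I \<mu>))"

section \<open>Rotations\<close>

text \<open>
  \<open>next_woman I \<mu> m w\<close>: \<open>w\<close> is the first woman after \<open>\<mu>(m)\<close> on the list of \<open>m\<close> who prefers
  \<open>m\<close> to her situation in \<open>\<mu>\<close>. An unmatched woman qualifies, and so ends the search; as she
  belongs to no pair of \<open>\<mu>\<close>, no rotation then passes through \<open>m\<close>.
\<close>

definition next_woman :: "sm \<Rightarrow> matching \<Rightarrow> nat \<Rightarrow> nat \<Rightarrow> bool" where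
  "next_woman I \<mu> m w \<longleftrightarrow> (\<exists>w0. (m, w0) \<in> \<mu> \<and>
     is_arg_min (mpos I m)
       (\<lambda>w'. acceptable I m w' \<and> mpos I m w0 < mpos I m w' \<and> woman_prefers I \<mu> w' m) w)"

text \<open>
  Rotations are sequences of pairs up to cyclic shift. We represent each cyclic class by the
  sequence that starts with the smallest man.
\<close>

type_synonym rotation = "(nat \<times> nat) list"

definition exposed :: "sm \<Rightarrow> matching \<Rightarrow> rotation \<Rightarrow> bool" where
  "exposed I \<mu> \<rho> \<longleftrightarrow> \<rho> \<noteq> [] \<and> distinct \<rho> \<and> set \<rho> \<subseteq> \<mu> \<and>
     (\<forall>i < length \<rho>. next_woman I \<mu> (fst (\<rho> ! i)) (snd (\<rho> ! (Suc i mod length \<rho>)))) \<and>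
     (\<forall>p \<in> set \<rho>. fst (hd \<rho>) \<le> fst p)"

definition eliminate :: "matching \<Rightarrow> rotation \<Rightarrow> matching" where
  "eliminate \<mu> \<rho> =
     (\<mu> - set \<rho>) \<union> {(fst (\<rho> ! i), snd (\<rho> ! (Suc i mod length \<rho>))) | i. i < length \<rho>}"

definition rotations :: "sm \<Rightarrow> rotation set" where
  "rotations I = {\<rho>. \<exists>\<mu>. stable I \<mu> \<and> exposed I \<mu> \<rho>}"

inductive elim_seq :: "sm \<Rightarrow> matching \<Rightarrow> rotation list \<Rightarrow> matching \<Rightarrow> bool" for I where
  Nil: "elim_seq I \<mu> [] \<mu>"
| Cons: "exposed I \<mu> \<rho> \<Longrightarrow> elim_seq I (eliminate \<mu> \<rho>) \<rho>s \<nu> \<Longrightarrow> elim_seq I \<mu> (\<rho> # \<rho>s) \<nu>"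

definition man_optimal :: "sm \<Rightarrow> matching \<Rightarrow> bool" where
  "man_optimal I \<mu> \<longleftrightarrow> stable I \<mu> \<and>
     (\<forall>\<nu>. stable I \<nu> \<longrightarrow> (\<forall>(m, w') \<in> \<nu>. \<exists>w. (m, w) \<in> \<mu> \<and> mpos I m w \<le> mpos I m w'))"

text \<open>
  The strict order of the rotation poset: \<open>\<rho>\<close> precedes \<open>\<rho>'\<close> if \<open>\<rho>\<close> has to be eliminated before
  \<open>\<rho>'\<close> becomes exposed.
\<close>

definition precedence :: "sm \<Rightarrow> rotation rel" where
  "precedence I = {(\<rho>, \<rho>'). \<rho> \<in> rotations I \<and> \<rho>' \<in> rotations I \<and>
     (\<forall>\<mu>0 \<rho>s \<mu>. man_optimal I \<mu>0 \<and> elim_seq I \<mu>0 \<rho>s \<mu> \<and> exposed I \<mu> \<rho>' \<longrightarrow> \<rho> \<in> set \<rho>s)}"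

text \<open>
  The vertices of the digraph are the rotations themselves, so its transitive closure is required
  to be equal, rather than isomorphic, to the rotation poset.
\<close>

definition rotation_digraph :: "sm \<Rightarrow> rotation rel \<Rightarrow> bool" where
  "rotation_digraph I D \<longleftrightarrow>
     is_arg_min card
       (\<lambda>D. D \<subseteq> rotations I \<times> rotations I \<and> acyclic D \<and> D\<^sup>+ = precedence I) D"

section \<open>Treewidth\<close>

definition underlying_edges :: "'v rel \<Rightarrow> 'v set set" where
  "underlying_edges D = {{u, v} | u v. (u, v) \<in> D}"

text \<open>Connectedness of the subgraph induced by \<open>V\<close>.\<close>

definition connected_on :: "'v set \<Rightarrow> 'v set set \<Rightarrow> bool" where
  "connected_on V E \<longleftrightarrow>
     (\<forall>u \<in> V. \<forall>v \<in> V. (u, v) \<in> {(x, y). x \<in> V \<and> y \<in> V \<and> {x, y} \<in> E}\<^sup>*)"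

definition cycle_in :: "'v set set \<Rightarrow> 'v list \<Rightarrow> bool" where
  "cycle_in E xs \<longleftrightarrow> length xs \<ge> 3 \<and> distinct xs \<and>
     (\<forall>i < length xs. {xs ! i, xs ! (Suc i mod length xs)} \<in> E)"

definition is_tree :: "'v set \<Rightarrow> 'v set set \<Rightarrow> bool" where
  "is_tree V E \<longleftrightarrow> finite V \<and> V \<noteq> {} \<and>
     E \<subseteq> {{x, y} | x y. x \<in> V \<and> y \<in> V \<and> x \<noteq> y} \<and>
     connected_on V E \<and> \<not> (\<exists>xs. cycle_in E xs)"

definition tree_decomposition ::
  "'v set \<Rightarrow> 'v set set \<Rightarrow> nat set \<Rightarrow> nat set set \<Rightarrow> (nat \<Rightarrow> 'v set) \<Rightarrow> bool" where
  "tree_decomposition V E N T B \<longleftrightarrow> is_tree N T \<and>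
     (\<Union>t \<in> N. B t) = V \<and>
     (\<forall>e \<in> E. \<exists>t \<in> N. e \<subseteq> B t) \<and>
     (\<forall>v \<in> V. connected_on {t \<in> N. v \<in> B t} T)"

text \<open>Integer-valued: the width is \<open>-1\<close> if all bags are empty.\<close>

definition width :: "nat set \<Rightarrow> (nat \<Rightarrow> 'v set) \<Rightarrow> int" where
  "width N B = int (MAX t \<in> N. card (B t)) - 1"

definition treewidth :: "'v set \<Rightarrow> 'v set set \<Rightarrow> int" where
  "treewidth V E = Inf {width N B | N T B. tree_decomposition V E N T B}"

definition rotation_tw :: "sm \<Rightarrow> rotation rel \<Rightarrow> int" where
  "rotation_tw I D = treewidth (rotations I) (underlying_edges D)"

section \<open>Model of computation\<close>

text \<open>
  A unit-cost random access machine with addition and subtraction (and no multiplication),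
  programmed in a while language. A program accesses the finitely many arrays that it names; a
  scalar variable is an array used at one index. The cost of a run is the number of symbols of
  expressions and commands evaluated.
\<close>

type_synonym state = "string \<Rightarrow> int \<Rightarrow> int"

datatype aexp = Const int | Read string aexp | Plus aexp aexp | Minus aexp aexp

datatype bexp = Less aexp aexp | Neg bexp | Conj bexp bexp

datatype com =
    Skip
  | Assign string aexp aexp
  | Seq com com
  | Cond bexp com com
  | While bexp com

fun aval :: "aexp \<Rightarrow> state \<Rightarrow> int" where
  "aval (Const k) s = k"
| "aval (Read a i) s = s a (aval i s)"
| "aval (Plus x y) s = aval x s + aval y s"
| "aval (Minus x y) s = aval x s - aval y s"

fun acost :: "aexp \<Rightarrow> nat" where
  "acost (Const k) = 1"
| "acost (Read a i) = 1 + acost i"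
| "acost (Plus x y) = 1 + acost x + acost y"
| "acost (Minus x y) = 1 + acost x + acost y"

fun bval :: "bexp \<Rightarrow> state \<Rightarrow> bool" where
  "bval (Less x y) s \<longleftrightarrow> aval x s < aval y s"
| "bval (Neg b) s \<longleftrightarrow> \<not> bval b s"
| "bval (Conj b c) s \<longleftrightarrow> bval b s \<and> bval c s"

fun bcost :: "bexp \<Rightarrow> nat" where
  "bcost (Less x y) = 1 + acost x + acost y"
| "bcost (Neg b) = 1 + bcost b"
| "bcost (Conj b c) = 1 + bcost b + bcost c"

text \<open>\<open>exec c s t s'\<close>: started in \<open>s\<close>, the command \<open>c\<close> halts in \<open>s'\<close> after \<open>t\<close> steps.\<close>

inductive exec :: "com \<Rightarrow> state \<Rightarrow> nat \<Rightarrow> state \<Rightarrow> bool" where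
  Skip: "exec Skip s 1 s"
| Assign: "exec (Assign a i x) s (1 + acost i + acost x)
             (s(a := (s a)(aval i s := aval x s)))"
| Seq: "exec c1 s1 t1 s2 \<Longrightarrow> exec c2 s2 t2 s3 \<Longrightarrow> exec (Seq c1 c2) s1 (t1 + t2) s3"
| IfTrue: "bval b s \<Longrightarrow> exec c1 s t s' \<Longrightarrow> exec (Cond b c1 c2) s (1 + bcost b + t) s'"
| IfFalse: "\<not> bval b s \<Longrightarrow> exec c2 s t s' \<Longrightarrow> exec (Cond b c1 c2) s (1 + bcost b + t) s'"
| WhileFalse: "\<not> bval b s \<Longrightarrow> exec (While b c) s (1 + bcost b) s"
| WhileTrue: "bval b s1 \<Longrightarrow> exec c s1 t1 s2 \<Longrightarrow> exec (While b c) s2 t2 s3 \<Longrightarrow>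
    exec (While b c) s1 (1 + bcost b + t1 + t2) s3"

section \<open>Input and output\<close>

text \<open>
  A decomposition is presented by the edges of its tree, each listed once, and the list of its
  bags, the nodes of the tree being the positions in that list.
\<close>

record decomp =
  tree_edges :: "(nat \<times> nat) list"
  bags :: "rotation list list"

definition given_decomposition :: "sm \<Rightarrow> rotation rel \<Rightarrow> decomp \<Rightarrow> bool" where
  "given_decomposition I D X \<longleftrightarrow>
     distinct (map (\<lambda>(u, v). {u, v}) (tree_edges X)) \<and>
     (\<forall>xs \<in> set (bags X). distinct xs) \<and>
     tree_decomposition (rotations I) (underlying_edges D)
       {..<length (bags X)} ((\<lambda>(u, v). {u, v}) ` set (tree_edges X)) (\<lambda>t. set (bags X ! t)) \<and>
     width {..<length (bags X)} (\<lambda>t. set (bags X ! t)) = rotation_tw I D"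

definition enc_list :: "('a \<Rightarrow> nat list) \<Rightarrow> 'a list \<Rightarrow> nat list" where
  "enc_list f xs = length xs # concat (map f xs)"

definition enc_nat :: "nat \<Rightarrow> nat list" where
  "enc_nat x = [x]"

definition enc_pair :: "nat \<times> nat \<Rightarrow> nat list" where
  "enc_pair p = [fst p, snd p]"

definition encode :: "sm \<Rightarrow> decomp \<Rightarrow> nat list" where
  "encode I X =
     enc_list (enc_list enc_nat) (mprefs I) @
     enc_list (enc_list enc_nat) (wprefs I) @
     enc_list enc_pair (tree_edges X) @
     enc_list (enc_list (enc_list enc_pair)) (bags X)"

definition init_state :: "nat list \<Rightarrow> state" where
  "init_state xs = (\<lambda>a i. if a = ''input'' \<and> 0 \<le> i \<and> i < int (length xs)
     then int (xs ! nat i) else 0)"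

text \<open>Cell \<open>m\<close> of the output holds one plus the partner of man \<open>m\<close>, or \<open>0\<close> if he is unmatched.\<close>

definition output_matching :: "sm \<Rightarrow> state \<Rightarrow> matching" where
  "output_matching I s = {(m, w). m < num_men I \<and> s ''output'' (int m) = int w + 1}"

definition optimal :: "(sm \<Rightarrow> matching \<Rightarrow> int) \<Rightarrow> sm \<Rightarrow> matching \<Rightarrow> bool" where
  "optimal cost I \<mu> \<longleftrightarrow> is_arg_min (cost I) (stable I) \<mu>"

text \<open>
  One program solves the problem on all instances. With \<open>n\<close> agents there are at most \<open>n\<^sup>2\<close>
  rotations, and as usual the tree of the given decomposition is assumed to be linear in that
  bound: the running time is \<open>O(f tw n)\<close> for decompositions with \<open>O(n\<^sup>2)\<close> nodes.
  As a tree is not empty, this covers exactly the instances with \<open>n > 0\<close>.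
\<close>

definition solvable_in_time :: "(sm \<Rightarrow> matching \<Rightarrow> int) \<Rightarrow> (int \<Rightarrow> nat \<Rightarrow> real) \<Rightarrow> bool" where
  "solvable_in_time cost f \<longleftrightarrow>
     (\<exists>P. \<forall>d::nat. \<exists>c::real. \<forall>I D X.
        sm_instance I \<longrightarrow> rotation_digraph I D \<longrightarrow> given_decomposition I D X \<longrightarrow>
        length (bags X) \<le> d * num_agents I ^ 2 \<longrightarrow>
        (\<exists>t s. exec P (init_state (encode I X)) t s \<and>
               real t \<le> c * f (rotation_tw I D) (num_agents I) \<and>
               optimal cost I (output_matching I s)))"

end

theory Submission
  imports Defs "HOL-Library.Nat_Bijection"
begin

text \<open>
  Writing a matching as the vector of the positions of the men's partners, the stable matchings are
  closed under pointwise minima and maxima, and for each rotation there is a least stable matching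
  in which the rotation has been eliminated. It is reached from the vector that pushes a single man
  of the rotation by repeatedly pushing men off women who prefer another suitor. A set of rotations is
  the set of rotations eliminated on the way to some stable matching iff it is closed under
  predecessors. As closure need only be tested along the edges of the digraph, it can be tested
  separately in each bag, without knowing the edges: both ends of an edge are in a common bag, and
  whether one rotation precedes another is read off its least matching.

  Eliminating a set of rotations changes both satisfactions by sums of weights of the rotations, and
  these sums are bounded by \<open>O(n\<^sup>2)\<close>. So a table per bag, indexed by a subset of the bag and a total
  weight, has \<open>O(2\<^bsup>tw\<^esup> n\<^sup>2)\<close> cells. Merging a leaf of the tree into its neighbour combines the weights
  of two tables in \<open>O(2\<^bsup>tw\<^esup> n\<^sup>4)\<close> steps, and there are \<open>O(n\<^sup>2)\<close> tree edges.
\<close>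

text \<open>Joining two tables by ranging over a subset of either bag would square
  \<open>2 ^ tw\<close>. The table of the leaf is therefore first projected to the common part of
  the two bags; a subset of the neighbour's bag then determines the key it can be joined with, and
  only the two weights remain to be enumerated. Weights are bounded because they are nonnegative
  and, over all rotations, add up to differences of satisfactions. For BSM one weight does not
  decide the maximum, but at equal \<open>dM\<close> a larger \<open>dW\<close> is never worse, so a
  single number per cell serves both problems. As the machine does not multiply, sets are sums of
  numbers \<open>v1 * 2 ^ r\<close> obtained by doubling; disjoint union, addition of weights and
  addressing then each take additions only. Addresses become exponential in the number of rotations,
  which is harmless: memory starts as zero and only cells in use are touched. The tree is not
  rooted; a leaf is searched for afresh before every merge, which stays within the bound.\<close>

lemma pos_nth:
  assumes "distinct xs" "k < length xs"
  shows "pos xs (xs ! k) = Suc k"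
proof -
  have "takeWhile (\<lambda>y. y \<noteq> xs ! k) xs = take k xs"
    using assms by (intro takeWhile_eq_take_P_nth) (auto simp: nth_eq_iff_index_eq)
  then show ?thesis using assms by (simp add: pos_def)
qed

lemma pos_ge_1: "1 \<le> pos xs x"
  by (simp add: pos_def)

lemma pos_le_length:
  assumes "x \<in> set xs"
  shows "pos xs x \<le> length xs"
proof -
  have "length (takeWhile (\<lambda>y. y \<noteq> x) xs) < length xs"
    using assms by (metis (full_types) length_takeWhile_le nat_less_le takeWhile_eq_all_conv takeWhile_eq_take take_all_iff order_refl)
  then show ?thesis by (simp add: pos_def)
qed

lemma nth_pos:
  assumes "x \<in> set xs"
  shows "xs ! (pos xs x - 1) = x"
  using nth_length_takeWhile[of "\<lambda>y. y \<noteq> x" xs] pos_le_length[OF assms] by (auto simp: pos_def)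

lemma pos_inject:
  assumes "x \<in> set xs" "y \<in> set xs" "pos xs x = pos xs y"
  shows "x = y"
  using assms nth_pos by metis

locale marriage =
  fixes I :: sm
  assumes inst: "sm_instance I"
begin

abbreviation "nm \<equiv> num_men I"
abbreviation "nw \<equiv> num_women I"
abbreviation "len m \<equiv> length (mprefs I ! m)"
abbreviation "acc \<equiv> acceptable I"

lemma acc_iff: "acc m w \<longleftrightarrow> m < nm \<and> w \<in> set (mprefs I ! m)"
  using inst unfolding acceptable_def sm_instance_def by blast

lemma acc_iff': "acc m w \<longleftrightarrow> w < nw \<and> m \<in> set (wprefs I ! w)"
  using inst unfolding acceptable_def sm_instance_def by blast

lemma mpos_inject: "acc m w \<Longrightarrow> acc m w' \<Longrightarrow> mpos I m w = mpos I m w' \<Longrightarrow> w = w'"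
  unfolding mpos_def acc_iff by (blast intro: pos_inject)

lemma wpos_inject: "acc m w \<Longrightarrow> acc m' w \<Longrightarrow> wpos I w m = wpos I w m' \<Longrightarrow> m = m'"
  unfolding wpos_def acc_iff' by (blast intro: pos_inject)

lemma mpos_bounds: "acc m w \<Longrightarrow> 1 \<le> mpos I m w \<and> mpos I m w \<le> len m"
  unfolding mpos_def acc_iff using pos_ge_1 pos_le_length by blast

lemma wpos_bounds: "acc m w \<Longrightarrow> 1 \<le> wpos I w m \<and> wpos I w m \<le> length (wprefs I ! w)"
  unfolding wpos_def acc_iff' using pos_ge_1 pos_le_length by blast

lemma woman_at: "m < nm \<Longrightarrow> 1 \<le> k \<Longrightarrow> k \<le> len m \<Longrightarrow>
  acc m (mprefs I ! m ! (k - 1)) \<and> mpos I m (mprefs I ! m ! (k - 1)) = k"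
  using inst by (auto simp: acc_iff mpos_def pos_nth sm_instance_def)

lemma len_le: "m < nm \<Longrightarrow> len m \<le> nw"
  using inst card_mono[of "{..<nw}" "set (mprefs I ! m)"] by (auto simp: sm_instance_def distinct_card)

lemma wlen_le: "w < nw \<Longrightarrow> length (wprefs I ! w) \<le> nm"
  using inst card_mono[of "{..<nm}" "set (wprefs I ! w)"] by (auto simp: sm_instance_def distinct_card)

section \<open>Stable matchings as vectors of positions\<close>

text \<open>
  A matching is represented by the position \<open>x m\<close> of the partner of each man \<open>m\<close> on his list, one
  past the end if he is single. Larger vectors are worse for the men.
\<close>

definition valid :: "(nat \<Rightarrow> nat) \<Rightarrow> bool" where
  "valid x \<longleftrightarrow> (\<forall>m<nm. 1 \<le> x m \<and> x m \<le> Suc (len m)) \<and> (\<forall>m\<ge>nm. x m = 0)"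

definition mat :: "(nat \<Rightarrow> nat) \<Rightarrow> matching" where
  "mat x = {(m, w). acc m w \<and> x m = mpos I m w}"

text \<open>In terms of Gale--Shapley, \<open>m\<close> has proposed to \<open>w\<close>. The pairs
  of \<open>mat x\<close> are the proposals still standing.\<close>

definition reached :: "(nat \<Rightarrow> nat) \<Rightarrow> nat \<Rightarrow> nat \<Rightarrow> bool" where
  "reached x m w \<longleftrightarrow> acc m w \<and> mpos I m w \<le> x m"

text \<open>
  In a settled vector no man sits at a woman who was reached by a man she likes better. Whatever is
  not settled has to be pushed further, so settled vectors are the prefixed points of
  Gale--Shapley.
\<close>

definition settled :: "(nat \<Rightarrow> nat) \<Rightarrow> bool" where
  "settled x \<longleftrightarrow> (\<forall>m w m'. (m, w) \<in> mat x \<longrightarrow> reached x m' w \<longrightarrow> wpos I w m \<le> wpos I w m')"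

text \<open>\<open>settled\<close> alone allows a woman who was reached to be single, and such a
  woman would block. With the last conjunct these vectors are exactly the images of stable matchings
  under \<open>vec\<close>, see \<open>stable_mat\<close> and \<open>stv_vec\<close>.\<close>

definition stv :: "(nat \<Rightarrow> nat) \<Rightarrow> bool" where
  "stv x \<longleftrightarrow> valid x \<and> settled x \<and> (\<forall>m w. reached x m w \<longrightarrow> w \<in> snd ` mat x)"

text \<open>Both bounds vanish beyond the men. So \<open>valid\<close> is an interval in the
  pointwise order on all of \<open>nat \<Rightarrow> nat\<close>, and \<open>inf\<close>,
  \<open>sup\<close> and \<open>\<le>\<close> apply without restricting functions to the
  men.\<close>

definition ones :: "nat \<Rightarrow> nat" where
  "ones m = (if m < nm then 1 else 0)"

definition tops :: "nat \<Rightarrow> nat" where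
  "tops m = (if m < nm then Suc (len m) else 0)"

lemma valid_iff: "valid x \<longleftrightarrow> ones \<le> x \<and> x \<le> tops"
proof
  show "valid x \<Longrightarrow> ones \<le> x \<and> x \<le> tops"
    by (auto simp: valid_def le_fun_def ones_def tops_def)
next
  assume a: "ones \<le> x \<and> x \<le> tops"
  show "valid x" unfolding valid_def
  proof (intro conjI allI impI)
    fix m
    have "ones m \<le> x m" "x m \<le> tops m" using a by (auto simp: le_fun_def)
    then show "m < nm \<Longrightarrow> 1 \<le> x m" "m < nm \<Longrightarrow> x m \<le> Suc (len m)" "nm \<le> m \<Longrightarrow> x m = 0"
      by (auto simp: ones_def tops_def)
  qed
qed

lemma mat_reached: "(m, w) \<in> mat x \<Longrightarrow> reached x m w"
  by (simp add: mat_def reached_def)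

lemma reached_mono: "reached x m w \<Longrightarrow> x \<le> y \<Longrightarrow> reached y m w"
  by (auto simp: reached_def le_fun_def intro: order_trans)

lemma mat_fun: "(m, w) \<in> mat x \<Longrightarrow> (m, w') \<in> mat x \<Longrightarrow> w = w'"
  by (auto simp: mat_def intro: mpos_inject)

lemma mat_inj: "settled x \<Longrightarrow> (m, w) \<in> mat x \<Longrightarrow> (m', w) \<in> mat x \<Longrightarrow> m = m'"
  by (rule wpos_inject[of m w m']) (auto simp: settled_def mat_def reached_def intro!: antisym)

lemma fst_mat: "valid x \<Longrightarrow> fst ` mat x = {m. m < nm \<and> x m \<le> len m}"
proof (intro set_eqI iffI)
  fix m assume v: "valid x" and "m \<in> {m. m < nm \<and> x m \<le> len m}"
  then have "(m, mprefs I ! m ! (x m - 1)) \<in> mat x"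
    using woman_at[of m "x m"] by (auto simp: mat_def valid_def)
  then show "m \<in> fst ` mat x" by force
next
  fix m assume "valid x" "m \<in> fst ` mat x"
  then show "m \<in> {m. m < nm \<and> x m \<le> len m}"
    using mpos_bounds by (fastforce simp: mat_def acc_iff)
qed

lemma finite_mat: "finite (mat x)"
  by (rule finite_subset[of _ "{..<nm} \<times> {..<nw}"]) (auto simp: mat_def acceptable_def)

lemma card_mat: "settled x \<Longrightarrow> card (fst ` mat x) = card (mat x) \<and> card (snd ` mat x) = card (mat x)"
  by (intro conjI card_image) (auto simp: inj_on_def dest: mat_fun mat_inj)

section \<open>Minima and maxima of stable vectors\<close>

lemma settled_inf:
  assumes "settled x" "settled y"
  shows "settled (inf x y)"
  unfolding settled_def
proof (intro allI impI)
  fix m w m' assume a: "(m, w) \<in> mat (inf x y)" "reached (inf x y) m' w"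
  then have "reached x m' w" "reached y m' w" by (auto simp: reached_def)
  moreover from a have "(m, w) \<in> mat x \<or> (m, w) \<in> mat y" by (auto simp: mat_def inf_nat_def min_def split: if_splits)
  ultimately show "wpos I w m \<le> wpos I w m'" using assms unfolding settled_def by blast
qed

text \<open>
  By counting: a man matched in the worse vector is matched in the better one, and a woman held in
  the better vector is reached, hence held, in the worse one.
\<close>

lemma
  assumes "valid z" "settled z" "stv x" "z \<le> x"
  shows stv_below: "stv z"
    and fst_mat_below: "fst ` mat z = fst ` mat x"
    and snd_mat_below: "snd ` mat z = snd ` mat x"
proof -
  have vx: "valid x" "settled x" using assms by (auto simp: stv_def)
  have 1: "fst ` mat x \<subseteq> fst ` mat z"
    unfolding fst_mat[OF vx(1)] fst_mat[OF assms(1)] using le_funD[OF assms(4)] order_trans by blast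
  have 2: "snd ` mat z \<subseteq> snd ` mat x"
  proof
    fix w assume "w \<in> snd ` mat z"
    then obtain m where "(m, w) \<in> mat z" by force
    then have "reached x m w" using mat_reached reached_mono assms(4) by blast
    then show "w \<in> snd ` mat x" using assms(3) unfolding stv_def by blast
  qed
  \<comment> \<open>On either side men and women are matched in equal numbers by
    \<open>card_mat\<close>, so the two inclusions, which point in opposite directions, leave no
    room for strictness.\<close>
  have "card (fst ` mat x) \<le> card (fst ` mat z)" "card (snd ` mat z) \<le> card (snd ` mat x)"
    using 1 2 by (simp_all add: card_mono finite_mat)
  then have "card (fst ` mat x) = card (fst ` mat z)" "card (snd ` mat z) = card (snd ` mat x)"
    using card_mat[OF vx(2)] card_mat[OF assms(2)] by auto
  then show 3: "fst ` mat z = fst ` mat x" and 4: "snd ` mat z = snd ` mat x"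
    using card_subset_eq[OF _ 1] card_subset_eq[OF _ 2] by (simp_all add: finite_mat)
  show "stv z"
    using assms(1,2,3) reached_mono[OF _ assms(4)] unfolding stv_def 4 by blast
qed

lemma valid_inf: "valid x \<Longrightarrow> valid y \<Longrightarrow> valid (inf x y)"
  unfolding valid_iff by (meson le_inf_iff le_infI1)

lemma valid_sup: "valid x \<Longrightarrow> valid y \<Longrightarrow> valid (sup x y)"
  unfolding valid_iff by (meson le_sup_iff le_supI1)

lemma stv_inf: "stv x \<Longrightarrow> stv y \<Longrightarrow> stv (inf x y)"
  by (rule stv_below[of _ x]) (simp_all add: stv_def valid_inf settled_inf)

text \<open>The rural hospitals theorem: two stable vectors need not be comparable, but each is
  comparable with their minimum, which is stable.\<close>

lemma fst_mat_stv: "stv x \<Longrightarrow> stv y \<Longrightarrow> fst ` mat x = fst ` mat y"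
  by (metis fst_mat_below inf_le1 inf_le2 stv_def stv_inf)

lemma snd_mat_stv: "stv x \<Longrightarrow> stv y \<Longrightarrow> snd ` mat x = snd ` mat y"
  by (metis snd_mat_below inf_le1 inf_le2 stv_def stv_inf)

text \<open>Suppose \<open>w\<close> prefers \<open>m'\<close> to \<open>m\<close>. Her partner
  \<open>m1\<close> in \<open>y\<close> is then better than \<open>m\<close> too. In the minimum
  \<open>w\<close> is held by someone, and at his coordinate the minimum agrees with
  \<open>x\<close> or with \<open>y\<close>, so he is \<open>m\<close> or \<open>m1\<close>. If he
  is \<open>m\<close>, then \<open>y\<close> also seats \<open>m\<close> at \<open>w\<close>, whence
  \<open>m = m1\<close>. If he is \<open>m1\<close>, then \<open>m1\<close> reached \<open>w\<close>
  in \<open>x\<close>, which is settled.\<close>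

lemma settled_sup_aux:
  assumes x: "stv x" and y: "stv y" and mw: "(m, w) \<in> mat x" and yx: "y m \<le> x m"
    and r: "reached y m' w"
  shows "wpos I w m \<le> wpos I w m'"
proof (rule ccontr)
  assume c: "\<not> ?thesis"
  have sx: "settled x" and sy: "settled y" and sz: "settled (inf x y)"
    using x y stv_inf by (auto simp: stv_def)
  from r y obtain m1 where m1: "(m1, w) \<in> mat y" unfolding stv_def by force
  have "wpos I w m1 \<le> wpos I w m'" using sy m1 r unfolding settled_def by blast
  with c have lt: "wpos I w m1 < wpos I w m" by simp
  have "w \<in> snd ` mat (inf x y)" using snd_mat_stv[OF x stv_inf[OF x y]] mw by force
  then obtain m2 where m2: "(m2, w) \<in> mat (inf x y)" by force
  have rx: "reached x m1 w \<Longrightarrow> False"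
    using sx mw lt unfolding settled_def by (metis not_le)
  from m2 have "(m2, w) \<in> mat x \<and> x m2 \<le> y m2 \<or> (m2, w) \<in> mat y \<and> y m2 \<le> x m2"
    by (auto simp: mat_def inf_nat_def min_def split: if_splits)
  then show False
  proof
    assume a: "(m2, w) \<in> mat x \<and> x m2 \<le> y m2"
    then have "m2 = m" using mat_inj[OF sx] mw by blast
    then have "(m, w) \<in> mat y" using a yx mw by (auto simp: mat_def)
    then have "m = m1" using mat_inj[OF sy] m1 by blast
    then show False using lt by simp
  next
    assume a: "(m2, w) \<in> mat y \<and> y m2 \<le> x m2"
    then have "m2 = m1" using mat_inj[OF sy] m1 by blast
    then have "reached x m1 w" using a by (auto simp: mat_def reached_def)
    then show False by (rule rx)
  qed
qed

lemma settled_sup: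
  assumes "stv x" "stv y"
  shows "settled (sup x y)"
  unfolding settled_def
proof (intro allI impI)
  fix m w m' assume a: "(m, w) \<in> mat (sup x y)" "reached (sup x y) m' w"
  then have r: "reached x m' w \<or> reached y m' w" by (auto simp: reached_def le_max_iff_disj sup_nat_def)
  from a have "(m, w) \<in> mat x \<and> y m \<le> x m \<or> (m, w) \<in> mat y \<and> x m \<le> y m"
    by (auto simp: mat_def sup_nat_def max_def split: if_splits)
  moreover have "settled x" "settled y" using assms by (auto simp: stv_def)
  ultimately show "wpos I w m \<le> wpos I w m'"
    using r settled_sup_aux assms unfolding settled_def by blast
qed

text \<open>The maximum lies above \<open>x\<close>, so \<open>stv_below\<close> does not apply and
  the counting is redone: the men matched in the maximum are those matched in both vectors, the same
  men by \<open>fst_mat_stv\<close>. So as many women are held as in \<open>x\<close>, and only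
  women held in \<open>x\<close> were ever reached.\<close>

lemma stv_sup:
  assumes x: "stv x" and y: "stv y"
  shows "stv (sup x y)"
proof -
  have v: "valid x" "valid y" "valid (sup x y)" using x y valid_sup by (auto simp: stv_def)
  have "fst ` mat (sup x y) = fst ` mat x \<inter> fst ` mat y"
    by (auto simp: fst_mat[OF v(1)] fst_mat[OF v(2)] fst_mat[OF v(3)])
  then have f: "fst ` mat (sup x y) = fst ` mat x" using fst_mat_stv[OF x y] by simp
  have s: "settled (sup x y)" using settled_sup[OF x y] .
  have r: "w \<in> snd ` mat x" if "reached (sup x y) m w" for m w
  proof -
    have "reached x m w \<or> reached y m w" using that by (auto simp: reached_def le_max_iff_disj sup_nat_def)
    then show ?thesis using x y snd_mat_stv[OF x y] unfolding stv_def by blast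
  qed
  then have sub: "snd ` mat (sup x y) \<subseteq> snd ` mat x" by (auto dest!: mat_reached)
  have "card (snd ` mat (sup x y)) = card (snd ` mat x)"
    using card_mat[OF s] card_mat[of x] f x by (auto simp: stv_def)
  then have "snd ` mat (sup x y) = snd ` mat x" using sub by (simp add: card_subset_eq finite_mat)
  then show ?thesis using r s v by (auto simp: stv_def)
qed

section \<open>Least settled vectors\<close>

text \<open>The pointwise minimum of all settled vectors between \<open>v\<close> and
  \<open>tops\<close>. It is defined one coordinate at a time; that the coordinates fit together is
  \<open>settled_cl\<close>.\<close>

definition cl :: "(nat \<Rightarrow> nat) \<Rightarrow> nat \<Rightarrow> nat" where
  "cl v m = (LEAST k. \<exists>z. settled z \<and> v \<le> z \<and> z \<le> tops \<and> z m = k)"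

lemma settled_tops: "settled tops"
  using mpos_bounds by (force simp: settled_def mat_def tops_def split: if_splits)

lemma cl_le: "settled z \<Longrightarrow> v \<le> z \<Longrightarrow> z \<le> tops \<Longrightarrow> cl v \<le> z"
  unfolding le_fun_def cl_def by (auto intro!: Least_le)

lemma cl_attained: "v \<le> tops \<Longrightarrow> \<exists>z. settled z \<and> v \<le> z \<and> z \<le> tops \<and> z m = cl v m"
  unfolding cl_def by (rule LeastI_ex) (use settled_tops in blast)

lemma cl_ge: "v \<le> tops \<Longrightarrow> v \<le> cl v"
  using cl_attained unfolding le_fun_def by metis

lemma cl_le_tops: "v \<le> tops \<Longrightarrow> cl v \<le> tops"
  using cl_attained unfolding le_fun_def by metis

text \<open>For a pair \<open>(m, w)\<close> it is enough to take a settled \<open>z\<close> that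
  attains the minimum at \<open>m\<close> alone. Elsewhere \<open>z\<close> may be larger, but a
  suitor who reached \<open>w\<close> in \<open>cl v\<close> has also reached her in
  \<open>z\<close>.\<close>

lemma settled_cl:
  assumes "v \<le> tops"
  shows "settled (cl v)"
  unfolding settled_def
proof (intro allI impI)
  fix m w m' assume a: "(m, w) \<in> mat (cl v)" "reached (cl v) m' w"
  obtain z where z: "settled z" "v \<le> z" "z \<le> tops" "z m = cl v m" using cl_attained[OF assms] by blast
  have "cl v \<le> z" using cl_le z by blast
  then have "reached z m' w" using a reached_mono by blast
  moreover have "(m, w) \<in> mat z" using a z by (simp add: mat_def)
  ultimately show "wpos I w m \<le> wpos I w m'" using z unfolding settled_def by blast
qed

lemma valid_cl: "ones \<le> v \<Longrightarrow> v \<le> tops \<Longrightarrow> valid (cl v)"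
  unfolding valid_iff using cl_ge cl_le_tops order_trans by blast

text \<open>A closure is settled in any case; it is the stable vector above it that rules out
  abandoned women, through the counting in \<open>stv_below\<close>.\<close>

lemma stv_cl:
  assumes "ones \<le> v" "stv x" "v \<le> x"
  shows "stv (cl v)" "cl v \<le> x"
proof -
  have x: "settled x" "x \<le> tops" using assms by (auto simp: stv_def valid_iff)
  then have v: "v \<le> tops" using assms by simp
  show "cl v \<le> x" using cl_le x assms by blast
  then show "stv (cl v)" by (rule stv_below[OF valid_cl[OF assms(1) v] settled_cl[OF v] assms(2)])
qed

definition best :: "nat \<Rightarrow> nat" where
  "best = cl ones"

lemma ones_le_tops: "ones \<le> tops"
  by (rule le_funI) (simp add: ones_def tops_def)

text \<open>
  If the most preferred man who reached \<open>w\<close> had left her, he could be put back without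
  unsettling the vector.
\<close>

lemma stv_best: "stv best"
proof -
  have s: "settled best" "valid best" unfolding best_def
    by (rule settled_cl[OF ones_le_tops], rule valid_cl[OF order_refl ones_le_tops])
  have "w \<in> snd ` mat best" if r: "reached best m w" for m w
  proof -
    obtain b where b: "reached best b w" "\<And>m'. reached best m' w \<Longrightarrow> wpos I w b \<le> wpos I w m'"
      using ex_has_least_nat[of "\<lambda>m'. reached best m' w" m "wpos I w"] r by blast
    show ?thesis
    proof (cases "best b = mpos I b w")
      case True
      then have "(b, w) \<in> mat best" using b by (auto simp: mat_def reached_def)
      then show ?thesis by force
    next
      case False
      define y where "y = best(b := mpos I b w)"
      have bb: "acc b w" "mpos I b w < best b" using b False by (auto simp: reached_def)
      have yb: "y \<le> best" using bb by (auto simp: y_def le_fun_def)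
      have "settled y" unfolding settled_def
      proof (intro allI impI)
        fix m1 w1 m2 assume a: "(m1, w1) \<in> mat y" "reached y m2 w1"
        have r2: "reached best m2 w1" using a yb reached_mono by blast
        show "wpos I w1 m1 \<le> wpos I w1 m2"
        proof (cases "m1 = b")
          case True
          then have "w1 = w" using a bb mpos_inject by (auto simp: mat_def y_def)
          then show ?thesis using True b r2 by auto
        next
          case False
          then have "(m1, w1) \<in> mat best" using a by (auto simp: mat_def y_def)
          then show ?thesis using s r2 unfolding settled_def by blast
        qed
      qed
      moreover have "ones \<le> y" using s bb mpos_bounds[OF bb(1)]
        by (auto simp: y_def valid_iff le_fun_def ones_def)
      moreover have "y \<le> tops" using yb s by (auto simp: valid_iff)
      ultimately have "best \<le> y" unfolding best_def using cl_le by blast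
      then show ?thesis using bb by (auto simp: y_def le_fun_def split: if_splits dest: spec[of _ b])
    qed
  qed
  then show ?thesis using s by (auto simp: stv_def)
qed

lemma best_le: "stv x \<Longrightarrow> best \<le> x"
  unfolding best_def by (rule cl_le) (auto simp: stv_def valid_iff)

section \<open>Stable matchings and their vectors\<close>

definition vec :: "matching \<Rightarrow> nat \<Rightarrow> nat" where
  "vec \<mu> m = (if m < nm then if m \<in> fst ` \<mu> then mpos I m (THE w. (m, w) \<in> \<mu>) else Suc (len m) else 0)"

lemma matchingD: "is_matching \<mu> \<Longrightarrow> (m, w) \<in> \<mu> \<Longrightarrow> (m, w') \<in> \<mu> \<Longrightarrow> w = w'"
  "is_matching \<mu> \<Longrightarrow> (m, w) \<in> \<mu> \<Longrightarrow> (m', w) \<in> \<mu> \<Longrightarrow> m = m'"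
  unfolding is_matching_def by blast+

lemma stableD: "stable I \<mu> \<Longrightarrow> is_matching \<mu>" "stable I \<mu> \<Longrightarrow> (m, w) \<in> \<mu> \<Longrightarrow> acc m w"
  unfolding stable_def by blast+

lemma vec_eq: "is_matching \<mu> \<Longrightarrow> m < nm \<Longrightarrow> (m, w) \<in> \<mu> \<Longrightarrow> vec \<mu> m = mpos I m w"
proof -
  assume a: "is_matching \<mu>" "m < nm" "(m, w) \<in> \<mu>"
  then have "(THE w. (m, w) \<in> \<mu>) = w" by (blast intro: the_equality matchingD)
  then show ?thesis using a by (force simp: vec_def)
qed

lemma vec_single: "m < nm \<Longrightarrow> m \<notin> fst ` \<mu> \<Longrightarrow> vec \<mu> m = Suc (len m)"
  by (simp add: vec_def)

lemma vec_stable: "stable I \<mu> \<Longrightarrow> (m, w) \<in> \<mu> \<Longrightarrow> vec \<mu> m = mpos I m w"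
  using vec_eq stableD by (auto simp: acc_iff)

lemma mat_vec:
  assumes "stable I \<mu>"
  shows "mat (vec \<mu>) = \<mu>"
proof (intro set_eqI iffI)
  fix p assume "p \<in> mat (vec \<mu>)"
  then obtain m w where p: "p = (m, w)" "acc m w" "vec \<mu> m = mpos I m w" by (auto simp: mat_def)
  then have "m \<in> fst ` \<mu>" using vec_single[of m \<mu>] mpos_bounds[of m w] by (force simp: acc_iff)
  then obtain w' where w': "(m, w') \<in> \<mu>" by force
  then have "w' = w" using p assms vec_stable stableD mpos_inject by metis
  then show "p \<in> \<mu>" using p w' by simp
next
  fix p assume "p \<in> \<mu>"
  then show "p \<in> mat (vec \<mu>)" using assms vec_stable stableD by (cases p) (auto simp: mat_def)
qed

lemma valid_vec:
  assumes "stable I \<mu>"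
  shows "valid (vec \<mu>)"
proof -
  have "1 \<le> vec \<mu> m \<and> vec \<mu> m \<le> Suc (len m)" if "m < nm" for m
  proof (cases "m \<in> fst ` \<mu>")
    case True
    then obtain w where "(m, w) \<in> \<mu>" by force
    then show ?thesis using vec_stable[OF assms] stableD[OF assms] mpos_bounds by (metis le_Suc_eq)
  qed (use that vec_single in auto)
  then show ?thesis by (auto simp: valid_def vec_def)
qed

lemma man_prefers_mat: "valid x \<Longrightarrow> acc m w \<Longrightarrow> man_prefers I (mat x) m w \<longleftrightarrow> mpos I m w < x m"
proof -
  assume v: "valid x" and a: "acc m w"
  show ?thesis
  proof (cases "m \<in> fst ` mat x")
    case True
    then obtain w' where w': "(m, w') \<in> mat x" by force
    then have "(m, w'') \<in> mat x \<longleftrightarrow> w'' = w'" for w'' using mat_fun by blast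
    then have "man_prefers I (mat x) m w \<longleftrightarrow> mpos I m w < mpos I m w'" by (simp add: man_prefers_def)
    then show ?thesis using w' by (simp add: mat_def)
  next
    case False
    moreover have "m < nm" using a by (simp add: acc_iff)
    ultimately have "\<not> x m \<le> len m" using fst_mat[OF v] by blast
    then have "mpos I m w < x m" using mpos_bounds[OF a] by simp
    moreover have "man_prefers I (mat x) m w" using False by (force simp: man_prefers_def)
    ultimately show ?thesis by simp
  qed
qed

lemma stable_mat:
  assumes "stv x"
  shows "stable I (mat x)"
proof -
  have s: "valid x" "settled x" using assms by (auto simp: stv_def)
  have "\<not> blocking I (mat x) m w" for m w
  proof
    assume b: "blocking I (mat x) m w"
    then have r: "reached x m w" "mpos I m w < x m"
      using man_prefers_mat[OF s(1)] by (auto simp: blocking_def reached_def)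
    then obtain m' where m': "(m', w) \<in> mat x" using assms unfolding stv_def by force
    then have "wpos I w m' \<le> wpos I w m" using s r unfolding settled_def by blast
    then show False using b m' by (force simp: blocking_def woman_prefers_def)
  qed
  moreover have "is_matching (mat x)"
    unfolding is_matching_def using mat_fun mat_inj[OF s(2)] by blast
  moreover have "\<forall>(m, w) \<in> mat x. acc m w" by (auto simp: mat_def)
  ultimately show ?thesis by (simp add: stable_def)
qed

lemma stv_vec:
  assumes st: "stable I \<mu>"
  shows "stv (vec \<mu>)"
proof -
  have v: "valid (vec \<mu>)" using valid_vec st .
  \<comment> \<open>The absence of blocking pairs in the form needed for \<open>stv\<close>: whoever
    reached a woman, she holds someone she likes at least as well.\<close>
  have nb: "\<exists>m'. (m', w) \<in> \<mu> \<and> wpos I w m' \<le> wpos I w m" if r: "reached (vec \<mu>) m w" for m w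
  proof (cases "mpos I m w = vec \<mu> m")
    case True
    then have "(m, w) \<in> \<mu>" using mat_vec[OF st] r by (auto simp: mat_def reached_def)
    then show ?thesis by auto
  next
    case False
    then have "man_prefers I \<mu> m w" "acc m w"
      using man_prefers_mat[OF v] r mat_vec[OF st] by (auto simp: reached_def)
    moreover have "\<not> blocking I \<mu> m w" using st by (auto simp: stable_def)
    ultimately show ?thesis by (auto simp: blocking_def woman_prefers_def not_less)
  qed
  have "settled (vec \<mu>)" unfolding settled_def mat_vec[OF st]
    using nb matchingD(2)[OF stableD(1)[OF st]] by blast
  moreover have "w \<in> snd ` mat (vec \<mu>)" if "reached (vec \<mu>) m w" for m w
    using nb[OF that] mat_vec[OF st] by force
  ultimately show ?thesis using v by (auto simp: stv_def)
qed

lemma vec_mat: 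
  assumes "stv x"
  shows "vec (mat x) = x"
proof
  fix m
  have v: "valid x" using assms by (auto simp: stv_def)
  show "vec (mat x) m = x m"
  proof (cases "m \<in> fst ` mat x")
    case True
    then obtain w where "(m, w) \<in> mat x" by force
    then show ?thesis using vec_stable[OF stable_mat[OF assms]] by (auto simp: mat_def)
  next
    case False
    then have "m < nm \<Longrightarrow> x m = Suc (len m)" using v fst_mat[OF v] by (auto simp: valid_def le_Suc_eq)
    then show ?thesis using False v by (auto simp: vec_def valid_def)
  qed
qed

lemma man_optimal_iff: "man_optimal I \<mu> \<longleftrightarrow> \<mu> = mat best"
proof
  assume o: "man_optimal I \<mu>"
  then have st: "stable I \<mu>" by (simp add: man_optimal_def)
  have "vec \<mu> \<le> best"
  proof (rule le_funI)
    fix m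
    show "vec \<mu> m \<le> best m"
    proof (cases "m \<in> fst ` mat best")
      case True
      then obtain w' where w': "(m, w') \<in> mat best" by force
      then obtain w where "(m, w) \<in> \<mu>" "mpos I m w \<le> mpos I m w'"
        using o stable_mat[OF stv_best] unfolding man_optimal_def by blast
      then show ?thesis using w' vec_stable[OF st] by (auto simp: mat_def)
    next
      case False
      \<comment> \<open>\<open>man_optimal\<close> compares matched men only. A man single in
        \<open>best\<close> sits one past the end of his list, which no valid vector
        exceeds.\<close>
      have v: "valid best" "valid (vec \<mu>)" using stv_best stv_vec[OF st] by (auto simp: stv_def)
      have "m < nm \<Longrightarrow> \<not> best m \<le> len m" using False fst_mat[OF v(1)] by blast
      then have "tops m \<le> best m" by (auto simp: tops_def)
      moreover have "vec \<mu> m \<le> tops m" using v(2) by (simp add: valid_iff le_funD)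
      ultimately show ?thesis by simp
    qed
  qed
  then have "vec \<mu> = best" using best_le[OF stv_vec[OF st]] by simp
  then show "\<mu> = mat best" using mat_vec[OF st] by simp
next
  assume mu: "\<mu> = mat best"
  have "\<exists>w. (m, w) \<in> mat best \<and> mpos I m w \<le> mpos I m w'" if st: "stable I \<nu>" and mw: "(m, w') \<in> \<nu>" for \<nu> m w'
  proof -
    have "m \<in> fst ` mat best"
      using fst_mat_stv[OF stv_best stv_vec[OF st]] mat_vec[OF st] mw by force
    then obtain w where w: "(m, w) \<in> mat best" by force
    have "best m \<le> vec \<nu> m" using best_le[OF stv_vec[OF st]] by (simp add: le_fun_def)
    then show ?thesis using w vec_stable[OF st mw] by (auto simp: mat_def)
  qed
  then show "man_optimal I \<mu>" unfolding man_optimal_def mu using stable_mat[OF stv_best] by blast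
qed

end

context marriage
begin

section \<open>Eliminating a rotation\<close>

lemma bij_betw_Suc_mod: "bij_betw (\<lambda>i. Suc i mod k) {..<k} {..<k}"
proof -
  have "inj_on (\<lambda>i. Suc i mod k) {..<k}"
  proof (rule inj_onI)
    fix i j assume "i \<in> {..<k}" "j \<in> {..<k}" "Suc i mod k = Suc j mod k"
    then show "i = j" by (cases "Suc i = k"; cases "Suc j = k") (auto simp: mod_less)
  qed
  moreover have "(\<lambda>i. Suc i mod k) ` {..<k} \<subseteq> {..<k}" by (cases "k = 0") auto
  ultimately show ?thesis by (simp add: bij_betw_def endo_inj_surj)
qed

lemma exposedD:
  assumes st: "stable I \<mu>" and ex: "exposed I \<mu> \<rho>" and i: "i < length \<rho>"
    and mw: "\<rho> ! i = (m, w)" and mw': "\<rho> ! (Suc i mod length \<rho>) = (m', w')"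
  shows "(m, w) \<in> \<mu>" "(m', w') \<in> \<mu>" "acc m w" "acc m' w'" "acc m w'" "mpos I m w < mpos I m w'"
    "wpos I w' m < wpos I w' m'"
    "\<And>v. acc m v \<Longrightarrow> mpos I m w < mpos I m v \<Longrightarrow> woman_prefers I \<mu> v m \<Longrightarrow> mpos I m w' \<le> mpos I m v"
proof -
  have j: "Suc i mod length \<rho> < length \<rho>" using i by (cases "\<rho> = []") auto
  have sub: "set \<rho> \<subseteq> \<mu>" using ex by (simp add: exposed_def)
  have "\<rho> ! i \<in> set \<rho>" "\<rho> ! (Suc i mod length \<rho>) \<in> set \<rho>" using i j nth_mem by auto
  then show 1: "(m, w) \<in> \<mu>" and 2: "(m', w') \<in> \<mu>" using sub mw mw' by auto
  then show "acc m w" "acc m' w'" using stableD[OF st] by auto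
  have "next_woman I \<mu> m w'" using ex i mw mw' by (force simp: exposed_def)
  then obtain w0 where w0: "(m, w0) \<in> \<mu>" and am: "is_arg_min (mpos I m)
       (\<lambda>w'. acc m w' \<and> mpos I m w0 < mpos I m w' \<and> woman_prefers I \<mu> w' m) w'"
    unfolding next_woman_def by blast
  have "w0 = w" using matchingD(1)[OF stableD(1)[OF st]] w0 1 by blast
  note am = am[unfolded this is_arg_min_def]
  then show "acc m w'" "mpos I m w < mpos I m w'" by auto
  show "wpos I w' m < wpos I w' m'" using am 2 by (auto simp: woman_prefers_def)
  show "\<And>v. acc m v \<Longrightarrow> mpos I m w < mpos I m v \<Longrightarrow> woman_prefers I \<mu> v m \<Longrightarrow> mpos I m w' \<le> mpos I m v"
    using am by (auto simp: not_less)
qed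

lemma exposed_index:
  assumes ex: "exposed I \<mu> \<rho>" and st: "stable I \<mu>" and i: "i < length \<rho>" "j < length \<rho>"
  shows "fst (\<rho> ! i) = fst (\<rho> ! j) \<longleftrightarrow> i = j" "snd (\<rho> ! i) = snd (\<rho> ! j) \<longleftrightarrow> i = j"
proof -
  have "\<rho> ! i \<in> \<mu>" "\<rho> ! j \<in> \<mu>" using ex i nth_mem by (force simp: exposed_def)+
  moreover have "\<rho> ! i = \<rho> ! j \<longleftrightarrow> i = j" using ex i by (simp add: exposed_def nth_eq_iff_index_eq)
  ultimately show "fst (\<rho> ! i) = fst (\<rho> ! j) \<longleftrightarrow> i = j" "snd (\<rho> ! i) = snd (\<rho> ! j) \<longleftrightarrow> i = j"
    using matchingD[OF stableD(1)[OF st]] by (metis prod.collapse)+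
qed

lemma Suc_mod_less: "i < k \<Longrightarrow> Suc i mod k < k"
  by (cases "k = 0") auto

definition moved :: "rotation \<Rightarrow> matching" where
  "moved \<rho> = {(fst (\<rho> ! i), snd (\<rho> ! (Suc i mod length \<rho>))) | i. i < length \<rho>}"

lemma eliminate_eq: "eliminate \<mu> \<rho> = (\<mu> - set \<rho>) \<union> moved \<rho>"
  by (simp add: eliminate_def moved_def)

text \<open>Women only improve (\<open>better\<close>), so the woman of a pair blocking the new
  matching already preferred the man before, and the man must have held someone at least as good.
  Hence he was moved, and the blocking woman lies strictly between his old and his new partner,
  contradicting the choice of the next woman as the first who would accept him.\<close>

lemma stable_eliminate:
  assumes st: "stable I \<mu>" and ex: "exposed I \<mu> \<rho>"
  shows "stable I (eliminate \<mu> \<rho>)"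
proof -
  let ?k = "length \<rho>"
  let ?\<nu> = "eliminate \<mu> \<rho>"
  let ?m = "\<lambda>i. fst (\<rho> ! i)" and ?w = "\<lambda>i. snd (\<rho> ! i)" and ?n = "\<lambda>i. Suc i mod ?k"
  have mt: "is_matching \<mu>" using stableD st by blast
  note fact = exposedD[OF st ex _ prod.collapse[symmetric] prod.collapse[symmetric]]
  have inmu: "i < ?k \<Longrightarrow> (?m i, ?w i) \<in> \<mu> \<and> (?m i, ?w i) \<in> set \<rho>" for i using fact(1) nth_mem by force
  have nlt: "i < ?k \<Longrightarrow> ?n i < ?k" for i by (rule Suc_mod_less)
  have oldm: "(?m i, w) \<in> \<mu> \<Longrightarrow> i < ?k \<Longrightarrow> (?m i, w) \<in> set \<rho>" for i w
    using inmu matchingD(1)[OF mt] by metis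
  have oldw: "(m, ?w i) \<in> \<mu> \<Longrightarrow> i < ?k \<Longrightarrow> (m, ?w i) \<in> set \<rho>" for i m
    using inmu matchingD(2)[OF mt] by metis
  have ninj: "i < ?k \<Longrightarrow> j < ?k \<Longrightarrow> ?n i = ?n j \<longleftrightarrow> i = j" for i j
    using bij_betw_Suc_mod[of ?k] by (auto simp: bij_betw_def inj_on_def)
  have cases: "(m, w) \<in> ?\<nu> \<Longrightarrow> (m, w) \<in> \<mu> - set \<rho> \<or> (\<exists>i<?k. m = ?m i \<and> w = ?w (?n i))" for m w
    by (auto simp: eliminate_def)
  have "m = m' \<longleftrightarrow> w = w'" if a: "(m, w) \<in> ?\<nu>" and b: "(m', w') \<in> ?\<nu>" for m w m' w'
    using cases[OF a] cases[OF b]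
  proof (elim disjE exE conjE)
    assume "(m, w) \<in> \<mu> - set \<rho>" "(m', w') \<in> \<mu> - set \<rho>"
    then show ?thesis using matchingD[OF mt] by blast
  next
    fix i assume "(m, w) \<in> \<mu> - set \<rho>" "i < ?k" "m' = ?m i" "w' = ?w (?n i)"
    then show ?thesis using oldm[of i w] oldw[of m "?n i"] nlt by blast
  next
    fix i assume "(m', w') \<in> \<mu> - set \<rho>" "i < ?k" "m = ?m i" "w = ?w (?n i)"
    then show ?thesis using oldm[of i w'] oldw[of m' "?n i"] nlt by blast
  next
    fix i j assume "i < ?k" "m = ?m i" "w = ?w (?n i)" "j < ?k" "m' = ?m j" "w' = ?w (?n j)"
    then show ?thesis using exposed_index[OF ex st] nlt ninj by simp
  qed
  then have 1: "is_matching ?\<nu>" unfolding is_matching_def by blast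
  have 2: "acc m w" if "(m, w) \<in> ?\<nu>" for m w
    using cases[OF that] stableD(2)[OF st] fact(5) by auto
  have better: "\<exists>m'. (m', w) \<in> ?\<nu> \<and> wpos I w m' \<le> wpos I w m" if "(m, w) \<in> \<mu>" for m w
  proof (cases "(m, w) \<in> set \<rho>")
    case True
    then obtain j where j: "j < ?k" "\<rho> ! j = (m, w)" by (metis in_set_conv_nth)
    then have "j \<in> ?n ` {..<?k}" using bij_betw_imp_surj_on[OF bij_betw_Suc_mod[of ?k]] by simp
    then obtain i where i: "i < ?k" "?n i = j" by blast
    then have "(?m i, ?w (?n i)) \<in> moved \<rho>" unfolding moved_def by blast
    then have "(?m i, w) \<in> ?\<nu>" using i j by (simp add: eliminate_eq)
    moreover have "wpos I w (?m i) < wpos I w m" using fact(7)[OF i(1)] i j by simp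
    ultimately show ?thesis by (intro exI[of _ "?m i"]) simp
  next
    case False
    then show ?thesis using that by (auto simp: eliminate_def)
  qed
  have "\<not> blocking I ?\<nu> m w" for m w
  proof
    assume b: "blocking I ?\<nu> m w"
    then have a: "acc m w" by (simp add: blocking_def)
    have wp: "woman_prefers I \<mu> w m" unfolding woman_prefers_def
    proof (intro allI impI)
      fix m' assume "(m', w) \<in> \<mu>"
      then obtain m'' where "(m'', w) \<in> ?\<nu>" "wpos I w m'' \<le> wpos I w m'" using better by blast
      then show "wpos I w m < wpos I w m'" using b unfolding blocking_def woman_prefers_def by (meson less_le_trans)
    qed
    have "\<not> blocking I \<mu> m w" using st by (auto simp: stable_def)
    then have "\<not> man_prefers I \<mu> m w" using a wp by (simp add: blocking_def)
    then obtain w0 where w0: "(m, w0) \<in> \<mu>" "mpos I m w0 \<le> mpos I m w"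
      by (auto simp: man_prefers_def not_less)
    show False
    proof (cases "(m, w0) \<in> set \<rho>")
      case False
      then have "(m, w0) \<in> ?\<nu>" using w0 by (simp add: eliminate_def)
      then show False using b w0(2) unfolding blocking_def man_prefers_def by (meson not_le)
    next
      case True
      then obtain i where i: "i < ?k" "\<rho> ! i = (m, w0)" by (metis in_set_conv_nth)
      then have "(?m i, ?w (?n i)) \<in> moved \<rho>" unfolding moved_def by blast
      then have nu: "(m, ?w (?n i)) \<in> ?\<nu>" using i by (simp add: eliminate_eq)
      have "w0 \<noteq> w"
      proof
        assume "w0 = w"
        then obtain m' where "(m', w) \<in> ?\<nu>" "wpos I w m' \<le> wpos I w m" using better[OF w0(1)] by blast
        then show False using b unfolding blocking_def woman_prefers_def by (meson not_le)
      qed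
      then have "mpos I m w0 \<noteq> mpos I m w" using mpos_inject[OF stableD(2)[OF st w0(1)] a] by blast
      then have "mpos I m w0 < mpos I m w" using w0(2) by simp
      then have "mpos I m (?w (?n i)) \<le> mpos I m w" using fact(8)[OF i(1)] i a wp by simp
      then show False using b nu unfolding blocking_def man_prefers_def by (meson not_le)
    qed
  qed
  then show ?thesis using 1 2 by (auto simp: stable_def)
qed

lemma vec_moved:
  assumes st: "stable I \<mu>" and ex: "exposed I \<mu> \<rho>" and i: "i < length \<rho>"
  shows "vec (eliminate \<mu> \<rho>) (fst (\<rho> ! i)) = mpos I (fst (\<rho> ! i)) (snd (\<rho> ! (Suc i mod length \<rho>)))"
  by (rule vec_stable[OF stable_eliminate[OF st ex]]) (use i in \<open>auto simp: eliminate_eq moved_def\<close>)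

lemma vec_unmoved:
  assumes "m \<notin> fst ` set \<rho>"
  shows "vec (eliminate \<mu> \<rho>) m = vec \<mu> m"
proof -
  have "(m, w) \<notin> moved \<rho>" "(m, w) \<notin> set \<rho>" for w
    using assms by (force simp: moved_def)+
  then have *: "(m, w) \<in> eliminate \<mu> \<rho> \<longleftrightarrow> (m, w) \<in> \<mu>" for w
    by (simp add: eliminate_eq)
  have "m \<in> fst ` A \<longleftrightarrow> (\<exists>w. (m, w) \<in> A)" for A :: matching by force
  then have "m \<in> fst ` eliminate \<mu> \<rho> \<longleftrightarrow> m \<in> fst ` \<mu>" using * by simp
  then show ?thesis by (simp add: vec_def *)
qed

lemma vec_le_eliminate:
  assumes st: "stable I \<mu>" and ex: "exposed I \<mu> \<rho>"
  shows "vec \<mu> \<le> vec (eliminate \<mu> \<rho>)"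
proof (rule le_funI)
  fix m
  show "vec \<mu> m \<le> vec (eliminate \<mu> \<rho>) m"
  proof (cases "m \<in> fst ` set \<rho>")
    case True
    then obtain i where i: "i < length \<rho>" "m = fst (\<rho> ! i)" by (auto simp: in_set_conv_nth)
    note f = exposedD[OF st ex i(1) prod.collapse[symmetric] prod.collapse[symmetric]]
    show ?thesis using vec_moved[OF st ex i(1)] f(6) vec_stable[OF st f(1)] i by simp
  qed (simp add: vec_unmoved)
qed

text \<open>For stable \<open>x\<close> and a rotation of the instance this says that the rotation
  is eliminated on the way from \<open>best\<close> to \<open>x\<close>;
  \<open>elim_seq_facts\<close> makes this precise.\<close>

definition past :: "(nat \<Rightarrow> nat) \<Rightarrow> rotation \<Rightarrow> bool" where
  "past x \<rho> \<longleftrightarrow> (\<forall>(m, w) \<in> set \<rho>. mpos I m w < x m)"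

text \<open>Her old partner stays among those who reached her as the vector grows, and in
  \<open>x\<close> she holds the favourite of all who did. Strictness comes from \<open>m\<close>
  having moved, so that he is not that old partner.\<close>

lemma woman_improves:
  assumes st: "stable I \<mu>" and x: "stv x" "vec \<mu> \<le> x"
    and v: "(m, v) \<in> mat x" and lt: "vec \<mu> m < x m"
  shows "woman_prefers I \<mu> v m"
  unfolding woman_prefers_def
proof (intro allI impI)
  fix m' assume a: "(m', v) \<in> \<mu>"
  then have "reached x m' v"
    using mat_reached reached_mono[OF _ x(2)] mat_vec[OF st] by metis
  then have le: "wpos I v m \<le> wpos I v m'" using x(1) v unfolding stv_def settled_def by blast
  have "m' \<noteq> m"
  proof
    assume "m' = m"
    then have "vec \<mu> m = x m" using a v vec_stable[OF st] by (simp add: mat_def)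
    then show False using lt by simp
  qed
  then show "wpos I v m < wpos I v m'"
    using le wpos_inject[of m v m'] stableD(2)[OF st a] v by (force simp: mat_def)
qed

text \<open>A man who moves on can only stop at the next woman, whose partner then has to move as well.\<close>

lemma past_step:
  assumes st: "stable I \<mu>" and ex: "exposed I \<mu> \<rho>" and x: "stv x" "vec \<mu> \<le> x"
    and i: "i < length \<rho>" and mw: "\<rho> ! i = (m, w)" and mw': "\<rho> ! (Suc i mod length \<rho>) = (m', w')"
    and lt: "mpos I m w < x m"
  shows "mpos I m w' \<le> x m" "mpos I m' w' < x m'"
proof -
  note f = exposedD[OF st ex i mw mw']
  have s: "settled x" "valid x" using x by (auto simp: stv_def)
  show 1: "mpos I m w' \<le> x m"
  proof (rule ccontr)
    assume c: "\<not> ?thesis"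
    then have "x m \<le> len m" using mpos_bounds[OF f(5)] by simp
    moreover have "m < nm" using f(5) by (simp add: acc_iff)
    ultimately have "m \<in> fst ` mat x" using fst_mat[OF s(2)] by blast
    then obtain v where v: "(m, v) \<in> mat x" by force
    have "woman_prefers I \<mu> v m"
      using woman_improves[OF st x v] vec_stable[OF st f(1)] lt by simp
    then have "mpos I m w' \<le> mpos I m v" using f(8)[of v] v lt by (auto simp: mat_def)
    then show False using c v by (simp add: mat_def)
  qed
  have "vec \<mu> m' = mpos I m' w'" using vec_stable[OF st f(2)] .
  moreover have "vec \<mu> m' \<le> x m'" using x(2) by (simp add: le_funD)
  moreover have "x m' \<noteq> mpos I m' w'"
  proof
    assume "x m' = mpos I m' w'"
    then have "(m', w') \<in> mat x" using f(4) by (simp add: mat_def)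
    moreover have "reached x m w'" using 1 f(5) by (simp add: reached_def)
    ultimately have "wpos I w' m' \<le> wpos I w' m" using s unfolding settled_def by blast
    then show False using f(7) by simp
  qed
  ultimately show "mpos I m' w' < x m'" by simp
qed

lemma mod_orbit:
  assumes "i < k" "j < k"
  shows "\<exists>n. (i + n) mod k = (j :: nat)"
  by (rule exI[of _ "k - i + j"]) (use assms in simp)

lemma past_all:
  assumes st: "stable I \<mu>" and ex: "exposed I \<mu> \<rho>" and x: "stv x" "vec \<mu> \<le> x"
    and mw: "(m, w) \<in> set \<rho>" and lt: "mpos I m w < x m"
  shows "past x \<rho>"
proof -
  obtain i where i: "i < length \<rho>" "\<rho> ! i = (m, w)" using mw by (metis in_set_conv_nth)
  let ?j = "\<lambda>n. (i + n) mod length \<rho>"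
  have "mpos I (fst (\<rho> ! ?j n)) (snd (\<rho> ! ?j n)) < x (fst (\<rho> ! ?j n))" for n
  proof (induction n)
    case 0
    then show ?case using i lt by simp
  next
    case (Suc n)
    have "?j n < length \<rho>" using i(1) by (metis less_nat_zero_code mod_less_divisor neq0_conv)
    then show ?case
      using past_step(2)[OF st ex x _ prod.collapse[symmetric] prod.collapse[symmetric]] Suc
      by (metis add_Suc_right mod_Suc_eq)
  qed
  then show ?thesis unfolding past_def
    using mod_orbit[OF i(1)] by (auto simp: in_set_conv_nth) (metis fst_conv snd_conv)
qed

text \<open>An elimination is the least move past an exposed rotation: the first claim of
  \<open>past_step\<close> bounds every moved man.\<close>

lemma eliminate_le:
  assumes st: "stable I \<mu>" and ex: "exposed I \<mu> \<rho>" and x: "stv x" "vec \<mu> \<le> x" and p: "past x \<rho>"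
  shows "vec (eliminate \<mu> \<rho>) \<le> x"
proof (rule le_funI)
  fix m
  show "vec (eliminate \<mu> \<rho>) m \<le> x m"
  proof (cases "m \<in> fst ` set \<rho>")
    case True
    then obtain i where i: "i < length \<rho>" "m = fst (\<rho> ! i)" by (auto simp: in_set_conv_nth)
    have "mpos I (fst (\<rho> ! i)) (snd (\<rho> ! i)) < x (fst (\<rho> ! i))"
      using p nth_mem[OF i(1)] unfolding past_def by (metis (mono_tags, lifting) case_prod_beta)
    then show ?thesis
      using past_step(1)[OF st ex x i(1) prod.collapse[symmetric] prod.collapse[symmetric]]
        vec_moved[OF st ex i(1)] i by simp
  qed (use x(2) in \<open>simp add: vec_unmoved le_funD\<close>)
qed

lemma rotationsE:
  assumes "\<rho> \<in> rotations I"
  obtains \<mu> where "stable I \<mu>" "exposed I \<mu> \<rho>"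
  using assms by (auto simp: rotations_def)

text \<open>The matching that exposes the rotation is unrelated to \<open>x\<close>. Joining it to
  \<open>x\<close> makes \<open>past_all\<close> applicable and leaves the question unchanged: on
  the men of the rotation that matching sits exactly at the positions to be exceeded.\<close>

lemma before_or_past:
  assumes r: "\<rho> \<in> rotations I" and x: "stv x" and mw: "(m, w) \<in> set \<rho>" and lt: "mpos I m w < x m"
  shows "past x \<rho>"
proof -
  obtain \<mu> where st: "stable I \<mu>" and ex: "exposed I \<mu> \<rho>" using r by (rule rotationsE)
  let ?y = "sup x (vec \<mu>)"
  have y: "stv ?y" "vec \<mu> \<le> ?y" using stv_sup x stv_vec[OF st] by auto
  have eq: "vec \<mu> m' = mpos I m' w'" if "(m', w') \<in> set \<rho>" for m' w'
    using that ex vec_stable[OF st] by (auto simp: exposed_def)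
  have "mpos I m w < ?y m" using lt by (simp add: less_supI1)
  then have "past ?y \<rho>" using past_all[OF st ex y mw] by blast
  then show ?thesis using eq unfolding past_def by (fastforce simp: sup_nat_def less_max_iff_disj)
qed

lemma rotation_nonempty: "\<rho> \<in> rotations I \<Longrightarrow> \<rho> \<noteq> []"
  by (auto simp: rotations_def exposed_def)

text \<open>One comparison decides whether a rotation has been passed. The program tests precedence
  in this way, and \<open>rots_sup\<close> rests on it.\<close>

lemma past_iff_hd:
  assumes r: "\<rho> \<in> rotations I" and x: "stv x"
  shows "past x \<rho> \<longleftrightarrow> mpos I (fst (hd \<rho>)) (snd (hd \<rho>)) < x (fst (hd \<rho>))"
proof -
  have h: "hd \<rho> \<in> set \<rho>" using rotation_nonempty[OF r] by simp
  show ?thesis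
    using before_or_past[OF r x, of "fst (hd \<rho>)" "snd (hd \<rho>)"] h
    by (auto simp: past_def case_prod_beta)
qed

lemma past_mono: "past x \<rho> \<Longrightarrow> x \<le> y \<Longrightarrow> past y \<rho>"
  unfolding past_def le_fun_def by (auto intro: less_le_trans)

lemma past_eliminate:
  assumes st: "stable I \<mu>" and ex: "exposed I \<mu> \<rho>"
  shows "past (vec (eliminate \<mu> \<rho>)) \<rho>"
  unfolding past_def
proof (safe)
  fix m w assume "(m, w) \<in> set \<rho>"
  then obtain i where i: "i < length \<rho>" "\<rho> ! i = (m, w)" by (metis in_set_conv_nth)
  show "mpos I m w < vec (eliminate \<mu> \<rho>) m"
    using vec_moved[OF st ex i(1)] exposedD(6)[OF st ex i prod.collapse[symmetric]] i by simp
qed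

text \<open>The next women do not change: the woman of the following pair still holds her partner of
  the rotation and so still prefers the man, while any woman who would accept him in
  \<open>\<nu>\<close> would have accepted him in \<open>\<mu>\<close>, since her situation has only
  improved.\<close>

lemma exposed_later:
  assumes st: "stable I \<mu>" "stable I \<nu>" and ex: "exposed I \<mu> \<rho>" and le: "vec \<mu> \<le> vec \<nu>"
    and sub: "set \<rho> \<subseteq> \<nu>"
  shows "exposed I \<nu> \<rho>"
proof -
  have "next_woman I \<nu> (fst (\<rho> ! i)) (snd (\<rho> ! (Suc i mod length \<rho>)))" if i: "i < length \<rho>" for i
  proof -
    obtain m w m' w' where mw: "\<rho> ! i = (m, w)" "\<rho> ! (Suc i mod length \<rho>) = (m', w')" by force
    note f = exposedD[OF st(1) ex i mw]
    have in': "(m, w) \<in> \<nu>" "(m', w') \<in> \<nu>"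
      using sub nth_mem[OF i] nth_mem[OF Suc_mod_less[OF i]] mw by auto
    have mt: "is_matching \<nu>" using stableD st by blast
    have wp: "woman_prefers I \<nu> w' m"
      using in' f(7) matchingD(2)[OF mt] unfolding woman_prefers_def by blast
    have "mpos I m w' \<le> mpos I m v"
      if v: "acc m v" "mpos I m w < mpos I m v" "woman_prefers I \<nu> v m" for v
    proof (rule f(8)[OF v(1,2)])
      show "woman_prefers I \<mu> v m" unfolding woman_prefers_def
      proof (intro allI impI)
        fix m'' assume "(m'', v) \<in> \<mu>"
        then have r: "reached (vec \<nu>) m'' v"
          using mat_reached reached_mono[OF _ le] mat_vec[OF st(1)] by metis
        then obtain m3 where m3: "(m3, v) \<in> mat (vec \<nu>)" using stv_vec[OF st(2)] unfolding stv_def by force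
        then have "wpos I v m3 \<le> wpos I v m''" using stv_vec[OF st(2)] r unfolding stv_def settled_def by blast
        moreover have "wpos I v m < wpos I v m3"
          using v(3) m3 mat_vec[OF st(2)] by (simp add: woman_prefers_def)
        ultimately show "wpos I v m < wpos I v m''" by simp
      qed
    qed
    then have "is_arg_min (mpos I m)
       (\<lambda>w'. acc m w' \<and> mpos I m w < mpos I m w' \<and> woman_prefers I \<nu> w' m) w'"
      using f(5,6) wp unfolding is_arg_min_def by (meson not_le)
    then show ?thesis using mw in' unfolding next_woman_def by auto
  qed
  then show ?thesis using ex sub by (simp add: exposed_def)
qed

section \<open>Distinct rotations share no pair\<close>

lemma exposed_orbit:
  assumes st: "stable I \<mu>" and ex: "exposed I \<mu> \<rho>" "exposed I \<mu> \<rho>'"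
    and i: "i < length \<rho>" and j: "j < length \<rho>'" and eq: "\<rho> ! i = \<rho>' ! j"
  shows "\<rho> ! ((i + n) mod length \<rho>) = \<rho>' ! ((j + n) mod length \<rho>')"
proof (induction n)
  case 0
  then show ?case using i j eq by simp
next
  case (Suc n)
  define a b where "a = (i + n) mod length \<rho>" and "b = (j + n) mod length \<rho>'"
  have ab: "a < length \<rho>" "b < length \<rho>'" unfolding a_def b_def using i j by (auto intro: mod_less_divisor)
  obtain m w where mw: "\<rho> ! a = (m, w)" by force
  have mw': "\<rho>' ! b = (m, w)" using Suc mw by (simp add: a_def b_def)
  obtain m1 w1 where 1: "\<rho> ! (Suc a mod length \<rho>) = (m1, w1)" by force
  obtain m2 w2 where 2: "\<rho>' ! (Suc b mod length \<rho>') = (m2, w2)" by force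
  note f = exposedD[OF st ex(1) ab(1) mw 1] and g = exposedD[OF st ex(2) ab(2) mw' 2]
  have wp: "woman_prefers I \<mu> w1 m" "woman_prefers I \<mu> w2 m"
    using f(2,7) g(2,7) matchingD(2)[OF stableD(1)[OF st]] unfolding woman_prefers_def by blast+
  have "mpos I m w1 = mpos I m w2"
    using f(8)[OF g(5,6) wp(2)] g(8)[OF f(5,6) wp(1)] by simp
  then have "w1 = w2" using f(5) g(5) mpos_inject by blast
  moreover have "m1 = m2" using f(2) g(2) matchingD(2)[OF stableD(1)[OF st]] calculation by blast
  ultimately show ?case using 1 2 by (simp add: a_def b_def mod_Suc_eq)
qed

text \<open>The successor of a pair is determined by the matching, so two exposed rotations through
  a common pair run in parallel. They agree as cyclic sequences, and starting with the smallest man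
  removes the remaining freedom of shifting.\<close>

lemma exposed_unique:
  assumes st: "stable I \<mu>" and ex: "exposed I \<mu> \<rho>" "exposed I \<mu> \<rho>'"
    and p: "p \<in> set \<rho>" "p \<in> set \<rho>'"
  shows "\<rho> = \<rho>'"
proof -
  have sub: "set \<sigma> \<subseteq> set \<sigma>'" if e: "exposed I \<mu> \<sigma>" "exposed I \<mu> \<sigma>'" "p \<in> set \<sigma>" "p \<in> set \<sigma>'" for \<sigma> \<sigma>'
  proof
    fix q assume "q \<in> set \<sigma>"
    then obtain a where a: "a < length \<sigma>" "\<sigma> ! a = q" by (metis in_set_conv_nth)
    obtain i where i: "i < length \<sigma>" "\<sigma> ! i = p" using e by (metis in_set_conv_nth)
    obtain j where j: "j < length \<sigma>'" "\<sigma>' ! j = p" using e by (metis in_set_conv_nth)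
    obtain n where n: "(i + n) mod length \<sigma> = a" using mod_orbit i(1) a(1) by blast
    then have "q = \<sigma>' ! ((j + n) mod length \<sigma>')"
      using exposed_orbit[OF st e(1,2) i(1) j(1)] i j a by metis
    moreover have "(j + n) mod length \<sigma>' < length \<sigma>'" using j(1) by (auto intro: mod_less_divisor)
    ultimately show "q \<in> set \<sigma>'" by simp
  qed
  have eq: "set \<rho> = set \<rho>'" using sub[OF ex p] sub[OF ex(2,1) p(2,1)] by blast
  have ne: "\<rho> \<noteq> []" "\<rho>' \<noteq> []" "distinct \<rho>" "distinct \<rho>'" using ex by (auto simp: exposed_def)
  then have l: "length \<rho> = length \<rho>'" using eq distinct_card by metis
  have h: "hd \<rho> \<in> set \<rho>" "hd \<rho>' \<in> set \<rho>'" using ne by auto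
  then have "fst (hd \<rho>) = fst (hd \<rho>')" using ex eq by (auto simp: exposed_def intro!: antisym)
  moreover have "hd \<rho> \<in> \<mu>" "hd \<rho>' \<in> \<mu>" using h ex by (auto simp: exposed_def)
  ultimately have "hd \<rho> = hd \<rho>'" using matchingD(1)[OF stableD(1)[OF st]] by (metis prod.collapse)
  then have z: "\<rho> ! 0 = \<rho>' ! 0" using ne by (simp add: hd_conv_nth)
  show ?thesis
  proof (rule nth_equalityI[OF l])
    fix i assume "i < length \<rho>"
    then show "\<rho> ! i = \<rho>' ! i" using exposed_orbit[OF st ex _ _ z, of i] ne l by simp
  qed
qed

text \<open>The two rotations may be exposed in different matchings. In the join of both, the man of
  the common pair still sits at its woman, so neither rotation has been passed and by
  \<open>before_or_past\<close> none of their men has moved on. Both rotations are therefore exposed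
  in the join, where \<open>exposed_unique\<close> applies.\<close>

lemma rotations_disjoint:
  assumes r: "\<rho> \<in> rotations I" "\<rho>' \<in> rotations I" and p: "p \<in> set \<rho>" "p \<in> set \<rho>'"
  shows "\<rho> = \<rho>'"
proof -
  obtain \<mu> where st: "stable I \<mu>" and ex: "exposed I \<mu> \<rho>" using r(1) by (rule rotationsE)
  obtain \<mu>' where st': "stable I \<mu>'" and ex': "exposed I \<mu>' \<rho>'" using r(2) by (rule rotationsE)
  let ?x = "sup (vec \<mu>) (vec \<mu>')"
  have x: "stv ?x" using stv_sup stv_vec st st' by blast
  obtain m w where mw: "p = (m, w)" by force
  have "(m, w) \<in> \<mu>" "(m, w) \<in> \<mu>'" using p ex ex' mw by (auto simp: exposed_def)
  then have xm: "?x m = mpos I m w" using vec_stable st st' by simp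
  have sub: "set \<sigma> \<subseteq> mat ?x" if s: "\<sigma> \<in> rotations I" "p \<in> set \<sigma>" "stable I \<nu>" "exposed I \<nu> \<sigma>" "vec \<nu> \<le> ?x" for \<sigma> \<nu>
  proof
    fix q assume q: "q \<in> set \<sigma>"
    obtain m1 w1 where mw1: "q = (m1, w1)" by force
    have in': "(m1, w1) \<in> \<nu>" using q s mw1 by (auto simp: exposed_def)
    have "\<not> past ?x \<sigma>" using s(2) mw xm unfolding past_def by fastforce
    then have "?x m1 \<le> mpos I m1 w1" using before_or_past[OF s(1) x] q mw1 by (metis not_less)
    moreover have "mpos I m1 w1 \<le> ?x m1" using vec_stable[OF s(3) in'] s(5) by (metis le_funD)
    ultimately have "?x m1 = mpos I m1 w1" by (rule antisym)
    then show "q \<in> mat ?x" unfolding mat_def using mw1 stableD(2)[OF s(3) in'] by blast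
  qed
  have "exposed I (mat ?x) \<rho>"
    by (rule exposed_later[OF st stable_mat[OF x] ex]) (use sub[OF r(1) p(1) st ex] vec_mat[OF x] in auto)
  moreover have "exposed I (mat ?x) \<rho>'"
    by (rule exposed_later[OF st' stable_mat[OF x] ex']) (use sub[OF r(2) p(2) st' ex'] vec_mat[OF x] in auto)
  ultimately show ?thesis using exposed_unique[OF stable_mat[OF x] _ _ p] by blast
qed

definition rots :: "(nat \<Rightarrow> nat) \<Rightarrow> rotation set" where
  "rots x = {\<rho> \<in> rotations I. past x \<rho>}"

text \<open>Let \<open>\<rho>'\<close> be newly passed. Its first man \<open>m\<close> moved, so he
  belongs to \<open>\<rho>\<close>, say with \<open>w0\<close>. If his woman \<open>w\<close> in
  \<open>\<rho>'\<close> were a different one, she would come after \<open>w0\<close>; in the join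
  with a matching exposing \<open>\<rho>'\<close> the man \<open>m\<close> sits at \<open>w\<close>,
  past \<open>w0\<close>, so by \<open>eliminate_le\<close> the elimination cannot carry him beyond
  \<open>w\<close>. So the two rotations share a pair and are equal.\<close>

lemma
  assumes st: "stable I \<mu>" and ex: "exposed I \<mu> \<rho>"
  shows rots_eliminate: "rots (vec (eliminate \<mu> \<rho>)) = insert \<rho> (rots (vec \<mu>))"
    and exposed_not_rots: "\<rho> \<notin> rots (vec \<mu>)"
proof -
  let ?y = "vec (eliminate \<mu> \<rho>)"
  have r: "\<rho> \<in> rotations I" using st ex by (auto simp: rotations_def)
  have h: "hd \<rho> \<in> set \<rho>" using rotation_nonempty[OF r] by simp
  then have "hd \<rho> \<in> \<mu>" using ex by (auto simp: exposed_def)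
  then have "vec \<mu> (fst (hd \<rho>)) = mpos I (fst (hd \<rho>)) (snd (hd \<rho>))"
    using vec_stable[OF st] by simp
  then show "\<rho> \<notin> rots (vec \<mu>)" using past_iff_hd[OF r stv_vec[OF st]] by (simp add: rots_def)
  have "\<rho>' = \<rho>" if r': "\<rho>' \<in> rotations I" and p: "past ?y \<rho>'" and np: "\<not> past (vec \<mu>) \<rho>'" for \<rho>'
  proof -
    obtain m w where mw: "hd \<rho>' = (m, w)" by force
    then have in': "(m, w) \<in> set \<rho>'" using rotation_nonempty[OF r'] by (metis hd_in_set)
    have 1: "mpos I m w < ?y m" "vec \<mu> m \<le> mpos I m w"
      using past_iff_hd[OF r' stv_vec[OF st]] past_iff_hd[OF r' stv_vec[OF stable_eliminate[OF st ex]]] p np mw by auto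
    have "m \<in> fst ` set \<rho>"
    proof (rule ccontr)
      assume "m \<notin> fst ` set \<rho>"
      then have "?y m = vec \<mu> m" by (rule vec_unmoved)
      then show False using 1 by simp
    qed
    then obtain w0 where w0: "(m, w0) \<in> set \<rho>" by auto
    obtain \<mu>' where st': "stable I \<mu>'" and ex': "exposed I \<mu>' \<rho>'" using r' by (rule rotationsE)
    let ?x = "sup (vec \<mu>) (vec \<mu>')"
    have x: "stv ?x" "vec \<mu> \<le> ?x" using stv_sup stv_vec st st' by auto
    have v0: "vec \<mu> m = mpos I m w0" "(m, w0) \<in> \<mu>" using w0 ex vec_stable[OF st] by (auto simp: exposed_def)
    have v1: "vec \<mu>' m = mpos I m w" "(m, w) \<in> \<mu>'" using in' ex' vec_stable[OF st'] by (auto simp: exposed_def)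
    have "w = w0"
    proof (rule ccontr)
      assume "w \<noteq> w0"
      then have "mpos I m w \<noteq> mpos I m w0"
        using mpos_inject[OF stableD(2)[OF st' v1(2)] stableD(2)[OF st v0(2)]] by blast
      then have "vec \<mu> m < mpos I m w" using 1(2) v0(1) by simp
      then have xm: "?x m = mpos I m w" "mpos I m w0 < ?x m" using v0 v1 by (auto simp: sup_nat_def)
      then have "?y \<le> ?x" using eliminate_le[OF st ex x past_all[OF st ex x w0]] by blast
      then have "?y m \<le> ?x m" by (rule le_funD)
      then show False using xm 1 by simp
    qed
    then show ?thesis using rotations_disjoint[OF r' r in'] w0 by simp
  qed
  then show "rots ?y = insert \<rho> (rots (vec \<mu>))"
    using past_mono[OF _ vec_le_eliminate[OF st ex]] past_eliminate[OF st ex] r unfolding rots_def by auto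
qed

end

section \<open>Rotations and the lattice of stable matchings\<close>

text \<open>The cycle is entered at its least element because a rotation has to start with its
  smallest man; the least period \<open>k\<close> makes its members distinct.\<close>

lemma exists_cycle:
  fixes A :: "nat set"
  assumes fin: "finite A" and ne: "A \<noteq> {}" and f: "f ` A \<subseteq> A"
  obtains c k where "0 < k" "(f ^^ k) c = c" "inj_on (\<lambda>i. (f ^^ i) c) {..<k}"
    "\<And>i. (f ^^ i) c \<in> A" "\<And>i. c \<le> (f ^^ i) c"
proof -
  obtain a where a: "a \<in> A" using ne by blast
  have orb: "(f ^^ i) z \<in> A" if "z \<in> A" for i z using that f by (induction i) auto
  have "range (\<lambda>i. (f ^^ i) a) \<subseteq> A" using orb[OF a] by blast
  then have "\<not> inj (\<lambda>i. (f ^^ i) a)" using fin finite_subset finite_imageD infinite_UNIV_nat by metis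
  then obtain i j where ij: "i < j" "(f ^^ i) a = (f ^^ j) a"
    unfolding inj_def by (metis linorder_neqE_nat)
  define b p where "b = (f ^^ i) a" and "p = j - i"
  have p: "0 < p" "(f ^^ p) b = b"
    using ij funpow_add[of p i f] by (simp_all add: b_def p_def)
  let ?C = "range (\<lambda>n. (f ^^ n) b)"
  have bA: "b \<in> A" using orb[OF a] by (simp add: b_def)
  have C: "finite ?C" "?C \<noteq> {}" using orb[OF bA] fin finite_subset[of ?C A] by auto
  define c where "c = Min ?C"
  have "c \<in> ?C" unfolding c_def by (rule Min_in[OF C])
  then obtain q where q: "c = (f ^^ q) b" by blast
  have step: "(f ^^ i) c = (f ^^ (i + q)) b" for i by (simp add: q funpow_add)
  have "(f ^^ p) c = (f ^^ (q + p)) b" unfolding step by (simp add: add.commute)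
  then have pc: "(f ^^ p) c = c" using p q by (simp add: funpow_add)
  define k where "k = (LEAST k. 0 < k \<and> (f ^^ k) c = c)"
  have k: "0 < k" "(f ^^ k) c = c"
    using LeastI[of "\<lambda>k. 0 < k \<and> (f ^^ k) c = c" p] p pc by (auto simp: k_def)
  have kl: "\<not> (0 < l \<and> (f ^^ l) c = c)" if "l < k" for l
    using not_less_Least[of l "\<lambda>k. 0 < k \<and> (f ^^ k) c = c"] that by (simp add: k_def)
  have "inj_on (\<lambda>i. (f ^^ i) c) {..<k}"
  proof (rule linorder_inj_onI)
    fix i j assume ij: "i < j" "i \<in> {..<k}" "j \<in> {..<k}"
    show "(f ^^ i) c \<noteq> (f ^^ j) c"
    proof
      assume "(f ^^ i) c = (f ^^ j) c"
      then have "(f ^^ (k - j)) ((f ^^ i) c) = (f ^^ (k - j)) ((f ^^ j) c)" by simp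
      then have "(f ^^ (k - j + i)) c = (f ^^ (k - j + j)) c" unfolding funpow_add by simp
      then have "(f ^^ (k - j + i)) c = c" using ij k by simp
      then show False using kl[of "k - j + i"] ij by auto
    qed
  qed auto
  moreover have "c \<le> (f ^^ i) c" for i unfolding step unfolding c_def by (rule Min_le[OF C(1)]) blast
  moreover have "(f ^^ i) c \<in> A" for i unfolding step by (rule orb[OF bA])
  ultimately show ?thesis using that k by blast
qed

context marriage
begin

text \<open>\<open>?A\<close> consists of the men who still have to move. The partner in
  \<open>x\<close> of such a man would accept him, so his next woman \<open>u\<close> comes no
  later; he has reached \<open>u\<close> in \<open>x\<close>, so her partner cannot stay with her
  and lies in \<open>?A\<close> as well. Iterating this map inside the finite set \<open>?A\<close>
  leads into a cycle, and the cycle is the rotation.\<close>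

lemma exists_exposed:
  assumes st: "stable I \<mu>" and x: "stv x" "vec \<mu> \<le> x" and ne: "vec \<mu> \<noteq> x"
  shows "\<exists>\<rho>. exposed I \<mu> \<rho> \<and> past x \<rho>"
proof -
  let ?A = "{m. vec \<mu> m < x m}"
  have vx: "valid x" "settled x" using x by (auto simp: stv_def)
  have sub: "?A \<subseteq> {..<nm}" using vx(1) unfolding valid_def by (metis (no_types, lifting) lessThan_iff mem_Collect_eq not_less not_less0 subsetI)
  have fin: "finite ?A" using sub finite_subset by blast
  have "\<exists>m. vec \<mu> m \<noteq> x m" using ne by blast
  then have neA: "?A \<noteq> {}" using x(2) by (auto simp: le_fun_def nat_less_le)
  have mt: "is_matching \<mu>" using stableD st by blast
  have ex: "\<exists>m' u. m' \<in> ?A \<and> (m', u) \<in> \<mu> \<and> next_woman I \<mu> m u \<and> (\<exists>w. (m, w) \<in> \<mu>)" if m: "m \<in> ?A" for m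
  proof -
    have mn: "m < nm" using m sub by blast
    then have "x m \<le> Suc (len m)" using vx by (simp add: valid_def)
    then have "vec \<mu> m \<le> len m" using m by simp
    then have mm: "m \<in> fst ` mat (vec \<mu>)" using fst_mat[OF valid_vec[OF st]] mn by blast
    then obtain w where w: "(m, w) \<in> \<mu>" using mat_vec[OF st] by auto
    have "m \<in> fst ` mat x" using mm fst_mat_stv[OF x(1) stv_vec[OF st]] by simp
    then obtain v where v: "(m, v) \<in> mat x" by auto
    define P where "P = (\<lambda>u. acc m u \<and> mpos I m w < mpos I m u \<and> woman_prefers I \<mu> u m)"
    have "acc m v" "x m = mpos I m v" using v by (auto simp: mat_def)
    then have "P v" unfolding P_def
      using woman_improves[OF st x v] m vec_stable[OF st w] by simp
    then obtain u where u: "P u" "\<And>u'. P u' \<Longrightarrow> mpos I m u \<le> mpos I m u'"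
      using ex_has_least_nat[of P v "mpos I m"] by blast
    have "is_arg_min (mpos I m) P u" using u by (auto simp: is_arg_min_def not_less)
    then have nw: "next_woman I \<mu> m u" using w unfolding next_woman_def P_def by blast
    have "mpos I m u \<le> x m" using u(2)[OF \<open>P v\<close>] \<open>x m = mpos I m v\<close> by simp
    then have r: "reached x m u" using u(1) by (simp add: P_def reached_def)
    then have "u \<in> snd ` mat x" using x unfolding stv_def by blast
    \<comment> \<open>All stable matchings hold the same women, so the search of \<open>m\<close>
      does not end at an unmatched woman.\<close>
    then have "u \<in> snd ` \<mu>" using snd_mat_stv[OF x(1) stv_vec[OF st]] mat_vec[OF st] by simp
    then obtain m' where m': "(m', u) \<in> \<mu>" by auto
    have lt: "wpos I u m < wpos I u m'" using u(1) m' by (auto simp: P_def woman_prefers_def)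
    have "x m' \<noteq> mpos I m' u"
    proof
      assume "x m' = mpos I m' u"
      then have "(m', u) \<in> mat x" using stableD(2)[OF st m'] by (simp add: mat_def)
      then have "wpos I u m' \<le> wpos I u m" using vx r unfolding settled_def by blast
      then show False using lt by simp
    qed
    moreover have "vec \<mu> m' = mpos I m' u" "vec \<mu> m' \<le> x m'"
      using vec_stable[OF st m'] le_funD[OF x(2), of m'] by auto
    ultimately have "m' \<in> ?A" by simp
    then show ?thesis using m' nw w by blast
  qed
  then have "\<forall>m\<in>?A. \<exists>m'. m' \<in> ?A \<and> (\<exists>u. (m', u) \<in> \<mu> \<and> next_woman I \<mu> m u)" by blast
  then obtain f where f: "\<forall>m\<in>?A. f m \<in> ?A \<and> (\<exists>u. (f m, u) \<in> \<mu> \<and> next_woman I \<mu> m u)"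
    using bchoice by metis
  define pw where "pw m = (THE w. (m, w) \<in> \<mu>)" for m
  have pw: "pw m = w" if "(m, w) \<in> \<mu>" for m w
    unfolding pw_def by (rule the_equality) (use that matchingD(1)[OF mt] in blast)+
  have pwA: "(m, pw m) \<in> \<mu>" if "m \<in> ?A" for m using ex[OF that] pw by metis
  have nxt: "next_woman I \<mu> m (pw (f m))" if "m \<in> ?A" for m using f that pw by metis
  have fA: "f ` ?A \<subseteq> ?A" using f by blast
  obtain c k where k: "0 < k" "(f ^^ k) c = c" and inj: "inj_on (\<lambda>i. (f ^^ i) c) {..<k}"
    and inA: "\<And>i. (f ^^ i) c \<in> ?A" and le: "\<And>i. c \<le> (f ^^ i) c"
    by (rule exists_cycle[OF fin neA fA]) blast
  define g where "g i = ((f ^^ i) c, pw ((f ^^ i) c))" for i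
  define \<rho> where "\<rho> = map g [0..<k]"
  have len: "length \<rho> = k" by (simp add: \<rho>_def)
  have nth: "i < k \<Longrightarrow> \<rho> ! i = g i" for i by (simp add: \<rho>_def)
  have set: "set \<rho> = g ` {..<k}" by (auto simp: \<rho>_def)
  have "inj_on g {..<k}" using inj by (auto simp: inj_on_def g_def)
  then have "distinct \<rho>" unfolding \<rho>_def by (simp add: distinct_map lessThan_atLeast0)
  moreover have "set \<rho> \<subseteq> \<mu>" using pwA[OF inA] by (auto simp: set g_def)
  moreover have "next_woman I \<mu> (fst (\<rho> ! i)) (snd (\<rho> ! (Suc i mod length \<rho>)))" if i: "i < length \<rho>" for i
  proof -
    have "g (Suc i mod k) = g (Suc i)" using i k by (cases "Suc i = k") (auto simp: len g_def)
    then have "\<rho> ! (Suc i mod length \<rho>) = g (Suc i)" using nth[of "Suc i mod k"] k len by simp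
    moreover have "\<rho> ! i = g i" using i len nth by simp
    ultimately show ?thesis using nxt[OF inA[of i]] by (simp add: g_def)
  qed
  moreover have "hd \<rho> = g 0" using k by (simp add: \<rho>_def hd_map)
  then have "\<forall>p\<in>set \<rho>. fst (hd \<rho>) \<le> fst p" using le by (auto simp: set g_def)
  moreover have "\<rho> \<noteq> []" using k by (simp add: \<rho>_def)
  ultimately have "exposed I \<mu> \<rho>" unfolding exposed_def by blast
  moreover have "past x \<rho>" unfolding past_def
  proof (rule ballI, clarify)
    fix m w assume "(m, w) \<in> set \<rho>"
    then obtain i where "m = (f ^^ i) c" "w = pw m" by (auto simp: set g_def)
    then have m: "m \<in> ?A" "w = pw m" using inA by blast+
    have "vec \<mu> m = mpos I m w" using vec_stable[OF st pwA[OF m(1)]] m(2) by simp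
    then show "mpos I m w < x m" using m(1) by simp
  qed
  ultimately show ?thesis by blast
qed

section \<open>Change of the satisfactions under an elimination\<close>

definition dM :: "rotation \<Rightarrow> int" where
  "dM \<rho> = (\<Sum>i<length \<rho>. int (mpos I (fst (\<rho> ! i)) (snd (\<rho> ! (Suc i mod length \<rho>))))
     - int (mpos I (fst (\<rho> ! i)) (snd (\<rho> ! i))))"

text \<open>Summed over the women: the one in the pair after pair \<open>i\<close> exchanges the man
  of her own pair for the man of pair \<open>i\<close>. What is counted is her gain, so that the
  weight, like \<open>dM\<close>, is nonnegative although \<open>sat_W\<close> falls.\<close>

definition dW :: "rotation \<Rightarrow> int" where
  "dW \<rho> = (\<Sum>i<length \<rho>.
     int (wpos I (snd (\<rho> ! (Suc i mod length \<rho>))) (fst (\<rho> ! (Suc i mod length \<rho>))))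
     - int (wpos I (snd (\<rho> ! (Suc i mod length \<rho>))) (fst (\<rho> ! i))))"

lemma sum_eliminate:
  fixes h :: "nat \<times> nat \<Rightarrow> int"
  assumes st: "stable I \<mu>" and ex: "exposed I \<mu> \<rho>"
  shows "sum h (eliminate \<mu> \<rho>) = sum h \<mu> +
    ((\<Sum>i<length \<rho>. h (fst (\<rho> ! i), snd (\<rho> ! (Suc i mod length \<rho>)))) - (\<Sum>i<length \<rho>. h (\<rho> ! i)))"
proof -
  let ?k = "length \<rho>"
  let ?g = "\<lambda>i. (fst (\<rho> ! i), snd (\<rho> ! (Suc i mod ?k)))"
  have fin: "finite \<mu>" using finite_mat mat_vec[OF st] by metis
  have sub: "set \<rho> \<subseteq> \<mu>" "distinct \<rho>" using ex by (auto simp: exposed_def)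
  have mv: "moved \<rho> = ?g ` {..<?k}" by (auto simp: moved_def)
  have "inj_on ?g {..<?k}" using exposed_index[OF ex st] by (auto simp: inj_on_def)
  then have s1: "sum h (moved \<rho>) = (\<Sum>i<?k. h (?g i))" unfolding mv by (simp add: sum.reindex)
  have s2: "sum h (set \<rho>) = (\<Sum>i<?k. h (\<rho> ! i))"
    using sum.reindex_bij_betw[OF bij_betw_nth[OF sub(2) refl refl], of h] by simp
  have "(\<mu> - set \<rho>) \<inter> moved \<rho> = {}"
  proof (safe)
    fix m w assume a: "(m, w) \<in> \<mu>" "(m, w) \<in> moved \<rho>" "(m, w) \<notin> set \<rho>"
    then obtain i where i: "i < ?k" "m = fst (\<rho> ! i)" by (auto simp: moved_def)
    have "\<rho> ! i \<in> \<mu>" "\<rho> ! i \<in> set \<rho>" using i nth_mem sub by auto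
    moreover have "\<rho> ! i = (m, snd (\<rho> ! i))" using i by simp
    ultimately show "(m, w) \<in> {}" using a matchingD(1)[OF stableD(1)[OF st]] by metis
  qed
  moreover have "finite (moved \<rho>)" by (simp add: mv)
  ultimately have "sum h (eliminate \<mu> \<rho>) = sum h (\<mu> - set \<rho>) + sum h (moved \<rho>)"
    unfolding eliminate_eq using fin by (intro sum.union_disjoint) auto
  moreover have "sum h (\<mu> - set \<rho>) = sum h \<mu> - sum h (set \<rho>)" using fin sub by (intro sum_diff) auto
  ultimately show ?thesis using s1 s2 by simp
qed

lemma sat_M_eliminate:
  assumes "stable I \<mu>" "exposed I \<mu> \<rho>"
  shows "int (sat_M I (eliminate \<mu> \<rho>)) = int (sat_M I \<mu>) + dM \<rho>"
proof -
  have "int (sat_M I \<nu>) = sum (\<lambda>p. int (mpos I (fst p) (snd p))) \<nu>" for \<nu>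
    by (simp add: sat_M_def case_prod_beta)
  then show ?thesis using sum_eliminate[OF assms, of "\<lambda>p. int (mpos I (fst p) (snd p))"]
    by (simp add: dM_def sum_subtractf)
qed

lemma sat_W_eliminate:
  assumes "stable I \<mu>" "exposed I \<mu> \<rho>"
  shows "int (sat_W I (eliminate \<mu> \<rho>)) = int (sat_W I \<mu>) - dW \<rho>"
proof -
  have "int (sat_W I \<nu>) = sum (\<lambda>p. int (wpos I (snd p) (fst p))) \<nu>" for \<nu>
    by (simp add: sat_W_def case_prod_beta)
  then show ?thesis using sum_eliminate[OF assms, of "\<lambda>p. int (wpos I (snd p) (fst p))"]
      sum.reindex_bij_betw[OF bij_betw_Suc_mod, of "\<lambda>i. int (wpos I (snd (\<rho> ! i)) (fst (\<rho> ! i)))" "length \<rho>"]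
    by (simp add: dW_def sum_subtractf)
qed

lemma
  assumes "\<rho> \<in> rotations I"
  shows dM_nonneg: "0 \<le> dM \<rho>" and dW_nonneg: "0 \<le> dW \<rho>"
proof -
  obtain \<mu> where st: "stable I \<mu>" and ex: "exposed I \<mu> \<rho>" using assms by (rule rotationsE)
  note f = exposedD[OF st ex _ prod.collapse[symmetric] prod.collapse[symmetric]]
  show "0 \<le> dM \<rho>" "0 \<le> dW \<rho>" unfolding dM_def dW_def using f(6,7)
    by (auto intro!: sum_nonneg simp: less_imp_le)
qed

text \<open>A consequence of disjointness. It bounds the number of rotations by the number of pairs,
  and lets the program recognize a rotation by its first pair.\<close>

lemma inj_on_hd_rotations: "inj_on hd (rotations I)"
proof (rule inj_onI)
  fix \<rho> \<rho>' assume r: "\<rho> \<in> rotations I" "\<rho>' \<in> rotations I" "hd \<rho> = hd \<rho>'"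
  show "\<rho> = \<rho>'"
    using rotations_disjoint[OF r(1,2)] hd_in_set[OF rotation_nonempty] r by metis
qed

lemma rotation_acc:
  assumes "\<rho> \<in> rotations I" "(m, w) \<in> set \<rho>"
  shows "acc m w"
proof -
  obtain \<mu> where st: "stable I \<mu>" and ex: "exposed I \<mu> \<rho>" using assms(1) by (rule rotationsE)
  have "(m, w) \<in> \<mu>" using assms(2) ex unfolding exposed_def by blast
  then show ?thesis using stableD(2)[OF st] by blast
qed

lemma rotation_length:
  assumes "\<rho> \<in> rotations I"
  shows "length \<rho> \<le> nm"
proof -
  obtain \<mu> where st: "stable I \<mu>" and ex: "exposed I \<mu> \<rho>" using assms by (rule rotationsE)
  have "inj_on (\<lambda>i. fst (\<rho> ! i)) {..<length \<rho>}" using exposed_index(1)[OF ex st] by (auto simp: inj_on_def)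
  moreover have "(\<lambda>i. fst (\<rho> ! i)) ` {..<length \<rho>} \<subseteq> {..<nm}"
    using rotation_acc[OF assms, of "fst (\<rho> ! i)" "snd (\<rho> ! i)" for i] by (auto simp: acc_iff)
  ultimately show ?thesis using card_inj_on_le[of _ "{..<length \<rho>}" "{..<nm}"] by fastforce
qed

lemma rots_finite: "finite (rotations I)"
  and card_rotations: "card (rotations I) \<le> nm * nw"
proof -
  note inj_on_hd_rotations
  moreover have "hd ` rotations I \<subseteq> {..<nm} \<times> {..<nw}"
  proof
    fix p assume "p \<in> hd ` rotations I"
    then obtain \<rho> where r: "\<rho> \<in> rotations I" "p = hd \<rho>" by blast
    then have "acc (fst p) (snd p)" using rotation_acc[OF r(1)] hd_in_set[OF rotation_nonempty[OF r(1)]] by simp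
    then show "p \<in> {..<nm} \<times> {..<nw}" by (cases p) (auto simp: acceptable_def)
  qed
  moreover have "finite ({..<nm} \<times> {..<nw})" by simp
  ultimately show "finite (rotations I)" "card (rotations I) \<le> nm * nw"
    using inj_on_finite[of hd "rotations I" "{..<nm} \<times> {..<nw}"]
      card_inj_on_le[of hd "rotations I" "{..<nm} \<times> {..<nw}"] by auto
qed

lemma elim_seq_facts:
  assumes "elim_seq I \<mu> \<rho>s \<nu>" "stable I \<mu>"
  shows "stable I \<nu> \<and> vec \<mu> \<le> vec \<nu> \<and> distinct \<rho>s \<and> set \<rho>s \<inter> rots (vec \<mu>) = {} \<and>
    rots (vec \<nu>) = rots (vec \<mu>) \<union> set \<rho>s \<and>
    int (sat_M I \<nu>) = int (sat_M I \<mu>) + sum dM (set \<rho>s) \<and>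
    int (sat_W I \<nu>) = int (sat_W I \<mu>) - sum dW (set \<rho>s)"
  using assms
proof (induction rule: elim_seq.induct)
  case (Nil \<mu>)
  then show ?case by simp
next
  case (Cons \<mu> \<rho> \<rho>s \<nu>)
  note f = stable_eliminate[OF Cons(4,1)] rots_eliminate[OF Cons(4,1)] exposed_not_rots[OF Cons(4,1)]
    vec_le_eliminate[OF Cons(4,1)] sat_M_eliminate[OF Cons(4,1)] sat_W_eliminate[OF Cons(4,1)]
  note ih = Cons.IH[OF f(1)]
  have "\<rho> \<notin> set \<rho>s" using ih f(2) by blast
  moreover have "vec \<mu> \<le> vec \<nu>" using ih f(4) order_trans by blast
  ultimately show ?case using ih f by auto
qed

text \<open>By induction on the number of rotations not yet passed. \<open>exists_exposed\<close>
  yields a rotation that \<open>\<nu>\<close> has passed, so \<open>\<nu>\<close> stays above after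
  the elimination.\<close>

lemma elim_seq_exists:
  assumes "stable I \<mu>" "stable I \<nu>" "vec \<mu> \<le> vec \<nu>"
  shows "\<exists>\<rho>s. elim_seq I \<mu> \<rho>s \<nu>"
  using assms
proof (induction "card (rotations I - rots (vec \<mu>))" arbitrary: \<mu> rule: less_induct)
  case less
  show ?case
  proof (cases "vec \<mu> = vec \<nu>")
    case True
    then have "\<mu> = \<nu>" using mat_vec less.prems by metis
    then show ?thesis using elim_seq.Nil by blast
  next
    case False
    obtain \<rho> where ex: "exposed I \<mu> \<rho>" and p: "past (vec \<nu>) \<rho>"
      using exists_exposed[OF less.prems(1) stv_vec[OF less.prems(2)] less.prems(3) False] by blast
    have st: "stable I (eliminate \<mu> \<rho>)" using stable_eliminate less.prems(1) ex by blast
    have le: "vec (eliminate \<mu> \<rho>) \<le> vec \<nu>"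
      using eliminate_le[OF less.prems(1) ex stv_vec[OF less.prems(2)] less.prems(3) p] .
    have "\<rho> \<in> rotations I" using less.prems(1) ex by (auto simp: rotations_def)
    then have "rotations I - rots (vec (eliminate \<mu> \<rho>)) \<subset> rotations I - rots (vec \<mu>)"
      using rots_eliminate[OF less.prems(1) ex] exposed_not_rots[OF less.prems(1) ex] by blast
    then have "card (rotations I - rots (vec (eliminate \<mu> \<rho>))) < card (rotations I - rots (vec \<mu>))"
      using rots_finite by (intro psubset_card_mono) auto
    then obtain \<rho>s where "elim_seq I (eliminate \<mu> \<rho>) \<rho>s \<nu>" using less.hyps[OF _ st less.prems(2) le] by blast
    then show ?thesis using elim_seq.Cons[OF ex] by blast
  qed
qed

lemma rots_best: "rots best = {}"
proof -
  have "\<not> past best \<rho>" if r: "\<rho> \<in> rotations I" for \<rho>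
  proof -
    obtain \<mu> where st: "stable I \<mu>" and ex: "exposed I \<mu> \<rho>" using r by (rule rotationsE)
    have "hd \<rho> \<in> \<mu>" using rotation_nonempty[OF r] ex hd_in_set by (auto simp: exposed_def)
    then have "vec \<mu> (fst (hd \<rho>)) = mpos I (fst (hd \<rho>)) (snd (hd \<rho>))" using vec_stable[OF st] by simp
    moreover have "best (fst (hd \<rho>)) \<le> vec \<mu> (fst (hd \<rho>))" using best_le[OF stv_vec[OF st]] by (rule le_funD)
    ultimately show ?thesis using past_iff_hd[OF r stv_best] by simp
  qed
  then show ?thesis by (auto simp: rots_def)
qed

lemma sat_rots:
  assumes "stv x"
  shows "int (sat_M I (mat x)) = int (sat_M I (mat best)) + sum dM (rots x)"
    "int (sat_W I (mat x)) = int (sat_W I (mat best)) - sum dW (rots x)"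
proof -
  obtain \<rho>s where s: "elim_seq I (mat best) \<rho>s (mat x)"
    using elim_seq_exists[OF stable_mat[OF stv_best] stable_mat[OF assms]]
    by (auto simp: vec_mat[OF stv_best] vec_mat[OF assms] best_le[OF assms])
  show "int (sat_M I (mat x)) = int (sat_M I (mat best)) + sum dM (rots x)"
    "int (sat_W I (mat x)) = int (sat_W I (mat best)) - sum dW (rots x)"
    using elim_seq_facts[OF s stable_mat[OF stv_best]] by (auto simp: vec_mat[OF stv_best] vec_mat[OF assms] rots_best)
qed

section \<open>Closed sets of rotations\<close>

definition start :: "nat \<Rightarrow> nat \<Rightarrow> nat \<Rightarrow> nat" where
  "start m k = ones(m := k)"

text \<open>The least stable matching past \<open>\<rho>\<close>; the rotations behind it form the down-set of \<open>\<rho>\<close>.\<close>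

definition clr :: "rotation \<Rightarrow> nat \<Rightarrow> nat" where
  "clr \<rho> = cl (start (fst (hd \<rho>)) (Suc (mpos I (fst (hd \<rho>)) (snd (hd \<rho>)))))"

text \<open>By \<open>past_iff_hd\<close>, being past \<open>\<rho>\<close> means for a stable
  vector no more than having the first man beyond his woman. A matching from which
  \<open>\<rho>\<close> has just been eliminated is such a vector and serves as the upper bound in
  \<open>stv_cl\<close>.\<close>

lemma
  assumes r: "\<rho> \<in> rotations I"
  shows stv_clr: "stv (clr \<rho>)"
    and past_clr: "past (clr \<rho>) \<rho>"
    and clr_le: "\<And>x. stv x \<Longrightarrow> past x \<rho> \<Longrightarrow> clr \<rho> \<le> x"
    and start_le_tops: "start (fst (hd \<rho>)) (Suc (mpos I (fst (hd \<rho>)) (snd (hd \<rho>)))) \<le> tops"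
proof -
  let ?m = "fst (hd \<rho>)" and ?w = "snd (hd \<rho>)"
  let ?v = "start ?m (Suc (mpos I ?m ?w))"
  obtain \<mu> where st: "stable I \<mu>" and ex: "exposed I \<mu> \<rho>" using r by (rule rotationsE)
  have h: "(?m, ?w) \<in> set \<rho>" using rotation_nonempty[OF r] by simp
  then have "(?m, ?w) \<in> \<mu>" using ex unfolding exposed_def by blast
  then have "acc ?m ?w" using stableD(2)[OF st] by blast
  then have m: "?m < nm" by (simp add: acc_iff)
  have v1: "ones \<le> ?v" by (auto simp: start_def le_fun_def ones_def)
  have vx: "?v \<le> x" if "stv x" "past x \<rho>" for x
    using that h past_iff_hd[OF r] by (auto simp: start_def le_fun_def stv_def valid_iff)
  show "\<And>x. stv x \<Longrightarrow> past x \<rho> \<Longrightarrow> clr \<rho> \<le> x" unfolding clr_def using stv_cl(2)[OF v1] vx by blast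
  let ?x = "vec (eliminate \<mu> \<rho>)"
  have x: "stv ?x" "past ?x \<rho>" using past_eliminate st ex stv_vec stable_eliminate by auto
  show "stv (clr \<rho>)" unfolding clr_def using stv_cl(1)[OF v1 x(1) vx[OF x]] .
  have vt: "?v \<le> tops" using vx[OF x] x(1) unfolding stv_def valid_iff by (blast intro: order_trans)
  then show "?v \<le> tops" .
  have "?v ?m \<le> clr \<rho> ?m" using cl_ge[OF vt] unfolding clr_def by (rule le_funD)
  then show "past (clr \<rho>) \<rho>" using past_iff_hd[OF r \<open>stv (clr \<rho>)\<close>] by (simp add: start_def)
qed

lemma elim_seq_split:
  assumes "elim_seq I \<mu> (as @ \<rho> # bs) \<nu>"
  shows "\<exists>\<mu>'. elim_seq I \<mu> as \<mu>' \<and> exposed I \<mu>' \<rho>"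
  using assms
proof (induction as arbitrary: \<mu>)
  case Nil
  then show ?case by (auto elim: elim_seq.cases intro: elim_seq.Nil)
next
  case (Cons a as)
  then have "exposed I \<mu> a" "elim_seq I (eliminate \<mu> a) (as @ \<rho> # bs) \<nu>" by (auto elim: elim_seq.cases)
  then show ?case using Cons.IH elim_seq.Cons by blast
qed

text \<open>Some elimination sequence leads from \<open>best\<close> to \<open>clr \<rho>'\<close>
  and must contain \<open>\<rho>'\<close>. The part before \<open>\<rho>'\<close> exposes it, so by
  definition of precedence it contains \<open>\<rho>\<close>.\<close>

lemma precedence_past:
  assumes p: "(\<rho>, \<rho>') \<in> precedence I"
  shows "past (clr \<rho>') \<rho>"
proof -
  have r: "\<rho> \<in> rotations I" "\<rho>' \<in> rotations I" using p by (auto simp: precedence_def)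
  let ?x = "clr \<rho>'"
  have x: "stv ?x" using stv_clr r by blast
  obtain \<rho>s where s: "elim_seq I (mat best) \<rho>s (mat ?x)"
    using elim_seq_exists[OF stable_mat[OF stv_best] stable_mat[OF x]]
    by (auto simp: vec_mat[OF stv_best] vec_mat[OF x] best_le[OF x])
  have rx: "rots ?x = set \<rho>s"
    using elim_seq_facts[OF s stable_mat[OF stv_best]] by (simp add: vec_mat[OF stv_best] vec_mat[OF x] rots_best)
  have "\<rho>' \<in> rots ?x" using r past_clr by (simp add: rots_def)
  then have "\<rho>' \<in> set \<rho>s" using rx by simp
  then obtain as bs where ab: "\<rho>s = as @ \<rho>' # bs" using split_list by metis
  then obtain \<mu>' where "elim_seq I (mat best) as \<mu>'" "exposed I \<mu>' \<rho>'"
    using elim_seq_split s by blast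
  then have "\<rho> \<in> set as" using p man_optimal_iff unfolding precedence_def by blast
  then have "\<rho> \<in> rots ?x" using rx ab by simp
  then show ?thesis by (simp add: rots_def)
qed

text \<open>Whenever \<open>\<rho>'\<close> is exposed, eliminating it leads above
  \<open>clr \<rho>'\<close> and thus past \<open>\<rho>\<close>. That last step added only
  \<open>\<rho>'\<close>, so a different \<open>\<rho>\<close> was eliminated earlier.\<close>

lemma past_precedence:
  assumes r: "\<rho> \<in> rotations I" "\<rho>' \<in> rotations I" and p: "past (clr \<rho>') \<rho>" and ne: "\<rho> \<noteq> \<rho>'"
  shows "(\<rho>, \<rho>') \<in> precedence I"
proof -
  have "\<rho> \<in> set \<rho>s" if o: "man_optimal I \<mu>0" and s: "elim_seq I \<mu>0 \<rho>s \<mu>" and ex: "exposed I \<mu> \<rho>'" for \<mu>0 \<rho>s \<mu>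
  proof -
    have m0: "\<mu>0 = mat best" using o man_optimal_iff by simp
    note f = elim_seq_facts[OF s[unfolded m0] stable_mat[OF stv_best]]
    have st: "stable I \<mu>" using f by blast
    have rm: "rots (vec \<mu>) = set \<rho>s" using f by (simp add: vec_mat[OF stv_best] rots_best)
    have "clr \<rho>' \<le> vec (eliminate \<mu> \<rho>')"
      by (rule clr_le[OF r(2) stv_vec[OF stable_eliminate[OF st ex]] past_eliminate[OF st ex]])
    then have "\<rho> \<in> rots (vec (eliminate \<mu> \<rho>'))" using past_mono[OF p] r by (simp add: rots_def)
    then show ?thesis using rots_eliminate[OF st ex] rm ne by simp
  qed
  then show ?thesis using r unfolding precedence_def by blast
qed

text \<open>A finite supremum. Including \<open>best\<close>, which lies below every stable vector,
  gives a value for the empty set and does not affect nonempty sets of rotations.\<close>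

definition joinv :: "rotation set \<Rightarrow> nat \<Rightarrow> nat" where
  "joinv U m = Max (insert (best m) ((\<lambda>\<rho>. clr \<rho> m) ` U))"

lemma rots_sup:
  assumes "stv x" "stv y"
  shows "rots (sup x y) = rots x \<union> rots y"
  using past_iff_hd assms stv_sup[OF assms] by (auto simp: rots_def sup_nat_def less_max_iff_disj)

lemma rots_joinv:
  assumes "finite U" "U \<subseteq> rotations I"
  shows "stv (joinv U) \<and> rots (joinv U) = (\<Union>\<rho>\<in>U. rots (clr \<rho>))"
  using assms
proof (induction U rule: finite_induct)
  case empty
  have "joinv {} = best" by (auto simp: joinv_def)
  then show ?case by (simp add: stv_best rots_best)
next
  case (insert \<rho> U)
  have "joinv (insert \<rho> U) m = sup (clr \<rho>) (joinv U) m" for m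
  proof -
    have "insert (best m) ((\<lambda>\<rho>. clr \<rho> m) ` insert \<rho> U) = insert (clr \<rho> m) (insert (best m) ((\<lambda>\<rho>. clr \<rho> m) ` U))" by auto
    then show ?thesis using insert(1) by (simp add: joinv_def sup_nat_def Max_insert del: insert_iff)
  qed
  then have eq: "joinv (insert \<rho> U) = sup (clr \<rho>) (joinv U)" by blast
  have st: "stv (clr \<rho>)" "stv (joinv U)" using insert stv_clr by auto
  show ?case unfolding eq rots_sup[OF st] using insert stv_sup[OF st] by blast
qed

text \<open>The closed sets of the rotation poset are the sets \<open>rots x\<close>, and it suffices to check closure along the edges of the digraph.\<close>

lemma closed_set_joinv:
  assumes D: "D\<^sup>+ = precedence I" and U: "U \<subseteq> rotations I"
    and closed: "\<And>\<rho> \<rho>'. (\<rho>, \<rho>') \<in> D \<Longrightarrow> \<rho>' \<in> U \<Longrightarrow> \<rho> \<in> U"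
  shows "stv (joinv U)" "rots (joinv U) = U"
proof -
  have fin: "finite U" using U rots_finite finite_subset by blast
  have tr: "\<rho>' \<in> U \<longrightarrow> \<rho> \<in> U" if "(\<rho>, \<rho>') \<in> D\<^sup>+" for \<rho> \<rho>'
    using that by (induction rule: trancl_induct) (use closed in blast)+
  have "rots (clr \<rho>) \<subseteq> U" if "\<rho> \<in> U" for \<rho>
  proof
    fix \<sigma> assume "\<sigma> \<in> rots (clr \<rho>)"
    then have s: "\<sigma> \<in> rotations I" "past (clr \<rho>) \<sigma>" by (auto simp: rots_def)
    show "\<sigma> \<in> U"
    proof (cases "\<sigma> = \<rho>")
      case False
      then have "(\<sigma>, \<rho>) \<in> D\<^sup>+" unfolding D using past_precedence s U that by blast
      then show ?thesis using tr that by blast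
    qed (use that in simp)
  qed
  moreover have "\<rho> \<in> rots (clr \<rho>)" if "\<rho> \<in> U" for \<rho> using that U past_clr by (auto simp: rots_def)
  ultimately show "stv (joinv U)" "rots (joinv U) = U" using rots_joinv[OF fin U] by auto
qed

lemma rots_closed:
  assumes "stv x" "\<rho>' \<in> rots x" "\<rho> \<in> rotations I" "past (clr \<rho>') \<rho>"
  shows "\<rho> \<in> rots x"
  using assms past_mono clr_le unfolding rots_def by blast

lemma card_stable:
  assumes "stv x"
  shows "card (mat x) \<le> nm"
proof -
  have "card (mat x) = card (fst ` mat x)" using card_mat assms by (simp add: stv_def)
  also have "\<dots> \<le> card {..<nm}" by (rule card_mono) (auto simp: mat_def acc_iff)
  finally show ?thesis by simp
qed

text \<open>Eliminating every rotation leads from \<open>best\<close> to another stable matching, so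
  the sums are differences of satisfactions. A satisfaction is nonnegative and at most the number of
  pairs, itself at most \<open>nm\<close>, times a bound on the length of the lists. This is the
  origin of the weight range of the tables.\<close>

lemma
  shows sum_dM_le: "sum dM (rotations I) \<le> int (nm * nw)"
    and sum_dW_le: "sum dW (rotations I) \<le> int (nm * nm)"
proof -
  let ?x = "joinv (rotations I)"
  have x: "stv ?x" "rots ?x = rotations I"
    using rots_joinv[OF rots_finite order_refl] past_clr by (auto simp: rots_def)
  have "sat_M I (mat ?x) \<le> (\<Sum>p\<in>mat ?x. nw)" unfolding sat_M_def
  proof (rule sum_mono, clarify)
    fix m w assume "(m, w) \<in> mat ?x"
    then have a: "acc m w" by (simp add: mat_def)
    then show "mpos I m w \<le> nw" using mpos_bounds[OF a] len_le[of m] by (auto simp: acc_iff)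
  qed
  then have 1: "sat_M I (mat ?x) \<le> nm * nw" using card_stable[OF x(1)] mult_le_mono1 by (simp add: order_trans)
  have "sat_W I (mat best) \<le> (\<Sum>p\<in>mat best. nm)" unfolding sat_W_def
  proof (rule sum_mono, clarify)
    fix m w assume "(m, w) \<in> mat best"
    then have a: "acc m w" by (simp add: mat_def)
    then show "wpos I w m \<le> nm" using wpos_bounds[OF a] wlen_le[of w] by (auto simp: acc_iff')
  qed
  then have 2: "sat_W I (mat best) \<le> nm * nm" using card_stable[OF stv_best] mult_le_mono1 by (simp add: order_trans)
  show "sum dM (rotations I) \<le> int (nm * nw)" "sum dW (rotations I) \<le> int (nm * nm)"
    using sat_rots[OF x(1)] x(2) 1 2 by (simp_all del: of_nat_mult)
qed

end

section \<open>Leaves of trees\<close>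

text \<open>The first vertex \<open>u\<close> of a longest path is a leaf. A neighbour of
  \<open>u\<close> in \<open>A\<close> other than the second vertex would either extend the path or,
  if it lies on the path, close a cycle.\<close>

lemma exists_leaf:
  fixes A :: "nat set"
  assumes fin: "finite A" and two: "a \<in> A" "b \<in> A" "a \<noteq> b" and con: "connected_on A T"
    and acyc: "\<not> (\<exists>xs. cycle_in T xs)" and noloop: "\<And>v. {v} \<notin> T"
  shows "\<exists>u p. u \<in> A \<and> p \<in> A \<and> u \<noteq> p \<and> {u, p} \<in> T \<and> (\<forall>v\<in>A. {u, v} \<in> T \<longrightarrow> v = p)"
proof -
  define path where "path xs \<longleftrightarrow> distinct xs \<and> set xs \<subseteq> A \<and> (\<forall>i. Suc i < length xs \<longrightarrow> {xs ! i, xs ! Suc i} \<in> T)" for xs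
  have "(a, b) \<in> {(x, y). x \<in> A \<and> y \<in> A \<and> {x, y} \<in> T}\<^sup>*" using con two unfolding connected_on_def by blast
  then obtain c where c: "c \<in> A" "{a, c} \<in> T" using two(3) by (auto elim: converse_rtranclE)
  have "a \<noteq> c" using c noloop[of a] by auto
  then have "path [a, c]" using c two by (auto simp: path_def less_Suc_eq)
  moreover have bound: "\<And>xs. path xs \<Longrightarrow> length xs < Suc (card A)"
    unfolding path_def using fin by (metis card_mono distinct_card less_Suc_eq_le)
  ultimately obtain xs where xs: "path xs" "\<And>ys. path ys \<Longrightarrow> length ys \<le> length xs"
    using ex_has_greatest_nat[of path "[a, c]" length "Suc (card A)"] less_imp_le by blast
  have "2 \<le> length xs" using xs(2)[OF \<open>path [a, c]\<close>] by simp
  then obtain u p zs where z: "xs = u # p # zs" by (cases xs; cases "tl xs") auto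
  have up: "u \<in> A" "p \<in> A" "u \<noteq> p" "{u, p} \<in> T" using xs(1) by (auto simp: path_def z)
  have "v = p" if v: "v \<in> A" "{u, v} \<in> T" for v
  proof (rule ccontr)
    assume ne: "v \<noteq> p"
    have "v \<noteq> u" using v noloop[of u] by auto
    show False
    proof (cases "v \<in> set xs")
      case False
      have "path (v # xs)" unfolding path_def
      proof (intro conjI allI impI)
        fix i assume "Suc i < length (v # xs)"
        then show "{(v # xs) ! i, (v # xs) ! Suc i} \<in> T"
          using v xs(1) by (cases i) (auto simp: path_def z insert_commute)
      qed (use False v xs(1) in \<open>auto simp: path_def\<close>)
      then show False using xs(2) by fastforce
    next
      case True
      then obtain j where j: "j < length xs" "xs ! j = v" by (metis in_set_conv_nth)
      \<comment> \<open>As \<open>v\<close> is neither of the first two vertices, the closed part of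
        the path has at least the three vertices that \<open>cycle_in\<close> asks for.\<close>
      have j2: "2 \<le> j" using j ne \<open>v \<noteq> u\<close> by (cases j; cases "j - 1") (auto simp: z)
      have "cycle_in T (take (Suc j) xs)" unfolding cycle_in_def
      proof (intro conjI allI impI)
        show "3 \<le> length (take (Suc j) xs)" using j j2 by simp
        show "distinct (take (Suc j) xs)" using xs(1) by (simp add: path_def)
        fix i assume i: "i < length (take (Suc j) xs)"
        show "{take (Suc j) xs ! i, take (Suc j) xs ! (Suc i mod length (take (Suc j) xs))} \<in> T"
        proof (cases "i = j")
          case True
          then have "Suc i mod length (take (Suc j) xs) = 0" using j(1) True by (simp add: min_absorb1 Suc_leI)
          moreover have "take (Suc j) xs ! i = v" "take (Suc j) xs ! 0 = u" using True j by (simp, simp add: z)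
          ultimately show ?thesis using v(2) by (simp only: insert_commute)
        next
          case False
          moreover have "length (take (Suc j) xs) = Suc j" using j(1) by (simp add: min_absorb1 Suc_leI)
          ultimately have "Suc i mod length (take (Suc j) xs) = Suc i" "Suc i < Suc j" using i by simp_all
          then show ?thesis using xs(1) j by (simp add: path_def)
        qed
      qed
      then show False using acyc by blast
    qed
  qed
  then show ?thesis using up by blast
qed

text \<open>Replacing \<open>u\<close> by \<open>p\<close> throughout turns a walk in
  \<open>S\<close> into a walk avoiding \<open>u\<close>. This is applied to the alive nodes and
  also to those among them whose bag contains a given rotation; \<open>p\<close> may be missing from
  the latter.\<close>

lemma connected_remove_leaf:
  assumes con: "connected_on S T" and leaf: "\<forall>v\<in>S. {u, v} \<in> T \<longrightarrow> v = p" and "u \<noteq> p"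
  shows "connected_on (S - {u}) T"
proof -
  let ?R = "\<lambda>S. {(x, y). x \<in> S \<and> y \<in> S \<and> {x, y} \<in> T}"
  let ?f = "\<lambda>z. if z = u then p else z"
  have "(?f a, ?f b) \<in> (?R (S - {u}))\<^sup>*" if "(a, b) \<in> (?R S)\<^sup>*" for a b
    using that
  proof (induction rule: rtrancl_induct)
    case base
    then show ?case by simp
  next
    case (step y z)
    then have yz: "y \<in> S" "z \<in> S" "{y, z} \<in> T" "{z, y} \<in> T" by (auto simp: insert_commute)
    have "?f y = ?f z \<or> (?f y, ?f z) \<in> ?R (S - {u})"
      using yz leaf \<open>u \<noteq> p\<close> by (cases "y = u"; cases "z = u") auto
    then show ?case
    proof
      assume "?f y = ?f z"
      then show ?thesis using step.IH by simp
    next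
      assume "(?f y, ?f z) \<in> ?R (S - {u})"
      then show ?thesis by (rule rtrancl_into_rtrancl[OF step.IH])
    qed
  qed note * = this
  show ?thesis unfolding connected_on_def
  proof (intro ballI)
    fix a b assume ab: "a \<in> S - {u}" "b \<in> S - {u}"
    then have "(a, b) \<in> (?R S)\<^sup>*" using con unfolding connected_on_def by blast
    then show "(a, b) \<in> (?R (S - {u}))\<^sup>*" using *[of a b] ab by simp
  qed
qed

text \<open>A walk from \<open>u\<close> to anywhere else starts with the step to \<open>p\<close>.
  So a rotation in the bag of a leaf and in any other alive bag is also in the bag of the
  neighbour.\<close>

lemma leaf_neighbour:
  assumes con: "connected_on S T" and leaf: "\<forall>v\<in>S. {u, v} \<in> T \<longrightarrow> v = p" and u: "u \<in> S" "v \<in> S" "u \<noteq> v"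
  shows "p \<in> S"
proof -
  have "(u, v) \<in> {(x, y). x \<in> S \<and> y \<in> S \<and> {x, y} \<in> T}\<^sup>*" using con u unfolding connected_on_def by blast
  then obtain z where "z \<in> S" "{u, z} \<in> T" using u(3) by (auto elim: converse_rtranclE)
  then show ?thesis using leaf by blast
qed

section \<open>Subsets as numbers\<close>

text \<open>One step of reading binary digits from the top: comparing the remainder with
  \<open>2 ^ i\<close> decides the digit and subtraction removes it, which the machine can do
  without division.\<close>

lemma mod_Suc_set_decode:
  "j mod 2 ^ Suc i = (if i \<in> set_decode j then 2 ^ i else 0) + j mod 2 ^ i"
proof -
  have "j mod (2 ^ i * 2) = 2 ^ i * (j div 2 ^ i mod 2) + j mod 2 ^ i" by (rule mod_mult2_eq)
  then show ?thesis by (auto simp: set_decode_def mult.commute odd_iff_mod_2_eq_one)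
qed

lemma set_decode_iff: "i \<in> set_decode j \<longleftrightarrow> 2 ^ i \<le> j mod 2 ^ Suc i"
  unfolding mod_Suc_set_decode by (simp add: not_le)

lemma set_decode_subset: "j < 2 ^ b \<Longrightarrow> set_decode j \<subseteq> {..<b}"
proof
  fix i assume j: "j < 2 ^ b" and i: "i \<in> set_decode j"
  have "(2::nat) ^ i \<le> j" using i set_decode_iff mod_less_eq_dividend order_trans by metis
  then have "(2::nat) ^ i < 2 ^ b" using j by (rule le_less_trans)
  then show "i \<in> {..<b}" using power_less_imp_less_exp[of "2::nat" i b] by simp
qed

lemma set_encode_less: "A \<subseteq> {..<b} \<Longrightarrow> set_encode A < 2 ^ b"
proof -
  assume A: "A \<subseteq> {..<b}"
  have "set_encode A \<le> set_encode {..<b}" unfolding set_encode_def by (rule sum_mono2) (use A in auto)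
  also have "\<dots> < 2 ^ b" unfolding set_encode_def by (induction b) auto
  finally show ?thesis .
qed

section \<open>Total correctness with a static time bound\<close>

text \<open>Program variables are numbered rather than named, so that distinctness is decided on numerals.\<close>

definition V :: "nat \<Rightarrow> string" where
  "V k = replicate k (CHR ''x'')"

lemma V_eq [simp]: "V i = V j \<longleftrightarrow> i = j"
  by (auto simp: V_def)

lemma V_noteq [simp]: "V i \<noteq> ''input''" "''input'' \<noteq> V i" "V i \<noteq> ''output''" "''output'' \<noteq> V i"
proof -
  have "set (V i) \<subseteq> {CHR ''x''}" by (auto simp: V_def)
  moreover have "\<not> set ''input'' \<subseteq> {CHR ''x''}" "\<not> set ''output'' \<subseteq> {CHR ''x''}" by auto
  ultimately show "V i \<noteq> ''input''" "''input'' \<noteq> V i" "V i \<noteq> ''output''" "''output'' \<noteq> V i" by metis+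
qed

abbreviation rd :: "string \<Rightarrow> aexp" (\<open>$_\<close> [1000] 1000) where
  "$a \<equiv> Read a (Const 0)"

abbreviation at :: "string \<Rightarrow> aexp \<Rightarrow> aexp" (\<open>_\<lblot>_\<rblot>\<close> [1000, 0] 1000) where
  "a\<lblot>i\<rblot> \<equiv> Read a i"

abbreviation inp :: "aexp \<Rightarrow> aexp" where
  "inp i \<equiv> Read ''input'' i"

notation Plus (infixl \<open>\<oplus>\<close> 65) and Minus (infixl \<open>\<ominus>\<close> 65) and Less (infix \<open>\<prec>\<close> 50)

abbreviation asg :: "string \<Rightarrow> aexp \<Rightarrow> com" (infix \<open>::=\<close> 45) where
  "a ::= x \<equiv> Assign a (Const 0) x"

abbreviation asga :: "string \<Rightarrow> aexp \<Rightarrow> aexp \<Rightarrow> com" (\<open>_\<lblot>_\<rblot> :== _\<close> [1000, 0, 46] 45) where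
  "a\<lblot>i\<rblot> :== x \<equiv> Assign a i x"

notation Seq (infixr \<open>;;\<close> 40)

definition For :: "string \<Rightarrow> aexp \<Rightarrow> com \<Rightarrow> com" where
  "For i hi c = (i ::= Const 0 ;; While ($i \<prec> hi) (c ;; i ::= $i \<oplus> Const 1))"

text \<open>A syntactic approximation of the arrays a command may change, so that
  \<open>exec_frame\<close> keeps everything else out of the invariants.\<close>

fun wr :: "com \<Rightarrow> string \<Rightarrow> bool" where
  "wr Skip a \<longleftrightarrow> False"
| "wr (Assign b i x) a \<longleftrightarrow> a = b"
| "wr (Seq c d) a \<longleftrightarrow> wr c a \<or> wr d a"
| "wr (Cond b c d) a \<longleftrightarrow> wr c a \<or> wr d a"
| "wr (While b c) a \<longleftrightarrow> wr c a"

lemma wr_For [simp]: "wr (For i hi c) a \<longleftrightarrow> a = i \<or> wr c a"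
  by (auto simp: For_def)

lemma exec_frame: "exec c s t s' \<Longrightarrow> \<not> wr c a \<Longrightarrow> s' a = s a"
  by (induction rule: exec.induct) auto

text \<open>Every loop of the program comes from \<open>For\<close>, whose test reads the loop
  variable first; the default covers all other tests.\<close>

fun loop_var :: "bexp \<Rightarrow> string" where
  "loop_var (Less (Read a i) x) = a"
| "loop_var _ = []"

text \<open>\<open>tb \<beta> c\<close> bounds the cost of \<open>c\<close> if the loop over the variable \<open>i\<close> makes at most \<open>\<beta> i\<close> rounds.\<close>

fun tb :: "(string \<Rightarrow> nat) \<Rightarrow> com \<Rightarrow> nat" where
  "tb \<beta> Skip = 1"
| "tb \<beta> (Assign a i x) = 1 + acost i + acost x"
| "tb \<beta> (Seq c d) = tb \<beta> c + tb \<beta> d"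
| "tb \<beta> (Cond b c d) = 1 + bcost b + tb \<beta> c + tb \<beta> d"
| "tb \<beta> (While b c) = (\<beta> (loop_var b) + 1) * (1 + bcost b + tb \<beta> c)"

text \<open>The bound is the static \<open>tb \<beta> c\<close>, independent of the state, so
  invariants never mention time. All that is left of the cost analysis inside a correctness proof is
  that each loop makes at most as many rounds as \<open>\<beta>\<close> allows.\<close>

definition wp :: "(string \<Rightarrow> nat) \<Rightarrow> com \<Rightarrow> (state \<Rightarrow> bool) \<Rightarrow> state \<Rightarrow> bool" where
  "wp \<beta> c Q s \<longleftrightarrow> (\<exists>t s'. exec c s t s' \<and> t \<le> tb \<beta> c \<and> Q s')"

section \<open>Executing loop-free code\<close>

fun lf :: "com \<Rightarrow> bool" where
  "lf (Seq c d) \<longleftrightarrow> lf c \<and> lf d"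
| "lf (Cond b c d) \<longleftrightarrow> lf c \<and> lf d"
| "lf (While b c) \<longleftrightarrow> False"
| "lf _ \<longleftrightarrow> True"

text \<open>Loop-free code has a functional semantics, which the simplifier can execute
  symbolically. The clause for \<open>While\<close> is a dummy.\<close>

fun run :: "com \<Rightarrow> state \<Rightarrow> state" where
  "run Skip s = s"
| "run (Assign a i x) s = s(a := (s a)(aval i s := aval x s))"
| "run (Seq c d) s = run d (run c s)"
| "run (Cond b c d) s = (if bval b s then run c s else run d s)"
| "run (While b c) s = s"

lemma exec_run: "lf c \<Longrightarrow> \<exists>t\<le>tb \<beta> c. exec c s t (run c s)"
proof (induction c arbitrary: s)
  case (Seq c d)
  then obtain t1 t2 where "t1 \<le> tb \<beta> c" "exec c s t1 (run c s)" "t2 \<le> tb \<beta> d" "exec d (run c s) t2 (run d (run c s))"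
    by (metis lf.simps(1))
  then show ?case using exec.Seq by (intro exI[of _ "t1 + t2"]) auto
next
  case (Cond b c d)
  then obtain t1 t2 where t: "t1 \<le> tb \<beta> c" "exec c s t1 (run c s)" "t2 \<le> tb \<beta> d" "exec d s t2 (run d s)"
    by (metis lf.simps(2))
  show ?case
  proof (cases "bval b s")
    case True
    then show ?thesis using t exec.IfTrue[OF True t(2)] by (intro exI[of _ "1 + bcost b + t1"]) auto
  next
    case False
    then show ?thesis using t exec.IfFalse[OF False t(4)] by (intro exI[of _ "1 + bcost b + t2"]) auto
  qed
next
  case (Assign a i x)
  show ?case unfolding run.simps(2) tb.simps(2) using exec.Assign[of a i x s] by blast
next
  case Skip
  show ?case using exec.Skip by auto
qed auto

lemma wp_run: "lf c \<Longrightarrow> Q (run c s) \<Longrightarrow> wp \<beta> c Q s"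
  using exec_run unfolding wp_def by blast

lemma wp_seq: "wp \<beta> c (wp \<beta> d Q) s \<Longrightarrow> wp \<beta> (Seq c d) Q s"
  unfolding wp_def by (metis add_mono exec.Seq tb.simps(3))

lemma wp_seq_run: "lf c \<Longrightarrow> wp \<beta> d Q (run c s) \<Longrightarrow> wp \<beta> (Seq c d) Q s"
  by (rule wp_seq, rule wp_run)

text \<open>The frame condition is passed on together with the postcondition, which therefore speaks
  only of what the command computes.\<close>

lemma wp_conseq:
  assumes "wp \<beta> c Q s" "\<And>s'. (\<And>a. \<not> wr c a \<Longrightarrow> s' a = s a) \<Longrightarrow> Q s' \<Longrightarrow> R s'"
  shows "wp \<beta> c R s"
  using assms exec_frame unfolding wp_def by meson

lemma wp_seq_conseq:
  assumes "wp \<beta> c Q s" "\<And>s'. (\<And>a. \<not> wr c a \<Longrightarrow> s' a = s a) \<Longrightarrow> Q s' \<Longrightarrow> wp \<beta> d R s'"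
  shows "wp \<beta> (Seq c d) R s"
  by (rule wp_seq, rule wp_conseq[OF assms])

text \<open>The bound \<open>hi\<close> is evaluated anew in each round, so the premise
  \<open>hi\<close> fixes its value in all states that differ from \<open>s0\<close> only in what
  the body and the counter may change. As the counter is written outside the body, invariants must
  be insensitive to it, which is \<open>indep\<close>.\<close>

lemma wp_for:
  assumes i: "\<not> wr c i" and h: "h \<le> \<beta> i"
    and hi: "\<And>s. (\<And>a. \<not> wr c a \<Longrightarrow> a \<noteq> i \<Longrightarrow> s a = s0 a) \<Longrightarrow> aval hi s = int h"
    and init: "Inv 0 s0"
    and step: "\<And>k s. k < h \<Longrightarrow> (\<And>a. \<not> wr c a \<Longrightarrow> a \<noteq> i \<Longrightarrow> s a = s0 a) \<Longrightarrow> s i 0 = int k \<Longrightarrow>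
      Inv k s \<Longrightarrow> wp \<beta> c (Inv (Suc k)) s"
    and indep: "\<And>k s f. Inv k s \<Longrightarrow> Inv k (s(i := f))"
    and post: "\<And>s. (\<And>a. \<not> wr c a \<Longrightarrow> a \<noteq> i \<Longrightarrow> s a = s0 a) \<Longrightarrow> Inv h s \<Longrightarrow> Q s"
  shows "wp \<beta> (For i hi c) Q s0"
proof -
  let ?b = "$i \<prec> hi" and ?c = "c ;; i ::= $i \<oplus> Const 1"
  let ?W = "1 + bcost ?b + tb \<beta> ?c"
  have loop: "\<exists>t s'. exec (While ?b ?c) s t s' \<and> t \<le> (h - k) * ?W + (1 + bcost ?b) \<and> Q s'"
    if "k \<le> h" "\<And>a. \<not> wr c a \<Longrightarrow> a \<noteq> i \<Longrightarrow> s a = s0 a" "s i 0 = int k" "Inv k s" for k s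
    using that
  proof (induction "h - k" arbitrary: k s)
    case 0
    then have "k = h" by simp
    then have "\<not> bval ?b s" using 0 hi[of s] by simp
    moreover have "Q s" using post[of s] 0 \<open>k = h\<close> by blast
    ultimately show ?case using exec.WhileFalse[of ?b s ?c] by (intro exI[of _ "1 + bcost ?b"] exI[of _ s]) simp
  next
    case (Suc n)
    then have kh: "k < h" by simp
    have b: "bval ?b s" using Suc.prems kh hi[of s] by simp
    have "wp \<beta> c (Inv (Suc k)) s" using step[OF kh] Suc.prems by blast
    then obtain t s1 where e: "exec c s t s1" "t \<le> tb \<beta> c" "Inv (Suc k) s1" unfolding wp_def by blast
    have fr: "s1 a = s a" if "\<not> wr c a" for a using exec_frame[OF e(1) that] .
    have s1i: "s1 i 0 = int k" using fr[OF i] Suc.prems by simp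
    define s2 where "s2 = s1(i := (s1 i)(0 := int (Suc k)))"
    have e1: "exec (i ::= $i \<oplus> Const 1) s1 (1 + 1 + acost ($i \<oplus> Const 1)) s2"
      using exec.Assign[of i "Const 0" "$i \<oplus> Const 1" s1] s1i by (simp add: s2_def add.commute)
    have e2: "exec ?c s (t + (1 + 1 + acost ($i \<oplus> Const 1))) s2" using exec.Seq[OF e(1) e1] .
    have "\<exists>t s'. exec (While ?b ?c) s2 t s' \<and> t \<le> (h - Suc k) * ?W + (1 + bcost ?b) \<and> Q s'"
    proof (rule Suc.hyps)
      show "n = h - Suc k" "Suc k \<le> h" using Suc by auto
      show "s2 a = s0 a" if "\<not> wr c a" "a \<noteq> i" for a using that fr Suc.prems by (simp add: s2_def)
      show "s2 i 0 = int (Suc k)" by (simp add: s2_def)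
      show "Inv (Suc k) s2" unfolding s2_def by (rule indep[OF e(3)])
    qed
    then obtain t' s' where e3: "exec (While ?b ?c) s2 t' s'" "t' \<le> (h - Suc k) * ?W + (1 + bcost ?b)" "Q s'" by blast
    have "exec (While ?b ?c) s (1 + bcost ?b + (t + (1 + 1 + acost ($i \<oplus> Const 1))) + t') s'"
      using exec.WhileTrue[OF b e2 e3(1)] .
    moreover have "h - k = Suc (h - Suc k)" using kh by simp
    then have "1 + bcost ?b + (t + (1 + 1 + acost ($i \<oplus> Const 1))) + t' \<le> (h - k) * ?W + (1 + bcost ?b)"
      using e(2) e3(2) by simp
    ultimately show ?case using e3(3) by blast
  qed
  define s1 where "s1 = s0(i := (s0 i)(0 := 0))"
  have "exec (i ::= Const 0) s0 3 s1" using exec.Assign[of i "Const 0" "Const 0" s0] by (simp add: s1_def numeral_3_eq_3)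
  moreover have "\<exists>t s'. exec (While ?b ?c) s1 t s' \<and> t \<le> (h - 0) * ?W + (1 + bcost ?b) \<and> Q s'"
    by (rule loop) (auto simp: s1_def init indep)
  then obtain t s' where "exec (While ?b ?c) s1 t s'" "t \<le> h * ?W + (1 + bcost ?b)" "Q s'" by auto
  moreover have "h * ?W \<le> \<beta> i * ?W" using h by (rule mult_le_mono1)
  ultimately show ?thesis unfolding wp_def For_def
    by (intro exI[of _ "3 + t"] exI[of _ s']) (auto intro: exec.Seq)
qed

section \<open>The program\<close>

text \<open>
  Scalars start with \<open>v\<close>, arrays with \<open>a\<close> and loop variables with \<open>l\<close>. A list of rotations is
  parsed once, after which a rotation is a number below \<open>vNR\<close>; a set of rotations is kept as the sum of
  the powers \<open>aPW\<close>.
\<close>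

abbreviation "vP \<equiv> V 11" abbreviation "vNM \<equiv> V 12" abbreviation "vNP \<equiv> V 13"
abbreviation "vNW \<equiv> V 14" abbreviation "vR \<equiv> V 15" abbreviation "vNE \<equiv> V 16"
abbreviation "vEO \<equiv> V 17" abbreviation "vNK \<equiv> V 18" abbreviation "vNR \<equiv> V 19"
abbreviation "vQ \<equiv> V 20" abbreviation "vX \<equiv> V 21" abbreviation "vXB \<equiv> V 22"
abbreviation "vHM \<equiv> V 23" abbreviation "vHV \<equiv> V 24" abbreviation "vW \<equiv> V 25"
abbreviation "vF \<equiv> V 26" abbreviation "vXT \<equiv> V 27" abbreviation "vSV \<equiv> V 28"
abbreviation "vA \<equiv> V 29" abbreviation "vD1 \<equiv> V 30" abbreviation "vD2 \<equiv> V 31"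
abbreviation "vB \<equiv> V 32" abbreviation "vE \<equiv> V 33" abbreviation "vFL \<equiv> V 34"
abbreviation "vV1 \<equiv> V 35" abbreviation "vZ \<equiv> V 36" abbreviation "vST \<equiv> V 37"
abbreviation "vSA \<equiv> V 38" abbreviation "vSB \<equiv> V 39" abbreviation "vREM \<equiv> V 40"
abbreviation "vKS \<equiv> V 41" abbreviation "vKT \<equiv> V 42" abbreviation "vDX \<equiv> V 43"
abbreviation "vDY \<equiv> V 44" abbreviation "vDU \<equiv> V 45" abbreviation "vLD \<equiv> V 46"
abbreviation "vG \<equiv> V 47" abbreviation "vVT \<equiv> V 48" abbreviation "vVQ \<equiv> V 49"
abbreviation "vTOP \<equiv> V 50" abbreviation "vOK \<equiv> V 51" abbreviation "vNB \<equiv> V 52"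
abbreviation "vNC \<equiv> V 53" abbreviation "vIX \<equiv> V 54" abbreviation "vY \<equiv> V 55"
abbreviation "vY1 \<equiv> V 56" abbreviation "vY2 \<equiv> V 57" abbreviation "vLU \<equiv> V 58"
abbreviation "vLP \<equiv> V 59" abbreviation "vRT \<equiv> V 60" abbreviation "vBF \<equiv> V 61"
abbreviation "vBC \<equiv> V 62" abbreviation "vBU \<equiv> V 63" abbreviation "vSE \<equiv> V 64"
abbreviation "vC \<equiv> V 65" abbreviation "aMO \<equiv> V 66" abbreviation "aRow \<equiv> V 67"
abbreviation "aMP \<equiv> V 68" abbreviation "aWP \<equiv> V 69" abbreviation "aBO \<equiv> V 70"
abbreviation "aBL \<equiv> V 71" abbreviation "aID \<equiv> V 72" abbreviation "aAD \<equiv> V 73"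
abbreviation "aBG \<equiv> V 74" abbreviation "aX \<equiv> V 75" abbreviation "aWX \<equiv> V 76"
abbreviation "aWY \<equiv> V 77" abbreviation "aHM \<equiv> V 78" abbreviation "aHV \<equiv> V 79"
abbreviation "aXB \<equiv> V 80" abbreviation "aPW \<equiv> V 81" abbreviation "aP2 \<equiv> V 82"
abbreviation "aMK \<equiv> V 83" abbreviation "aSel \<equiv> V 84" abbreviation "aCB \<equiv> V 85"
abbreviation "aTY \<equiv> V 86" abbreviation "aTU \<equiv> V 87" abbreviation "aAL \<equiv> V 88"
abbreviation "aDG \<equiv> V 89" abbreviation "aO \<equiv> V 90" abbreviation "lm \<equiv> V 91"
abbreviation "lm2 \<equiv> V 92" abbreviation "lk \<equiv> V 93" abbreviation "lw \<equiv> V 94"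
abbreviation "lt \<equiv> V 95" abbreviation "lb \<equiv> V 96" abbreviation "lb2 \<equiv> V 97"
abbreviation "lp \<equiv> V 98" abbreviation "lr \<equiv> V 99" abbreviation "li \<equiv> V 100"
abbreviation "lj \<equiv> V 101" abbreviation "lv \<equiv> V 102" abbreviation "lv2 \<equiv> V 103"
abbreviation "le \<equiv> V 104" abbreviation "ls \<equiv> V 105"

text \<open>\<open>aMO\<close> holds the addresses of the men's lists. \<open>aRow\<close> holds the
  multiples of \<open>nw\<close>, built by repeated addition, and so gives access to the matrices
  \<open>aMP\<close> and \<open>aWP\<close> of positions, in which \<open>0\<close> marks an
  unacceptable pair. \<open>vNP\<close> is the address behind the men's lists; it is reused as a
  bound on rounds.\<close>

definition c_parse :: com where
  "c_parse = (
    vP ::= Const 1 ;; vNM ::= inp (Const 0) ;;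
    For lm $vNM (aMO\<lblot>$lm\<rblot> :== $vP ;; vP ::= $vP \<oplus> inp $vP \<oplus> Const 1) ;;
    vNP ::= $vP ;; vNW ::= inp $vP ;; vR ::= Const 0 ;;
    For lm $vNM (
      aRow\<lblot>$lm\<rblot> :== $vR ;; vR ::= $vR \<oplus> $vNW ;;
      For lk (inp aMO\<lblot>$lm\<rblot>)
        (aMP\<lblot>aRow\<lblot>$lm\<rblot> \<oplus> inp (aMO\<lblot>$lm\<rblot> \<oplus> $lk \<oplus> Const 1)\<rblot> :== $lk \<oplus> Const 1)) ;;
    vP ::= $vP \<oplus> Const 1 ;;
    For lw $vNW (
      For lk (inp $vP)
        (aWP\<lblot>aRow\<lblot>inp ($vP \<oplus> $lk \<oplus> Const 1)\<rblot> \<oplus> $lw\<rblot> :== $lk \<oplus> Const 1) ;;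
      vP ::= $vP \<oplus> inp $vP \<oplus> Const 1) ;;
    vNE ::= inp $vP ;; vEO ::= $vP \<oplus> Const 1 ;; vP ::= $vP \<oplus> Const 1 \<oplus> $vNE \<oplus> $vNE ;;
    vNK ::= inp $vP ;; vP ::= $vP \<oplus> Const 1)"

text \<open>
  A rotation is recognized by its first pair \<open>(m, w)\<close>, which no other rotation contains; \<open>aID\<close> is
  indexed by \<open>m * nw + w\<close> and holds one plus the number of the rotation.
\<close>

definition c_bags :: com where
  "c_bags = (
    For lt $vNK (
      aBO\<lblot>$lt\<rblot> :== $vQ ;; aBL\<lblot>$lt\<rblot> :== inp $vP ;; vP ::= $vP \<oplus> Const 1 ;;
      For lb aBL\<lblot>$lt\<rblot> (
        vX ::= aRow\<lblot>inp ($vP \<oplus> Const 1)\<rblot> \<oplus> inp ($vP \<oplus> Const 2) ;;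
        Cond (aID\<lblot>$vX\<rblot> \<prec> Const 1)
          (aAD\<lblot>$vNR\<rblot> :== $vP ;; vNR ::= $vNR \<oplus> Const 1 ;; aID\<lblot>$vX\<rblot> :== $vNR) Skip ;;
        aBG\<lblot>$vQ\<rblot> :== aID\<lblot>$vX\<rblot> \<ominus> Const 1 ;; vQ ::= $vQ \<oplus> Const 1 ;;
        vP ::= $vP \<oplus> Const 1 \<oplus> inp $vP \<oplus> inp $vP)))"

text \<open>
  Each of the \<open>vNP\<close> rounds pushes some man on unless the vector is already settled, and \<open>vNP\<close> is an
  upper bound for the sum of all positions.
\<close>

definition c_close :: com where
  "c_close = (
    For lm $vNM (aX\<lblot>$vXB \<oplus> $lm\<rblot> :== Const 1) ;;
    aX\<lblot>$vXB \<oplus> $vHM\<rblot> :== $vHV ;;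
    For lp $vNP (For lm $vNM (For lm2 $vNM (
      Cond (aX\<lblot>$vXB \<oplus> $lm\<rblot> \<prec> inp aMO\<lblot>$lm\<rblot> \<oplus> Const 1)
        (vW ::= inp (aMO\<lblot>$lm\<rblot> \<oplus> aX\<lblot>$vXB \<oplus> $lm\<rblot>) ;;
         vF ::= aMP\<lblot>aRow\<lblot>$lm2\<rblot> \<oplus> $vW\<rblot> ;;
         Cond (Conj (Const 0 \<prec> $vF) (Conj ($vF \<prec> aX\<lblot>$vXB \<oplus> $lm2\<rblot> \<oplus> Const 1)
             (aWP\<lblot>aRow\<lblot>$lm2\<rblot> \<oplus> $vW\<rblot> \<prec> aWP\<lblot>aRow\<lblot>$lm\<rblot> \<oplus> $vW\<rblot>)))
           (aX\<lblot>$vXB \<oplus> $lm\<rblot> :== aX\<lblot>$vXB \<oplus> $lm\<rblot> \<oplus> Const 1) Skip) Skip))))"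

text \<open>
  For SESM (\<open>flag > 0\<close>) the single weight \<open>dM + dW\<close> determines the cost. For BSM a table is indexed by the
  first weight \<open>dM\<close> and maximizes the second one, \<open>dW\<close>.
\<close>

definition c_rots :: com where
  "c_rots = (
    vHV ::= Const 1 ;; c_close ;;
    vXT ::= $vNM ;;
    For lr $vNR (
      vA ::= aAD\<lblot>$lr\<rblot> ;; vD1 ::= Const 0 ;; vD2 ::= Const 0 ;;
      For li (inp $vA) (
        vB ::= $vA \<oplus> Const 1 \<oplus> $li \<oplus> $li ;;
        Cond ($li \<oplus> Const 1 \<prec> inp $vA) (vE ::= $vB \<oplus> Const 2) (vE ::= $vA \<oplus> Const 1) ;;
        vD1 ::= $vD1 \<oplus> (aMP\<lblot>aRow\<lblot>inp $vB\<rblot> \<oplus> inp ($vE \<oplus> Const 1)\<rblot>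
          \<ominus> aMP\<lblot>aRow\<lblot>inp $vB\<rblot> \<oplus> inp ($vB \<oplus> Const 1)\<rblot>) ;;
        vD2 ::= $vD2 \<oplus> (aWP\<lblot>aRow\<lblot>inp $vE\<rblot> \<oplus> inp ($vE \<oplus> Const 1)\<rblot>
          \<ominus> aWP\<lblot>aRow\<lblot>inp $vB\<rblot> \<oplus> inp ($vE \<oplus> Const 1)\<rblot>)) ;;
      Cond (Const 0 \<prec> $vFL)
        (aWX\<lblot>$lr\<rblot> :== $vD1 \<oplus> $vD2 ;; aWY\<lblot>$lr\<rblot> :== Const 0)
        (aWX\<lblot>$lr\<rblot> :== $vD1 ;; aWY\<lblot>$lr\<rblot> :== $vD2) ;;
      vSV ::= $vSV \<oplus> aWX\<lblot>$lr\<rblot> ;;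
      vHM ::= inp ($vA \<oplus> Const 1) ;; aHM\<lblot>$lr\<rblot> :== $vHM ;;
      vHV ::= aMP\<lblot>aRow\<lblot>$vHM\<rblot> \<oplus> inp ($vA \<oplus> Const 2)\<rblot> \<oplus> Const 1 ;; aHV\<lblot>$lr\<rblot> :== $vHV ;;
      aXB\<lblot>$lr\<rblot> :== $vXT ;; vXB ::= $vXT ;; vXT ::= $vXT \<oplus> $vNM ;;
      c_close))"

text \<open>
  With \<open>vV1\<close> exceeding every total weight, the numbers \<open>vV1 * 2^r\<close> let one index carry both a set and
  a weight. The table of size \<open>vST\<close> is sparse; its cells need no initialization, as a fresh one is used
  every time.
\<close>

definition c_pow :: com where
  "c_pow = (
    vV1 ::= $vSV \<oplus> Const 1 ;; vZ ::= $vV1 ;;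
    For lr $vNR (aPW\<lblot>$lr\<rblot> :== $vZ ;; vZ ::= $vZ \<oplus> $vZ) ;;
    vST ::= $vZ ;; vZ ::= Const 1 ;;
    For lr $vNR (aP2\<lblot>$lr\<rblot> :== $vZ ;; vZ ::= $vZ \<oplus> $vZ) ;;
    aP2\<lblot>$vNR\<rblot> :== $vZ)"

text \<open>The first row of \<open>aX\<close> is the man-optimal matching. Its satisfactions are
  the base to which the weights of rotations are applied.\<close>

definition c_sat :: com where
  "c_sat = For lm $vNM (
    Cond (aX\<lblot>$lm\<rblot> \<prec> inp aMO\<lblot>$lm\<rblot> \<oplus> Const 1)
      (vSA ::= $vSA \<oplus> aX\<lblot>$lm\<rblot> ;;
       vSB ::= $vSB \<oplus> aWP\<lblot>aRow\<lblot>$lm\<rblot> \<oplus> inp (aMO\<lblot>$lm\<rblot> \<oplus> aX\<lblot>$lm\<rblot>)\<rblot>) Skip)"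

definition c_mark :: com where
  "c_mark = (
    For lr $vNR (aMK\<lblot>$lr\<rblot> :== Const 0) ;;
    For lb aBL\<lblot>$vVQ\<rblot> (aMK\<lblot>aBG\<lblot>aBO\<lblot>$vVQ\<rblot> \<oplus> $lb\<rblot>\<rblot> :== Const 1))"

text \<open>
  The binary digits of \<open>lj\<close> select a subset of the bag \<open>vVT\<close>. Marked rotations belong to the other bag of
  the tree edge and stay visible in the key \<open>vKT\<close>; the others are forgotten.
\<close>

definition c_decode :: com where
  "c_decode = (
    vREM ::= $lj ;; vKS ::= Const 0 ;; vKT ::= Const 0 ;; vDX ::= Const 0 ;; vDY ::= Const 0 ;; vDU ::= Const 0 ;;
    vLD ::= aBL\<lblot>$vVT\<rblot> ;;
    For lb aBL\<lblot>$vVT\<rblot> (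
      vLD ::= $vLD \<ominus> Const 1 ;; vG ::= aBG\<lblot>aBO\<lblot>$vVT\<rblot> \<oplus> $vLD\<rblot> ;;
      Cond ($vREM \<prec> aP2\<lblot>$vLD\<rblot>) (aSel\<lblot>$vLD\<rblot> :== Const 0)
        (vREM ::= $vREM \<ominus> aP2\<lblot>$vLD\<rblot> ;; aSel\<lblot>$vLD\<rblot> :== Const 1 ;; vKS ::= $vKS \<oplus> aPW\<lblot>$vG\<rblot> ;;
         Cond (aMK\<lblot>$vG\<rblot> \<prec> Const 1)
           (vDX ::= $vDX \<oplus> aWX\<lblot>$vG\<rblot> ;; vDY ::= $vDY \<oplus> aWY\<lblot>$vG\<rblot> ;; vDU ::= $vDU \<oplus> aPW\<lblot>$vG\<rblot>)
           (vKT ::= $vKT \<oplus> aPW\<lblot>$vG\<rblot>))))"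

text \<open>\<open>lb\<close> looks for unselected and \<open>lb2\<close> for selected rotations;
  the comparison asks whether the least matching of the latter has passed the former, which would
  then be a missing predecessor. A table entry \<open>0\<close> means absence, so a closed set with
  nothing forgotten gets the value \<open>1\<close>.\<close>

definition c_init :: com where
  "c_init = For lt $vNK (
    vVT ::= $lt ;; aCB\<lblot>$lt\<rblot> :== $vTOP ;; aAL\<lblot>$lt\<rblot> :== Const 1 ;;
    For lj aP2\<lblot>aBL\<lblot>$vVT\<rblot>\<rblot> (
      c_decode ;; vOK ::= Const 1 ;;
      For lb aBL\<lblot>$vVT\<rblot> (For lb2 aBL\<lblot>$vVT\<rblot> (
        Cond (Conj (aSel\<lblot>$lb\<rblot> \<prec> Const 1) (Conj (Const 0 \<prec> aSel\<lblot>$lb2\<rblot>)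
            (Neg (aX\<lblot>aXB\<lblot>aBG\<lblot>aBO\<lblot>$vVT\<rblot> \<oplus> $lb2\<rblot>\<rblot> \<oplus> aHM\<lblot>aBG\<lblot>aBO\<lblot>$vVT\<rblot> \<oplus> $lb\<rblot>\<rblot>\<rblot>
              \<prec> aHV\<lblot>aBG\<lblot>aBO\<lblot>$vVT\<rblot> \<oplus> $lb\<rblot>\<rblot>))))
          (vOK ::= Const 0) Skip)) ;;
      Cond (Conj (Const 0 \<prec> $vOK) (aTY\<lblot>$vTOP \<oplus> $vKS\<rblot> \<prec> Const 1))
        (aTU\<lblot>$vTOP \<oplus> $vKS\<rblot> :== Const 0 ;; aTY\<lblot>$vTOP \<oplus> $vKS\<rblot> :== Const 1) Skip) ;;
    vTOP ::= $vTOP \<oplus> $vST)"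

text \<open>
  An alive node of degree one is found by counting; alive edges are those between alive nodes.
\<close>

definition c_leaf :: com where
  "c_leaf = (
    For lt $vNK (aDG\<lblot>$lt\<rblot> :== Const 0) ;;
    For le $vNE (
      vA ::= inp ($vEO \<oplus> $le \<oplus> $le) ;; vB ::= inp ($vEO \<oplus> $le \<oplus> $le \<oplus> Const 1) ;;
      Cond (Conj (Const 0 \<prec> aAL\<lblot>$vA\<rblot>) (Const 0 \<prec> aAL\<lblot>$vB\<rblot>))
        (aDG\<lblot>$vA\<rblot> :== aDG\<lblot>$vA\<rblot> \<oplus> Const 1 ;; aDG\<lblot>$vB\<rblot> :== aDG\<lblot>$vB\<rblot> \<oplus> Const 1) Skip) ;;
    For le $vNE (
      vA ::= inp ($vEO \<oplus> $le \<oplus> $le) ;; vB ::= inp ($vEO \<oplus> $le \<oplus> $le \<oplus> Const 1) ;;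
      Cond (Conj (Const 0 \<prec> aAL\<lblot>$vA\<rblot>) (Const 0 \<prec> aAL\<lblot>$vB\<rblot>))
        (Cond (aDG\<lblot>$vA\<rblot> \<prec> Const 2) (vLU ::= $vA ;; vLP ::= $vB)
          (Cond (aDG\<lblot>$vB\<rblot> \<prec> Const 2) (vLU ::= $vB ;; vLP ::= $vA) Skip)) Skip))"

text \<open>Projecting the table to the marked rotations, those shared with the neighbour, is what
  keeps the following join at one subset instead of a pair of subsets.\<close>

definition c_forget :: com where
  "c_forget = (
    vNB ::= $vTOP ;; vTOP ::= $vTOP \<oplus> $vST ;;
    For lj aP2\<lblot>aBL\<lblot>$vVT\<rblot>\<rblot> (
      c_decode ;;
      For lv $vV1 (
        vY ::= aTY\<lblot>aCB\<lblot>$vVT\<rblot> \<oplus> $vKS \<oplus> $lv\<rblot> ;;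
        Cond (Const 0 \<prec> $vY)
          (vIX ::= $vNB \<oplus> $vKT \<oplus> ($lv \<oplus> $vDX) ;; vY ::= $vY \<oplus> $vDY ;;
           Cond (aTY\<lblot>$vIX\<rblot> \<prec> $vY)
             (aTU\<lblot>$vIX\<rblot> :== aTU\<lblot>aCB\<lblot>$vVT\<rblot> \<oplus> $vKS \<oplus> $lv\<rblot> \<oplus> $vDU ;; aTY\<lblot>$vIX\<rblot> :== $vY) Skip)
          Skip)))"

text \<open>For the subset \<open>vKS\<close> of the bag only the entries under its trace
  \<open>vKT\<close> on the other bag can match. Both values are one too large, hence the
  subtraction.\<close>

definition c_join :: com where
  "c_join = (
    vNC ::= $vTOP ;; vTOP ::= $vTOP \<oplus> $vST ;;
    For lj aP2\<lblot>aBL\<lblot>$vVT\<rblot>\<rblot> (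
      c_decode ;;
      For lv $vV1 (For lv2 $vV1 (
        vY1 ::= aTY\<lblot>aCB\<lblot>$vVT\<rblot> \<oplus> $vKS \<oplus> $lv\<rblot> ;; vY2 ::= aTY\<lblot>$vNB \<oplus> $vKT \<oplus> $lv2\<rblot> ;;
        Cond (Conj (Const 0 \<prec> $vY1) (Const 0 \<prec> $vY2))
          (vIX ::= $vNC \<oplus> $vKS \<oplus> ($lv \<oplus> $lv2) ;; vY ::= $vY1 \<oplus> $vY2 \<ominus> Const 1 ;;
           Cond (aTY\<lblot>$vIX\<rblot> \<prec> $vY)
             (aTU\<lblot>$vIX\<rblot> :== aTU\<lblot>aCB\<lblot>$vVT\<rblot> \<oplus> $vKS \<oplus> $lv\<rblot> \<oplus> aTU\<lblot>$vNB \<oplus> $vKT \<oplus> $lv2\<rblot> ;; aTY\<lblot>$vIX\<rblot> :== $vY) Skip)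
          Skip))) ;;
    aCB\<lblot>$vVT\<rblot> :== $vNC)"

text \<open>
  The last step forgets everything, leaving a table with only the key \<open>0\<close>.
\<close>

definition c_merge :: com where
  "c_merge = (
    For ls ($vNK \<ominus> Const 1) (
      c_leaf ;;
      vVQ ::= $vLP ;; c_mark ;; vVT ::= $vLU ;; c_forget ;;
      vVQ ::= $vLU ;; c_mark ;; vVT ::= $vLP ;; c_join ;;
      aAL\<lblot>$vLU\<rblot> :== Const 0 ;; vRT ::= $vLP) ;;
    For lr $vNR (aMK\<lblot>$lr\<rblot> :== Const 0) ;; vVT ::= $vRT ;; c_forget)"

text \<open>\<open>vY - 1\<close> is the largest total of second weights for the weight
  \<open>lv\<close>, so for BSM the women's satisfaction is \<open>vSB - (vY - 1)\<close>. The flag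
  \<open>vBF\<close> takes the place of an infinite initial cost.\<close>

definition c_select :: com where
  "c_select = For lv $vV1 (
    vY ::= aTY\<lblot>$vNB \<oplus> $lv\<rblot> ;;
    Cond (Const 0 \<prec> $vY)
      (Cond (Const 0 \<prec> $vFL)
        (vC ::= $vSA \<ominus> $vSB \<oplus> $lv ;; Cond ($vC \<prec> Const 0) (vC ::= Const 0 \<ominus> $vC) Skip)
        (vC ::= $vSA \<oplus> $lv ;;
         Cond ($vC \<prec> $vSB \<ominus> ($vY \<ominus> Const 1)) (vC ::= $vSB \<ominus> ($vY \<ominus> Const 1)) Skip) ;;
       Cond (Neg (Conj (Const 0 \<prec> $vBF) (Neg ($vC \<prec> $vBC))))
         (vBF ::= Const 1 ;; vBC ::= $vC ;; vBU ::= aTU\<lblot>$vNB \<oplus> $lv\<rblot>) Skip)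
      Skip)"

text \<open>The solution \<open>vBU\<close> is a sum of distinct powers and is read from the largest
  down. The matching is the pointwise maximum of \<open>best\<close> and the least matchings of the
  selected rotations, that is \<open>joinv\<close>.\<close>

definition c_output :: com where
  "c_output = (
    For lm $vNM (aO\<lblot>$lm\<rblot> :== aX\<lblot>$lm\<rblot>) ;;
    vLD ::= $vNR ;;
    For lr $vNR (
      vLD ::= $vLD \<ominus> Const 1 ;;
      Cond ($vBU \<prec> aPW\<lblot>$vLD\<rblot>) (vSE ::= Const 0) (vBU ::= $vBU \<ominus> aPW\<lblot>$vLD\<rblot> ;; vSE ::= Const 1) ;;
      For lm $vNM (
        Cond (Conj (Const 0 \<prec> $vSE) (aO\<lblot>$lm\<rblot> \<prec> aX\<lblot>aXB\<lblot>$vLD\<rblot> \<oplus> $lm\<rblot>))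
          (aO\<lblot>$lm\<rblot> :== aX\<lblot>aXB\<lblot>$vLD\<rblot> \<oplus> $lm\<rblot>) Skip)) ;;
    For lm $vNM (
      Cond (aO\<lblot>$lm\<rblot> \<prec> inp aMO\<lblot>$lm\<rblot> \<oplus> Const 1)
        (Assign ''output'' $lm (inp (aMO\<lblot>$lm\<rblot> \<oplus> aO\<lblot>$lm\<rblot>) \<oplus> Const 1)) Skip))"

definition program :: "int \<Rightarrow> com" where
  "program flag = (
    c_parse ;; vFL ::= Const flag ;; c_bags ;; c_rots ;; c_pow ;; c_sat ;; c_init ;; c_merge ;; c_select ;; c_output)"

section \<open>Reading the input\<close>

definition holds :: "(int \<Rightarrow> int) \<Rightarrow> nat \<Rightarrow> nat list \<Rightarrow> bool" where
  "holds f p ys \<longleftrightarrow> (\<forall>k<length ys. f (int (p + k)) = int (ys ! k))"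

lemma holds_Nil [simp]: "holds f p []"
  by (simp add: holds_def)

lemma holds_Cons [simp]: "holds f p (y # ys) \<longleftrightarrow> f (int p) = int y \<and> holds f (Suc p) ys"
proof
  assume h: "holds f p (y # ys)"
  have "f (int (Suc p + k)) = int (ys ! k)" if "k < length ys" for k
  proof -
    have "f (int (p + Suc k)) = int ((y # ys) ! Suc k)"
      using h that unfolding holds_def by (metis Suc_less_eq length_Cons)
    then show ?thesis by (simp add: add.left_commute add.commute)
  qed
  moreover have "f (int p) = int y" using h unfolding holds_def by (auto dest: spec[of _ 0])
  ultimately show "f (int p) = int y \<and> holds f (Suc p) ys" by (simp add: holds_def)
next
  assume h: "f (int p) = int y \<and> holds f (Suc p) ys"
  show "holds f p (y # ys)" unfolding holds_def
  proof (intro allI impI)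
    fix k assume "k < length (y # ys)"
    then show "f (int (p + k)) = int ((y # ys) ! k)" using h by (cases k) (auto simp: holds_def)
  qed
qed

lemma holds_append [simp]: "holds f p (xs @ ys) \<longleftrightarrow> holds f p xs \<and> holds f (p + length xs) ys"
  by (induction xs arbitrary: p) auto

definition skip :: "('a \<Rightarrow> nat list) \<Rightarrow> 'a list \<Rightarrow> nat \<Rightarrow> nat" where
  "skip g xs i = length (concat (map g (take i xs)))"

lemma skip_0 [simp]: "skip g xs 0 = 0"
  by (simp add: skip_def)

lemma skip_Suc: "i < length xs \<Longrightarrow> skip g xs (Suc i) = skip g xs i + length (g (xs ! i))"
  by (simp add: skip_def take_Suc_conv_app_nth)

lemma skip_length: "skip g xs (length xs) = length (concat (map g xs))"
  by (simp add: skip_def)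

lemma holds_concat: "holds f p (concat (map g xs)) \<Longrightarrow> i < length xs \<Longrightarrow> holds f (p + skip g xs i) (g (xs ! i))"
proof -
  assume h: "holds f p (concat (map g xs))" and i: "i < length xs"
  have "xs = take i xs @ xs ! i # drop (Suc i) xs" using i by (rule id_take_nth_drop)
  then have "concat (map g xs) = concat (map g (take i xs)) @ g (xs ! i) @ concat (map g (drop (Suc i) xs))"
    by (metis concat.simps(2) concat_append list.simps(9) map_append)
  then show ?thesis using h by (simp add: skip_def)
qed

lemma concat_enc_nat [simp]: "concat (map enc_nat xs) = xs"
  by (induction xs) (auto simp: enc_nat_def)

lemma length_concat_enc_pair [simp]: "length (concat (map enc_pair xs)) = 2 * length xs"
  by (induction xs) (auto simp: enc_pair_def)

lemma skip_enc_pair: "i \<le> length xs \<Longrightarrow> skip enc_pair xs i = 2 * i"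
  by (simp add: skip_def min_def)

lemma grid_inject: "w < n \<Longrightarrow> w' < n \<Longrightarrow> int m * int n + int w = int m' * int n + int w' \<longleftrightarrow> m = m' \<and> w = w'"
proof -
  assume w: "w < n" "w' < n"
  have "int m * int n + int w = int m' * int n + int w' \<longleftrightarrow> m * n + w = m' * n + w'"
    by (metis of_nat_add of_nat_eq_iff of_nat_mult)
  also have "\<dots> \<longleftrightarrow> m = m' \<and> w = w'"
  proof
    assume e: "m * n + w = m' * n + w'"
    have "(m * n + w) div n = m" "(m' * n + w') div n = m'" using w by simp_all
    then have "m = m'" using e by simp
    then show "m = m' \<and> w = w'" using e by simp
  qed simp
  finally show ?thesis .
qed

locale reading = marriage +
  fixes X :: decomp and \<xi> :: "int \<Rightarrow> int"
  assumes holds_encode: "holds \<xi> 0 (encode I X)"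
begin

text \<open>Addresses in the input. The encoding of the women's lists begins at
  \<open>moff nm\<close>, that of the tree edges at \<open>woff nw\<close>, and that of the bags at
  \<open>koff\<close>.\<close>

definition "moff m = 1 + skip (enc_list enc_nat) (mprefs I) m"
definition "woff w = moff nm + 1 + skip (enc_list enc_nat) (wprefs I) w"
abbreviation "ne \<equiv> length (tree_edges X)"
abbreviation "nk \<equiv> length (bags X)"
definition "eoff = woff nw + 1"
definition "koff = eoff + 2 * ne"

lemma parts: "holds \<xi> 1 (concat (map (enc_list enc_nat) (mprefs I)))"
  "holds \<xi> (moff nm) (enc_list (enc_list enc_nat) (wprefs I))"
  "holds \<xi> (woff nw) (enc_list enc_pair (tree_edges X))"
  "holds \<xi> koff (enc_list (enc_list (enc_list enc_pair)) (bags X))" "\<xi> 0 = int nm"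
proof -
  have a: "holds \<xi> 0 (enc_list (enc_list enc_nat) (mprefs I))" "holds \<xi> (length (enc_list (enc_list enc_nat) (mprefs I)))
    (enc_list (enc_list enc_nat) (wprefs I) @ enc_list enc_pair (tree_edges X) @ enc_list (enc_list (enc_list enc_pair)) (bags X))"
    using holds_encode by (simp_all add: encode_def)
  then show "\<xi> 0 = int nm" "holds \<xi> 1 (concat (map (enc_list enc_nat) (mprefs I)))"
    by (simp_all add: enc_list_def num_men_def)
  have m: "length (enc_list (enc_list enc_nat) (mprefs I)) = moff nm"
    by (simp add: moff_def enc_list_def num_men_def skip_length)
  have w: "moff nm + length (enc_list (enc_list enc_nat) (wprefs I)) = woff nw"
    by (simp add: woff_def enc_list_def num_women_def skip_length)
  show "holds \<xi> (moff nm) (enc_list (enc_list enc_nat) (wprefs I))" using a m by simp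
  have b: "holds \<xi> (woff nw) (enc_list enc_pair (tree_edges X) @ enc_list (enc_list (enc_list enc_pair)) (bags X))"
    using a(2) w unfolding m by simp
  then show "holds \<xi> (woff nw) (enc_list enc_pair (tree_edges X))" by simp
  have "woff nw + length (enc_list enc_pair (tree_edges X)) = koff" by (simp add: koff_def eoff_def enc_list_def)
  then show "holds \<xi> koff (enc_list (enc_list (enc_list enc_pair)) (bags X))" using b by simp
qed

lemma moff_0: "moff 0 = 1"
  by (simp add: moff_def)

lemma xi_men: "m < nm \<Longrightarrow> \<xi> (int (moff m)) = int (len m)"
  "m < nm \<Longrightarrow> moff (Suc m) = moff m + len m + 1"
  "m < nm \<Longrightarrow> k < len m \<Longrightarrow> \<xi> (int (moff m) + int k + 1) = int (mprefs I ! m ! k)"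
proof -
  assume m: "m < nm"
  have "holds \<xi> (moff m) (enc_list enc_nat (mprefs I ! m))"
    using holds_concat[OF parts(1)] m by (simp add: moff_def num_men_def)
  then have h: "\<xi> (int (moff m)) = int (len m)" "holds \<xi> (Suc (moff m)) (mprefs I ! m)" by (simp_all add: enc_list_def)
  then show "\<xi> (int (moff m)) = int (len m)" by simp
  show "moff (Suc m) = moff m + len m + 1" using m by (simp add: moff_def skip_Suc num_men_def enc_list_def)
  show "k < len m \<Longrightarrow> \<xi> (int (moff m) + int k + 1) = int (mprefs I ! m ! k)"
    using h(2) by (auto simp: holds_def add.commute add.left_commute)
qed

lemma xi_women: "\<xi> (int (moff nm)) = int nw" "woff 0 = moff nm + 1"
  "w < nw \<Longrightarrow> \<xi> (int (woff w)) = int (length (wprefs I ! w))"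
  "w < nw \<Longrightarrow> woff (Suc w) = woff w + length (wprefs I ! w) + 1"
  "w < nw \<Longrightarrow> k < length (wprefs I ! w) \<Longrightarrow> \<xi> (int (woff w) + int k + 1) = int (wprefs I ! w ! k)"
proof -
  have a: "\<xi> (int (moff nm)) = int (length (wprefs I))" "holds \<xi> (Suc (moff nm)) (concat (map (enc_list enc_nat) (wprefs I)))"
    using parts(2) by (simp_all add: enc_list_def)
  then show "\<xi> (int (moff nm)) = int nw" by (simp add: num_women_def)
  show "woff 0 = moff nm + 1" by (simp add: woff_def)
  assume w: "w < nw"
  have "holds \<xi> (woff w) (enc_list enc_nat (wprefs I ! w))"
    using holds_concat[OF a(2)] w by (simp add: woff_def num_women_def)
  then have h: "\<xi> (int (woff w)) = int (length (wprefs I ! w))" "holds \<xi> (Suc (woff w)) (wprefs I ! w)"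
    by (simp_all add: enc_list_def)
  then show "\<xi> (int (woff w)) = int (length (wprefs I ! w))" by simp
  show "woff (Suc w) = woff w + length (wprefs I ! w) + 1"
    using w by (simp add: woff_def skip_Suc num_women_def enc_list_def)
  show "k < length (wprefs I ! w) \<Longrightarrow> \<xi> (int (woff w) + int k + 1) = int (wprefs I ! w ! k)"
    using h(2) by (auto simp: holds_def add.commute add.left_commute)
qed

lemma xi_edges: "\<xi> (int (woff nw)) = int ne" "\<xi> (int koff) = int nk"
  "i < ne \<Longrightarrow> \<xi> (int eoff + int i + int i) = int (fst (tree_edges X ! i))"
  "i < ne \<Longrightarrow> \<xi> (int eoff + int i + int i + 1) = int (snd (tree_edges X ! i))"
proof -
  have a: "\<xi> (int (woff nw)) = int ne" "holds \<xi> eoff (concat (map enc_pair (tree_edges X)))"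
    using parts(3) by (simp_all add: enc_list_def eoff_def)
  then show "\<xi> (int (woff nw)) = int ne" by simp
  show "\<xi> (int koff) = int nk" using parts(4) by (simp add: enc_list_def)
  assume i: "i < ne"
  have "holds \<xi> (eoff + 2 * i) (enc_pair (tree_edges X ! i))"
    using holds_concat[OF a(2) i] skip_enc_pair[of i "tree_edges X"] i by simp
  then have h: "\<xi> (int (eoff + 2 * i)) = int (fst (tree_edges X ! i))" "\<xi> (int (Suc (eoff + 2 * i))) = int (snd (tree_edges X ! i))"
    by (simp_all add: enc_pair_def del: of_nat_add of_nat_Suc)
  have "int (eoff + 2 * i) = int eoff + int i + int i" "int (Suc (eoff + 2 * i)) = int eoff + int i + int i + 1" by simp_all
  then show "\<xi> (int eoff + int i + int i) = int (fst (tree_edges X ! i))" "\<xi> (int eoff + int i + int i + 1) = int (snd (tree_edges X ! i))"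
    using h by (simp_all only:)
qed

text \<open>What \<open>c_parse\<close> establishes and no later part overwrites. Positions start at
  \<open>1\<close>, so the entry \<open>0\<close> is free to encode that a pair is not
  acceptable.\<close>

definition env :: "state \<Rightarrow> bool" where
  "env s \<longleftrightarrow> s ''input'' = \<xi> \<and> s vNM 0 = int nm \<and> s vNP 0 = int (moff nm) \<and> s vNW 0 = int nw \<and>
    s vNE 0 = int ne \<and> s vEO 0 = int eoff \<and> s vNK 0 = int nk \<and>
    (\<forall>m<nm. s aMO (int m) = int (moff m)) \<and> (\<forall>m<nm. s aRow (int m) = int m * int nw) \<and>
    (\<forall>m w. w < nw \<longrightarrow> s aMP (int m * int nw + int w) = (if acc m w then int (mpos I m w) else 0)) \<and>
    (\<forall>m w. w < nw \<longrightarrow> s aWP (int m * int nw + int w) = (if acc m w then int (wpos I w m) else 0))"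

lemma env_frame: "env s \<Longrightarrow> (\<And>a. a \<in> {''input'', vNM, vNP, vNW, vNE, vEO, vNK, aMO, aRow, aMP, aWP} \<Longrightarrow> s' a = s a) \<Longrightarrow> env s'"
  by (simp add: env_def)

lemma mem_less: "m < nm \<Longrightarrow> k < len m \<Longrightarrow> mprefs I ! m ! k < nw"
  "w < nw \<Longrightarrow> k < length (wprefs I ! w) \<Longrightarrow> wprefs I ! w ! k < nm"
  using inst nth_mem unfolding sm_instance_def by blast+

lemma pos_at: "m < nm \<Longrightarrow> k < len m \<Longrightarrow> mpos I m (mprefs I ! m ! k) = Suc k"
  "w < nw \<Longrightarrow> k < length (wprefs I ! w) \<Longrightarrow> wpos I w (wprefs I ! w ! k) = Suc k"
  using inst pos_nth unfolding sm_instance_def mpos_def wpos_def by blast+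

lemma wp_parse:
  assumes z: "\<And>i. s0 (V i) = (\<lambda>_. 0)" "s0 ''input'' = \<xi>"
    and b: "nm \<le> \<beta> lm" "nw \<le> \<beta> lk" "nm \<le> \<beta> lk" "nw \<le> \<beta> lw"
  shows "wp \<beta> c_parse (\<lambda>s. env s \<and> s vP 0 = int (koff + 1)) s0"
  unfolding c_parse_def
proof (rule wp_seq_run, simp, rule wp_seq_run, simp, rule wp_seq, 
    rule wp_for[where h = nm and Inv = "\<lambda>k s. s vP 0 = int (moff k) \<and> (\<forall>m<k. s aMO (int m) = int (moff m))"], goal_cases)
  case (5 k s)
  then show ?case using z by (intro wp_run) (auto simp: less_Suc_eq xi_men)
next
  case (7 s1)
  note fr1 = 7(1)
  have s1: "s1 ''input'' = \<xi>" "s1 vNM 0 = int nm" using fr1 z parts(5) by simp_all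
  show ?case
  proof (rule wp_seq_run, simp, rule wp_seq_run, simp, rule wp_seq_run, simp, rule wp_seq,
      rule wp_for[where h = nm and Inv = "\<lambda>k s. s vR 0 = int k * int nw \<and> (\<forall>m<k. s aRow (int m) = int m * int nw) \<and>
        (\<forall>m w. w < nw \<longrightarrow> s aMP (int m * int nw + int w) = (if m < k \<and> acc m w then int (mpos I m w) else 0))"], goal_cases)
    case 4
    then show ?case using fr1 z by simp
  next
    case (5 k s)
    note fr2 = 5(2)
    have s: "s ''input'' = \<xi>" "s vNW 0 = int nw" "s aMO (int k) = int (moff k)"
      using fr2 s1 7 5 xi_women(1) by simp_all
    show ?case
    proof (rule wp_seq_run, simp, rule wp_seq_run, simp,
        rule wp_for[where h = "len k" and Inv = "\<lambda>j s. (\<forall>m w. w < nw \<longrightarrow> s aMP (int m * int nw + int w) =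
          (if m < k \<and> acc m w \<or> m = k \<and> w \<in> set (take j (mprefs I ! k)) then int (mpos I m w) else 0))"], goal_cases)
      case 2
      then show ?case using len_le[of k] 5 b by simp
    next
      case (3 s')
      then show ?case using 5 s by (simp add: xi_men)
    next
      case (5 j s')
      have sj: "s' ''input'' = \<xi>" "s' aMO (int k) = int (moff k)" "s' lm 0 = int k" "s' aRow (int k) = int k * int nw"
        using 5 s \<open>s lm 0 = int k\<close> \<open>s vR 0 = int k * int nw \<and> _\<close> by simp_all
      show ?case
      proof (intro wp_run, simp, intro allI impI)
        fix m w assume w: "w < nw"
        have j: "j < len k" "k < nm" using 5 \<open>k < nm\<close> by simp_all
        have "set (take (Suc j) (mprefs I ! k)) = insert (mprefs I ! k ! j) (set (take j (mprefs I ! k)))"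
          using j by (simp add: take_Suc_conv_app_nth)
        then show "run (aMP\<lblot>aRow\<lblot>$lm\<rblot> \<oplus> inp (aMO\<lblot>$lm\<rblot> \<oplus> $lk \<oplus> Const 1)\<rblot> :== $lk \<oplus> Const 1) s' aMP (int m * int nw + int w) =
          (if m < k \<and> acc m w \<or> m = k \<and> w \<in> set (take (Suc j) (mprefs I ! k)) then int (mpos I m w) else 0)"
          using 5 sj w j grid_inject[OF w mem_less(1)[OF j(2,1)]] by (auto simp: xi_men pos_at)
      qed
    next
      case (7 s')
      then show ?case using 5 s by (auto simp: less_Suc_eq acc_iff algebra_simps)
    qed (use 5 in simp_all)
  next
    case (7 s2)
    note fr2 = 7(1) and inv2 = 7(2)
    have s2: "s2 ''input'' = \<xi>" "s2 vNM 0 = int nm" "s2 vP 0 = int (moff nm)" "s2 vNW 0 = int nw"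
      "s2 vNP 0 = int (moff nm)" "\<forall>m<nm. s2 aMO (int m) = int (moff m)"
      using fr2 s1 xi_women(1) \<open>s1 vP 0 = _ \<and> _\<close> by simp_all
    have wp0: "s2 aWP = (\<lambda>_. 0)" using fr2 fr1 z by simp
    show ?case
    proof (rule wp_seq_run, simp, rule wp_seq,
        rule wp_for[where h = nw and Inv = "\<lambda>k s. s vP 0 = int (woff k) \<and>
        (\<forall>m w. w < nw \<longrightarrow> s aWP (int m * int nw + int w) = (if w < k \<and> acc m w then int (wpos I w m) else 0))"], goal_cases)
      case (5 k s)
      have s: "s ''input'' = \<xi>" "\<forall>m<nm. s aRow (int m) = int m * int nw" "s vP 0 = int (woff k)" "s lw 0 = int k"
        using 5 s2 inv2 by simp_all
      show ?case
      proof (rule wp_seq, rule wp_for[where h = "length (wprefs I ! k)" and Inv = "\<lambda>j s. (\<forall>m w. w < nw \<longrightarrow> s aWP (int m * int nw + int w) =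
          (if w < k \<and> acc m w \<or> w = k \<and> m \<in> set (take j (wprefs I ! k)) then int (wpos I w m) else 0))"], goal_cases)
        case 2
        then show ?case using wlen_le[of k] 5 b by simp
      next
        case (3 s')
        then show ?case using 5 s by (simp add: xi_women)
      next
        case (5 j s')
        have sj: "s' ''input'' = \<xi>" "\<forall>m<nm. s' aRow (int m) = int m * int nw" "s' vP 0 = int (woff k)" "s' lw 0 = int k"
          using 5 s by simp_all
        show ?case
        proof (intro wp_run, simp, intro allI impI)
          fix m w assume w: "w < nw"
          have j: "j < length (wprefs I ! k)" "k < nw" using 5 \<open>k < nw\<close> by simp_all
          have "set (take (Suc j) (wprefs I ! k)) = insert (wprefs I ! k ! j) (set (take j (wprefs I ! k)))"
            using j by (simp add: take_Suc_conv_app_nth)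
          then show "run (aWP\<lblot>aRow\<lblot>inp ($vP \<oplus> $lk \<oplus> Const 1)\<rblot> \<oplus> $lw\<rblot> :== $lk \<oplus> Const 1) s' aWP (int m * int nw + int w) =
            (if w < k \<and> acc m w \<or> w = k \<and> m \<in> set (take (Suc j) (wprefs I ! k)) then int (wpos I w m) else 0)"
            using 5 sj w j grid_inject[OF w j(2)] mem_less(2)[OF j(2,1)] by (auto simp: xi_women pos_at)
        qed
      next
        case (7 s')
        then show ?case using 5 s by (intro wp_run) (auto simp: less_Suc_eq acc_iff' xi_women)
      qed (use 5 in simp_all)
    next
      case (7 s3)
      have s3: "s3 ''input'' = \<xi>" "s3 vNM 0 = int nm" "s3 vNW 0 = int nw"
      "s3 vNP 0 = int (moff nm)" "\<forall>m<nm. s3 aMO (int m) = int (moff m)" "s3 aMP = s2 aMP" "s3 aRow = s2 aRow"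
        using 7(1) s2 by simp_all
      have "2 * int ne + (int (woff nw) + 1) = int koff" by (simp add: koff_def eoff_def)
      then have "\<xi> (2 * int ne + (int (woff nw) + 1)) = int nk" using xi_edges(2) by simp
      then show ?case
        using s3 7(2) inv2 by (intro wp_run) (auto simp: env_def xi_edges eoff_def koff_def acc_iff acc_iff')
    qed (use b s2 wp0 xi_women(2) in simp_all)
  qed (use s1 b in simp_all)
qed (use z parts(5) moff_0 b in simp_all)

end

section \<open>Computing least settled vectors\<close>

context marriage
begin

definition unsettled :: "(nat \<Rightarrow> nat) \<Rightarrow> nat \<Rightarrow> nat \<Rightarrow> bool" where
  "unsettled x m m' \<longleftrightarrow> (\<exists>w. (m, w) \<in> mat x \<and> reached x m' w \<and> wpos I w m' < wpos I w m)"

lemma unsettled_iff: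
  assumes "m < nm" "1 \<le> x m"
  shows "unsettled x m m' \<longleftrightarrow> x m \<le> len m \<and> reached x m' (mprefs I ! m ! (x m - 1)) \<and>
    wpos I (mprefs I ! m ! (x m - 1)) m' < wpos I (mprefs I ! m ! (x m - 1)) m"
proof (cases "x m \<le> len m")
  case True
  let ?w = "mprefs I ! m ! (x m - 1)"
  have "(m, w) \<in> mat x \<longleftrightarrow> w = ?w" for w
    using woman_at[OF assms True] mpos_inject by (auto simp: mat_def)
  then show ?thesis using True by (auto simp: unsettled_def)
next
  case False
  then show ?thesis using mpos_bounds by (force simp: unsettled_def mat_def)
qed

lemma settled_iff: "settled x \<longleftrightarrow> (\<forall>m<nm. \<forall>m'<nm. \<not> unsettled x m m')"
  unfolding settled_def unsettled_def reached_def mat_def by (auto simp: acc_iff not_less)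

text \<open>In \<open>cl v\<close> the rival \<open>m'\<close> has reached \<open>w\<close> as well,
  so \<open>m\<close> cannot sit there and is strictly further on. A push therefore never overshoots
  the closure.\<close>

lemma unsettled_push:
  assumes "unsettled x m m'" "x \<le> cl v" "v \<le> tops"
  shows "x(m := Suc (x m)) \<le> cl v"
proof -
  obtain w where w: "(m, w) \<in> mat x" "reached x m' w" "wpos I w m' < wpos I w m"
    using assms by (auto simp: unsettled_def)
  have "reached (cl v) m' w" using w assms reached_mono by blast
  then have "(m, w) \<notin> mat (cl v)" using settled_cl[OF assms(3)] w(3) unfolding settled_def by (meson not_less)
  then have "x m \<noteq> cl v m" using w(1) by (auto simp: mat_def)
  then show ?thesis using assms(2) by (auto simp: le_fun_def Suc_le_eq le_neq_implies_less)
qed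

end

context reading
begin

lemma moff_sum: "k \<le> nm \<Longrightarrow> moff k = 1 + (\<Sum>m<k. len m + 1)"
  by (induction k) (simp_all add: moff_0 xi_men)

text \<open>Each list is encoded with its length in front, one cell more than its entries, just as a
  man has one position more than his list. A round of \<open>c_close\<close> that finds anything
  unsettled raises the sum of positions, so \<open>moff nm\<close> rounds are enough.\<close>

lemma sum_tops: "moff nm = 1 + sum tops {..<nm}"
  by (simp add: moff_sum tops_def)

lemma xi_woman: "m < nm \<Longrightarrow> 1 \<le> j \<Longrightarrow> j \<le> len m \<Longrightarrow> \<xi> (int (moff m) + int j) = int (mprefs I ! m ! (j - 1))"
  using xi_men(3)[of m "j - 1"] by (simp add: of_nat_diff)

definition row :: "state \<Rightarrow> int \<Rightarrow> (nat \<Rightarrow> nat) \<Rightarrow> bool" where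
  "row s b x \<longleftrightarrow> (\<forall>m<nm. s aX (b + int m) = int (x m))"

lemma run_close_step:
  assumes e: "env s" and r: "row s b x" and b: "s vXB 0 = b" and m: "m < nm" "m' < nm" "s lm 0 = int m" "s lm2 0 = int m'"
    and x: "1 \<le> x m"
  shows "run (Cond (aX\<lblot>$vXB \<oplus> $lm\<rblot> \<prec> inp aMO\<lblot>$lm\<rblot> \<oplus> Const 1)
        (vW ::= inp (aMO\<lblot>$lm\<rblot> \<oplus> aX\<lblot>$vXB \<oplus> $lm\<rblot>) ;;
         vF ::= aMP\<lblot>aRow\<lblot>$lm2\<rblot> \<oplus> $vW\<rblot> ;;
         Cond (Conj (Const 0 \<prec> $vF) (Conj ($vF \<prec> aX\<lblot>$vXB \<oplus> $lm2\<rblot> \<oplus> Const 1)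
             (aWP\<lblot>aRow\<lblot>$lm2\<rblot> \<oplus> $vW\<rblot> \<prec> aWP\<lblot>aRow\<lblot>$lm\<rblot> \<oplus> $vW\<rblot>)))
           (aX\<lblot>$vXB \<oplus> $lm\<rblot> :== aX\<lblot>$vXB \<oplus> $lm\<rblot> \<oplus> Const 1) Skip) Skip) s aX =
    (if unsettled x m m' then (s aX)(b + int m := int (Suc (x m))) else s aX)"
proof (cases "x m \<le> len m")
  case False
  then show ?thesis using e r m b unsettled_iff[of m x m', OF m(1) x] by (simp add: env_def row_def xi_men)
next
  case True
  let ?w = "mprefs I ! m ! (x m - 1)"
  have w: "?w < nw" "acc m ?w" using woman_at[OF m(1) x True] mem_less(1)[OF m(1), of "x m - 1"] x True by auto
  have u: "unsettled x m m' \<longleftrightarrow> acc m' ?w \<and> mpos I m' ?w \<le> x m' \<and> wpos I ?w m' < wpos I ?w m"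
    using unsettled_iff[of m x m', OF m(1) x] True by (simp add: reached_def)
  have "acc m' ?w \<Longrightarrow> 0 < mpos I m' ?w" using mpos_bounds[of m' ?w] by simp
  then show ?thesis unfolding u
    using e r m b True w xi_woman[OF m(1) x True] by (auto simp: env_def row_def xi_men)
qed

text \<open>The vector always lies between the start and its closure. After \<open>p\<close> rounds
  it is settled or its sum is at least \<open>p\<close>, and the sum cannot reach
  \<open>moff nm\<close>. A settled vector between the start and the closure is the closure.\<close>

lemma wp_close:
  assumes e: "env s0" and s0: "s0 vXB 0 = b" "s0 vHM 0 = int hm" "s0 vHV 0 = int hv"
    and v: "nm > 0 \<Longrightarrow> hm < nm \<and> ones \<le> start hm hv \<and> start hm hv \<le> tops"
    and \<beta>: "nm \<le> \<beta> lm" "nm \<le> \<beta> lm2" "moff nm \<le> \<beta> lp"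
  shows "wp \<beta> c_close (\<lambda>s. row s b (cl (start hm hv)) \<and> (\<forall>i<b. s aX i = s0 aX i)) s0"
  unfolding c_close_def
proof (rule wp_seq, rule wp_for[where h = nm and Inv = "\<lambda>k s. (\<forall>m<k. s aX (b + int m) = 1) \<and> (\<forall>i<b. s aX i = s0 aX i)"], goal_cases)
  case (5 k s)
  then show ?case using s0 by (intro wp_run) (auto simp: less_Suc_eq)
next
  case (7 s1)
  define v0 where "v0 = start hm hv"
  have e1: "env s1" by (rule env_frame[OF e]) (auto simp: 7(1))
  have s1: "s1 vXB 0 = b" "s1 vHM 0 = int hm" "s1 vHV 0 = int hv" using 7(1) s0 by simp_all
  show ?case
  proof (cases "nm = 0")
    \<comment> \<open>Without men the row is empty and there is no man \<open>hm\<close>, but the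
      write to cell \<open>b + hm\<close> still happens; it only has to spare the cells below
      \<open>b\<close>.\<close>
    case True
    show ?thesis
    proof (rule wp_seq_run, simp, rule wp_for[where h = "moff nm" and Inv = "\<lambda>k s. \<forall>i<b. s aX i = s0 aX i"], goal_cases)
      case (5 k s)
      then have "s vNM 0 = 0" using e1 True by (simp add: env_def)
      then show ?case
        by (intro wp_for[where h = 0 and Inv = "\<lambda>k s. \<forall>i<b. s aX i = s0 aX i"]) (use 5 in simp_all)
    qed (use 7 s1 e1 \<beta> True in \<open>auto simp: env_def row_def\<close>)
  next
    case False
    then have hm: "hm < nm" and v0: "ones \<le> v0" "v0 \<le> tops" using v by (auto simp: v0_def)
    have v0c: "v0 \<le> cl v0" using cl_ge v0 by blast
    define good where "good y s \<longleftrightarrow> (\<exists>x. row s b x \<and> y \<le> x \<and> x \<le> cl v0 \<and> (\<forall>i<b. s aX i = s0 aX i))" for y s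
    show ?thesis
    proof (rule wp_seq_run, simp, rule wp_for[where h = "moff nm" and Inv =
          "\<lambda>k s. \<exists>x. row s b x \<and> v0 \<le> x \<and> x \<le> cl v0 \<and> (\<forall>i<b. s aX i = s0 aX i) \<and> (settled x \<or> k \<le> sum x {..<nm})"], goal_cases)
      case 4
      have "row (run (aX\<lblot>$vXB \<oplus> $vHM\<rblot> :== $vHV) s1) b v0" using 7 s1 by (auto simp: row_def v0_def start_def ones_def)
      then show ?case using v0c 7 s1 hm by (intro exI[of _ v0]) auto
    next
      case (5 p s)
      then obtain x0 where x0: "row s b x0" "v0 \<le> x0" "x0 \<le> cl v0" "\<forall>i<b. s aX i = s0 aX i" "settled x0 \<or> p \<le> sum x0 {..<nm}" by blast
      have e2: "env s" by (rule env_frame[OF e1]) (auto simp: 5(2))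
      have s2: "s vXB 0 = b" using 5(2) s1 by simp
      let ?G = "\<lambda>s x. row s b x \<and> x0 \<le> x \<and> x \<le> cl v0 \<and> (\<forall>i<b. s aX i = s0 aX i)"
      \<comment> \<open>While the vector is still \<open>x0\<close>, every test so far has failed; a
        successful one changes the vector for good, since pushes only increase it. So a vector left
        unchanged by the whole round is settled.\<close>
      show ?case
      proof (rule wp_for[where h = nm and Inv = "\<lambda>k s. \<exists>x. ?G s x \<and> (x = x0 \<longrightarrow> (\<forall>m<k. \<forall>m'<nm. \<not> unsettled x0 m m'))"], goal_cases)
        case (5 k s')
        note o = this
        have e3: "env s'" by (rule env_frame[OF e2]) (auto simp: o(2))
        have s3: "s' vXB 0 = b" using o(2) s2 by simp
        show ?case
        proof (rule wp_for[where h = nm and Inv = "\<lambda>j s. \<exists>x. ?G s x \<and>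
            (x = x0 \<longrightarrow> (\<forall>m<k. \<forall>m'<nm. \<not> unsettled x0 m m') \<and> (\<forall>m'<j. \<not> unsettled x0 k m'))"], goal_cases)
          case (5 j s'')
          have e4: "env s''" by (rule env_frame[OF e3]) (auto simp: 5(2))
          have s4: "s'' vXB 0 = b" "s'' lm 0 = int k" using 5(2) s3 o by simp_all
          obtain x where x: "?G s'' x" and xx: "x = x0 \<Longrightarrow> (\<forall>m<k. \<forall>m'<nm. \<not> unsettled x0 m m') \<and> (\<forall>m'<j. \<not> unsettled x0 k m')"
            using 5(4) by blast
          have "ones k \<le> x k" using x x0(2) v0(1) by (meson le_funD order_trans)
          then have xk: "1 \<le> x k" using o(1) by (simp add: ones_def)
          show ?case
          proof (rule wp_run, simp, unfold run_close_step[OF e4 conjunct1[OF x] s4(1) o(1) 5(1) s4(2) 5(3) xk], goal_cases)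
            case 1
            show ?case
            proof (cases "unsettled x k j")
              case True
              have "x(k := Suc (x k)) \<le> cl v0" using unsettled_push[OF True _ v0(2)] x by blast
              moreover have "x0 \<le> x(k := Suc (x k))" "x(k := Suc (x k)) \<noteq> x0"
                using x by (auto simp: le_fun_def fun_eq_iff le_SucI dest: spec[of _ k]) (metis Suc_n_not_le_n)
              ultimately show ?thesis using True x
                by (intro exI[of _ "x(k := Suc (x k))"]) (auto simp: row_def run_close_step[OF e4 conjunct1[OF x] s4(1) o(1) 5(1) s4(2) 5(3) xk] simp del: run.simps)
            next
              case False
              then show ?thesis using x xx
                by (intro exI[of _ x]) (auto simp: row_def less_Suc_eq run_close_step[OF e4 conjunct1[OF x] s4(1) o(1) 5(1) s4(2) 5(3) xk] simp del: run.simps)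
            qed
          qed
        next
          case (7 s'')
          then show ?case by (auto simp: less_Suc_eq)
        next
          case 3
          then show ?case using e3 by (simp add: env_def)
        qed (use o \<beta> in \<open>auto simp: row_def\<close>)
      next
        case (7 s')
        then obtain x where x: "?G s' x" and xx: "x = x0 \<Longrightarrow> (\<forall>m<nm. \<forall>m'<nm. \<not> unsettled x0 m m')" by blast
        have "settled x \<or> Suc p \<le> sum x {..<nm}"
        proof (cases "x = x0")
          case True
          then show ?thesis using xx settled_iff by blast
        next
          case False
          have ns: "\<not> settled x0 \<Longrightarrow> p \<le> sum x0 {..<nm}" using x0 by blast
          have "settled x" if "settled x0"
          proof -
            have "x0 \<le> tops" using x0 cl_le_tops v0 order_trans by blast
            then have "cl v0 \<le> x0" using cl_le that x0 by blast
            then show ?thesis using x x0 False by (metis order_antisym order_trans)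
          qed
          moreover obtain m where m: "x0 m \<noteq> x m" using False by (metis ext)
          have "x0 m < x m" using x m by (meson le_funD le_neq_implies_less)
          moreover have "x m \<le> tops m" using x cl_le_tops v0 by (meson le_funD order_trans)
          ultimately have "m < nm" by (simp add: tops_def split: if_splits)
          then have "sum x0 {..<nm} < sum x {..<nm}"
            using \<open>x0 m < x m\<close> x by (intro sum_strict_mono_ex1) (auto simp: le_fun_def)
          then show ?thesis using ns \<open>settled x0 \<Longrightarrow> settled x\<close> by fastforce
        qed
        moreover have "v0 \<le> x" using x x0(2) order_trans by blast
        ultimately show ?case using x by blast
      next
        case 4
        then show ?case using x0 by (intro exI[of _ x0]) auto
      next
        case 3
        then show ?case using e2 by (simp add: env_def)
      qed (use \<beta> in \<open>auto simp: row_def\<close>)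
    next
      case (7 s)
      then obtain x where x: "row s b x" "v0 \<le> x" "x \<le> cl v0" "\<forall>i<b. s aX i = s0 aX i" "settled x \<or> moff nm \<le> sum x {..<nm}" by blast
      have xt: "x \<le> tops" using x cl_le_tops v0 order_trans by blast
      then have "sum x {..<nm} \<le> sum tops {..<nm}" by (intro sum_mono) (simp add: le_funD)
      then have "settled x" using x(5) sum_tops by simp
      then have "cl v0 \<le> x" using cl_le x xt by blast
      then show ?case using x by (simp add: v0_def)
    next
      case 3
      then show ?case using e1 by (simp add: env_def)
    qed (use \<beta> in \<open>auto simp: row_def\<close>)
  qed
qed (use e s0 \<beta> in \<open>auto simp: env_def\<close>)

end

section \<open>Numbering the rotations\<close>

locale solving = reading +
  fixes D :: "rotation rel"
  assumes digraph: "rotation_digraph I D" and decomposition: "given_decomposition I D X"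
begin

abbreviation "bag t \<equiv> bags X ! t"

lemma Union_bags: "(\<Union>t<nk. set (bag t)) = rotations I"
  using decomposition by (auto simp: given_decomposition_def tree_decomposition_def)

lemma bag_rotation: "t < nk \<Longrightarrow> i < length (bag t) \<Longrightarrow> bag t ! i \<in> rotations I"
  using Union_bags nth_mem by blast

lemma bag_distinct: "t < nk \<Longrightarrow> distinct (bag t)"
  using decomposition by (simp add: given_decomposition_def)

definition "B = nat (rotation_tw I D + 1)"

lemma length_bag: "t < nk \<Longrightarrow> length (bag t) \<le> B" and B_eq: "int B = rotation_tw I D + 1"
proof -
  have w: "rotation_tw I D = int (MAX t \<in> {..<nk}. card (set (bag t))) - 1"
    using decomposition by (simp add: given_decomposition_def width_def)
  then show "int B = rotation_tw I D + 1" by (simp add: B_def)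
  have b: "B = (MAX t \<in> {..<nk}. card (set (bag t)))" using w by (simp add: B_def)
  show "length (bag t) \<le> B" if t: "t < nk"
  proof -
    have "card (set (bag t)) \<le> B" unfolding b by (rule Max_ge) (use t in auto)
    then show ?thesis using bag_distinct[OF t] by (simp add: distinct_card)
  qed
qed

definition "boffs t = koff + 1 + skip (enc_list (enc_list enc_pair)) (bags X) t"
definition "boo t = (\<Sum>t'<t. length (bag t'))"

definition stored :: "int \<Rightarrow> rotation \<Rightarrow> bool" where
  "stored a \<rho> \<longleftrightarrow> (\<exists>p. a = int p \<and> holds \<xi> p (enc_list enc_pair \<rho>))"

lemma storedD:
  assumes "stored a \<rho>"
  shows "\<xi> a = int (length \<rho>)" "i < length \<rho> \<Longrightarrow> \<xi> (a + 1 + int i + int i) = int (fst (\<rho> ! i))"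
    "i < length \<rho> \<Longrightarrow> \<xi> (a + 2 + int i + int i) = int (snd (\<rho> ! i))"
proof -
  obtain p where p: "a = int p" "holds \<xi> p (enc_list enc_pair \<rho>)" using assms by (auto simp: stored_def)
  then have h: "\<xi> (int p) = int (length \<rho>)" "holds \<xi> (Suc p) (concat (map enc_pair \<rho>))" by (simp_all add: enc_list_def)
  then show "\<xi> a = int (length \<rho>)" using p by simp
  assume i: "i < length \<rho>"
  have "holds \<xi> (Suc p + 2 * i) (enc_pair (\<rho> ! i))"
    using holds_concat[OF h(2) i] skip_enc_pair[of i \<rho>] i by simp
  then have q: "\<xi> (int (Suc p + 2 * i)) = int (fst (\<rho> ! i))" "\<xi> (int (Suc (Suc p + 2 * i))) = int (snd (\<rho> ! i))"
    by (simp_all add: enc_pair_def del: of_nat_add of_nat_Suc)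
  have "int (Suc p + 2 * i) = a + 1 + int i + int i" "int (Suc (Suc p + 2 * i)) = a + 2 + int i + int i" using p by simp_all
  then show "\<xi> (a + 1 + int i + int i) = int (fst (\<rho> ! i))" "\<xi> (a + 2 + int i + int i) = int (snd (\<rho> ! i))"
    using q by (simp_all only:)
qed

lemma stored_hd:
  assumes "stored a \<rho>" "\<rho> \<noteq> []"
  shows "\<xi> (a + 1) = int (fst (hd \<rho>))" "\<xi> (a + 2) = int (snd (hd \<rho>))"
  using storedD(2,3)[OF assms(1), of 0] assms(2) by (simp_all add: hd_conv_nth)

lemma xi_bags:
  assumes t: "t < nk"
  shows "\<xi> (int (boffs t)) = int (length (bag t))"
    "boffs (Suc t) = boffs t + 1 + skip (enc_list enc_pair) (bag t) (length (bag t))"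
    "i < length (bag t) \<Longrightarrow> stored (int (boffs t) + 1 + int (skip (enc_list enc_pair) (bag t) i)) (bag t ! i)"
    "i < length (bag t) \<Longrightarrow> skip (enc_list enc_pair) (bag t) (Suc i) = skip (enc_list enc_pair) (bag t) i + 1 + 2 * length (bag t ! i)"
proof -
  have h0: "holds \<xi> (Suc koff) (concat (map (enc_list (enc_list enc_pair)) (bags X)))"
    using parts(4) unfolding enc_list_def by simp
  then have "holds \<xi> (boffs t) (enc_list (enc_list enc_pair) (bag t))"
    using holds_concat[OF h0 t] by (simp add: boffs_def)
  then have h: "\<xi> (int (boffs t)) = int (length (bag t))" "holds \<xi> (Suc (boffs t)) (concat (map (enc_list enc_pair) (bag t)))"
    unfolding enc_list_def[of "enc_list enc_pair"] by simp_all
  then show "\<xi> (int (boffs t)) = int (length (bag t))" by simp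
  show "boffs (Suc t) = boffs t + 1 + skip (enc_list enc_pair) (bag t) (length (bag t))"
    using t unfolding boffs_def by (simp add: skip_Suc skip_length enc_list_def[of "enc_list enc_pair"])
  assume i: "i < length (bag t)"
  show "stored (int (boffs t) + 1 + int (skip (enc_list enc_pair) (bag t) i)) (bag t ! i)" unfolding stored_def
    by (rule exI[of _ "Suc (boffs t) + skip (enc_list enc_pair) (bag t) i"]) (use holds_concat[OF h(2) i] in simp)
  show "skip (enc_list enc_pair) (bag t) (Suc i) = skip (enc_list enc_pair) (bag t) i + 1 + 2 * length (bag t ! i)"
    using i by (simp add: skip_Suc enc_list_def)
qed

text \<open>\<open>rl\<close> lists the rotations found so far by first occurrence; the position in
  \<open>rl\<close> is the number under which the program knows a rotation.\<close>

definition numbering :: "rotation list \<Rightarrow> state \<Rightarrow> bool" where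
  "numbering rl s \<longleftrightarrow> s vNR 0 = int (length rl) \<and> (\<forall>r<length rl. stored (s aAD (int r)) (rl ! r))"

definition ids :: "rotation list \<Rightarrow> state \<Rightarrow> bool" where
  "ids rl s \<longleftrightarrow> distinct rl \<and>
    (\<forall>r<length rl. s aID (int (fst (hd (rl ! r))) * int nw + int (snd (hd (rl ! r)))) = int r + 1) \<and>
    (\<forall>m w. w < nw \<longrightarrow> (m, w) \<notin> hd ` set rl \<longrightarrow> s aID (int m * int nw + int w) = 0)"

definition entry :: "rotation list \<Rightarrow> state \<Rightarrow> nat \<Rightarrow> nat \<Rightarrow> bool" where
  "entry rl s t i \<longleftrightarrow> (\<exists>r<length rl. rl ! r = bag t ! i \<and> s aBG (int (boo t) + int i) = int r)"

definition tables :: "rotation list \<Rightarrow> state \<Rightarrow> nat \<Rightarrow> bool" where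
  "tables rl s t \<longleftrightarrow> s aBO (int t) = int (boo t) \<and> s aBL (int t) = int (length (bag t)) \<and> (\<forall>i<length (bag t). entry rl s t i)"

lemma boo_mono: "t' < t \<Longrightarrow> boo t' + length (bag t') \<le> boo t"
proof -
  assume "t' < t"
  then have "boo (Suc t') \<le> boo t" unfolding boo_def by (intro sum_mono2) auto
  then show ?thesis by (simp add: boo_def)
qed

lemma hd_rotation: "\<rho> \<in> rotations I \<Longrightarrow> fst (hd \<rho>) < nm \<and> snd (hd \<rho>) < nw \<and> acc (fst (hd \<rho>)) (snd (hd \<rho>))"
  using rotation_acc[of \<rho> "fst (hd \<rho>)" "snd (hd \<rho>)"] rotation_nonempty hd_in_set by (auto simp: acceptable_def)

lemma run_bag_step:
  assumes e: "env s" and t: "t < nk" and j: "j < length (bag t)" and s: "s lt 0 = int t"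
    and P: "s vP 0 = int (boffs t) + 1 + int (skip (enc_list enc_pair) (bag t) j)" and Q: "s vQ 0 = int (boo t) + int j"
    and n: "numbering rl s" "ids rl s" and sub: "set rl \<subseteq> rotations I"
    and old: "\<And>t' i. t' < t \<Longrightarrow> i < length (bag t') \<Longrightarrow> entry rl s t' i" "\<And>i. i < j \<Longrightarrow> entry rl s t i"
    and Z: "Z = (vX ::= aRow\<lblot>inp ($vP \<oplus> Const 1)\<rblot> \<oplus> inp ($vP \<oplus> Const 2) ;;
        Cond (aID\<lblot>$vX\<rblot> \<prec> Const 1)
          (aAD\<lblot>$vNR\<rblot> :== $vP ;; vNR ::= $vNR \<oplus> Const 1 ;; aID\<lblot>$vX\<rblot> :== $vNR) Skip ;;
        aBG\<lblot>$vQ\<rblot> :== aID\<lblot>$vX\<rblot> \<ominus> Const 1 ;; vQ ::= $vQ \<oplus> Const 1 ;;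
        vP ::= $vP \<oplus> Const 1 \<oplus> inp $vP \<oplus> inp $vP)"
  shows "\<exists>rl'. set rl' = insert (bag t ! j) (set rl) \<and> numbering rl' (run Z s) \<and> ids rl' (run Z s) \<and>
    (\<forall>t'<t. \<forall>i<length (bag t'). entry rl' (run Z s) t' i) \<and> (\<forall>i<Suc j. entry rl' (run Z s) t i) \<and>
    run Z s vP 0 = int (boffs t) + 1 + int (skip (enc_list enc_pair) (bag t) (Suc j)) \<and> run Z s vQ 0 = int (boo t) + int (Suc j)"
proof -
  let ?\<rho> = "bag t ! j"
  obtain m w where mw: "hd ?\<rho> = (m, w)" by force
  have r: "?\<rho> \<in> rotations I" using bag_rotation t j .
  then have mw': "m < nm" "w < nw" using hd_rotation[OF r] mw by auto
  have st: "stored (s vP 0) ?\<rho>" unfolding P by (rule xi_bags(3)[OF t j])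
  note sd = storedD(1)[OF st] stored_hd[OF st rotation_nonempty[OF r]]
  have x: "s aRow (s ''input'' (s vP 0 + 1)) + s ''input'' (s vP 0 + 2) = int m * int nw + int w"
    using sd e mw mw' by (simp add: env_def)
  have inp: "s ''input'' = \<xi>" using e by (simp add: env_def)
  have P': "s vP 0 + 1 + s ''input'' (s vP 0) + s ''input'' (s vP 0) = int (boffs t) + 1 + int (skip (enc_list enc_pair) (bag t) (Suc j))"
    using sd(1) P xi_bags(4)[OF t j] inp by simp
  \<comment> \<open>Whether the rotation was met before shows at the dictionary entry of its first
    pair, because first pairs identify rotations.\<close>
  have hdeq: "(m, w) \<in> hd ` set rl \<longleftrightarrow> ?\<rho> \<in> set rl"
    using inj_on_image_mem_iff[OF inj_on_hd_rotations r sub] mw by simp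
  have oldidx: "int (boo t') + int i \<noteq> int (boo t) + int j" if "t' < t \<and> i < length (bag t') \<or> t' = t \<and> i < j" for t' i
    using that boo_mono[of t' t] by auto
  show ?thesis
  proof (cases "?\<rho> \<in> set rl")
    case True
    then obtain r0 where r0: "r0 < length rl" "rl ! r0 = ?\<rho>" by (metis in_set_conv_nth)
    then have idv: "s aID (int m * int nw + int w) = int r0 + 1" using n(2) mw by (force simp: ids_def)
    have z: "run Z s aBG = (s aBG)(int (boo t) + int j := int r0)" "run Z s aID = s aID" "run Z s aAD = s aAD" "run Z s vNR = s vNR"
        "run Z s vP 0 = int (boffs t) + 1 + int (skip (enc_list enc_pair) (bag t) (Suc j))" "run Z s vQ 0 = int (boo t) + int (Suc j)"
      using P' by (simp_all add: Z x idv Q)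
    show ?thesis
      by (intro exI[of _ rl] conjI allI impI)
        (use True n z old oldidx r0 in \<open>auto simp: numbering_def ids_def entry_def less_Suc_eq\<close>)
  next
    case False
    then have idv: "s aID (int m * int nw + int w) = 0" using n(2) mw' hdeq by (auto simp: ids_def)
    have nr: "s vNR 0 = int (length rl)" using n by (simp add: numbering_def)
    have z: "run Z s aBG = (s aBG)(int (boo t) + int j := int (length rl))"
        "run Z s aID = (s aID)(int m * int nw + int w := int (length rl) + 1)"
        "run Z s aAD = (s aAD)(int (length rl) := s vP 0)" "run Z s vNR 0 = int (length rl) + 1"
        "run Z s vP 0 = int (boffs t) + 1 + int (skip (enc_list enc_pair) (bag t) (Suc j))" "run Z s vQ 0 = int (boo t) + int (Suc j)"
      using P' by (simp_all add: Z x idv Q nr)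
    have ne: "int (fst (hd (rl ! r1))) * int nw + int (snd (hd (rl ! r1))) \<noteq> int m * int nw + int w" if "r1 < length rl" for r1
    proof -
      have in': "rl ! r1 \<in> set rl" using that by simp
      then have "snd (hd (rl ! r1)) < nw" using hd_rotation sub by blast
      moreover have "hd (rl ! r1) \<noteq> (m, w)" using hdeq False in' by force
      ultimately show ?thesis using grid_inject[of "snd (hd (rl ! r1))" nw w "fst (hd (rl ! r1))" m] mw' by (auto simp: prod_eq_iff)
    qed
    have 1: "ids (rl @ [?\<rho>]) (run Z s)" unfolding ids_def
    proof (intro conjI allI impI)
      show "distinct (rl @ [?\<rho>])" using n(2) False by (simp add: ids_def)
    next
      fix r assume "r < length (rl @ [?\<rho>])"
      then show "run Z s aID (int (fst (hd ((rl @ [?\<rho>]) ! r))) * int nw + int (snd (hd ((rl @ [?\<rho>]) ! r)))) = int r + 1"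
        using n(2) ne mw z(2) by (cases "r < length rl") (auto simp: nth_append ids_def less_Suc_eq)
    next
      fix m' w' assume a: "w' < nw" "(m', w') \<notin> hd ` set (rl @ [?\<rho>])"
      then have "(m', w') \<noteq> (m, w)" "(m', w') \<notin> hd ` set rl" using mw by auto
      then show "run Z s aID (int m' * int nw + int w') = 0"
        using n(2) a mw' z(2) grid_inject[of w' nw w m' m] by (auto simp: ids_def)
    qed
    have 2: "numbering (rl @ [?\<rho>]) (run Z s)"
      using n(1) st z by (auto simp: numbering_def nth_append less_Suc_eq)
    have ext: "entry (rl @ [?\<rho>]) (run Z s) t' i" if o: "entry rl s t' i" and d: "int (boo t') + int i \<noteq> int (boo t) + int j" for t' i
    proof -
      obtain r where "r < length rl" "rl ! r = bag t' ! i" "s aBG (int (boo t') + int i) = int r" using o by (auto simp: entry_def)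
      then show ?thesis unfolding entry_def using d z(1) by (intro exI[of _ r]) (simp add: nth_append)
    qed
    have 3: "entry (rl @ [?\<rho>]) (run Z s) t j" unfolding entry_def using z(1)
      by (intro exI[of _ "length rl"]) simp
    have 4: "entry (rl @ [?\<rho>]) (run Z s) t i" if "i < Suc j" for i
      using that ext[OF old(2)] oldidx[of t i] 3 by (cases "i = j") auto
    have 5: "entry (rl @ [?\<rho>]) (run Z s) t' i" if "t' < t" "i < length (bag t')" for t' i
      using ext[OF old(1)] oldidx[of t' i] that by auto
    show ?thesis
      by (intro exI[of _ "rl @ [?\<rho>]"] conjI allI impI) (use 1 2 4 5 z in simp_all)
  qed
qed

lemma tables_frame: "tables rl s t \<Longrightarrow> (\<And>a. a \<in> {aBO, aBL, aBG} \<Longrightarrow> s' a = s a) \<Longrightarrow> tables rl s' t"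
  by (simp add: tables_def entry_def)

lemma wp_bags:
  assumes e: "env s0" and P: "s0 vP 0 = int (koff + 1)" and z: "s0 vQ 0 = 0" "s0 vNR 0 = 0" "s0 aID = (\<lambda>_. 0)"
    and \<beta>: "nk \<le> \<beta> lt" "B \<le> \<beta> lb"
  shows "wp \<beta> c_bags (\<lambda>s. \<exists>rl. set rl = rotations I \<and> distinct rl \<and> numbering rl s \<and> (\<forall>t<nk. tables rl s t)) s0"
  unfolding c_bags_def
proof (rule wp_for[where h = nk and Inv = "\<lambda>t s. \<exists>rl. set rl = (\<Union>t'<t. set (bag t')) \<and> numbering rl s \<and> ids rl s \<and>
    (\<forall>t'<t. tables rl s t') \<and> s vP 0 = int (boffs t) \<and> s vQ 0 = int (boo t)"], goal_cases)
  case 4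
  show ?case by (rule exI[of _ "[]"]) (use P z in \<open>simp add: numbering_def ids_def boffs_def boo_def\<close>)
next
  case (5 t s)
  note o = this
  obtain rl0 where rl0: "set rl0 = (\<Union>t'<t. set (bag t'))" "numbering rl0 s" "ids rl0 s" "\<forall>t'<t. tables rl0 s t'"
    "s vP 0 = int (boffs t)" "s vQ 0 = int (boo t)" using o(4) by blast
  have e1: "env s" by (rule env_frame[OF e]) (auto simp: o(2))
  have inp: "s ''input'' = \<xi>" using e1 by (simp add: env_def)
  have sub: "(\<Union>t'<t. set (bag t')) \<union> set (take i (bag t)) \<subseteq> rotations I" for i
  proof -
    have sb: "set (bag t') \<subseteq> rotations I" if "t' \<le> t" for t' using Union_bags o(1) that by auto
    have "set (take i (bag t)) \<subseteq> rotations I" using sb[of t] set_take_subset[of i "bag t"] by blast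
    then show ?thesis using sb by (meson Un_least UN_least lessThan_iff less_imp_le)
  qed
  show ?case
  proof (rule wp_seq_run, simp, rule wp_seq_run, simp, rule wp_seq_run, simp,
      rule wp_for[where h = "length (bag t)" and Inv = "\<lambda>i s. \<exists>rl. set rl = (\<Union>t'<t. set (bag t')) \<union> set (take i (bag t)) \<and>
      numbering rl s \<and> ids rl s \<and> (\<forall>t'<t. \<forall>i<length (bag t'). entry rl s t' i) \<and> (\<forall>i'<i. entry rl s t i') \<and>
      s vP 0 = int (boffs t) + 1 + int (skip (enc_list enc_pair) (bag t) i) \<and> s vQ 0 = int (boo t) + int i"], goal_cases)
    case 2
    then show ?case using length_bag[OF o(1)] \<beta> by simp
  next
    case (3 s')
    then show ?case using inp xi_bags(1)[OF o(1)] rl0 o(3) by simp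
  next
    case 4
    show ?case
      by (rule exI[of _ rl0]) (use rl0 o(3) in \<open>auto simp: numbering_def ids_def tables_def entry_def\<close>)
  next
    case (5 j s')
    then obtain rl where rl: "set rl = (\<Union>t'<t. set (bag t')) \<union> set (take j (bag t))"
      "numbering rl s'" "ids rl s'" "\<forall>t'<t. \<forall>i<length (bag t'). entry rl s' t' i" "\<forall>i'<j. entry rl s' t i'"
      "s' vP 0 = int (boffs t) + 1 + int (skip (enc_list enc_pair) (bag t) j)" "s' vQ 0 = int (boo t) + int j" by blast
    have e2: "env s'" by (rule env_frame[OF e1]) (auto simp: 5(2))
    have s': "s' lt 0 = int t" using 5(2) o(3) by simp
    have sub': "set rl \<subseteq> rotations I" using sub rl by simp
    have tk: "set (take (Suc j) (bag t)) = insert (bag t ! j) (set (take j (bag t)))"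
      using 5(1) by (simp add: take_Suc_conv_app_nth)
    show ?case
      by (rule wp_run, simp) (use run_bag_step[OF e2 o(1) 5(1) s' rl(6,7,2,3) sub' _ _ refl] rl in \<open>simp add: tk\<close>)
  next
    case (7 s')
    then obtain rl where rl: "set rl = (\<Union>t'<t. set (bag t')) \<union> set (bag t)"
      "numbering rl s'" "ids rl s'" "\<forall>t'<t. \<forall>i<length (bag t'). entry rl s' t' i" "\<forall>i'<length (bag t). entry rl s' t i'"
      "s' vP 0 = int (boffs t) + 1 + int (skip (enc_list enc_pair) (bag t) (length (bag t)))" "s' vQ 0 = int (boo t) + int (length (bag t))"
      by auto
    have "s' aBO = (s aBO)(int t := int (boo t))" "s' aBL = (s aBL)(int t := int (length (bag t)))"
      using 7(1) rl0 o(3) inp xi_bags(1)[OF o(1)] by simp_all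
    then have "\<forall>t'<Suc t. tables rl s' t'" using rl0(4) rl by (auto simp: tables_def less_Suc_eq)
    moreover have "s' vP 0 = int (boffs (Suc t))" "s' vQ 0 = int (boo (Suc t))"
      using rl xi_bags(2)[OF o(1)] by (simp_all add: boo_def)
    moreover have "set rl = (\<Union>t'<Suc t. set (bag t'))" using rl(1) by (auto simp: less_Suc_eq)
    ultimately show ?case using rl by blast
  qed (simp_all add: numbering_def ids_def entry_def)
next
  case (7 s)
  then show ?case using Union_bags by (auto simp: ids_def)
next
  case (6 t s f)
  then show ?case by (simp add: numbering_def ids_def tables_def entry_def)
qed (use e \<beta> in \<open>simp_all add: env_def\<close>)

end

section \<open>Weights of rotations\<close>

context solving
begin

definition wx :: "int \<Rightarrow> rotation \<Rightarrow> int" where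
  "wx fl \<rho> = (if 0 < fl then dM \<rho> + dW \<rho> else dM \<rho>)"

definition wy :: "int \<Rightarrow> rotation \<Rightarrow> int" where
  "wy fl \<rho> = (if 0 < fl then 0 else dW \<rho>)"

definition v1 :: "int \<Rightarrow> nat" where
  "v1 fl = Suc (nat (sum (wx fl) (rotations I)))"

text \<open>Row \<open>0\<close> of \<open>aX\<close> belongs to \<open>best\<close>, so the row of
  rotation \<open>r\<close> starts at \<open>Suc r * nm\<close>. \<open>aHM\<close> and
  \<open>aHV\<close> are the coordinate and the threshold of the test in
  \<open>past_iff_hd\<close>.\<close>

definition rot_data :: "rotation list \<Rightarrow> int \<Rightarrow> state \<Rightarrow> nat \<Rightarrow> bool" where
  "rot_data rl fl s r \<longleftrightarrow> s aWX (int r) = wx fl (rl ! r) \<and> s aWY (int r) = wy fl (rl ! r) \<and>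
    s aHM (int r) = int (fst (hd (rl ! r))) \<and>
    s aHV (int r) = int (mpos I (fst (hd (rl ! r))) (snd (hd (rl ! r)))) + 1 \<and>
    s aXB (int r) = int (Suc r) * int nm \<and> row s (int (Suc r) * int nm) (clr (rl ! r))"

lemma rotation_pairs:
  assumes r: "\<rho> \<in> rotations I" and i: "i < length \<rho>" and j: "j = Suc i mod length \<rho>"
  shows "acc (fst (\<rho> ! i)) (snd (\<rho> ! i))" "acc (fst (\<rho> ! i)) (snd (\<rho> ! j))" "acc (fst (\<rho> ! j)) (snd (\<rho> ! j))"
proof -
  obtain \<mu> where st: "stable I \<mu>" and ex: "exposed I \<mu> \<rho>" using r by (rule rotationsE)
  note f = exposedD[OF st ex i prod.collapse[symmetric] prod.collapse[symmetric]]
  show "acc (fst (\<rho> ! i)) (snd (\<rho> ! i))" "acc (fst (\<rho> ! i)) (snd (\<rho> ! j))" "acc (fst (\<rho> ! j)) (snd (\<rho> ! j))"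
    using f(3,4,5) j by simp_all
qed

lemma env_tables: "env s \<Longrightarrow> acc m w \<Longrightarrow> s aMP (s aRow (int m) + int w) = int (mpos I m w)"
  "env s \<Longrightarrow> acc m w \<Longrightarrow> s aWP (s aRow (int m) + int w) = int (wpos I w m)"
  by (auto simp: env_def acceptable_def)

lemma wp_weights:
  assumes e: "env s0" and A: "stored (s0 vA 0) \<rho>" and r: "\<rho> \<in> rotations I" and z: "s0 vD1 0 = 0" "s0 vD2 0 = 0"
    and \<beta>: "nm \<le> \<beta> li"
  shows "wp \<beta> (For li (inp $vA) (
        vB ::= $vA \<oplus> Const 1 \<oplus> $li \<oplus> $li ;;
        Cond ($li \<oplus> Const 1 \<prec> inp $vA) (vE ::= $vB \<oplus> Const 2) (vE ::= $vA \<oplus> Const 1) ;;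
        vD1 ::= $vD1 \<oplus> (aMP\<lblot>aRow\<lblot>inp $vB\<rblot> \<oplus> inp ($vE \<oplus> Const 1)\<rblot>
          \<ominus> aMP\<lblot>aRow\<lblot>inp $vB\<rblot> \<oplus> inp ($vB \<oplus> Const 1)\<rblot>) ;;
        vD2 ::= $vD2 \<oplus> (aWP\<lblot>aRow\<lblot>inp $vE\<rblot> \<oplus> inp ($vE \<oplus> Const 1)\<rblot>
          \<ominus> aWP\<lblot>aRow\<lblot>inp $vB\<rblot> \<oplus> inp ($vE \<oplus> Const 1)\<rblot>)))
    (\<lambda>s. s vD1 0 = dM \<rho> \<and> s vD2 0 = dW \<rho>) s0"
proof (rule wp_for[where h = "length \<rho>" and Inv = "\<lambda>k s.
    s vD1 0 = (\<Sum>i<k. int (mpos I (fst (\<rho> ! i)) (snd (\<rho> ! (Suc i mod length \<rho>)))) - int (mpos I (fst (\<rho> ! i)) (snd (\<rho> ! i)))) \<and>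
    s vD2 0 = (\<Sum>i<k. int (wpos I (snd (\<rho> ! (Suc i mod length \<rho>))) (fst (\<rho> ! (Suc i mod length \<rho>))))
     - int (wpos I (snd (\<rho> ! (Suc i mod length \<rho>))) (fst (\<rho> ! i))))"], goal_cases)
  case (5 i s)
  have e1: "env s" by (rule env_frame[OF e]) (auto simp: 5(2))
  have A1: "stored (s vA 0) \<rho>" using A 5(2) by simp
  have inp: "s ''input'' = \<xi>" using e1 by (simp add: env_def)
  let ?j = "Suc i mod length \<rho>"
  have j: "?j < length \<rho>" using Suc_mod_less 5(1) .
  note x = storedD[OF A1] storedD(2,3)[OF A1 5(1)] storedD(2,3)[OF A1 j]
  let ?e = "s vA 0 + 1 + int ?j + int ?j"
  \<comment> \<open>The address of the cyclic successor: behind the last pair it wraps around to the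
    first, at \<open>vA + 1\<close>.\<close>
  have ve: "(if int i + 1 < \<xi> (s vA 0) then s vA 0 + 1 + int i + int i + 2 else s vA 0 + 1) = ?e"
    using 5(1) x(1) by (cases "Suc i = length \<rho>") auto
  have x2: "\<xi> (?e + 1) = int (snd (\<rho> ! ?j))" "\<xi> (s vA 0 + 1 + int i + int i + 1) = int (snd (\<rho> ! i))"
    using x(5,7) by (simp_all add: algebra_simps)
  have t: "s aMP (s aRow (int (fst (\<rho> ! i))) + int (snd (\<rho> ! ?j))) = int (mpos I (fst (\<rho> ! i)) (snd (\<rho> ! ?j)))"
    "s aMP (s aRow (int (fst (\<rho> ! i))) + int (snd (\<rho> ! i))) = int (mpos I (fst (\<rho> ! i)) (snd (\<rho> ! i)))"
    "s aWP (s aRow (int (fst (\<rho> ! i))) + int (snd (\<rho> ! ?j))) = int (wpos I (snd (\<rho> ! ?j)) (fst (\<rho> ! i)))"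
    "s aWP (s aRow (int (fst (\<rho> ! ?j))) + int (snd (\<rho> ! ?j))) = int (wpos I (snd (\<rho> ! ?j)) (fst (\<rho> ! ?j)))"
    using env_tables[OF e1] rotation_pairs[OF r 5(1) refl] by simp_all
  let ?c1 = "vB ::= $vA \<oplus> Const 1 \<oplus> $li \<oplus> $li ;;
        Cond ($li \<oplus> Const 1 \<prec> inp $vA) (vE ::= $vB \<oplus> Const 2) (vE ::= $vA \<oplus> Const 1)"
  let ?s1 = "run ?c1 s"
  have s1: "?s1 vB 0 = s vA 0 + 1 + int i + int i" "?s1 vE 0 = ?e"
    using ve inp 5(3) by (auto split: if_splits)
  have fr: "a \<noteq> vB \<Longrightarrow> a \<noteq> vE \<Longrightarrow> ?s1 a = s a" for a by simp
  show ?case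
  proof (rule wp_run, simp, unfold run.simps(3), goal_cases)
    case 1
    have "run (vB ::= $vA \<oplus> Const 1 \<oplus> $li \<oplus> $li) s = s(vB := (s vB)(0 := s vA 0 + 1 + int i + int i))"
      using 5(3) by simp
    then show ?case using s1 fr 5(4) x x2 t inp by (simp del: run.simps(4))
  qed
qed (use A z rotation_length[OF r] \<beta> e storedD(1)[OF A] in \<open>simp_all add: env_def dM_def dW_def\<close>)

lemma rot_data_frame: "rot_data rl fl s r \<Longrightarrow> (\<And>a. a \<in> {aWX, aWY, aHM, aHV, aXB, aX} \<Longrightarrow> s' a = s a) \<Longrightarrow> rot_data rl fl s' r"
  by (simp add: rot_data_def row_def)

lemma ones_le_start: "ones \<le> start m (Suc k)"
  by (auto simp: start_def ones_def le_fun_def)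

text \<open>The first closing has man \<open>0\<close> pushed to position \<open>1\<close>, where
  every man starts, so it computes \<open>best\<close>. Each later one writes its row behind all
  previous rows, and \<open>wp_close\<close> leaves the cells below its base alone.\<close>

lemma wp_rots:
  assumes e: "env s0" and n: "numbering rl s0" and rl: "set rl = rotations I" and fl: "s0 vFL 0 = fl"
    and z: "s0 vXB 0 = 0" "s0 vHM 0 = 0" "s0 vSV 0 = 0"
    and \<beta>: "nm \<le> \<beta> lm" "nm \<le> \<beta> lm2" "moff nm \<le> \<beta> lp" "nm \<le> \<beta> li" "length rl \<le> \<beta> lr"
  shows "wp \<beta> c_rots (\<lambda>s. s vSV 0 = (\<Sum>r<length rl. wx fl (rl ! r)) \<and> row s 0 best \<and>
    (\<forall>r<length rl. rot_data rl fl s r)) s0"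
  unfolding c_rots_def
proof (rule wp_seq_run, simp, rule wp_seq_conseq, rule wp_close[where b = 0 and hm = 0 and hv = 1])
  let ?s = "run (vHV ::= Const 1) s0"
  show "env ?s" by (rule env_frame[OF e]) auto
  show "?s vXB 0 = 0" "?s vHM 0 = int 0" "?s vHV 0 = int 1" using z by simp_all
  show "0 < nm \<Longrightarrow> 0 < nm \<and> ones \<le> start 0 1 \<and> start 0 1 \<le> tops"
    using ones_le_tops by (auto simp: start_def ones_def tops_def le_fun_def)
  show "nm \<le> \<beta> lm" "nm \<le> \<beta> lm2" "moff nm \<le> \<beta> lp" using \<beta> by auto
next
  fix s1 assume fr1: "\<And>a. \<not> wr c_close a \<Longrightarrow> s1 a = run (vHV ::= Const 1) s0 a"
    and q1: "row s1 0 (cl (start 0 1)) \<and> (\<forall>i<0. s1 aX i = run (vHV ::= Const 1) s0 aX i)"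
  have fr: "s1 a = s0 a" if "\<not> wr c_close a" "a \<noteq> vHV" for a using fr1 that by simp
  have e1: "env s1" by (rule env_frame[OF e]) (auto simp: fr c_close_def)
  have s1: "s1 vNR 0 = int (length rl)" "s1 vFL 0 = fl" "s1 vSV 0 = 0" "\<forall>r<length rl. stored (s1 aAD (int r)) (rl ! r)"
    using n fl z fr by (auto simp: numbering_def c_close_def)
  have row0: "row s1 0 best"
  proof (cases "nm = 0")
    case False
    then have "start 0 1 = ones" by (auto simp: start_def ones_def)
    then show ?thesis using q1 by (simp add: best_def)
  qed (simp add: row_def)
  show "wp \<beta> (vXT ::= $vNM ;; For lr $vNR (
      vA ::= aAD\<lblot>$lr\<rblot> ;; vD1 ::= Const 0 ;; vD2 ::= Const 0 ;;
      For li (inp $vA) (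
        vB ::= $vA \<oplus> Const 1 \<oplus> $li \<oplus> $li ;;
        Cond ($li \<oplus> Const 1 \<prec> inp $vA) (vE ::= $vB \<oplus> Const 2) (vE ::= $vA \<oplus> Const 1) ;;
        vD1 ::= $vD1 \<oplus> (aMP\<lblot>aRow\<lblot>inp $vB\<rblot> \<oplus> inp ($vE \<oplus> Const 1)\<rblot>
          \<ominus> aMP\<lblot>aRow\<lblot>inp $vB\<rblot> \<oplus> inp ($vB \<oplus> Const 1)\<rblot>) ;;
        vD2 ::= $vD2 \<oplus> (aWP\<lblot>aRow\<lblot>inp $vE\<rblot> \<oplus> inp ($vE \<oplus> Const 1)\<rblot>
          \<ominus> aWP\<lblot>aRow\<lblot>inp $vB\<rblot> \<oplus> inp ($vE \<oplus> Const 1)\<rblot>)) ;;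
      Cond (Const 0 \<prec> $vFL)
        (aWX\<lblot>$lr\<rblot> :== $vD1 \<oplus> $vD2 ;; aWY\<lblot>$lr\<rblot> :== Const 0)
        (aWX\<lblot>$lr\<rblot> :== $vD1 ;; aWY\<lblot>$lr\<rblot> :== $vD2) ;;
      vSV ::= $vSV \<oplus> aWX\<lblot>$lr\<rblot> ;;
      vHM ::= inp ($vA \<oplus> Const 1) ;; aHM\<lblot>$lr\<rblot> :== $vHM ;;
      vHV ::= aMP\<lblot>aRow\<lblot>$vHM\<rblot> \<oplus> inp ($vA \<oplus> Const 2)\<rblot> \<oplus> Const 1 ;; aHV\<lblot>$lr\<rblot> :== $vHV ;;
      aXB\<lblot>$lr\<rblot> :== $vXT ;; vXB ::= $vXT ;; vXT ::= $vXT \<oplus> $vNM ;;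
      c_close)) (\<lambda>s. s vSV 0 = (\<Sum>r<length rl. wx fl (rl ! r)) \<and> row s 0 best \<and> (\<forall>r<length rl. rot_data rl fl s r)) s1"
  proof (rule wp_seq_run, simp, rule wp_for[where h = "length rl" and Inv = "\<lambda>k s. s vXT 0 = int (Suc k) * int nm \<and>
      s vSV 0 = (\<Sum>r<k. wx fl (rl ! r)) \<and> row s 0 best \<and> (\<forall>r<k. rot_data rl fl s r)"], goal_cases)
    case (5 k s)
    note o = this
    let ?\<rho> = "rl ! k"
    have r: "?\<rho> \<in> rotations I" using o(1) rl nth_mem by blast
    have e2: "env s" by (rule env_frame[OF e1]) (auto simp: o(2) c_close_def)
    have st: "stored (s aAD (int k)) ?\<rho>" using s1(4) o(1,2) by (simp add: c_close_def)
    have sfl: "s vFL 0 = fl" using s1 o(2) by (simp add: c_close_def)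
    obtain m w where mw: "hd ?\<rho> = (m, w)" by force
    have mw': "m < nm" "w < nw" "acc m w" using hd_rotation[OF r] mw by auto
    show ?case
    proof (rule wp_seq_run, simp, rule wp_seq_run, simp, rule wp_seq_run, simp, rule wp_seq_conseq[OF wp_weights[where \<rho> = ?\<rho>]], goal_cases)
      case 1
      show ?case by (rule env_frame[OF e2]) auto
    next
      case (7 s')
      note fr' = 7(1)
      let ?s0 = "run (vD2 ::= Const 0) (run (vD1 ::= Const 0) (run (vA ::= aAD\<lblot>$lr\<rblot>) s))"
      have fs: "s' a = s a" if "a \<notin> {vA, vD1, vD2, vB, vE, li}" for a using fr' that by simp
      have e3: "env s'" by (rule env_frame[OF e2]) (auto simp: fs)
      have s': "s' vA 0 = s aAD (int k)" "s' vD1 0 = dM ?\<rho>" "s' vD2 0 = dW ?\<rho>" "s' lr 0 = int k" "s' vFL 0 = fl"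
        "s' vXT 0 = int (Suc k) * int nm" "s' vSV 0 = (\<Sum>r<k. wx fl (rl ! r))" "s' vNM 0 = int nm" "s' ''input'' = \<xi>"
        using 7(2) fr' o sfl e3 by (simp_all add: env_def)
      have hd': "\<xi> (s aAD (int k) + 1) = int m" "\<xi> (s aAD (int k) + 2) = int w"
        using stored_hd[OF st rotation_nonempty[OF r]] mw by simp_all
      have mp: "s' aMP (s' aRow (int m) + int w) = int (mpos I m w)" using env_tables(1)[OF e3 mw'(3)] .
      define c where "c = (Cond (Const 0 \<prec> $vFL)
        (aWX\<lblot>$lr\<rblot> :== $vD1 \<oplus> $vD2 ;; aWY\<lblot>$lr\<rblot> :== Const 0)
        (aWX\<lblot>$lr\<rblot> :== $vD1 ;; aWY\<lblot>$lr\<rblot> :== $vD2) ;;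
        vSV ::= $vSV \<oplus> aWX\<lblot>$lr\<rblot> ;;
        vHM ::= inp ($vA \<oplus> Const 1) ;; aHM\<lblot>$lr\<rblot> :== $vHM ;;
        vHV ::= aMP\<lblot>aRow\<lblot>$vHM\<rblot> \<oplus> inp ($vA \<oplus> Const 2)\<rblot> \<oplus> Const 1 ;; aHV\<lblot>$lr\<rblot> :== $vHV ;;
        aXB\<lblot>$lr\<rblot> :== $vXT ;; vXB ::= $vXT ;; vXT ::= $vXT \<oplus> $vNM)"
      define s2 where "s2 = run c s'"
      have s2: "s2 aWX = (s aWX)(int k := wx fl ?\<rho>)" "s2 aWY = (s aWY)(int k := wy fl ?\<rho>)"
        "s2 aHM = (s aHM)(int k := int m)" "s2 aHV = (s aHV)(int k := int (mpos I m w) + 1)"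
        "s2 aXB = (s aXB)(int k := int (Suc k) * int nm)" "s2 vXB 0 = int (Suc k) * int nm"
        "s2 vXT 0 = int (Suc (Suc k)) * int nm" "s2 vHM 0 = int m" "s2 vHV 0 = int (Suc (mpos I m w))"
        "s2 vSV 0 = (\<Sum>r<Suc k. wx fl (rl ! r))" "s2 aX = s aX"
        using s' hd' mp fs by (simp_all add: s2_def c_def wx_def wy_def algebra_simps)
      have e4: "env s2" by (rule env_frame[OF e3]) (auto simp: s2_def c_def)
      have "wp \<beta> c_close (\<lambda>s. row s (int (Suc k) * int nm) (cl (start m (Suc (mpos I m w)))) \<and>
          (\<forall>i<int (Suc k) * int nm. s aX i = s2 aX i)) s2"
        by (rule wp_close[OF e4 s2(6,8,9)]) (use ones_le_start start_le_tops[OF r] mw mw' \<beta> in auto)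
      then have "wp \<beta> c_close (\<lambda>s. s vXT 0 = int (Suc (Suc k)) * int nm \<and>
        s vSV 0 = (\<Sum>r<Suc k. wx fl (rl ! r)) \<and> row s 0 best \<and> (\<forall>r<Suc k. rot_data rl fl s r)) s2"
      proof (rule wp_conseq)
        fix s3 assume fr3: "\<And>a. \<not> wr c_close a \<Longrightarrow> s3 a = s2 a"
          and q: "row s3 (int (Suc k) * int nm) (cl (start m (Suc (mpos I m w)))) \<and> (\<forall>i<int (Suc k) * int nm. s3 aX i = s2 aX i)"
        have s3: "s3 aWX = s2 aWX" "s3 aWY = s2 aWY" "s3 aHM = s2 aHM" "s3 aHV = s2 aHV" "s3 aXB = s2 aXB" "s3 vXT = s2 vXT" "s3 vSV = s2 vSV"
          by (auto simp: fr3 c_close_def)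
        have keep: "row s3 (int j * int nm) x" if "row s (int j * int nm) x" "j \<le> k" for j x
          unfolding row_def
        proof (intro allI impI)
          fix m' assume m': "m' < nm"
          have "j * nm + m' < Suc k * nm" using m' mult_le_mono1[OF that(2), of nm] unfolding mult_Suc by linarith
          then have "int j * int nm + int m' < int (Suc k) * int nm" by (metis of_nat_add of_nat_less_iff of_nat_mult)
          then show "s3 aX (int j * int nm + int m') = int (x m')" using q s2(11) that(1) m' by (simp add: row_def)
        qed
        have "rot_data rl fl s3 r" if "r < Suc k" for r
        proof (cases "r = k")
          case True
          then show ?thesis using q s2 s3 mw by (simp add: rot_data_def clr_def)
        next
          case False
          then have "rot_data rl fl s r" "r < k" using that o(4) by auto
          then show ?thesis using s2 s3 keep[of "Suc r"] by (simp add: rot_data_def)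
        qed
        then show "s3 vXT 0 = int (Suc (Suc k)) * int nm \<and>
          s3 vSV 0 = (\<Sum>r<Suc k. wx fl (rl ! r)) \<and> row s3 0 best \<and> (\<forall>r<Suc k. rot_data rl fl s3 r)"
          using s2 s3 keep[of 0] o(4) by simp
      qed
      note close = this[unfolded s2_def c_def run.simps(3)]
      show ?case by (rule wp_seq_run, simp)+ (rule close)
    qed (use st r \<beta> o in simp_all)
  qed (use s1 row0 e1 \<beta> in \<open>auto simp: env_def rot_data_def row_def c_close_def\<close>)
qed

end

context solving
begin

lemma wp_pow:
  assumes n: "s0 vNR 0 = int nr" and sv: "s0 vSV 0 = int v" and \<beta>: "nr \<le> \<beta> lr"
  shows "wp \<beta> c_pow (\<lambda>s. s vV1 0 = int (Suc v) \<and> s vST 0 = int (Suc v * 2 ^ nr) \<and>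
    (\<forall>r<nr. s aPW (int r) = int (Suc v * 2 ^ r)) \<and> (\<forall>i\<le>nr. s aP2 (int i) = int (2 ^ i))) s0"
  unfolding c_pow_def
proof (rule wp_seq_run, simp, rule wp_seq_run, simp, rule wp_seq,
    rule wp_for[where h = nr and Inv = "\<lambda>k s. s vZ 0 = int (Suc v * 2 ^ k) \<and> (\<forall>r<k. s aPW (int r) = int (Suc v * 2 ^ r))"], goal_cases)
  case (5 k s)
  then show ?case by (intro wp_run) (auto simp: less_Suc_eq)
next
  case (7 s)
  show ?case
  proof (rule wp_seq_run, simp, rule wp_seq_run, simp, rule wp_seq,
    rule wp_for[where h = nr and Inv = "\<lambda>k s. s vZ 0 = int (2 ^ k) \<and> (\<forall>i<k. s aP2 (int i) = int (2 ^ i))"], goal_cases)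
    case (5 k s')
    then show ?case by (intro wp_run) (auto simp: less_Suc_eq)
  next
    case (7 s')
    then show ?case using \<open>s vZ 0 = int (Suc v * 2 ^ nr) \<and> _\<close> \<open>\<And>a. _ \<Longrightarrow> _ \<Longrightarrow> s a = _\<close> n sv
      by (intro wp_run) (auto simp: le_less)
  qed (use n 7 \<beta> in auto)
qed (use n sv \<beta> in auto)

lemma mat_best_sum:
  fixes h :: "nat \<Rightarrow> nat \<Rightarrow> int"
  shows "(\<Sum>(m, w)\<in>mat best. h m w) = (\<Sum>m<nm. if best m \<le> len m then h m (mprefs I ! m ! (best m - 1)) else 0)"
proof -
  let ?g = "\<lambda>m. (m, mprefs I ! m ! (best m - 1))"
  let ?S = "{m \<in> {..<nm}. best m \<le> len m}"
  have v: "valid best" using stv_best by (simp add: stv_def)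
  have g: "?g m \<in> mat best" if "m \<in> ?S" for m
    using that v woman_at[of m "best m"] by (auto simp: mat_def valid_def)
  have "mat best = ?g ` ?S"
  proof (intro set_eqI iffI)
    fix p assume p: "p \<in> mat best"
    then have "fst p \<in> ?S" using fst_mat[OF v] by force
    moreover from this have "p = ?g (fst p)" using g[of "fst p"] p mat_fun by (metis prod.collapse)
    ultimately show "p \<in> ?g ` ?S" by blast
  next
    fix p assume "p \<in> ?g ` ?S"
    then show "p \<in> mat best" using g by blast
  qed
  then have "(\<Sum>(m, w)\<in>mat best. h m w) = (\<Sum>m\<in>?S. h m (mprefs I ! m ! (best m - 1)))"
    by (simp add: sum.reindex inj_on_def)
  then show ?thesis by (simp only: sum.inter_filter[OF finite_lessThan])
qed

lemma wp_sat:
  assumes e: "env s0" and r: "row s0 0 best" and z: "s0 vSA 0 = 0" "s0 vSB 0 = 0" and \<beta>: "nm \<le> \<beta> lm"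
  shows "wp \<beta> c_sat (\<lambda>s. s vSA 0 = int (sat_M I (mat best)) \<and> s vSB 0 = int (sat_W I (mat best))) s0"
  unfolding c_sat_def
proof (rule wp_for[where h = nm and Inv = "\<lambda>k s.
    s vSA 0 = (\<Sum>m<k. if best m \<le> len m then int (mpos I m (mprefs I ! m ! (best m - 1))) else 0) \<and>
    s vSB 0 = (\<Sum>m<k. if best m \<le> len m then int (wpos I (mprefs I ! m ! (best m - 1)) m) else 0)"], goal_cases)
  case (5 k s)
  have e1: "env s" by (rule env_frame[OF e]) (auto simp: 5(2))
  have s: "s aX (int k) = int (best k)" "s lm 0 = int k" "s ''input'' = \<xi>" "s aMO (int k) = int (moff k)"
    using r 5 e1 by (simp_all add: row_def env_def)
  have b: "1 \<le> best k" using stv_best 5(1) by (simp add: stv_def valid_def)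
  show ?case
  proof (cases "best k \<le> len k")
    case True
    let ?w = "mprefs I ! k ! (best k - 1)"
    have w: "acc k ?w" "mpos I k ?w = best k" using woman_at[OF 5(1) b True] by auto
    have x: "\<xi> (int (moff k) + int (best k)) = int ?w" using xi_woman[OF 5(1) b True] .
    have wt: "s aWP (s aRow (int k) + int ?w) = int (wpos I ?w k)" using env_tables(2)[OF e1 w(1)] .
    show ?thesis using True s x wt w 5 by (intro wp_run) (simp_all add: xi_men)
  next
    case False
    then show ?thesis using s 5 by (intro wp_run) (simp_all add: xi_men)
  qed
next
  case (7 s)
  then show ?case using mat_best_sum[of "\<lambda>m w. int (mpos I m w)"] mat_best_sum[of "\<lambda>m w. int (wpos I w m)"]
    by (simp add: sat_M_def sat_W_def case_prod_beta)
qed (use e z \<beta> in \<open>auto simp: env_def\<close>)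

end

section \<open>Dynamic programming over the tree decomposition\<close>

text \<open>Marriages have disappeared: what remains is an optimization with two additive weights
  over sets of numbers that are closed under \<open>req\<close> within each bag. The weights are
  natural numbers so that totals can be used in addresses.\<close>

locale dp =
  fixes R K :: nat and bg :: "nat \<Rightarrow> nat list" and boo :: "nat \<Rightarrow> nat" and wx wy :: "nat \<Rightarrow> nat" and v1 :: nat
    and req :: "nat \<Rightarrow> nat \<Rightarrow> bool" and es :: "(nat \<times> nat) list" and fl sa sb :: int
  assumes bag_sub: "t < K \<Longrightarrow> set (bg t) \<subseteq> {..<R}" and bag_dist: "t < K \<Longrightarrow> distinct (bg t)"
    and v1: "(\<Sum>r<R. wx r) < v1"
begin

definition dp_env :: "state \<Rightarrow> bool" where
  "dp_env s \<longleftrightarrow> s vNR 0 = int R \<and> s vNK 0 = int K \<and> s vNE 0 = int (length es) \<and> s vV1 0 = int v1 \<and>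
    s vST 0 = int (v1 * 2 ^ R) \<and> s vFL 0 = fl \<and> s vSA 0 = sa \<and> s vSB 0 = sb \<and>
    (\<forall>i<length es. s ''input'' (s vEO 0 + int i + int i) = int (fst (es ! i)) \<and>
      s ''input'' (s vEO 0 + int i + int i + 1) = int (snd (es ! i))) \<and>
    (\<forall>t<K. s aBO (int t) = int (boo t) \<and> s aBL (int t) = int (length (bg t)) \<and>
      (\<forall>i<length (bg t). s aBG (int (boo t) + int i) = int (bg t ! i))) \<and>
    (\<forall>r<R. s aWX (int r) = int (wx r) \<and> s aWY (int r) = int (wy r) \<and> s aPW (int r) = int (v1 * 2 ^ r)) \<and>
    (\<forall>i\<le>R. s aP2 (int i) = int (2 ^ i)) \<and>
    (\<forall>r<R. \<forall>r'<R. s aHV (int r) \<le> s aX (s aXB (int r') + s aHM (int r)) \<longleftrightarrow> req r' r)"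

lemma dp_env_frame: "dp_env s \<Longrightarrow> (\<And>a. a \<in> {''input'', vNR, vNK, vNE, vV1, vST, vFL, vSA, vSB, vEO, aBO, aBL, aBG,
    aWX, aWY, aPW, aP2, aHV, aX, aXB, aHM} \<Longrightarrow> s' a = s a) \<Longrightarrow> dp_env s'"
  by (simp add: dp_env_def)

lemma dp_envD:
  assumes "dp_env s"
  shows "t < K \<Longrightarrow> s aBO (int t) = int (boo t)" "t < K \<Longrightarrow> s aBL (int t) = int (length (bg t))"
    "t < K \<Longrightarrow> i < length (bg t) \<Longrightarrow> s aBG (int (boo t) + int i) = int (bg t ! i)"
    "r < R \<Longrightarrow> s aWX (int r) = int (wx r)" "r < R \<Longrightarrow> s aWY (int r) = int (wy r)"
    "r < R \<Longrightarrow> s aPW (int r) = int (v1 * 2 ^ r)" "i \<le> R \<Longrightarrow> s aP2 (int i) = int (2 ^ i)"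
    "r < R \<Longrightarrow> r' < R \<Longrightarrow> s aHV (int r) \<le> s aX (s aXB (int r') + s aHM (int r)) \<longleftrightarrow> req r' r"
    "s vNR 0 = int R" "s vNK 0 = int K" "s vNE 0 = int (length es)" "s vV1 0 = int v1" "s vST 0 = int (v1 * 2 ^ R)"
    "s vFL 0 = fl" "s vSA 0 = sa" "s vSB 0 = sb"
  using assms unfolding dp_env_def by blast+

lemma length_bag_le: "t < K \<Longrightarrow> length (bg t) \<le> R"
  using card_mono[OF _ bag_sub, of t] bag_dist[of t] by (simp add: distinct_card)

definition key :: "nat set \<Rightarrow> int" where
  "key S = int (v1 * set_encode S)"

definition idx :: "nat \<Rightarrow> nat set \<Rightarrow> nat \<Rightarrow> int" where
  "idx n S v = int (n * (v1 * 2 ^ R)) + key S + int v"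

abbreviation "WX U \<equiv> sum wx U"
abbreviation "WY U \<equiv> sum wy U"

lemma key_empty [simp]: "key {} = 0"
  by (simp add: key_def)

lemma key_Un: "finite S \<Longrightarrow> finite T \<Longrightarrow> S \<inter> T = {} \<Longrightarrow> key (S \<union> T) = key S + key T"
  by (simp add: key_def set_encode_def sum.union_disjoint algebra_simps)

lemma key_insert: "finite S \<Longrightarrow> r \<notin> S \<Longrightarrow> key (insert r S) = int (v1 * 2 ^ r) + key S"
  by (simp add: key_def set_encode_insert algebra_simps)

lemma WX_less: "U \<subseteq> {..<R} \<Longrightarrow> WX U < v1"
  using v1 sum_mono2[of "{..<R}" U wx] by (simp add: le_less_trans)

text \<open>Mixed radix: \<open>v\<close> is a digit below \<open>v1\<close>, the code of
  \<open>S\<close> a digit below \<open>2 ^ R\<close>, and the table number \<open>n\<close> is the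
  leading digit.\<close>

lemma idx_inject:
  assumes "v < v1" "v' < v1" "S \<subseteq> {..<R}" "S' \<subseteq> {..<R}"
  shows "idx n S v = idx n' S' v' \<longleftrightarrow> n = n' \<and> S = S' \<and> v = v'"
proof
  assume "idx n S v = idx n' S' v'"
  moreover have "idx n S v = int ((n * 2 ^ R + set_encode S) * v1 + v)" for n S v
    by (simp add: idx_def key_def algebra_simps)
  ultimately have e: "(n * 2 ^ R + set_encode S) * v1 + v = (n' * 2 ^ R + set_encode S') * v1 + v'"
    by (simp only: of_nat_eq_iff)
  have "n * 2 ^ R + set_encode S = ((n * 2 ^ R + set_encode S) * v1 + v) div v1" using assms(1) by simp
  also have "\<dots> = n' * 2 ^ R + set_encode S'" unfolding e using assms(2) by simp
  finally have e2: "n * 2 ^ R + set_encode S = n' * 2 ^ R + set_encode S'" .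
  have l: "set_encode S < 2 ^ R" "set_encode S' < 2 ^ R" using assms set_encode_less by auto
  have "n = (n * 2 ^ R + set_encode S) div 2 ^ R" using l(1) by simp
  also have "\<dots> = n'" unfolding e2 using l(2) by simp
  finally have "n = n'" .
  then have "set_encode S = set_encode S'" using e2 by simp
  then have "S = S'" using assms(3,4) finite_subset[OF _ finite_lessThan] set_encode_inverse by metis
  then show "n = n' \<and> S = S' \<and> v = v'" using e \<open>n = n'\<close> by simp
qed simp

lemma idx_bounds:
  assumes "v < v1" "S \<subseteq> {..<R}"
  shows "int (n * (v1 * 2 ^ R)) \<le> idx n S v" "idx n S v < int (Suc n * (v1 * 2 ^ R))"
proof -
  show "int (n * (v1 * 2 ^ R)) \<le> idx n S v" by (simp add: idx_def key_def)
  have "Suc (set_encode S) \<le> 2 ^ R" using set_encode_less[OF assms(2)] by simp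
  then have "Suc (set_encode S) * v1 \<le> 2 ^ R * v1" by (rule mult_le_mono1)
  then have "v1 * set_encode S + v < v1 * 2 ^ R" using assms(1) by (simp add: algebra_simps)
  then have "n * (v1 * 2 ^ R) + (v1 * set_encode S + v) < Suc n * (v1 * 2 ^ R)" by simp
  moreover have "idx n S v = int (n * (v1 * 2 ^ R) + (v1 * set_encode S + v))" by (simp add: idx_def key_def)
  ultimately show "idx n S v < int (Suc n * (v1 * 2 ^ R))" by (simp only: of_nat_less_iff)
qed

text \<open>
  Table \<open>n\<close> represents a family of pairs \<open>(S, U)\<close>, where \<open>S\<close> is the part of a solution inside the
  current bag and \<open>U\<close> the part already forgotten: the cell for \<open>S\<close> and \<open>v\<close> holds one plus the
  maximal \<open>WY U\<close> among the \<open>U\<close> with \<open>WX U = v\<close>, or \<open>0\<close> if there is none. The solution itself is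
  stored as the number \<open>key U\<close>, so that disjoint unions are computed by a single addition.
\<close>

definition sound :: "state \<Rightarrow> nat \<Rightarrow> (nat set \<times> nat set) set \<Rightarrow> bool" where
  "sound s n G \<longleftrightarrow> (\<forall>S v. S \<subseteq> {..<R} \<longrightarrow> v < v1 \<longrightarrow> 0 < s aTY (idx n S v) \<longrightarrow>
    (\<exists>U. (S, U) \<in> G \<and> WX U = v \<and> s aTY (idx n S v) = int (WY U) + 1 \<and> s aTU (idx n S v) = key U))"

text \<open>Only a lower bound, hence preserved when the cell grows. Together with
  \<open>sound\<close>, by which a positive cell is attained, it forces the cell to hold the
  maximum.\<close>

definition covers :: "state \<Rightarrow> nat \<Rightarrow> nat set \<Rightarrow> nat set \<Rightarrow> bool" where
  "covers s n S U \<longleftrightarrow> int (WY U) + 1 \<le> s aTY (idx n S (WX U))"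

definition table :: "state \<Rightarrow> nat \<Rightarrow> (nat set \<times> nat set) set \<Rightarrow> bool" where
  "table s n G \<longleftrightarrow> (\<forall>(S, U) \<in> G. S \<subseteq> {..<R} \<and> U \<subseteq> {..<R} \<and> covers s n S U) \<and> sound s n G"

text \<open>Tables are allocated upwards and never freed. Everything from the next base on is still
  zero, so a fresh table starts out empty.\<close>

definition unused :: "state \<Rightarrow> nat \<Rightarrow> bool" where
  "unused s n \<longleftrightarrow> (\<forall>z\<ge>int (n * (v1 * 2 ^ R)). s aTY z = 0)"

definition same_below :: "state \<Rightarrow> state \<Rightarrow> nat \<Rightarrow> bool" where
  "same_below s s' n \<longleftrightarrow> (\<forall>z<int (n * (v1 * 2 ^ R)). s' aTY z = s aTY z \<and> s' aTU z = s aTU z)"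

lemma table_same_below:
  assumes t: "table s n G" and sb: "same_below s s' m" and nm: "n < m"
  shows "table s' n G"
proof -
  have "s' aTY (idx n S v) = s aTY (idx n S v) \<and> s' aTU (idx n S v) = s aTU (idx n S v)" if "S \<subseteq> {..<R}" "v < v1" for S v
  proof -
    have "Suc n * (v1 * 2 ^ R) \<le> m * (v1 * 2 ^ R)" using nm by (intro mult_le_mono1) simp
    then have "idx n S v < int (m * (v1 * 2 ^ R))" using idx_bounds(2)[OF that(2,1), of n] by linarith
    then show ?thesis using sb by (simp add: same_below_def)
  qed
  then show ?thesis using t WX_less unfolding table_def sound_def covers_def by fastforce
qed

text \<open>The effect of a relaxation step as in shortest path algorithms: value and witness are
  replaced together if the value improves.\<close>

definition relaxed :: "state \<Rightarrow> state \<Rightarrow> int \<Rightarrow> int \<Rightarrow> int \<Rightarrow> bool" where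
  "relaxed s s' z y u \<longleftrightarrow> s' aTY = (if s aTY z < y then (s aTY)(z := y) else s aTY) \<and>
    s' aTU = (if s aTY z < y then (s aTU)(z := u) else s aTU)"

lemma relaxed_facts:
  assumes r: "relaxed s s' (idx n S (WX U)) (int (WY U) + 1) (key U)" and S: "S \<subseteq> {..<R}" and U: "U \<subseteq> {..<R}"
  shows "covers s n S' U' \<Longrightarrow> covers s' n S' U'"
    and "\<And>U'. WX U' = WX U \<Longrightarrow> WY U' \<le> WY U \<Longrightarrow> covers s' n S U'"
    and "sound s n G \<Longrightarrow> (S, U) \<in> G \<Longrightarrow> sound s' n G"
    and "same_below s0 s n \<Longrightarrow> same_below s0 s' n"
    and "unused s (Suc n) \<Longrightarrow> unused s' (Suc n)"
proof -
  let ?z = "idx n S (WX U)"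
  have v: "WX U < v1" using WX_less[OF U] .
  have mono: "s aTY z \<le> s' aTY z" for z using r by (simp add: relaxed_def)
  show "covers s n S' U' \<Longrightarrow> covers s' n S' U'" using mono unfolding covers_def by (meson order_trans)
  show "\<And>U'. WX U' = WX U \<Longrightarrow> WY U' \<le> WY U \<Longrightarrow> covers s' n S U'" using r
    by (auto simp: covers_def relaxed_def simp del: of_nat_sum)
  show "same_below s0 s n \<Longrightarrow> same_below s0 s' n" using r idx_bounds(1)[OF v S, of n] by (auto simp: same_below_def relaxed_def)
  show "unused s (Suc n) \<Longrightarrow> unused s' (Suc n)" using r idx_bounds(2)[OF v S, of n] by (auto simp: unused_def relaxed_def)
  assume so: "sound s n G" and G: "(S, U) \<in> G"
  show "sound s' n G" unfolding sound_def
  proof (intro allI impI)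
    fix S2 v2 assume a: "S2 \<subseteq> {..<R}" "v2 < v1" "0 < s' aTY (idx n S2 v2)"
    show "\<exists>U. (S2, U) \<in> G \<and> WX U = v2 \<and> s' aTY (idx n S2 v2) = int (WY U) + 1 \<and> s' aTU (idx n S2 v2) = key U"
    proof (cases "s aTY ?z < int (WY U) + 1 \<and> S2 = S \<and> v2 = WX U")
      case True
      then show ?thesis using G r by (intro exI[of _ U]) (simp add: relaxed_def)
    next
      case False
      then have "s' aTY (idx n S2 v2) = s aTY (idx n S2 v2)" "s' aTU (idx n S2 v2) = s aTU (idx n S2 v2)"
        using r idx_inject[OF a(2) v a(1) S, of n n] by (auto simp: relaxed_def)
      then show ?thesis using so a unfolding sound_def by simp
    qed
  qed
qed

section \<open>Decoding subsets of a bag\<close>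

definition sel :: "nat \<Rightarrow> nat \<Rightarrow> nat set" where
  "sel t j = (!) (bg t) ` set_decode j"

lemma sel_subset: "j < 2 ^ length (bg t) \<Longrightarrow> sel t j \<subseteq> set (bg t)"
  using set_decode_subset by (force simp: sel_def)

lemma sel_surj:
  assumes "S \<subseteq> set (bg t)"
  obtains j where "j < 2 ^ length (bg t)" "S = sel t j"
proof -
  let ?A = "{i. i < length (bg t) \<and> bg t ! i \<in> S}"
  have A: "?A \<subseteq> {..<length (bg t)}" by auto
  then have "finite ?A" using finite_subset by blast
  then have "set_decode (set_encode ?A) = ?A" by simp
  moreover have "(!) (bg t) ` ?A = S" using assms by (force simp: in_set_conv_nth)
  ultimately show ?thesis using that set_encode_less[OF A] by (simp add: sel_def)
qed

definition marked :: "state \<Rightarrow> nat set \<Rightarrow> bool" where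
  "marked s M \<longleftrightarrow> (\<forall>r<R. s aMK (int r) = (if r \<in> M then 1 else 0))"

lemma wp_mark:
  assumes e: "dp_env s0" and q: "s0 vVQ 0 = int t" "t < K" and \<beta>: "R \<le> \<beta> lr" "length (bg t) \<le> \<beta> lb"
  shows "wp \<beta> c_mark (\<lambda>s. marked s (set (bg t))) s0"
  unfolding c_mark_def
proof (rule wp_seq, rule wp_for[where h = R and Inv = "\<lambda>k s. \<forall>r<k. s aMK (int r) = 0"], goal_cases)
  case (5 k s)
  then show ?case by (intro wp_run) (auto simp: less_Suc_eq)
next
  case (7 s)
  have e1: "dp_env s" by (rule dp_env_frame[OF e]) (auto simp: 7(1))
  have q1: "s vVQ 0 = int t" using 7 q by simp
  show ?case
  proof (rule wp_for[where h = "length (bg t)" and Inv = "\<lambda>k s. \<forall>r<R. s aMK (int r) = (if r \<in> set (take k (bg t)) then 1 else 0)"], goal_cases)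
    case (5 k s')
    have "dp_env s'" by (rule dp_env_frame[OF e1]) (auto simp: 5(2))
    then show ?case using 5 q1 q(2) by (intro wp_run) (auto simp: dp_env_def take_Suc_conv_app_nth)
  next
    case (3 s')
    have "dp_env s'" by (rule dp_env_frame[OF e1]) (auto simp: 3)
    then show ?case using 3 q1 q(2) by (simp add: dp_env_def)
  next
    case (7 s')
    then show ?case by (simp add: marked_def)
  qed (use 7 \<beta> in simp_all)
qed (use e \<beta> in \<open>simp_all add: dp_env_def\<close>)

text \<open>Digits come from the highest position down, with \<open>j mod 2 ^ (?b - k)\<close> left
  after \<open>k\<close> rounds. \<open>T k\<close> is the part of the subset decoded by then; a bag
  has no repetitions, so each selected digit adds a new member and keys add up.\<close>

lemma wp_decode:
  assumes e: "dp_env s0" and t: "s0 vVT 0 = int t" "t < K" and j: "s0 lj 0 = int j" "j < 2 ^ length (bg t)"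
    and M: "marked s0 M" and \<beta>: "length (bg t) \<le> \<beta> lb"
  shows "wp \<beta> c_decode (\<lambda>s. s vKS 0 = key (sel t j) \<and> s vKT 0 = key (sel t j \<inter> M) \<and>
    s vDX 0 = int (WX (sel t j - M)) \<and> s vDY 0 = int (WY (sel t j - M)) \<and> s vDU 0 = key (sel t j - M) \<and>
    (\<forall>i<length (bg t). s aSel (int i) = (if i \<in> set_decode j then 1 else 0))) s0"
proof -
  let ?b = "length (bg t)"
  define T where "T k = (!) (bg t) ` (set_decode j \<inter> {?b - k..<?b})" for k
  have T0: "T 0 = {}" by (simp add: T_def)
  have Tb: "T ?b = sel t j" using set_decode_subset[OF j(2)] by (simp add: T_def sel_def Int_absorb2 lessThan_atLeast0)
  have Tfin: "finite (T k)" for k by (simp add: T_def)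
  have Tsub: "T k \<subseteq> {..<R}" for k using bag_sub[OF t(2)] nth_mem by (fastforce simp: T_def)
  have TSuc: "T (Suc k) = (if ?b - Suc k \<in> set_decode j then insert (bg t ! (?b - Suc k)) (T k) else T k)" if "k < ?b" for k
  proof -
    have "{?b - Suc k..<?b} = insert (?b - Suc k) {?b - k..<?b}" using that by auto
    then show ?thesis by (auto simp: T_def)
  qed
  have Tnew: "bg t ! (?b - Suc k) \<notin> T k" if "k < ?b" for k
  proof
    assume "bg t ! (?b - Suc k) \<in> T k"
    then obtain i where i: "i \<in> {?b - k..<?b}" "bg t ! i = bg t ! (?b - Suc k)" by (auto simp: T_def)
    then have "i = ?b - Suc k" using bag_dist[OF t(2)] that by (simp add: nth_eq_iff_index_eq)
    then show False using i that by auto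
  qed
  show ?thesis unfolding c_decode_def
  proof ((rule wp_seq_run, simp)+, rule wp_for[where h = ?b and Inv = "\<lambda>k s.
      s vREM 0 = int (j mod 2 ^ (?b - k)) \<and> s vLD 0 = int (?b - k) \<and> s vKS 0 = key (T k) \<and> s vKT 0 = key (T k \<inter> M) \<and>
      s vDX 0 = int (WX (T k - M)) \<and> s vDY 0 = int (WY (T k - M)) \<and> s vDU 0 = key (T k - M) \<and>
      (\<forall>i<?b. ?b - k \<le> i \<longrightarrow> s aSel (int i) = (if i \<in> set_decode j then 1 else 0))"], goal_cases)
    case 4
    show ?case using j t e T0 by (simp add: dp_env_def)
  next
    case (5 k s)
    note o = this
    define i g where "i = ?b - Suc k" and "g = bg t ! i"
    have e1: "dp_env s" by (rule dp_env_frame[OF e]) (auto simp: o(2))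
    have i: "i < ?b" "i \<le> R" "int (?b - k) - 1 = int i" "?b - k = Suc i" "?b - Suc k = i" using o(1) length_bag_le[OF t(2)] by (auto simp: i_def)
    have g: "g < R" using bag_sub[OF t(2)] nth_mem[OF i(1)] by (auto simp: g_def)
    have st: "s vVT 0 = int t" "s aBO (int t) = int (boo t)" "s aBG (int (boo t) + int i) = int g" "s aP2 (int i) = int (2 ^ i)"
      "s aPW (int g) = int (v1 * 2 ^ g)" "s aWX (int g) = int (wx g)" "s aWY (int g) = int (wy g)"
      using o(2) t(1) dp_envD(1,3)[OF e1 t(2)] dp_envD(4-6)[OF e1 g] dp_envD(7)[OF e1 i(2)] i(1)
      by (simp_all only: g_def[symmetric]) simp_all
    have mk: "s aMK (int g) = (if g \<in> M then 1 else 0)" using M o(2) g by (simp add: marked_def)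
    have rem: "s vREM 0 = int (j mod 2 ^ Suc i)" using o(4) i(4) by simp
    have dec: "j mod 2 ^ Suc i = (if i \<in> set_decode j then 2 ^ i else 0) + j mod 2 ^ i" by (rule mod_Suc_set_decode)
    have selk: "i' = i \<or> Suc i \<le> i'" if "i \<le> i'" for i' using that by auto
    show ?case
    proof (cases "i \<in> set_decode j")
      case False
      have lt: "j mod 2 ^ Suc i < 2 ^ i" using dec False by simp
      have c: "s vREM 0 < s aP2 (int i)" using rem lt st by (simp del: power_Suc)
      have Te: "T (Suc k) = T k" using TSuc[OF o(1)] False by (simp add: i_def)
      have rem': "s vREM 0 = int (j mod 2 ^ i)" using rem dec False by (simp del: power_Suc)
      show ?thesis using o c st False i rem' selk unfolding Te
        by (intro wp_run) (auto simp del: power_Suc)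
    next
      case True
      have "2 ^ i \<le> j mod 2 ^ Suc i" using dec True by simp
      then have c: "\<not> s vREM 0 < s aP2 (int i)" using rem st by (simp del: power_Suc)
      have Te: "T (Suc k) = insert g (T k)" using TSuc[OF o(1)] True by (simp add: i_def g_def)
      have rem': "s vREM 0 - s aP2 (int i) = int (j mod 2 ^ i)" using rem dec True st by (simp del: power_Suc)
      have n1: "g \<notin> T k" "finite (T k)" using Tnew[OF o(1)] Tfin by (auto simp: i_def g_def)
      have k1: "key (T (Suc k)) = key (T k) + int (v1 * 2 ^ g)" unfolding Te using key_insert[OF n1(2,1)] by simp
      show ?thesis
      proof (cases "g \<in> M")
        case True
        have k2: "key (T (Suc k) \<inter> M) = key (T k \<inter> M) + int (v1 * 2 ^ g)" "T (Suc k) - M = T k - M"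
          unfolding Te using key_insert[of "T k \<inter> M" g] n1 True by (auto simp: Int_insert_left)
        show ?thesis using o c st \<open>i \<in> set_decode j\<close> i rem' mk True selk unfolding k1 k2
          by (intro wp_run) (auto simp del: power_Suc)
      next
        case False
        have "T (Suc k) - M = insert g (T k - M)" unfolding Te using False by auto
        then have k2: "key (T (Suc k) - M) = key (T k - M) + int (v1 * 2 ^ g)" "T (Suc k) \<inter> M = T k \<inter> M"
          "int (WX (T (Suc k) - M)) = int (WX (T k - M)) + int (wx g)" "int (WY (T (Suc k) - M)) = int (WY (T k - M)) + int (wy g)"
          using key_insert[of "T k - M" g] n1 False unfolding Te by (auto simp: Int_insert_left)
        show ?thesis using o c st \<open>i \<in> set_decode j\<close> i rem' mk False selk unfolding k1 k2
          by (intro wp_run) (auto simp del: power_Suc)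
      qed
    qed
  next
    case (3 s)
    then show ?case using e t by (simp add: dp_env_def)
  next
    case (7 s)
    then show ?case using Tb by simp
  qed (use \<beta> in simp_all)
qed

end

context dp
begin

text \<open>The state of a table under construction: \<open>C\<close> are the pairs of the target family \<open>G\<close> already accounted for.\<close>

definition build :: "state \<Rightarrow> state \<Rightarrow> nat \<Rightarrow> (nat set \<times> nat set) set \<Rightarrow> (nat set \<times> nat set) set \<Rightarrow> bool" where
  "build s0 s n G C \<longleftrightarrow> sound s n G \<and> same_below s0 s n \<and> unused s (Suc n) \<and> (\<forall>(S, U) \<in> C. covers s n S U)"

lemma build_cong: "s' aTY = s aTY \<Longrightarrow> s' aTU = s aTU \<Longrightarrow> build s0 s' n G C \<longleftrightarrow> build s0 s n G C"
  by (simp add: build_def sound_def same_below_def unused_def covers_def)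

lemma build_upd [simp]: "a \<noteq> aTY \<Longrightarrow> a \<noteq> aTU \<Longrightarrow> build s0 (s(a := f)) n G C \<longleftrightarrow> build s0 s n G C"
  by (rule build_cong) simp_all

lemma table_cong: "s' aTY = s aTY \<Longrightarrow> s' aTU = s aTU \<Longrightarrow> table s' n G \<longleftrightarrow> table s n G"
  by (simp add: table_def sound_def covers_def)

lemma build_mono: "build s0 s n G C \<Longrightarrow> C' \<subseteq> C \<Longrightarrow> build s0 s n G C'"
  by (auto simp: build_def)

text \<open>One update accounts for all pairs that share key and weight with the written one and
  have no larger \<open>WY\<close>. This is why a single witness per cell suffices.\<close>

lemma build_relaxed:
  assumes b: "build s0 s n G C" and r: "relaxed s s' (idx n S (WX U)) (int (WY U) + 1) (key U)"
    and S: "S \<subseteq> {..<R}" "U \<subseteq> {..<R}" "(S, U) \<in> G"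
    and C': "\<And>S' U'. (S', U') \<in> C' \<Longrightarrow> (S', U') \<in> C \<or> S' = S \<and> WX U' = WX U \<and> WY U' \<le> WY U"
  shows "build s0 s' n G C'"
  unfolding build_def
proof (intro conjI ballI, goal_cases)
  case (4 p)
  then show ?case using C'[of "fst p" "snd p"] b relaxed_facts(1,2)[OF r S(1,2)] by (auto simp: build_def)
qed (use b relaxed_facts(3-5)[OF r S(1,2)] S(3) in \<open>auto simp: build_def\<close>)

lemma build_start: "unused s n \<Longrightarrow> build s s n G {}"
proof -
  assume u: "unused s n"
  have "int (n * (v1 * 2 ^ R)) \<le> int (Suc n * (v1 * 2 ^ R))" by (simp only: of_nat_le_iff) simp
  then have "unused s (Suc n)" using u unfolding unused_def by (meson order_trans)
  moreover have "sound s n G" using u idx_bounds(1) by (auto simp: sound_def unused_def)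
  ultimately show ?thesis by (simp add: build_def same_below_def)
qed

lemma build_table: "build s0 s n G G \<Longrightarrow> (\<And>S U. (S, U) \<in> G \<Longrightarrow> S \<subseteq> {..<R} \<and> U \<subseteq> {..<R}) \<Longrightarrow>
  table s n G \<and> same_below s0 s n \<and> unused s (Suc n)"
  by (auto simp: build_def table_def)

lemma build_sources: "build s0 s n G C \<Longrightarrow> table s0 m H \<Longrightarrow> m < n \<Longrightarrow> table s m H"
  using table_same_below by (auto simp: build_def)

text \<open>\<open>M\<close> is the bag of the neighbour when a leaf is merged. A rotation of the
  leaf outside \<open>M\<close> occurs in no other remaining bag, so it takes part in no further
  constraint and only its weights matter.\<close>

definition fgt :: "nat set \<Rightarrow> (nat set \<times> nat set) set \<Rightarrow> (nat set \<times> nat set) set" where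
  "fgt M G = {(S \<inter> M, U \<union> (S - M)) | S U. (S, U) \<in> G}"

definition jn :: "nat set \<Rightarrow> (nat set \<times> nat set) set \<Rightarrow> (nat set \<times> nat set) set \<Rightarrow> (nat set \<times> nat set) set" where
  "jn M G F = {(S, U1 \<union> U2) | S U1 U2. (S, U1) \<in> G \<and> (S \<inter> M, U2) \<in> F}"

definition bounded :: "(string \<Rightarrow> nat) \<Rightarrow> bool" where
  "bounded \<beta> \<longleftrightarrow> (\<forall>t<K. length (bg t) \<le> \<beta> lb \<and> length (bg t) \<le> \<beta> lb2 \<and> 2 ^ length (bg t) \<le> \<beta> lj) \<and>
    v1 \<le> \<beta> lv \<and> v1 \<le> \<beta> lv2 \<and> R \<le> \<beta> lr \<and> K \<le> \<beta> lt \<and> K \<le> \<beta> ls \<and> length es \<le> \<beta> le"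

lemma WX_Un: "finite A \<Longrightarrow> finite B \<Longrightarrow> A \<inter> B = {} \<Longrightarrow> WX (A \<union> B) = WX A + WX B \<and> WY (A \<union> B) = WY A + WY B"
  by (simp add: sum.union_disjoint)

text \<open>Each source cell, given by a subset and a weight, is relaxed into one target cell;
  \<open>Fg\<close> with a predicate describes the pairs whose cells were visited. Disjointness of
  \<open>U\<close> and \<open>S\<close> is what permits adding keys and weights.\<close>

lemma wp_forget:
  assumes e: "dp_env s0" and t: "s0 vVT 0 = int t" "t < K" and cb: "s0 aCB (int t) = int (m * (v1 * 2 ^ R))" "m < n"
    and tbl: "table s0 m G" and G: "\<And>S U. (S, U) \<in> G \<Longrightarrow> S \<subseteq> set (bg t) \<and> U \<subseteq> {..<R} \<and> U \<inter> S = {}"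
    and M: "marked s0 M" and top: "s0 vTOP 0 = int (n * (v1 * 2 ^ R))" and un: "unused s0 n" and \<beta>: "bounded \<beta>"
  shows "wp \<beta> c_forget (\<lambda>s. table s n (fgt M G) \<and> same_below s0 s n \<and> unused s (Suc n) \<and>
    s vTOP 0 = int (Suc n * (v1 * 2 ^ R)) \<and> s vNB 0 = int (n * (v1 * 2 ^ R))) s0"
proof -
  define Fg where "Fg P = {(S \<inter> M, U \<union> (S - M)) | S U. (S, U) \<in> G \<and> P S U}" for P
  have Fg_mono: "Fg P \<subseteq> Fg Q" if "\<And>S U. (S, U) \<in> G \<Longrightarrow> P S U \<Longrightarrow> Q S U" for P Q
    using that unfolding Fg_def by blast
  have FgG: "Fg (\<lambda>S U. True) = fgt M G" by (simp add: Fg_def fgt_def)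
  have setR: "set (bg t) \<subseteq> {..<R}" using bag_sub t(2) .
  have GR: "S \<inter> M \<subseteq> {..<R} \<and> U \<union> (S - M) \<subseteq> {..<R}" if "(S, U) \<in> G" for S U using G[OF that] setR by blast
  have fin: "finite S \<and> finite U" if "(S, U) \<in> G" for S U
    using G[OF that] setR finite_subset[OF _ finite_lessThan] by (meson subset_trans)
  have sums: "WX (U \<union> (S - M)) = WX U + WX (S - M)" "WY (U \<union> (S - M)) = WY U + WY (S - M)"
    "key (U \<union> (S - M)) = key U + key (S - M)" if "(S, U) \<in> G" for S U
    using fin[OF that] G[OF that] WX_Un[of U "S - M"] key_Un[of U "S - M"] by blast+
  let ?s1 = "run (vTOP ::= $vTOP \<oplus> $vST) (run (vNB ::= $vTOP) s0)"
  have e1: "dp_env ?s1" by (rule dp_env_frame[OF e]) auto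
  have s1: "?s1 vTOP 0 = int (Suc n * (v1 * 2 ^ R))" "?s1 vNB 0 = int (n * (v1 * 2 ^ R))" "?s1 vVT 0 = int t"
    "?s1 aCB (int t) = int (m * (v1 * 2 ^ R))" "?s1 aTY = s0 aTY" "?s1 aTU = s0 aTU" "?s1 aMK = s0 aMK"
    using top t cb dp_envD(13)[OF e] by simp_all
  show ?thesis unfolding c_forget_def
  proof (rule wp_seq_run, simp, rule wp_seq_run, simp, rule wp_for[where h = "2 ^ length (bg t)" and
      Inv = "\<lambda>j s. build s0 s n (fgt M G) (Fg (\<lambda>S U. \<exists>j'<j. S = sel t j'))"], goal_cases)
    case 3
    then show ?case using s1(3) dp_envD(2)[OF e1 t(2)] dp_envD(7)[OF e1 length_bag_le[OF t(2)]] by (simp add: c_decode_def)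
  next
    case 4
    have z: "Fg (\<lambda>S U. \<exists>j'<0. S = sel t j') = {}" by (simp add: Fg_def)
    show ?case unfolding z by (rule iffD2[OF build_cong[OF s1(5,6)] build_start[OF un]])
  next
    case (5 j s)
    note o = this
    have fr: "s a = ?s1 a" if "\<not> wr c_decode a" "a \<notin> {vY, vIX, aTY, aTU, lv, lj}" for a using o(2) that by simp
    have e2: "dp_env s" by (rule dp_env_frame[OF e1]) (use fr in \<open>auto simp: c_decode_def\<close>)
    have s2: "s vVT 0 = int t" "marked s M" "s vNB 0 = int (n * (v1 * 2 ^ R))" "s aCB (int t) = int (m * (v1 * 2 ^ R))"
      using fr[of vVT] fr[of aMK] fr[of vNB] fr[of aCB] s1 M by (simp_all add: c_decode_def marked_def)
    let ?S = "sel t j"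
    show ?case
    proof (rule wp_seq_conseq[OF wp_decode[OF e2 s2(1) t(2) o(3,1) s2(2)]])
      show "length (bg t) \<le> \<beta> lb" using \<beta> t(2) by (simp add: bounded_def)
    next
      fix s3 assume fr3: "\<And>a. \<not> wr c_decode a \<Longrightarrow> s3 a = s a" and q: "s3 vKS 0 = key ?S \<and> s3 vKT 0 = key (?S \<inter> M) \<and>
        s3 vDX 0 = int (WX (?S - M)) \<and> s3 vDY 0 = int (WY (?S - M)) \<and> s3 vDU 0 = key (?S - M) \<and>
        (\<forall>i<length (bg t). s3 aSel (int i) = (if i \<in> set_decode j then 1 else 0))"
      have s3: "s3 vVT 0 = int t" "s3 vNB 0 = int (n * (v1 * 2 ^ R))" "s3 aCB (int t) = int (m * (v1 * 2 ^ R))"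
        "s3 aTY = s aTY" "s3 aTU = s aTU" "s3 vV1 0 = int v1"
        using s2 dp_envD(12)[OF e2] by (simp_all add: fr3 c_decode_def)
      show "wp \<beta> (For lv $vV1 (
        vY ::= aTY\<lblot>aCB\<lblot>$vVT\<rblot> \<oplus> $vKS \<oplus> $lv\<rblot> ;;
        Cond (Const 0 \<prec> $vY)
          (vIX ::= $vNB \<oplus> $vKT \<oplus> ($lv \<oplus> $vDX) ;; vY ::= $vY \<oplus> $vDY ;;
           Cond (aTY\<lblot>$vIX\<rblot> \<prec> $vY)
             (aTU\<lblot>$vIX\<rblot> :== aTU\<lblot>aCB\<lblot>$vVT\<rblot> \<oplus> $vKS \<oplus> $lv\<rblot> \<oplus> $vDU ;; aTY\<lblot>$vIX\<rblot> :== $vY) Skip)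
          Skip)) (\<lambda>s. build s0 s n (fgt M G) (Fg (\<lambda>S U. \<exists>j'<Suc j. S = sel t j'))) s3"
      proof (rule wp_for[where h = v1 and Inv = "\<lambda>v s. build s0 s n (fgt M G) (Fg (\<lambda>S U. (\<exists>j'<j. S = sel t j') \<or> S = ?S \<and> WX U < v))"], goal_cases)
        case 4
        then show ?case using o(4) build_cong[OF s3(4,5)] by simp
      next
        case (5 v s)
        have st: "s vVT 0 = int t" "s vNB 0 = int (n * (v1 * 2 ^ R))" "s aCB (int t) = int (m * (v1 * 2 ^ R))"
          "s vKS 0 = key ?S" "s vKT 0 = key (?S \<inter> M)" "s vDX 0 = int (WX (?S - M))" "s vDY 0 = int (WY (?S - M))"
          "s vDU 0 = key (?S - M)" "s lv 0 = int v"
          using 5(2,3) s3 q by simp_all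
        have tb: "table s m G" using build_sources[OF 5(4) tbl cb(2)] .
        have SR: "?S \<subseteq> {..<R}" using sel_subset[OF o(1)] setR by blast
        have src: "int (m * (v1 * 2 ^ R)) + key ?S + int v = idx m ?S v" by (simp add: idx_def)
        show ?case
        proof (rule wp_run, simp, cases "0 < s aTY (idx m ?S v)")
          case False
          \<comment> \<open>An empty cell leaves nothing to account for, as the table covers each of
            its pairs by a positive value.\<close>
          have none: "WX U \<noteq> v" if "(?S, U) \<in> G" for U
          proof
            assume v: "WX U = v"
            have "covers s m ?S U" using tb that by (auto simp: table_def)
            then have "int (WY U) + 1 \<le> s aTY (idx m ?S v)" using v by (simp add: covers_def)
            then show False using False by linarith
          qed
          let ?s' = "run (vY ::= aTY\<lblot>aCB\<lblot>$vVT\<rblot> \<oplus> $vKS \<oplus> $lv\<rblot> ;;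
            Cond (Const 0 \<prec> $vY)
              (vIX ::= $vNB \<oplus> $vKT \<oplus> ($lv \<oplus> $vDX) ;; vY ::= $vY \<oplus> $vDY ;;
               Cond (aTY\<lblot>$vIX\<rblot> \<prec> $vY)
                 (aTU\<lblot>$vIX\<rblot> :== aTU\<lblot>aCB\<lblot>$vVT\<rblot> \<oplus> $vKS \<oplus> $lv\<rblot> \<oplus> $vDU ;; aTY\<lblot>$vIX\<rblot> :== $vY) Skip)
              Skip) s"
          have "?s' aTY = s aTY" "?s' aTU = s aTU" using False st src by (simp_all del: of_nat_mult of_nat_sum)
          then have "build s0 ?s' n (fgt M G) (Fg (\<lambda>S U. (\<exists>j'<j. S = sel t j') \<or> S = ?S \<and> WX U < v))"
            using build_cong 5(4) by blast
          then show "build s0 ?s' n (fgt M G) (Fg (\<lambda>S U. (\<exists>j'<j. S = sel t j') \<or> S = ?S \<and> WX U < Suc v))"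
            by (rule build_mono) (use none in \<open>auto simp: Fg_def less_Suc_eq\<close>)
        next
          case True
          then obtain U where U: "(?S, U) \<in> G" "WX U = v" "s aTY (idx m ?S v) = int (WY U) + 1" "s aTU (idx m ?S v) = key U"
            using tb SR 5(1) unfolding table_def sound_def by blast
          let ?U = "U \<union> (?S - M)"
          let ?z = "idx n (?S \<inter> M) (WX ?U)"
          have z: "int (n * (v1 * 2 ^ R)) + key (?S \<inter> M) + (int v + int (WX (?S - M))) = ?z"
            using sums[OF U(1)] U(2) by (simp add: idx_def)
          let ?s' = "run (vY ::= aTY\<lblot>aCB\<lblot>$vVT\<rblot> \<oplus> $vKS \<oplus> $lv\<rblot> ;;
            Cond (Const 0 \<prec> $vY)
              (vIX ::= $vNB \<oplus> $vKT \<oplus> ($lv \<oplus> $vDX) ;; vY ::= $vY \<oplus> $vDY ;;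
               Cond (aTY\<lblot>$vIX\<rblot> \<prec> $vY)
                 (aTU\<lblot>$vIX\<rblot> :== aTU\<lblot>aCB\<lblot>$vVT\<rblot> \<oplus> $vKS \<oplus> $lv\<rblot> \<oplus> $vDU ;; aTY\<lblot>$vIX\<rblot> :== $vY) Skip)
              Skip) s"
          have y: "int (WY U) + 1 + int (WY (?S - M)) = int (WY ?U) + 1" "key U + key (?S - M) = key ?U"
            using sums[OF U(1)] by simp_all
          have "relaxed s ?s' ?z (int (WY ?U) + 1) (key ?U)" unfolding relaxed_def y[symmetric] z[symmetric]
            using True st src U(3,4) by (simp del: of_nat_mult of_nat_sum)
          then show "build s0 ?s' n (fgt M G) (Fg (\<lambda>S U. (\<exists>j'<j. S = sel t j') \<or> S = ?S \<and> WX U < Suc v))"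
          proof (rule build_relaxed[OF 5(4)])
            show "?S \<inter> M \<subseteq> {..<R}" "?U \<subseteq> {..<R}" using GR[OF U(1)] by auto
            show "(?S \<inter> M, ?U) \<in> fgt M G" using U(1) by (auto simp: fgt_def)
            fix S' U' assume "(S', U') \<in> Fg (\<lambda>S U. (\<exists>j'<j. S = sel t j') \<or> S = ?S \<and> WX U < Suc v)"
            then obtain S2 U2 where 2: "(S2, U2) \<in> G" "S' = S2 \<inter> M" "U' = U2 \<union> (S2 - M)"
              "(\<exists>j'<j. S2 = sel t j') \<or> S2 = ?S \<and> WX U2 < Suc v" unfolding Fg_def by blast
            show "(S', U') \<in> Fg (\<lambda>S U. (\<exists>j'<j. S = sel t j') \<or> S = ?S \<and> WX U < v) \<or>
              S' = ?S \<inter> M \<and> WX U' = WX ?U \<and> WY U' \<le> WY ?U"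
            proof (cases "S2 = ?S \<and> WX U2 = v")
              \<comment> \<open>This pair shares the source cell with the witness \<open>U\<close>,
                and the cell holds the maximum.\<close>
              case True
              then have "covers s m ?S U2" using tb 2(1) by (auto simp: table_def)
              then have "int (WY U2) + 1 \<le> int (WY U) + 1" using U(3) True by (simp add: covers_def)
              then have "WY U2 \<le> WY U" by (simp del: of_nat_sum)
              then show ?thesis using True 2 sums[OF 2(1)] sums[OF U(1)] U(2) by simp
            next
              case False
              then have "(\<exists>j'<j. S2 = sel t j') \<or> S2 = ?S \<and> WX U2 < v" using 2(4) by (auto simp: less_Suc_eq)
              then show ?thesis using 2(1-3) unfolding Fg_def by blast
            qed
          qed
        qed
      next
        case (7 s)
        show ?case
        proof (rule build_mono[OF 7(2)])
          show "Fg (\<lambda>S U. \<exists>j'<Suc j. S = sel t j') \<subseteq> Fg (\<lambda>S U. (\<exists>j'<j. S = sel t j') \<or> S = ?S \<and> WX U < v1)"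
          proof (rule Fg_mono)
            fix S U assume a: "(S, U) \<in> G" "\<exists>j'<Suc j. S = sel t j'"
            have "WX U < v1" using G[OF a(1)] WX_less by blast
            then show "(\<exists>j'<j. S = sel t j') \<or> S = ?S \<and> WX U < v1" using a(2) less_Suc_eq by auto
          qed
        qed
      qed (use s3 \<beta> in \<open>simp_all add: bounded_def\<close>)
    qed
  next
    case (7 s)
    have "fgt M G \<subseteq> Fg (\<lambda>S U. \<exists>j'<2 ^ length (bg t). S = sel t j')"
      unfolding FgG[symmetric]
    proof (rule Fg_mono)
      fix S U assume "(S, U) \<in> G"
      then have "S \<subseteq> set (bg t)" using G by blast
      then show "\<exists>j'<2 ^ length (bg t). S = sel t j'" by (rule sel_surj) blast
    qed
    then have "build s0 s n (fgt M G) (fgt M G)" by (rule build_mono[OF 7(2)])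
    then have "table s n (fgt M G) \<and> same_below s0 s n \<and> unused s (Suc n)"
      by (rule build_table) (use GR in \<open>unfold fgt_def, blast\<close>)
    moreover have "s vTOP 0 = ?s1 vTOP 0" "s vNB 0 = ?s1 vNB 0" using 7(1)[of vTOP] 7(1)[of vNB] by (simp_all add: c_decode_def)
    ultimately show ?case using s1 by simp
  qed (use \<beta> t(2) in \<open>simp_all add: bounded_def c_decode_def\<close>)
qed

end

context dp
begin

text \<open>Only equal traces on \<open>M\<close> can be combined, so three nested loops, over a
  subset and two weights, visit all combinations; the predicates of \<open>J\<close> describe their
  lexicographic progress. \<open>disj\<close> turns the union of witnesses into an addition.\<close>

lemma wp_join:
  assumes e: "dp_env s0" and t: "s0 vVT 0 = int t" "t < K" and cb: "s0 aCB (int t) = int (m * (v1 * 2 ^ R))" "m < n"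
    and nb: "s0 vNB 0 = int (m' * (v1 * 2 ^ R))" "m' < n"
    and tbl: "table s0 m G" "table s0 m' F" and G: "\<And>S U. (S, U) \<in> G \<Longrightarrow> S \<subseteq> set (bg t) \<and> U \<subseteq> {..<R}"
    and F: "\<And>S U. (S, U) \<in> F \<Longrightarrow> U \<subseteq> {..<R}"
    and disj: "\<And>S U1 U2. (S, U1) \<in> G \<Longrightarrow> (S \<inter> M, U2) \<in> F \<Longrightarrow> U1 \<inter> U2 = {}"
    and M: "marked s0 M" and top: "s0 vTOP 0 = int (n * (v1 * 2 ^ R))" and un: "unused s0 n" and \<beta>: "bounded \<beta>"
  shows "wp \<beta> c_join (\<lambda>s. table s n (jn M G F) \<and> same_below s0 s n \<and> unused s (Suc n) \<and>
    s vTOP 0 = int (Suc n * (v1 * 2 ^ R)) \<and> s aCB = (s0 aCB)(int t := int (n * (v1 * 2 ^ R)))) s0"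
proof -
  define J where "J P = {(S, U1 \<union> U2) | S U1 U2. (S, U1) \<in> G \<and> (S \<inter> M, U2) \<in> F \<and> P S U1 U2}" for P
  have J_mono: "J P \<subseteq> J Q" if "\<And>S U1 U2. (S, U1) \<in> G \<Longrightarrow> (S \<inter> M, U2) \<in> F \<Longrightarrow> P S U1 U2 \<Longrightarrow> Q S U1 U2" for P Q
    using that unfolding J_def by blast
  have JG: "J (\<lambda>S U1 U2. True) = jn M G F" by (simp add: J_def jn_def)
  have setR: "set (bg t) \<subseteq> {..<R}" using bag_sub t(2) .
  have GR: "S \<subseteq> {..<R} \<and> U1 \<union> U2 \<subseteq> {..<R}" if "(S, U1) \<in> G" "(S \<inter> M, U2) \<in> F" for S U1 U2
    using G[OF that(1)] F[OF that(2)] setR by blast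
  have sums: "WX (U1 \<union> U2) = WX U1 + WX U2" "WY (U1 \<union> U2) = WY U1 + WY U2" "key (U1 \<union> U2) = key U1 + key U2"
    if "(S, U1) \<in> G" "(S \<inter> M, U2) \<in> F" for S U1 U2
  proof -
    have "finite U1" "finite U2" using GR[OF that] finite_subset[OF _ finite_lessThan] by (meson Un_subset_iff)+
    then show "WX (U1 \<union> U2) = WX U1 + WX U2" "WY (U1 \<union> U2) = WY U1 + WY U2" "key (U1 \<union> U2) = key U1 + key U2"
      using disj[OF that] WX_Un[of U1 U2] key_Un[of U1 U2] by blast+
  qed
  let ?s1 = "run (vTOP ::= $vTOP \<oplus> $vST) (run (vNC ::= $vTOP) s0)"
  have e1: "dp_env ?s1" by (rule dp_env_frame[OF e]) auto
  have s1: "?s1 vTOP 0 = int (Suc n * (v1 * 2 ^ R))" "?s1 vNC 0 = int (n * (v1 * 2 ^ R))" "?s1 vVT 0 = int t"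
    "?s1 aCB = s0 aCB" "?s1 aTY = s0 aTY" "?s1 aTU = s0 aTU" "?s1 aMK = s0 aMK" "?s1 vNB 0 = int (m' * (v1 * 2 ^ R))"
    using top t nb dp_envD(13)[OF e] by simp_all
  define body where "body = (
        vY1 ::= aTY\<lblot>aCB\<lblot>$vVT\<rblot> \<oplus> $vKS \<oplus> $lv\<rblot> ;; vY2 ::= aTY\<lblot>$vNB \<oplus> $vKT \<oplus> $lv2\<rblot> ;;
        Cond (Conj (Const 0 \<prec> $vY1) (Const 0 \<prec> $vY2))
          (vIX ::= $vNC \<oplus> $vKS \<oplus> ($lv \<oplus> $lv2) ;; vY ::= $vY1 \<oplus> $vY2 \<ominus> Const 1 ;;
           Cond (aTY\<lblot>$vIX\<rblot> \<prec> $vY)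
             (aTU\<lblot>$vIX\<rblot> :== aTU\<lblot>aCB\<lblot>$vVT\<rblot> \<oplus> $vKS \<oplus> $lv\<rblot> \<oplus> aTU\<lblot>$vNB \<oplus> $vKT \<oplus> $lv2\<rblot> ;; aTY\<lblot>$vIX\<rblot> :== $vY) Skip)
          Skip)"
  have lfb: "lf body" by (simp add: body_def)
  have wrb: "wr body a \<longleftrightarrow> a \<in> {vY1, vY2, vIX, vY, aTU, aTY}" for a by (auto simp: body_def)
  show ?thesis unfolding c_join_def body_def[symmetric]
  proof (rule wp_seq_run, simp, rule wp_seq_run, simp, rule wp_seq, rule wp_for[where h = "2 ^ length (bg t)" and
      Inv = "\<lambda>j s. build s0 s n (jn M G F) (J (\<lambda>S U1 U2. \<exists>j'<j. S = sel t j'))"], goal_cases)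
    case 3
    then show ?case using s1(3) dp_envD(2)[OF e1 t(2)] dp_envD(7)[OF e1 length_bag_le[OF t(2)]] by (simp add: c_decode_def wrb)
  next
    case 4
    have z: "J (\<lambda>S U1 U2. \<exists>j'<0. S = sel t j') = {}" by (simp add: J_def)
    show ?case unfolding z by (rule iffD2[OF build_cong[OF s1(5,6)] build_start[OF un]])
  next
    case (5 j s)
    note o = this
    have fr: "s a = ?s1 a" if "\<not> wr c_decode a" "a \<notin> {vY1, vY2, vY, vIX, aTY, aTU, lv, lv2, lj}" for a using o(2) that by (simp add: wrb)
    have e2: "dp_env s" by (rule dp_env_frame[OF e1]) (use fr in \<open>auto simp: c_decode_def\<close>)
    have s2: "s vVT 0 = int t" "marked s M" "s vNC 0 = int (n * (v1 * 2 ^ R))" "s aCB (int t) = int (m * (v1 * 2 ^ R))"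
      "s vNB 0 = int (m' * (v1 * 2 ^ R))"
      using fr[of vVT] fr[of aMK] fr[of vNB] fr[of aCB] fr[of vNC] s1 M cb by (simp_all add: c_decode_def marked_def)
    let ?S = "sel t j"
    have SR: "?S \<subseteq> {..<R}" using sel_subset[OF o(1)] setR by blast
    show ?case
    proof (rule wp_seq_conseq[OF wp_decode[OF e2 s2(1) t(2) o(3,1) s2(2)]])
      show "length (bg t) \<le> \<beta> lb" using \<beta> t(2) by (simp add: bounded_def)
    next
      fix s3 assume fr3: "\<And>a. \<not> wr c_decode a \<Longrightarrow> s3 a = s a" and q: "s3 vKS 0 = key ?S \<and> s3 vKT 0 = key (?S \<inter> M) \<and>
        s3 vDX 0 = int (WX (?S - M)) \<and> s3 vDY 0 = int (WY (?S - M)) \<and> s3 vDU 0 = key (?S - M) \<and>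
        (\<forall>i<length (bg t). s3 aSel (int i) = (if i \<in> set_decode j then 1 else 0))"
      have s3: "s3 vVT 0 = int t" "s3 vNC 0 = int (n * (v1 * 2 ^ R))" "s3 aCB (int t) = int (m * (v1 * 2 ^ R))"
        "s3 aTY = s aTY" "s3 aTU = s aTU" "s3 vV1 0 = int v1" "s3 vNB 0 = int (m' * (v1 * 2 ^ R))"
        using s2 dp_envD(12)[OF e2] by (simp_all add: fr3 c_decode_def)
      show "wp \<beta> (For lv $vV1 (For lv2 $vV1 body)) (\<lambda>s. build s0 s n (jn M G F) (J (\<lambda>S U1 U2. \<exists>j'<Suc j. S = sel t j'))) s3"
      proof (rule wp_for[where h = v1 and Inv = "\<lambda>v s. build s0 s n (jn M G F)
          (J (\<lambda>S U1 U2. (\<exists>j'<j. S = sel t j') \<or> S = ?S \<and> WX U1 < v))"], goal_cases)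
        case 4
        then show ?case using o(4) build_cong[OF s3(4,5)] by simp
      next
        case (5 v s)
        note p = this
        have s4: "s vVT 0 = int t" "s vNC 0 = int (n * (v1 * 2 ^ R))" "s aCB (int t) = int (m * (v1 * 2 ^ R))"
          "s vV1 0 = int v1" "s vNB 0 = int (m' * (v1 * 2 ^ R))" "s vKS 0 = key ?S" "s vKT 0 = key (?S \<inter> M)" "s lv 0 = int v"
          using p(2,3) s3 q by (simp_all add: wrb)
        show ?case
        proof (rule wp_for[where h = v1 and Inv = "\<lambda>v2 s. build s0 s n (jn M G F)
          (J (\<lambda>S U1 U2. (\<exists>j'<j. S = sel t j') \<or> S = ?S \<and> WX U1 < v \<or> S = ?S \<and> WX U1 = v \<and> WX U2 < v2))"], goal_cases)
          case (5 v2 s)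
          have st: "s vVT 0 = int t" "s vNC 0 = int (n * (v1 * 2 ^ R))" "s aCB (int t) = int (m * (v1 * 2 ^ R))"
            "s vNB 0 = int (m' * (v1 * 2 ^ R))" "s vKS 0 = key ?S" "s vKT 0 = key (?S \<inter> M)" "s lv 0 = int v" "s lv2 0 = int v2"
            using 5(2,3) s4 by (simp_all add: wrb)
          have tb: "table s m G" "table s m' F"
            using build_sources[OF 5(4) tbl(1) cb(2)] build_sources[OF 5(4) tbl(2) nb(2)] by auto
          have src: "int (m * (v1 * 2 ^ R)) + key ?S + int v = idx m ?S v"
            "int (m' * (v1 * 2 ^ R)) + key (?S \<inter> M) + int v2 = idx m' (?S \<inter> M) v2" by (simp_all add: idx_def)
          show ?case
          proof (rule wp_run[OF lfb], cases "0 < s aTY (idx m ?S v) \<and> 0 < s aTY (idx m' (?S \<inter> M) v2)")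
            case False
            have none: "\<not> (WX U1 = v \<and> WX U2 = v2)" if g: "(?S, U1) \<in> G" "(?S \<inter> M, U2) \<in> F" for U1 U2
            proof
              assume v: "WX U1 = v \<and> WX U2 = v2"
              have "covers s m ?S U1" "covers s m' (?S \<inter> M) U2" using tb g by (auto simp: table_def)
              then have "int (WY U1) + 1 \<le> s aTY (idx m ?S v)" "int (WY U2) + 1 \<le> s aTY (idx m' (?S \<inter> M) v2)"
                using v by (simp_all add: covers_def)
              then show False using False by linarith
            qed
            have "run body s aTY = s aTY" "run body s aTU = s aTU"
              using False st src by (auto simp: body_def simp del: of_nat_mult of_nat_sum)
            then have "build s0 (run body s) n (jn M G F) (J (\<lambda>S U1 U2. (\<exists>j'<j. S = sel t j') \<or> S = ?S \<and> WX U1 < v \<or>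
                S = ?S \<and> WX U1 = v \<and> WX U2 < v2))"
              using build_cong 5(4) by blast
            then show "build s0 (run body s) n (jn M G F) (J (\<lambda>S U1 U2. (\<exists>j'<j. S = sel t j') \<or> S = ?S \<and> WX U1 < v \<or>
                S = ?S \<and> WX U1 = v \<and> WX U2 < Suc v2))"
            proof (rule build_mono, intro J_mono)
              fix S U1 U2 assume a: "(S, U1) \<in> G" "(S \<inter> M, U2) \<in> F"
                "(\<exists>j'<j. S = sel t j') \<or> S = ?S \<and> WX U1 < v \<or> S = ?S \<and> WX U1 = v \<and> WX U2 < Suc v2"
              show "(\<exists>j'<j. S = sel t j') \<or> S = ?S \<and> WX U1 < v \<or> S = ?S \<and> WX U1 = v \<and> WX U2 < v2"
                using a none less_Suc_eq by metis
            qed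
          next
            case True
            then obtain U1 where U1: "(?S, U1) \<in> G" "WX U1 = v" "s aTY (idx m ?S v) = int (WY U1) + 1" "s aTU (idx m ?S v) = key U1"
              using tb(1) SR p(1) unfolding table_def sound_def by blast
            have "?S \<inter> M \<subseteq> {..<R}" using SR by blast
            then obtain U2 where U2: "(?S \<inter> M, U2) \<in> F" "WX U2 = v2" "s aTY (idx m' (?S \<inter> M) v2) = int (WY U2) + 1"
              "s aTU (idx m' (?S \<inter> M) v2) = key U2"
              using True tb(2) 5(1) unfolding table_def sound_def by blast
            let ?U = "U1 \<union> U2"
            let ?z = "idx n ?S (WX ?U)"
            have z: "int (n * (v1 * 2 ^ R)) + key ?S + (int v + int v2) = ?z"
              using sums[OF U1(1) U2(1)] U1(2) U2(2) by (simp add: idx_def)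
            \<comment> \<open>Both cells are one above the totals they encode, and the result has to
              be one above again.\<close>
            have y: "int (WY U1) + 1 + (int (WY U2) + 1) - 1 = int (WY ?U) + 1" "key U1 + key U2 = key ?U"
              using sums[OF U1(1) U2(1)] by simp_all
            have "relaxed s (run body s) ?z (int (WY ?U) + 1) (key ?U)" unfolding relaxed_def y[symmetric] z[symmetric]
              using True st src U1(3,4) U2(3,4) by (simp add: body_def del: of_nat_mult of_nat_sum)
            then show "build s0 (run body s) n (jn M G F) (J (\<lambda>S U1 U2. (\<exists>j'<j. S = sel t j') \<or> S = ?S \<and> WX U1 < v \<or>
                S = ?S \<and> WX U1 = v \<and> WX U2 < Suc v2))"
            proof (rule build_relaxed[OF 5(4)])
              show "?S \<subseteq> {..<R}" "?U \<subseteq> {..<R}" using GR[OF U1(1) U2(1)] by auto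
              show "(?S, ?U) \<in> jn M G F" using U1(1) U2(1) by (auto simp: jn_def)
              fix S' U' assume "(S', U') \<in> J (\<lambda>S U1 U2. (\<exists>j'<j. S = sel t j') \<or> S = ?S \<and> WX U1 < v \<or>
                S = ?S \<and> WX U1 = v \<and> WX U2 < Suc v2)"
              then obtain V1 V2 where 2: "(S', V1) \<in> G" "(S' \<inter> M, V2) \<in> F" "U' = V1 \<union> V2"
                "(\<exists>j'<j. S' = sel t j') \<or> S' = ?S \<and> WX V1 < v \<or> S' = ?S \<and> WX V1 = v \<and> WX V2 < Suc v2"
                unfolding J_def by blast
              show "(S', U') \<in> J (\<lambda>S U1 U2. (\<exists>j'<j. S = sel t j') \<or> S = ?S \<and> WX U1 < v \<or> S = ?S \<and> WX U1 = v \<and> WX U2 < v2) \<or>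
                S' = ?S \<and> WX U' = WX ?U \<and> WY U' \<le> WY ?U"
              proof (cases "S' = ?S \<and> WX V1 = v \<and> WX V2 = v2")
                case True
                then have "covers s m ?S V1" "covers s m' (?S \<inter> M) V2" using tb 2(1,2) by (auto simp: table_def)
                then have "int (WY V1) + 1 \<le> int (WY U1) + 1" "int (WY V2) + 1 \<le> int (WY U2) + 1"
                  using U1(3) U2(3) True by (simp_all add: covers_def)
                then have "WY V1 \<le> WY U1" "WY V2 \<le> WY U2" by (simp_all del: of_nat_sum)
                then show ?thesis using True 2 sums[OF 2(1,2)] sums[OF U1(1) U2(1)] U1(2) U2(2) by simp
              next
                case False
                then have "(\<exists>j'<j. S' = sel t j') \<or> S' = ?S \<and> WX V1 < v \<or> S' = ?S \<and> WX V1 = v \<and> WX V2 < v2"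
                  using 2(4) less_Suc_eq by metis
                then show ?thesis using 2(1-3) unfolding J_def by blast
              qed
            qed
          qed
        next
          case 4
          show ?case by (rule build_mono[OF p(4)], rule J_mono) auto
        next
          case (7 s)
          show ?case
          proof (rule build_mono[OF 7(2)], rule J_mono)
            fix S U1 U2 assume a: "(S, U1) \<in> G" "(S \<inter> M, U2) \<in> F" "(\<exists>j'<j. S = sel t j') \<or> S = ?S \<and> WX U1 < Suc v"
            have "WX U2 < v1" using F[OF a(2)] WX_less by blast
            then show "(\<exists>j'<j. S = sel t j') \<or> S = ?S \<and> WX U1 < v \<or> S = ?S \<and> WX U1 = v \<and> WX U2 < v1"
              using a(3) less_Suc_eq by metis
          qed
        qed (use s4 \<beta> in \<open>simp_all add: bounded_def wrb\<close>)
      next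
        case (7 s)
        show ?case
        proof (rule build_mono[OF 7(2)], rule J_mono)
          fix S U1 U2 assume a: "(S, U1) \<in> G" "(S \<inter> M, U2) \<in> F" "\<exists>j'<Suc j. S = sel t j'"
          have "WX U1 < v1" using G[OF a(1)] WX_less by blast
          then show "(\<exists>j'<j. S = sel t j') \<or> S = ?S \<and> WX U1 < v1" using a(3) less_Suc_eq by auto
        qed
      qed (use s3 \<beta> in \<open>simp_all add: bounded_def wrb\<close>)
    qed
  next
    case (7 s)
    have "jn M G F \<subseteq> J (\<lambda>S U1 U2. \<exists>j'<2 ^ length (bg t). S = sel t j')"
      unfolding JG[symmetric]
    proof (rule J_mono)
      fix S U1 U2 assume "(S, U1) \<in> G"
      then have "S \<subseteq> set (bg t)" using G by blast
      then show "\<exists>j'<2 ^ length (bg t). S = sel t j'" by (rule sel_surj) blast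
    qed
    then have "build s0 s n (jn M G F) (jn M G F)" by (rule build_mono[OF 7(2)])
    then have b: "table s n (jn M G F) \<and> same_below s0 s n \<and> unused s (Suc n)"
      by (rule build_table) (use GR in \<open>unfold jn_def, blast\<close>)
    have s': "s vTOP 0 = ?s1 vTOP 0" "s vNC 0 = ?s1 vNC 0" "s vVT 0 = ?s1 vVT 0" "s aCB = ?s1 aCB"
      using 7(1)[of vTOP] 7(1)[of vNC] 7(1)[of vVT] 7(1)[of aCB] by (simp_all add: c_decode_def wrb)
    let ?s2 = "run (aCB\<lblot>$vVT\<rblot> :== $vNC) s"
    have tt: "?s2 aTY = s aTY" "?s2 aTU = s aTU" by simp_all
    have "table ?s2 n (jn M G F) \<and> same_below s0 ?s2 n \<and> unused ?s2 (Suc n)"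
      using b iffD2[OF table_cong[OF tt]] tt unfolding same_below_def unused_def by metis
    moreover have "?s2 vTOP 0 = int (Suc n * (v1 * 2 ^ R))" "?s2 aCB = (s0 aCB)(int t := int (n * (v1 * 2 ^ R)))"
      using s' s1 by simp_all
    ultimately show ?case by (intro wp_run) auto
  qed (use \<beta> t(2) in \<open>simp_all add: bounded_def c_decode_def wrb\<close>)
qed

definition closed_in :: "nat \<Rightarrow> nat set \<Rightarrow> bool" where
  "closed_in t S \<longleftrightarrow> (\<forall>r\<in>set (bg t). \<forall>r'\<in>set (bg t). r' \<in> S \<longrightarrow> req r' r \<longrightarrow> r \<in> S)"

lemma sel_iff:
  assumes "t < K" "j < 2 ^ length (bg t)" "i < length (bg t)"
  shows "bg t ! i \<in> sel t j \<longleftrightarrow> i \<in> set_decode j"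
  using bag_dist[OF assms(1)] set_decode_subset[OF assms(2)] assms(3) nth_eq_iff_index_eq[OF bag_dist[OF assms(1)]]
  by (force simp: sel_def)

definition leafs :: "nat \<Rightarrow> (nat set \<times> nat set) set" where
  "leafs t = {(S, {}) | S. S \<subseteq> set (bg t) \<and> closed_in t S}"

lemma wp_init:
  assumes e: "dp_env s0" and z: "s0 vTOP 0 = 0" "s0 aMK = (\<lambda>_. 0)" "s0 aTY = (\<lambda>_. 0)" and \<beta>: "bounded \<beta>"
  shows "wp \<beta> c_init (\<lambda>s. s vTOP 0 = int (K * (v1 * 2 ^ R)) \<and> unused s K \<and>
    (\<forall>t<K. s aCB (int t) = int (t * (v1 * 2 ^ R)) \<and> s aAL (int t) = 1 \<and> table s t (leafs t))) s0"
  unfolding c_init_def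
proof (rule wp_for[where h = K and Inv = "\<lambda>t s. s vTOP 0 = int (t * (v1 * 2 ^ R)) \<and> unused s t \<and>
    (\<forall>t'<t. s aCB (int t') = int (t' * (v1 * 2 ^ R)) \<and> s aAL (int t') = 1 \<and> table s t' (leafs t'))"], goal_cases)
  case (5 t s)
  note o = this
  have setR: "set (bg t) \<subseteq> {..<R}" using bag_sub o(1) .
  let ?s1 = "run (aAL\<lblot>$lt\<rblot> :== Const 1) (run (aCB\<lblot>$lt\<rblot> :== $vTOP) (run (vVT ::= $lt) s))"
  have e1: "dp_env ?s1" by (rule dp_env_frame[OF e]) (auto simp: o(2) c_decode_def)
  have s1: "?s1 vTOP 0 = int (t * (v1 * 2 ^ R))" "?s1 vVT 0 = int t" "?s1 aMK = (\<lambda>_. 0)" "?s1 aTY = s aTY" "?s1 aTU = s aTU"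
    "?s1 aCB = (s aCB)(int t := int (t * (v1 * 2 ^ R)))" "?s1 aAL = (s aAL)(int t := 1)" "?s1 lt 0 = int t"
    using o z by (simp_all add: c_decode_def)
  have un: "unused s t" using o(4) by blast
  show ?case
  proof (rule wp_seq_run, simp, rule wp_seq_run, simp, rule wp_seq_run, simp, rule wp_seq,
      rule wp_for[where h = "2 ^ length (bg t)" and
      Inv = "\<lambda>j s'. build s s' t (leafs t) {(S, {}) | S. S \<subseteq> set (bg t) \<and> closed_in t S \<and> (\<exists>j'<j. S = sel t j')}"], goal_cases)
    case 3
    then show ?case using s1(2) dp_envD(2)[OF e1 o(1)] dp_envD(7)[OF e1 length_bag_le[OF o(1)]] by (simp add: c_decode_def)
  next
    case 4
    have z: "{(S, {} :: nat set) | S. S \<subseteq> set (bg t) \<and> closed_in t S \<and> (\<exists>j'<0. S = sel t j')} = {}" by simp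
    show ?case unfolding z by (rule iffD2[OF build_cong[OF s1(4,5)] build_start[OF un]])
  next
    case (5 j s2)
    note p = this
    have fr: "s2 a = ?s1 a" if "\<not> wr c_decode a" "a \<notin> {vOK, aTY, aTU, lb, lb2, lj}" for a using p(2) that by simp
    have e2: "dp_env s2" by (rule dp_env_frame[OF e1]) (use fr in \<open>auto simp: c_decode_def\<close>)
    have s2: "s2 vVT 0 = int t" "marked s2 {}" "s2 vTOP 0 = int (t * (v1 * 2 ^ R))"
      using fr[of vVT] fr[of aMK] fr[of vTOP] s1 by (simp_all add: c_decode_def marked_def)
    let ?S = "sel t j" and ?b = "length (bg t)"
    have SR: "?S \<subseteq> {..<R}" using sel_subset[OF p(1)] setR by blast
    define bad where "bad i i2 \<longleftrightarrow> bg t ! i \<notin> ?S \<and> bg t ! i2 \<in> ?S \<and> req (bg t ! i2) (bg t ! i)" for i i2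
    have closed: "closed_in t ?S \<longleftrightarrow> (\<forall>i<?b. \<forall>i2<?b. \<not> bad i i2)"
      unfolding closed_in_def bad_def by (metis in_set_conv_nth)
    show ?case
    proof (rule wp_seq_conseq[OF wp_decode[OF e2 s2(1) o(1) p(3,1) s2(2)]])
      show "length (bg t) \<le> \<beta> lb" using \<beta> o(1) by (simp add: bounded_def)
    next
      fix s3 assume fr3: "\<And>a. \<not> wr c_decode a \<Longrightarrow> s3 a = s2 a" and q: "s3 vKS 0 = key ?S \<and> s3 vKT 0 = key (?S \<inter> {}) \<and>
        s3 vDX 0 = int (WX (?S - {})) \<and> s3 vDY 0 = int (WY (?S - {})) \<and> s3 vDU 0 = key (?S - {}) \<and>
        (\<forall>i<length (bg t). s3 aSel (int i) = (if i \<in> set_decode j then 1 else 0))"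
      have e3: "dp_env s3" by (rule dp_env_frame[OF e2]) (use fr3 in \<open>auto simp: c_decode_def\<close>)
      have s3: "s3 vVT 0 = int t" "s3 vTOP 0 = int (t * (v1 * 2 ^ R))" "s3 aTY = s2 aTY" "s3 aTU = s2 aTU"
        using s2 by (simp_all add: fr3 c_decode_def)
      show "wp \<beta> (vOK ::= Const 1 ;;
      For lb aBL\<lblot>$vVT\<rblot> (For lb2 aBL\<lblot>$vVT\<rblot> (
        Cond (Conj (aSel\<lblot>$lb\<rblot> \<prec> Const 1) (Conj (Const 0 \<prec> aSel\<lblot>$lb2\<rblot>)
            (Neg (aX\<lblot>aXB\<lblot>aBG\<lblot>aBO\<lblot>$vVT\<rblot> \<oplus> $lb2\<rblot>\<rblot> \<oplus> aHM\<lblot>aBG\<lblot>aBO\<lblot>$vVT\<rblot> \<oplus> $lb\<rblot>\<rblot>\<rblot>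
              \<prec> aHV\<lblot>aBG\<lblot>aBO\<lblot>$vVT\<rblot> \<oplus> $lb\<rblot>\<rblot>))))
          (vOK ::= Const 0) Skip)) ;;
      Cond (Conj (Const 0 \<prec> $vOK) (aTY\<lblot>$vTOP \<oplus> $vKS\<rblot> \<prec> Const 1))
        (aTU\<lblot>$vTOP \<oplus> $vKS\<rblot> :== Const 0 ;; aTY\<lblot>$vTOP \<oplus> $vKS\<rblot> :== Const 1) Skip)
        (\<lambda>s'. build s s' t (leafs t) {(S, {}) | S. S \<subseteq> set (bg t) \<and> closed_in t S \<and> (\<exists>j'<Suc j. S = sel t j')}) s3"
      proof (rule wp_seq_run, simp, rule wp_seq, rule wp_for[where h = ?b and
          Inv = "\<lambda>k s'. s' vOK 0 = (if \<forall>i<k. \<forall>i2<?b. \<not> bad i i2 then 1 else 0)"], goal_cases)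
        case (5 k s4)
        note r = this
        show ?case
        proof (rule wp_for[where h = ?b and
          Inv = "\<lambda>k2 s'. s' vOK 0 = (if (\<forall>i<k. \<forall>i2<?b. \<not> bad i i2) \<and> (\<forall>i2<k2. \<not> bad k i2) then 1 else 0)"], goal_cases)
          case 3
          then show ?case using r(2) s3(1) dp_envD(2)[OF e3 o(1)] by simp
        next
          case (5 k2 s5)
          have b: "bg t ! k < R" "bg t ! k2 < R" using setR r(1) 5(1) nth_mem by blast+
          have "s5 aBO (int t) = int (boo t)" "s5 aBG (int (boo t) + int k) = int (bg t ! k)"
            "s5 aBG (int (boo t) + int k2) = int (bg t ! k2)" "s5 vVT 0 = int t" "s5 lb 0 = int k"
            "s5 aSel (int k) = (if bg t ! k \<in> ?S then 1 else 0)" "s5 aSel (int k2) = (if bg t ! k2 \<in> ?S then 1 else 0)"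
            "s5 aHV (int (bg t ! k)) \<le> s5 aX (s5 aXB (int (bg t ! k2)) + s5 aHM (int (bg t ! k))) \<longleftrightarrow> req (bg t ! k2) (bg t ! k)"
            using 5(1-3) r(1-3) s3 q dp_envD(1,3)[OF e3 o(1)] dp_envD(8)[OF e3 b] sel_iff[OF o(1) p(1)] by simp_all
          then show ?case using 5 by (intro wp_run) (auto simp: less_Suc_eq bad_def not_less)
        next
          case (7 s5)
          then show ?case by (simp add: less_Suc_eq all_conj_distrib)
        qed (use r \<beta> o(1) in \<open>simp_all add: bounded_def\<close>)
      next
        case 3
        then show ?case using s3(1) dp_envD(2)[OF e3 o(1)] by simp
      next
        case (7 s4)
        have ok: "s4 vOK 0 = (if closed_in t ?S then 1 else 0)" using 7(2) closed by simp
        have s4: "s4 aTY = s2 aTY" "s4 aTU = s2 aTU" "s4 vTOP 0 = int (t * (v1 * 2 ^ R))" "s4 vKS 0 = key ?S"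
          using 7(1) s3 q by simp_all
        define c where "c = Cond (Conj (Const 0 \<prec> $vOK) (aTY\<lblot>$vTOP \<oplus> $vKS\<rblot> \<prec> Const 1))
          (aTU\<lblot>$vTOP \<oplus> $vKS\<rblot> :== Const 0 ;; aTY\<lblot>$vTOP \<oplus> $vKS\<rblot> :== Const 1) Skip"
        let ?C = "\<lambda>j. {(S, {} :: nat set) | S. S \<subseteq> set (bg t) \<and> closed_in t S \<and> (\<exists>j'<j. S = sel t j')}"
        have b4: "build s s4 t (leafs t) (?C j)" using p(4) build_cong[OF s4(1,2)] by simp
        have "build s (run c s4) t (leafs t) (?C (Suc j))"
        proof (cases "closed_in t ?S")
          case True
          have "relaxed s4 (run c s4) (idx t ?S (WX {})) (int (WY {}) + 1) (key {})"
            using ok True s4 by (auto simp: relaxed_def c_def idx_def)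
          then show ?thesis
          proof (rule build_relaxed[OF b4 _ SR])
            show "(?S, {}) \<in> leafs t" using True sel_subset[OF p(1)] by (simp add: leafs_def)
          qed (auto simp: less_Suc_eq)
        next
          case False
          then have rc: "run c s4 = s4" using ok by (simp add: c_def)
          show ?thesis unfolding rc by (rule build_mono[OF b4]) (use False in \<open>auto simp: less_Suc_eq\<close>)
        qed
        then show ?case unfolding c_def by (intro wp_run) simp_all
      qed (use \<beta> o(1) in \<open>simp_all add: bounded_def\<close>)
    qed
  next
    case (7 s2)
    have "leafs t \<subseteq> {(S, {}) | S. S \<subseteq> set (bg t) \<and> closed_in t S \<and> (\<exists>j'<2 ^ length (bg t). S = sel t j')}"
    proof
      fix p assume "p \<in> leafs t"
      then obtain S where S: "p = (S, {})" "S \<subseteq> set (bg t)" "closed_in t S" by (auto simp: leafs_def)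
      obtain j where "j < 2 ^ length (bg t)" "S = sel t j" using sel_surj[OF S(2)] .
      then show "p \<in> {(S, {}) | S. S \<subseteq> set (bg t) \<and> closed_in t S \<and> (\<exists>j'<2 ^ length (bg t). S = sel t j')}" using S by blast
    qed
    then have "build s s2 t (leafs t) (leafs t)" by (rule build_mono[OF 7(2)])
    then have b: "table s2 t (leafs t) \<and> same_below s s2 t \<and> unused s2 (Suc t)"
      by (rule build_table) (use setR in \<open>auto simp: leafs_def\<close>)
    have old: "table s2 t' (leafs t')" if "t' < t" for t' using table_same_below b o(4) that by blast
    have fr: "s2 a = ?s1 a" if "\<not> wr c_decode a" "a \<notin> {vOK, aTY, aTU, lb, lb2, lj}" for a using 7(1) that by simp
    have s2: "s2 vTOP 0 = int (t * (v1 * 2 ^ R))" "s2 aCB = (s aCB)(int t := int (t * (v1 * 2 ^ R)))" "s2 aAL = (s aAL)(int t := 1)"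
      "s2 vST 0 = int (v1 * 2 ^ R)"
      using fr[of vTOP] fr[of aCB] fr[of aAL] fr[of vST] s1 dp_envD(13)[OF e1] by (simp_all add: c_decode_def)
    let ?s3 = "run (vTOP ::= $vTOP \<oplus> $vST) s2"
    have tt: "?s3 aTY = s2 aTY" "?s3 aTU = s2 aTU" by simp_all
    have "?s3 vTOP 0 = int (Suc t * (v1 * 2 ^ R))" "?s3 aCB = s2 aCB" "?s3 aAL = s2 aAL" using s2 by simp_all
    moreover have "unused ?s3 (Suc t)" using b tt by (simp add: unused_def)
    moreover have "table ?s3 t' (leafs t')" if "t' < Suc t" for t'
      using that old[of t'] b iffD2[OF table_cong[OF tt]] unfolding less_Suc_eq by blast
    ultimately show ?case using s2 o(4) by (intro wp_run) (auto simp: less_Suc_eq)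
  qed (use \<beta> o(1) in \<open>simp_all add: bounded_def c_decode_def\<close>)
next
  case 4
  then show ?case using z by (simp add: unused_def)
next
  case (6 t s f)
  then show ?case by (simp add: unused_def table_def sound_def covers_def)
qed (use \<beta> dp_envD(10)[OF e] in \<open>simp_all add: bounded_def c_decode_def\<close>)

end

context dp
begin

section \<open>Families of partial solutions\<close>

lemma closed_in_cong: "U \<inter> set (bg t) = U' \<inter> set (bg t) \<Longrightarrow> closed_in t U \<Longrightarrow> closed_in t U'"
  unfolding closed_in_def by blast

definition RR :: "nat set \<Rightarrow> nat set" where
  "RR G = (\<Union>t\<in>G. set (bg t))"

text \<open>\<open>G\<close> is the set of nodes merged into \<open>t\<close> so far. A partial
  solution for their bags is split into what is visible in the bag of \<open>t\<close> and what is
  forgotten; with all nodes in \<open>G\<close> these are the members of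
  \<open>solutions\<close>.\<close>

definition fam :: "nat set \<Rightarrow> nat \<Rightarrow> (nat set \<times> nat set) set" where
  "fam G t = {(U \<inter> set (bg t), U - set (bg t)) | U. U \<subseteq> RR G \<and> (\<forall>t'\<in>G. closed_in t' U)}"

lemma fam_iff: "(S, U) \<in> fam G t \<longleftrightarrow> (\<exists>W. S = W \<inter> set (bg t) \<and> U = W - set (bg t) \<and> W \<subseteq> RR G \<and> (\<forall>t'\<in>G. closed_in t' W))"
  by (simp add: fam_def)

lemma fgt_iff: "(S, U) \<in> fgt M G \<longleftrightarrow> (\<exists>S0 U0. S = S0 \<inter> M \<and> U = U0 \<union> (S0 - M) \<and> (S0, U0) \<in> G)"
  by (auto simp: fgt_def)

lemma leafs_fam: "leafs t = fam {t} t"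
proof (intro set_eqI iffI)
  fix p assume "p \<in> leafs t"
  then obtain S where S: "p = (S, {})" "S \<subseteq> set (bg t)" "closed_in t S" by (auto simp: leafs_def)
  then have "p = (S \<inter> set (bg t), S - set (bg t))" by auto
  then show "p \<in> fam {t} t" using S by (auto simp: fam_def RR_def)
next
  fix p assume "p \<in> fam {t} t"
  then obtain U where U: "p = (U \<inter> set (bg t), U - set (bg t))" "U \<subseteq> set (bg t)" "closed_in t U" by (auto simp: fam_def RR_def)
  then have "p = (U, {})" by auto
  then show "p \<in> leafs t" using U by (auto simp: leafs_def)
qed

text \<open>
  Two partial solutions agree on everything they share as soon as they agree on the common part of
  the two bags.
\<close>

lemma
  assumes p: "p \<in> Gp" and u: "u \<in> Gu" and sep: "RR Gp \<inter> RR Gu \<subseteq> set (bg p) \<inter> set (bg u)"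
  shows fam_merge: "jn (set (bg u)) (fam Gp p) (fgt (set (bg p)) (fam Gu u)) = fam (Gp \<union> Gu) p"
    and fam_disjoint: "\<And>S U1 U2. (S, U1) \<in> fam Gp p \<Longrightarrow> (S \<inter> set (bg u), U2) \<in> fgt (set (bg p)) (fam Gu u) \<Longrightarrow> U1 \<inter> U2 = {}"
proof -
  let ?p = "set (bg p)" and ?u = "set (bg u)"
  have sub: "?p \<subseteq> RR Gp" "?u \<subseteq> RR Gu" using p u by (auto simp: RR_def)
  have Gsub: "t \<in> G \<Longrightarrow> set (bg t) \<subseteq> RR G" for t G by (auto simp: RR_def)
  have RUn: "RR (Gp \<union> Gu) = RR Gp \<union> RR Gu" by (auto simp: RR_def)
  show "U1 \<inter> U2 = {}" if g: "(S, U1) \<in> fam Gp p" "(S \<inter> ?u, U2) \<in> fgt ?p (fam Gu u)" for S U1 U2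
  proof -
    obtain W1 where 1: "U1 = W1 - ?p" "W1 \<subseteq> RR Gp" using iffD1[OF fam_iff g(1)] by auto
    obtain S0 U0 where 0: "U2 = U0 \<union> (S0 - ?p)" "(S0, U0) \<in> fam Gu u" using iffD1[OF fgt_iff g(2)] by auto
    obtain W2 where 2: "S0 = W2 \<inter> ?u" "U0 = W2 - ?u" "W2 \<subseteq> RR Gu" using iffD1[OF fam_iff 0(2)] by auto
    show ?thesis using 1 0(1) 2 sep by blast
  qed
  show "jn ?u (fam Gp p) (fgt ?p (fam Gu u)) = fam (Gp \<union> Gu) p"
  proof (intro set_eqI iffI)
    fix q assume "q \<in> jn ?u (fam Gp p) (fgt ?p (fam Gu u))"
    then obtain S U1 U2 where q: "q = (S, U1 \<union> U2)" "(S, U1) \<in> fam Gp p" "(S \<inter> ?u, U2) \<in> fgt ?p (fam Gu u)"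
      unfolding jn_def by blast
    obtain W1 where 1: "S = W1 \<inter> ?p" "U1 = W1 - ?p" "W1 \<subseteq> RR Gp" "\<forall>t\<in>Gp. closed_in t W1" using iffD1[OF fam_iff q(2)] by auto
    obtain S0 U0 where 0: "S \<inter> ?u = S0 \<inter> ?p" "U2 = U0 \<union> (S0 - ?p)" "(S0, U0) \<in> fam Gu u"
      using iffD1[OF fgt_iff q(3)] by auto
    obtain W2 where 2: "S \<inter> ?u = W2 \<inter> ?u \<inter> ?p" "U2 = (W2 - ?u) \<union> (W2 \<inter> ?u - ?p)" "W2 \<subseteq> RR Gu" "\<forall>t\<in>Gu. closed_in t W2"
      using iffD1[OF fam_iff 0(3)] 0(1,2) by auto
    \<comment> \<open>By \<open>sep\<close> everything the two groups share lies in the bags of both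
      representatives, and there the join has compared the traces.\<close>
    have agree: "W1 \<inter> RR Gp \<inter> RR Gu = W2 \<inter> RR Gp \<inter> RR Gu"
    proof -
      have "RR Gp \<inter> RR Gu = ?p \<inter> ?u" using sep sub by blast
      then show ?thesis using 1(1) 2(1) by blast
    qed
    \<comment> \<open>Closedness at \<open>t\<close> depends only on the trace on its bag, and in a
      bag of the group \<open>Gp\<close> the union shows nothing beyond \<open>W1\<close>.\<close>
    have "closed_in t (W1 \<union> W2)" if "t \<in> Gp" for t
      by (rule closed_in_cong[of W1]) (use agree 2(3) 1(4) Gsub[OF that] that in blast)+
    moreover have "closed_in t (W1 \<union> W2)" if "t \<in> Gu" for t
      by (rule closed_in_cong[of W2]) (use agree 1(3) 2(4) Gsub[OF that] that in blast)+
    moreover have "S = (W1 \<union> W2) \<inter> ?p" using 1(1) agree 2(3) sub by blast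
    moreover have "U1 \<union> U2 = (W1 \<union> W2) - ?p" using 1(2) 2(2,3) agree sub sep by blast
    moreover have "W1 \<union> W2 \<subseteq> RR (Gp \<union> Gu)" using 1(3) 2(3) RUn by blast
    ultimately show "q \<in> fam (Gp \<union> Gu) p" unfolding q(1) fam_def by blast
  next
    fix q assume "q \<in> fam (Gp \<union> Gu) p"
    then obtain W where W: "q = (W \<inter> ?p, W - ?p)" "W \<subseteq> RR (Gp \<union> Gu)" "\<forall>t\<in>Gp \<union> Gu. closed_in t W"
      unfolding fam_def by blast
    define W1 W2 where "W1 = W \<inter> RR Gp" and "W2 = W \<inter> RR Gu"
    have c1: "closed_in t W1" if "t \<in> Gp" for t
      by (rule closed_in_cong[of W]) (use W(3) Gsub[OF that] that in \<open>auto simp: W1_def\<close>)+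
    have c2: "closed_in t W2" if "t \<in> Gu" for t
      by (rule closed_in_cong[of W]) (use W(3) Gsub[OF that] that in \<open>auto simp: W2_def\<close>)+
    have f1: "(W1 \<inter> ?p, W1 - ?p) \<in> fam Gp p" unfolding fam_def using c1 by (auto simp: W1_def)
    have f2: "(W2 \<inter> ?u, W2 - ?u) \<in> fam Gu u" unfolding fam_def using c2 by (auto simp: W2_def)
    have f3: "(W2 \<inter> ?u \<inter> ?p, W2 - ?u \<union> (W2 \<inter> ?u - ?p)) \<in> fgt ?p (fam Gu u)" unfolding fgt_def using f2 by blast
    have e: "W2 \<inter> ?u \<inter> ?p = W1 \<inter> ?p \<inter> ?u" using sub by (auto simp: W1_def W2_def)
    have "(W1 \<inter> ?p, (W1 - ?p) \<union> (W2 - ?u \<union> (W2 \<inter> ?u - ?p))) \<in> jn ?u (fam Gp p) (fgt ?p (fam Gu u))"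
      unfolding jn_def using f1 f3[unfolded e] by blast
    moreover have "W1 \<inter> ?p = W \<inter> ?p" using sub by (auto simp: W1_def)
    moreover have "(W1 - ?p) \<union> (W2 - ?u \<union> (W2 \<inter> ?u - ?p)) = W - ?p"
      using W(2) sep sub unfolding W1_def W2_def RUn by blast
    ultimately show "q \<in> jn ?u (fam Gp p) (fgt ?p (fam Gu u))" using W(1) by simp
  qed
qed

lemma fam_sub:
  assumes "G \<subseteq> {..<K}" "t < K" "(S, U) \<in> fam G t"
  shows "S \<subseteq> set (bg t) \<and> U \<subseteq> {..<R} \<and> U \<inter> S = {}"
proof -
  have "RR G \<subseteq> {..<R}" using assms(1) bag_sub by (fastforce simp: RR_def)
  then show ?thesis using assms(3) by (auto simp: fam_def)
qed

definition solutions :: "nat set set" where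
  "solutions = {U. U \<subseteq> RR {..<K} \<and> (\<forall>t<K. closed_in t U)}"

lemma fgt_all: "fgt {} (fam {..<K} t) = {({}, U) | U. U \<in> solutions}"
proof -
  have e: "U - set (bg t) \<union> (U \<inter> set (bg t) - {}) = U" for U by blast
  have "(S, U) \<in> fgt {} (fam {..<K} t) \<longleftrightarrow> S = {} \<and> U \<in> solutions" for S U
  proof
    assume "(S, U) \<in> fgt {} (fam {..<K} t)"
    then show "S = {} \<and> U \<in> solutions" unfolding fgt_iff fam_iff solutions_def using e by auto
  next
    assume a: "S = {} \<and> U \<in> solutions"
    then have "(U \<inter> set (bg t), U - set (bg t)) \<in> fam {..<K} t" unfolding fam_iff solutions_def by blast
    moreover have "S = (U \<inter> set (bg t)) \<inter> {}" "U = U - set (bg t) \<union> (U \<inter> set (bg t) - {})" using a by blast+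
    ultimately show "(S, U) \<in> fgt {} (fam {..<K} t)" unfolding fgt_iff by metis
  qed
  then show ?thesis by auto
qed

end

locale dp_tree = dp +
  fixes T :: "nat set set"
  assumes tree: "is_tree {..<K} T" and T_eq: "T = (\<lambda>(u, v). {u, v}) ` set es"
    and dist: "distinct (map (\<lambda>(u, v). {u, v}) es)"
    and conn: "\<And>r. connected_on {t \<in> {..<K}. r \<in> set (bg t)} T"
begin

section \<open>Finding a leaf among the alive nodes\<close>

lemma edge:
  assumes "i < length es"
  shows "{fst (es ! i), snd (es ! i)} \<in> T" "fst (es ! i) < K" "snd (es ! i) < K" "fst (es ! i) \<noteq> snd (es ! i)"
proof -
  show 1: "{fst (es ! i), snd (es ! i)} \<in> T" unfolding T_eq using nth_mem[OF assms] by (force simp: case_prod_beta)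
  have "T \<subseteq> {{x, y} | x y. x \<in> {..<K} \<and> y \<in> {..<K} \<and> x \<noteq> y}" using tree by (simp add: is_tree_def)
  then obtain x y where "{fst (es ! i), snd (es ! i)} = {x, y}" "x < K" "y < K" "x \<noteq> y" using 1 by blast
  then show "fst (es ! i) < K" "snd (es ! i) < K" "fst (es ! i) \<noteq> snd (es ! i)" by (auto simp: doubleton_eq_iff)
qed

lemma edge_index:
  assumes "e \<in> T"
  obtains i where "i < length es" "e = {fst (es ! i), snd (es ! i)}"
  using assms by (auto simp: T_eq in_set_conv_nth case_prod_beta)

lemma edge_inject:
  assumes "i < length es" "j < length es" "{fst (es ! i), snd (es ! i)} = {fst (es ! j), snd (es ! j)}"
  shows "i = j"
  using nth_eq_iff_index_eq[OF dist, of i j] assms by (simp add: case_prod_beta)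

text \<open>The degree counts alive edges, and each edge is listed only once, so a degree below two
  at one end of an alive edge means that the other end is its only alive neighbour. That such an end
  exists is \<open>exists_leaf\<close>; the program keeps the last one it sees.\<close>

lemma wp_leaf:
  assumes e: "dp_env s0" and al: "\<forall>t<K. s0 aAL (int t) = (if t \<in> Al then 1 else 0)" and Al: "Al \<subseteq> {..<K}"
    and ab: "a \<in> Al" "b \<in> Al" "a \<noteq> b" and con: "connected_on Al T" and \<beta>: "bounded \<beta>"
  shows "wp \<beta> c_leaf (\<lambda>s. \<exists>u p. s vLU 0 = int u \<and> s vLP 0 = int p \<and> u \<in> Al \<and> p \<in> Al \<and> u \<noteq> p \<and>
    (\<forall>v\<in>Al. {u, v} \<in> T \<longrightarrow> v = p)) s0"
proof -
  let ?u = "\<lambda>i. fst (es ! i)" and ?v = "\<lambda>i. snd (es ! i)"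
  define alive where "alive i \<longleftrightarrow> ?u i \<in> Al \<and> ?v i \<in> Al" for i
  define inc where "inc x i \<longleftrightarrow> alive i \<and> (?u i = x \<or> ?v i = x)" for x i
  define deg where "deg x k = card {i. i < k \<and> inc x i}" for x k
  define good where "good u p \<longleftrightarrow> u \<in> Al \<and> p \<in> Al \<and> u \<noteq> p \<and> (\<forall>v\<in>Al. {u, v} \<in> T \<longrightarrow> v = p)" for u p
  have degS: "deg x (Suc k) = (if inc x k then deg x k + 1 else deg x k)" for x k
  proof -
    have "{i. i < Suc k \<and> inc x i} = (if inc x k then insert k {i. i < k \<and> inc x i} else {i. i < k \<and> inc x i})"
      by (auto simp: less_Suc_eq)
    then show ?thesis by (simp add: deg_def)
  qed
  have good1: "good x y" if i: "i < length es" "alive i" and xy: "{x, y} = {?u i, ?v i}" and d: "deg x (length es) < 2" for i x y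
  proof -
    have x: "x \<in> Al" "y \<in> Al" "x \<noteq> y" "inc x i"
      using i xy edge(4)[OF i(1)] by (auto simp: alive_def inc_def doubleton_eq_iff)
    have "v = y" if v: "v \<in> Al" "{x, v} \<in> T" for v
    proof -
      obtain j where j: "j < length es" "{x, v} = {?u j, ?v j}"
        using edge_index[OF v(2)] .
      have ij: "inc x j" using j v x by (auto simp: inc_def alive_def doubleton_eq_iff)
      have "i = j"
      proof (rule ccontr)
        assume "i \<noteq> j"
        then have "2 = card {i, j}" by simp
        also have "\<dots> \<le> deg x (length es)" unfolding deg_def by (rule card_mono) (use i j x ij in auto)
        finally show False using d by simp
      qed
      then have "{x, v} = {x, y}" using j xy by simp
      then show "v = y" using x(3) by (auto simp: doubleton_eq_iff)
    qed
    then show ?thesis using x by (simp add: good_def)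
  qed
  have ex: "\<exists>i<length es. alive i \<and> (deg (?u i) (length es) < 2 \<or> deg (?v i) (length es) < 2)"
  proof -
    have acyc: "\<not> (\<exists>xs. cycle_in T xs)" using tree by (simp add: is_tree_def)
    have nl: "{v} \<notin> T" for v
    proof
      assume "{v} \<in> T"
      then obtain i where i: "i < length es" "{v} = {?u i, ?v i}" by (rule edge_index)
      then have "?u i = v" "?v i = v" by auto
      then show False using edge(4)[OF i(1)] by simp
    qed
    obtain u p where up: "u \<in> Al" "p \<in> Al" "u \<noteq> p" "{u, p} \<in> T" "\<forall>v\<in>Al. {u, v} \<in> T \<longrightarrow> v = p"
      using exists_leaf[OF finite_subset[OF Al finite_lessThan] ab con acyc nl] by blast
    obtain i where i: "i < length es" "{u, p} = {?u i, ?v i}"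
      using edge_index[OF up(4)] .
    have ui: "u = ?u i \<and> p = ?v i \<or> u = ?v i \<and> p = ?u i" using i(2) unfolding doubleton_eq_iff by blast
    have ali: "alive i" using ui up(1,2) unfolding alive_def by blast
    have "{j. j < length es \<and> inc u j} \<subseteq> {i}"
    proof safe
      fix j assume j: "j < length es" "inc u j"
      then have "?u j \<in> Al" "?v j \<in> Al" "?u j = u \<or> ?v j = u" by (simp_all add: inc_def alive_def)
      then have "\<exists>v\<in>Al. {?u j, ?v j} = {u, v}" by (metis insert_commute)
      then obtain v where v: "v \<in> Al" "{?u j, ?v j} = {u, v}" by blast
      then have "{u, v} \<in> T" using edge(1)[OF j(1)] by simp
      then have "v = p" using up(5) v(1) by blast
      then show "j = i" using edge_inject[OF j(1) i(1)] v i by simp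
    qed
    then have "deg u (length es) \<le> card {i}" unfolding deg_def by (intro card_mono) auto
    then have "deg u (length es) < 2" by simp
    moreover have "u = ?u i \<or> u = ?v i" using ui by blast
    ultimately show ?thesis using i(1) ali by metis
  qed
  have rdE: "s ''input'' (s vEO 0 + int i + int i) = int (?u i)" "s ''input'' (s vEO 0 + int i + int i + 1) = int (?v i)"
    if "dp_env s" "i < length es" for s i using that unfolding dp_env_def by blast+
  show ?thesis unfolding c_leaf_def
  proof (rule wp_seq, rule wp_for[where h = K and Inv = "\<lambda>k s. \<forall>t<k. s aDG (int t) = 0"], goal_cases)
    case (5 k s)
    then show ?case by (intro wp_run) (auto simp: less_Suc_eq)
  next
    case (7 s1)
    have e1: "dp_env s1" by (rule dp_env_frame[OF e]) (auto simp: 7(1))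
    have al1: "\<forall>t<K. s1 aAL (int t) = (if t \<in> Al then 1 else 0)" using al 7(1) by simp
    show ?case
    proof (rule wp_seq, rule wp_for[where h = "length es" and Inv = "\<lambda>k s. \<forall>t<K. s aDG (int t) = int (deg t k)"], goal_cases)
      case (5 k s)
      have e2: "dp_env s" by (rule dp_env_frame[OF e1]) (auto simp: 5(2))
      have a: "s aAL (int (?u k)) = (if ?u k \<in> Al then 1 else 0)" "s aAL (int (?v k)) = (if ?v k \<in> Al then 1 else 0)"
        using al1 5(2) edge[OF 5(1)] by simp_all
      have dg: "s aDG (int (?u k)) = int (deg (?u k) k)" "s aDG (int (?v k)) = int (deg (?v k) k)"
        using 5(4) edge[OF 5(1)] by simp_all
      show ?case
        using 5(3,4) rdE[OF e2 5(1)] a dg edge(4)[OF 5(1)] by (intro wp_run) (auto simp: degS inc_def alive_def)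
    next
      case (7 s2)
      have e2: "dp_env s2" by (rule dp_env_frame[OF e1]) (auto simp: 7(1))
      have al2: "\<forall>t<K. s2 aAL (int t) = (if t \<in> Al then 1 else 0)" using al1 7(1) by simp
      show ?case
      proof (rule wp_for[where h = "length es" and Inv = "\<lambda>k s.
          (\<forall>i<k. alive i \<longrightarrow> \<not> deg (?u i) (length es) < 2 \<and> \<not> deg (?v i) (length es) < 2) \<or>
          (\<exists>u p. s vLU 0 = int u \<and> s vLP 0 = int p \<and> good u p)"], goal_cases)
        case (5 k s)
        have e3: "dp_env s" by (rule dp_env_frame[OF e2]) (auto simp: 5(2))
        have a: "s aAL (int (?u k)) = (if ?u k \<in> Al then 1 else 0)" "s aAL (int (?v k)) = (if ?v k \<in> Al then 1 else 0)"
          using al2 5(2) edge[OF 5(1)] by simp_all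
        have dg: "s aDG (int (?u k)) = int (deg (?u k) (length es))" "s aDG (int (?v k)) = int (deg (?v k) (length es))"
          using 7(2) 5(2) edge[OF 5(1)] by simp_all
        note rd = rdE[OF e3 5(1)]
        have g: "good (?u k) (?v k)" if "alive k" "deg (?u k) (length es) < 2" using good1[OF 5(1) that(1) refl that(2)] .
        have g': "good (?v k) (?u k)" if "alive k" "deg (?v k) (length es) < 2"
          using good1[OF 5(1) that(1) insert_commute that(2)] .
        show ?case
        proof (cases "alive k")
          case False
          then show ?thesis using 5(3,4) rd a by (intro wp_run) (auto simp: alive_def less_Suc_eq)
        next
          case True
          then have a': "?u k \<in> Al" "?v k \<in> Al" by (auto simp: alive_def)
          show ?thesis
          proof (cases "deg (?u k) (length es) < 2")
            case d: True
            show ?thesis using 5(3) rd a a' dg d g[OF True d] by (intro wp_run) auto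
          next
            case d: False
            show ?thesis
            proof (cases "deg (?v k) (length es) < 2")
              case d': True
              show ?thesis using 5(3) rd a a' dg d d' g'[OF True d'] by (intro wp_run) auto
            next
              case d': False
              show ?thesis using 5(3,4) rd a a' dg d d' by (intro wp_run) (auto simp: less_Suc_eq)
            qed
          qed
        qed
      next
        case (7 s)
        then show ?case using ex unfolding good_def by blast
      next
        case 3
        then show ?case using dp_envD(11)[OF e2] by simp
      qed (use \<beta> in \<open>simp_all add: bounded_def\<close>)
    next
      case 3
      then show ?case using dp_envD(11)[OF e1] by simp
    next
      case 4
      then show ?case using 7(2) by (simp add: deg_def)
    qed (use \<beta> in \<open>simp_all add: bounded_def\<close>)
  qed (use \<beta> dp_envD(10)[OF e] in \<open>simp_all add: bounded_def\<close>)
qed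

end

context dp
begin

section \<open>Choosing among the weights\<close>

definition cost :: "nat set \<Rightarrow> int" where
  "cost U = (if 0 < fl then \<bar>sa - sb + int (WX U)\<bar> else max (sa + int (WX U)) (sb - int (WY U)))"

lemma solutions_sub: "U \<in> solutions \<Longrightarrow> U \<subseteq> {..<R}"
  using bag_sub by (fastforce simp: solutions_def RR_def)

text \<open>The justification for keeping only the maximal \<open>WY\<close> per weight: the cost of
  SESM depends on \<open>WX\<close> alone, and in BSM a larger \<open>WY\<close> lowers the second
  argument of the maximum.\<close>

lemma cost_mono: "WX U = WX U' \<Longrightarrow> WY U' \<le> WY U \<Longrightarrow> cost U \<le> cost U'"
  by (auto simp: cost_def simp del: of_nat_sum)

lemma wp_select:
  assumes e: "dp_env s0" and tb: "table s0 n {({}, U) | U. U \<in> solutions}" and nb: "s0 vNB 0 = int (n * (v1 * 2 ^ R))"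
    and bf: "s0 vBF 0 = 0" and \<beta>: "bounded \<beta>"
  shows "wp \<beta> c_select (\<lambda>s. \<exists>U\<in>solutions. s vBU 0 = key U \<and> (\<forall>U'\<in>solutions. cost U \<le> cost U')) s0"
  unfolding c_select_def
proof (rule wp_for[where h = v1 and Inv = "\<lambda>v s. s vBF 0 = 0 \<and> (\<forall>U\<in>solutions. \<not> WX U < v) \<or>
    s vBF 0 = 1 \<and> (\<exists>U\<in>solutions. s vBU 0 = key U \<and> s vBC 0 = cost U \<and> (\<forall>U'\<in>solutions. WX U' < v \<longrightarrow> cost U \<le> cost U'))"], goal_cases)
  case (5 v s)
  have src: "int (n * (v1 * 2 ^ R)) + int v = idx n {} v" by (simp add: idx_def)
  have st: "s vNB 0 + int v = idx n {} v" "s aTY = s0 aTY" "s aTU = s0 aTU" "s vFL 0 = fl" "s vSA 0 = sa" "s vSB 0 = sb" "s lv 0 = int v"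
    using 5(2,3) nb src dp_envD(14-16)[OF e] by simp_all
  show ?case
  proof (cases "0 < s0 aTY (idx n {} v)")
    case False
    have none: "WX U \<noteq> v" if "U \<in> solutions" for U
    proof
      assume v: "WX U = v"
      have "covers s0 n {} U" using tb that by (auto simp: table_def)
      then have "int (WY U) + 1 \<le> s0 aTY (idx n {} v)" using v by (simp add: covers_def)
      then show False using False by linarith
    qed
    then have "WX U < Suc v \<longleftrightarrow> WX U < v" if "U \<in> solutions" for U using that by (auto simp: less_Suc_eq)
    then show ?thesis using st False 5(4) by (intro wp_run) auto
  next
    case True
    then obtain U where U: "U \<in> solutions" "WX U = v" "s0 aTY (idx n {} v) = int (WY U) + 1" "s0 aTU (idx n {} v) = key U"
      using tb 5(1) unfolding table_def sound_def by blast
    have best: "cost U \<le> cost U'" if u': "U' \<in> solutions" "WX U' = v" for U'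
    proof -
      have "covers s0 n {} U'" using tb u' by (auto simp: table_def)
      then have "int (WY U') + 1 \<le> int (WY U) + 1" using U(3) u' by (simp add: covers_def)
      then show ?thesis using cost_mono[of U U'] u' U by (simp del: of_nat_sum)
    qed
    let ?c1 = "vY ::= aTY\<lblot>$vNB \<oplus> $lv\<rblot>"
    let ?c2 = "Cond (Const 0 \<prec> $vFL)
        (vC ::= $vSA \<ominus> $vSB \<oplus> $lv ;; Cond ($vC \<prec> Const 0) (vC ::= Const 0 \<ominus> $vC) Skip)
        (vC ::= $vSA \<oplus> $lv ;;
         Cond ($vC \<prec> $vSB \<ominus> ($vY \<ominus> Const 1)) (vC ::= $vSB \<ominus> ($vY \<ominus> Const 1)) Skip)"
    define s2 where "s2 = run ?c2 (run ?c1 s)"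
    have c2: "s2 vC 0 = cost U" "s2 vBF = s vBF" "s2 vBC = s vBC" "s2 vBU = s vBU" "s2 aTU = s0 aTU" "s2 vNB = s vNB" "s2 lv = s lv"
      using st U by (auto simp: s2_def cost_def max_def simp del: of_nat_sum)
    define c3 where "c3 = Cond (Neg (Conj (Const 0 \<prec> $vBF) (Neg ($vC \<prec> $vBC))))
         (vBF ::= Const 1 ;; vBC ::= $vC ;; vBU ::= aTU\<lblot>$vNB \<oplus> $lv\<rblot>) Skip"
    have split: "U' \<in> solutions \<Longrightarrow> WX U' < Suc v \<Longrightarrow> WX U' < v \<or> cost U \<le> cost U'" for U' using best less_Suc_eq by blast
    have y: "run ?c1 s vY 0 = int (WY U) + 1" using st U by (simp del: of_nat_sum)
    have "run (?c1 ;; Cond (Const 0 \<prec> $vY) (?c2 ;; c3) Skip) s = run c3 s2"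
      unfolding run.simps(3) s2_def using y by (subst run.simps(4)) (simp del: run.simps of_nat_sum, simp only: run.simps(3))
    moreover have "run c3 s2 vBF 0 = 0 \<and> (\<forall>U\<in>solutions. \<not> WX U < Suc v) \<or> run c3 s2 vBF 0 = 1 \<and>
      (\<exists>U\<in>solutions. run c3 s2 vBU 0 = key U \<and> run c3 s2 vBC 0 = cost U \<and> (\<forall>U'\<in>solutions. WX U' < Suc v \<longrightarrow> cost U \<le> cost U'))"
    proof (cases "s vBF 0 = 0 \<or> cost U < s vBC 0")
      case True
      have r: "run c3 s2 vBF 0 = 1" "run c3 s2 vBU 0 = key U" "run c3 s2 vBC 0 = cost U"
        using True c2 st U(4) by (auto simp: c3_def)
      have "cost U \<le> cost U'" if "U' \<in> solutions" "WX U' < Suc v" for U'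
        using split[OF that] 5(4) True that(1) by fastforce
      then show ?thesis using r U(1) by blast
    next
      case False
      then have r: "run c3 s2 = s2" "s vBF 0 = 1" using 5(4) c2 by (auto simp: c3_def)
      obtain U0 where U0: "U0 \<in> solutions" "s vBU 0 = key U0" "s vBC 0 = cost U0" "\<forall>U'\<in>solutions. WX U' < v \<longrightarrow> cost U0 \<le> cost U'"
        using 5(4) r(2) by auto
      have "cost U0 \<le> cost U" using False U0(3) by simp
      then have "cost U0 \<le> cost U'" if "U' \<in> solutions" "WX U' < Suc v" for U' using split[OF that] U0(4) that(1) by fastforce
      then show ?thesis unfolding r(1) using c2 r(2) U0 by auto
    qed
    ultimately show ?thesis unfolding c3_def by (intro wp_run) simp_all
  qed
next
  case (7 s)
  have all: "WX U < v1" if "U \<in> solutions" for U using solutions_sub[OF that] WX_less by blast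
  \<comment> \<open>The empty set guarantees a candidate, so the flag cannot still be
    \<open>0\<close>.\<close>
  have "{} \<in> solutions" by (auto simp: solutions_def closed_in_def)
  then show ?case using 7(2) all by blast
next
  case 4
  then show ?case using bf by simp
qed (use \<beta> dp_envD(12)[OF e] in \<open>simp_all add: bounded_def\<close>)

end

context dp_tree
begin

text \<open>\<open>Al\<close> are the alive nodes, \<open>grp t\<close> the nodes merged into
  \<open>t\<close>, \<open>cbn t\<close> the number of its current table and \<open>n\<close> the
  next free one. The intersection condition on groups is the form that connectedness of a rotation's
  bags takes for merged nodes, and the one that \<open>fam_merge\<close> needs. \<open>vRT\<close>
  always names an alive node, hence in the end the only one.\<close>

definition merged :: "nat \<Rightarrow> state \<Rightarrow> nat set \<Rightarrow> (nat \<Rightarrow> nat set) \<Rightarrow> (nat \<Rightarrow> nat) \<Rightarrow> nat \<Rightarrow> bool" where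
  "merged k s Al grp cbn n \<longleftrightarrow> Al \<subseteq> {..<K} \<and> card Al = K - k \<and>
    (\<forall>t<K. s aAL (int t) = (if t \<in> Al then 1 else 0)) \<and>
    (\<forall>t\<in>Al. t \<in> grp t \<and> grp t \<subseteq> {..<K} \<and> s aCB (int t) = int (cbn t * (v1 * 2 ^ R)) \<and> cbn t < n \<and>
      table s (cbn t) (fam (grp t) t)) \<and>
    (\<Union>t\<in>Al. grp t) = {..<K} \<and>
    (\<forall>t\<in>Al. \<forall>t'\<in>Al. t \<noteq> t' \<longrightarrow> RR (grp t) \<inter> RR (grp t') \<subseteq> set (bg t) \<inter> set (bg t')) \<and>
    s vTOP 0 = int (n * (v1 * 2 ^ R)) \<and> unused s n \<and> connected_on Al T \<and>
    (\<forall>r. connected_on {t \<in> Al. r \<in> set (bg t)} T) \<and> (\<exists>rt\<in>Al. s vRT 0 = int rt)"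

definition minv :: "nat \<Rightarrow> state \<Rightarrow> bool" where
  "minv k s \<longleftrightarrow> (\<exists>Al grp cbn n. merged k s Al grp cbn n)"

lemma mergedD:
  assumes "merged k s Al grp cbn n"
  shows "Al \<subseteq> {..<K}" "card Al = K - k" "\<forall>t<K. s aAL (int t) = (if t \<in> Al then 1 else 0)"
    and "\<And>t. t \<in> Al \<Longrightarrow> t \<in> grp t \<and> grp t \<subseteq> {..<K} \<and> s aCB (int t) = int (cbn t * (v1 * 2 ^ R)) \<and> cbn t < n \<and>
      table s (cbn t) (fam (grp t) t)" and "(\<Union>t\<in>Al. grp t) = {..<K}"
    and "\<And>t t'. t \<in> Al \<Longrightarrow> t' \<in> Al \<Longrightarrow> t \<noteq> t' \<Longrightarrow> RR (grp t) \<inter> RR (grp t') \<subseteq> set (bg t) \<inter> set (bg t')"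
    and "s vTOP 0 = int (n * (v1 * 2 ^ R))" "unused s n" and "connected_on Al T"
    and "\<And>r. connected_on {t \<in> Al. r \<in> set (bg t)} T" and "\<exists>rt\<in>Al. s vRT 0 = int rt"
  using assms unfolding merged_def by (simp_all del: of_nat_mult)

lemma wp_merge_step:
  assumes e: "dp_env s" and inv: "minv k s" and k: "k < K - 1" and \<beta>: "bounded \<beta>"
  shows "wp \<beta> (c_leaf ;;
      vVQ ::= $vLP ;; c_mark ;; vVT ::= $vLU ;; c_forget ;;
      vVQ ::= $vLU ;; c_mark ;; vVT ::= $vLP ;; c_join ;;
      aAL\<lblot>$vLU\<rblot> :== Const 0 ;; vRT ::= $vLP) (minv (Suc k)) s"
proof -
  obtain Al grp cbn n where m: "merged k s Al grp cbn n" using inv unfolding minv_def by blast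
  note Al = mergedD(1-3)[OF m] and g = mergedD(4)[OF m] and un = mergedD(5)[OF m] and sep = mergedD(6)[OF m]
    and top = mergedD(7,8)[OF m] and con = mergedD(9)[OF m] and conr = mergedD(10)[OF m]
  have finAl: "finite Al" using Al(1) finite_subset by blast
  have "\<not> card Al \<le> Suc 0" using Al(2) k by simp
  then obtain a b where ab: "a \<in> Al" "b \<in> Al" "a \<noteq> b" using card_le_Suc0_iff_eq[OF finAl] by blast
  have bnd: "length (bg t) \<le> \<beta> lb" "R \<le> \<beta> lr" if "t < K" for t using \<beta> that by (auto simp: bounded_def)
  show ?thesis
  proof (rule wp_seq_conseq[OF wp_leaf[OF e Al(3,1) ab con \<beta>]])
    fix s1 assume f1: "\<And>a. \<not> wr c_leaf a \<Longrightarrow> s1 a = s a" and "\<exists>u p. s1 vLU 0 = int u \<and> s1 vLP 0 = int p \<and> u \<in> Al \<and> p \<in> Al \<and>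
      u \<noteq> p \<and> (\<forall>v\<in>Al. {u, v} \<in> T \<longrightarrow> v = p)"
    then obtain u p where up: "s1 vLU 0 = int u" "s1 vLP 0 = int p" "u \<in> Al" "p \<in> Al" "u \<noteq> p"
      and leaf: "\<forall>v\<in>Al. {u, v} \<in> T \<longrightarrow> v = p" by blast
    have uK: "u < K" "p < K" using up Al by auto
    let ?bp = "set (bg p)" and ?bu = "set (bg u)" and ?Gu = "fam (grp u) u" and ?Gp = "fam (grp p) p"
    have e1: "dp_env s1" by (rule dp_env_frame[OF e]) (auto simp: f1 c_leaf_def)
    have s1: "s1 aTY = s aTY" "s1 aTU = s aTU" "s1 aCB = s aCB" "s1 vTOP = s vTOP" "s1 aAL = s aAL"
      by (simp_all add: f1 c_leaf_def)
    let ?s1 = "run (vVQ ::= $vLP) s1"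
    have e1': "dp_env ?s1" by (rule dp_env_frame[OF e1]) auto
    have q1: "?s1 vVQ 0 = int p" using up by simp
    show "wp \<beta> (vVQ ::= $vLP ;; c_mark ;; vVT ::= $vLU ;; c_forget ;;
      vVQ ::= $vLU ;; c_mark ;; vVT ::= $vLP ;; c_join ;;
      aAL\<lblot>$vLU\<rblot> :== Const 0 ;; vRT ::= $vLP) (minv (Suc k)) s1"
    proof (rule wp_seq_run, simp, rule wp_seq_conseq[OF wp_mark[OF e1' q1 uK(2) bnd(2)[OF uK(2)] bnd(1)[OF uK(2)]]])
      fix s2 assume f2: "\<And>a. \<not> wr c_mark a \<Longrightarrow> s2 a = ?s1 a" and m2: "marked s2 ?bp"
      let ?s2 = "run (vVT ::= $vLU) s2"
      have s2: "?s2 aTY = s aTY" "?s2 aTU = s aTU" "?s2 aCB = s aCB" "?s2 vTOP = s vTOP" "?s2 aAL = s aAL"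
        "?s2 vVT 0 = int u" "?s2 vLU 0 = int u" "?s2 vLP 0 = int p"
        using s1 up by (simp_all add: f2 c_mark_def)
      have e2: "dp_env ?s2" by (rule dp_env_frame[OF e1]) (auto simp: f2 c_mark_def)
      have m2': "marked ?s2 ?bp" using m2 by (simp add: marked_def)
      have cb2: "?s2 aCB (int u) = int (cbn u * (v1 * 2 ^ R))" "cbn u < n" using s2 g[OF up(3)] by auto
      have t2: "table ?s2 (cbn u) ?Gu" using g[OF up(3)] table_cong[OF s2(1,2)] by blast
      have G2: "\<And>S U. (S, U) \<in> ?Gu \<Longrightarrow> S \<subseteq> ?bu \<and> U \<subseteq> {..<R} \<and> U \<inter> S = {}" using fam_sub[OF _ uK(1)] g[OF up(3)] by blast
      have top2: "?s2 vTOP 0 = int (n * (v1 * 2 ^ R))" using top s2 by simp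
      have un2: "unused ?s2 n" using top(2) s2(1) unfolding unused_def by metis
      show "wp \<beta> (vVT ::= $vLU ;; c_forget ;;
        vVQ ::= $vLU ;; c_mark ;; vVT ::= $vLP ;; c_join ;;
        aAL\<lblot>$vLU\<rblot> :== Const 0 ;; vRT ::= $vLP) (minv (Suc k)) s2"
      proof (rule wp_seq_run, simp, rule wp_seq_conseq[OF wp_forget[OF e2 s2(6) uK(1) cb2 t2 G2 m2' top2 un2 \<beta>]], assumption)
        fix s3 assume f3: "\<And>a. \<not> wr c_forget a \<Longrightarrow> s3 a = ?s2 a" and p3: "table s3 n (fgt ?bp ?Gu) \<and> same_below ?s2 s3 n \<and>
          unused s3 (Suc n) \<and> s3 vTOP 0 = int (Suc n * (v1 * 2 ^ R)) \<and> s3 vNB 0 = int (n * (v1 * 2 ^ R))"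
        let ?s3 = "run (vVQ ::= $vLU) s3"
        have e3: "dp_env ?s3" by (rule dp_env_frame[OF e2]) (auto simp: f3 c_forget_def c_decode_def)
        have s3: "s3 aCB = s aCB" "s3 aAL = s aAL" "s3 vLU 0 = int u" "s3 vLP 0 = int p"
          using s2 by (simp_all add: f3 c_forget_def c_decode_def del: run.simps)
        have q3: "?s3 vVQ 0 = int u" using s3 by simp
        show "wp \<beta> (vVQ ::= $vLU ;; c_mark ;; vVT ::= $vLP ;; c_join ;;
          aAL\<lblot>$vLU\<rblot> :== Const 0 ;; vRT ::= $vLP) (minv (Suc k)) s3"
        proof (rule wp_seq_run, simp, rule wp_seq_conseq[OF wp_mark[OF e3 q3 uK(1) bnd(2)[OF uK(1)] bnd(1)[OF uK(1)]]])
          fix s4 assume f4: "\<And>a. \<not> wr c_mark a \<Longrightarrow> s4 a = ?s3 a" and m4: "marked s4 ?bu"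
          let ?s4 = "run (vVT ::= $vLP) s4"
          have s4: "?s4 aTY = s3 aTY" "?s4 aTU = s3 aTU" "?s4 aCB = s aCB" "?s4 vTOP = s3 vTOP" "?s4 aAL = s aAL"
            "?s4 vVT 0 = int p" "?s4 vLU 0 = int u" "?s4 vLP 0 = int p" "?s4 vNB = s3 vNB"
            using s3 by (simp_all add: f4 c_mark_def)
          have e4: "dp_env ?s4" by (rule dp_env_frame[OF e3]) (auto simp: f4 c_mark_def)
          have m4': "marked ?s4 ?bu" using m4 by (simp add: marked_def)
          have cb4: "?s4 aCB (int p) = int (cbn p * (v1 * 2 ^ R))" "cbn p < Suc n" using s4 g[OF up(4)] by auto
          have nb4: "?s4 vNB 0 = int (n * (v1 * 2 ^ R))" using s4 p3 by simp
          have sb: "same_below s s3 n" using p3 s2(1,2) unfolding same_below_def by simp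
          have told: "table ?s4 (cbn t) (fam (grp t) t)" if "t \<in> Al" for t
            using table_same_below[OF _ sb] g[OF that] table_cong[OF s4(1,2)] by blast
          have t4: "table ?s4 n (fgt ?bp ?Gu)" using p3 table_cong[OF s4(1,2)] by blast
          have Gp: "\<And>S U. (S, U) \<in> ?Gp \<Longrightarrow> S \<subseteq> ?bp \<and> U \<subseteq> {..<R}" using fam_sub[OF _ uK(2)] g[OF up(4)] by blast
          have F4: "\<And>S U. (S, U) \<in> fgt ?bp ?Gu \<Longrightarrow> U \<subseteq> {..<R}" using t4 by (auto simp: table_def)
          have pg: "p \<in> grp p" "u \<in> grp u" using g up by auto
          have spu: "RR (grp p) \<inter> RR (grp u) \<subseteq> ?bp \<inter> ?bu" using sep[OF up(4,3)] up(5) by blast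
          have top4: "?s4 vTOP 0 = int (Suc n * (v1 * 2 ^ R))" using p3 s4 by simp
          have un4: "unused ?s4 (Suc n)" using p3 s4(1) unfolding unused_def by metis
          have nn: "n < Suc n" by simp
          show "wp \<beta> (vVT ::= $vLP ;; c_join ;; aAL\<lblot>$vLU\<rblot> :== Const 0 ;; vRT ::= $vLP) (minv (Suc k)) s4"
          proof (rule wp_seq_run, simp, rule wp_seq_conseq[OF wp_join[OF e4 s4(6) uK(2) cb4 nb4 nn told[OF up(4)] t4 Gp F4
                fam_disjoint[OF pg spu] m4' top4 un4 \<beta>]], assumption, assumption, assumption, assumption)
            fix s5 assume f5: "\<And>a. \<not> wr c_join a \<Longrightarrow> s5 a = ?s4 a"
              and p5: "table s5 (Suc n) (jn ?bu ?Gp (fgt ?bp ?Gu)) \<and> same_below ?s4 s5 (Suc n) \<and> unused s5 (Suc (Suc n)) \<and>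
                s5 vTOP 0 = int (Suc (Suc n) * (v1 * 2 ^ R)) \<and> s5 aCB = (?s4 aCB)(int p := int (Suc n * (v1 * 2 ^ R)))"
            have s5: "s5 aAL = s aAL" "s5 vLU 0 = int u" "s5 vLP 0 = int p" "s5 aCB = (s aCB)(int p := int (Suc n * (v1 * 2 ^ R)))"
              using s4 p5 by (simp_all add: f5 c_join_def c_decode_def del: run.simps)
            let ?s6 = "run (aAL\<lblot>$vLU\<rblot> :== Const 0 ;; vRT ::= $vLP) s5"
            have s6: "?s6 aTY = s5 aTY" "?s6 aTU = s5 aTU" "?s6 aCB = (s aCB)(int p := int (Suc n * (v1 * 2 ^ R)))"
              "?s6 vTOP = s5 vTOP" "?s6 aAL = (s aAL)(int u := 0)" "?s6 vRT 0 = int p" using s5 by simp_all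
            define Al' where "Al' = Al - {u}"
            define grp' where "grp' = grp(p := grp p \<union> grp u)"
            define cbn' where "cbn' = cbn(p := Suc n)"
            have tp: "table ?s6 (Suc n) (fam (grp' p) p)"
              using p5 table_cong[OF s6(1,2)] fam_merge[OF pg spu] by (simp add: grp'_def del: run.simps)
            have to: "table ?s6 (cbn t) (fam (grp t) t)" if "t \<in> Al" for t
            proof -
              have "cbn t < Suc n" using g[OF that] by auto
              then have "table s5 (cbn t) (fam (grp t) t)" using table_same_below[OF told[OF that]] p5 by blast
              then show ?thesis using table_cong[OF s6(1,2)] by blast
            qed
            have RRp: "RR (grp' p) = RR (grp p) \<union> RR (grp u)" by (auto simp: RR_def grp'_def)
            \<comment> \<open>A rotation shared by the leaf's group and another group lies in the
              bags of both representatives by the old invariant, and the walk between them passes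
              \<open>p\<close>.\<close>
            have move: "RR (grp u) \<inter> RR (grp t) \<subseteq> ?bp \<inter> set (bg t)" if t: "t \<in> Al" "t \<noteq> u" for t
            proof
              fix r assume "r \<in> RR (grp u) \<inter> RR (grp t)"
              then have r: "r \<in> ?bu" "r \<in> set (bg t)" using sep[OF up(3) t(1)] t(2) by blast+
              have S: "\<forall>v\<in>{t \<in> Al. r \<in> set (bg t)}. {u, v} \<in> T \<longrightarrow> v = p" "u \<in> {t \<in> Al. r \<in> set (bg t)}" "t \<in> {t \<in> Al. r \<in> set (bg t)}"
                using leaf r t up(3) by auto
              have "p \<in> {t \<in> Al. r \<in> set (bg t)}"
                using leaf_neighbour[OF conr S] t(2) by blast
              then show "r \<in> ?bp \<inter> set (bg t)" using r by blast
            qed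
            have sepp: "RR (grp' p) \<inter> RR (grp t) \<subseteq> ?bp \<inter> set (bg t)" if t: "t \<in> Al" "t \<noteq> u" "t \<noteq> p" for t
              unfolding RRp using move[OF t(1,2)] sep[OF up(4) t(1)] t(3) by blast
            have "merged (Suc k) ?s6 Al' grp' cbn' (Suc (Suc n))" unfolding merged_def
            proof (intro conjI)
              show "Al' \<subseteq> {..<K}" using Al by (auto simp: Al'_def)
              show "card Al' = K - Suc k" using Al(2) up(3) finAl by (simp add: Al'_def card_Diff_singleton)
              show "\<forall>t<K. ?s6 aAL (int t) = (if t \<in> Al' then 1 else 0)" unfolding s6(5) using Al(3) by (auto simp: Al'_def)
              show "\<forall>t\<in>Al'. t \<in> grp' t \<and> grp' t \<subseteq> {..<K} \<and> ?s6 aCB (int t) = int (cbn' t * (v1 * 2 ^ R)) \<and> cbn' t < Suc (Suc n) \<and>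
                table ?s6 (cbn' t) (fam (grp' t) t)"
              proof
                fix t assume "t \<in> Al'"
                then have t: "t \<in> Al" "t \<noteq> u" by (auto simp: Al'_def)
                show "t \<in> grp' t \<and> grp' t \<subseteq> {..<K} \<and> ?s6 aCB (int t) = int (cbn' t * (v1 * 2 ^ R)) \<and> cbn' t < Suc (Suc n) \<and>
                  table ?s6 (cbn' t) (fam (grp' t) t)"
                proof (cases "t = p")
                  case True
                  then show ?thesis unfolding s6(3) using tp g[OF up(3)] g[OF up(4)] by (auto simp: grp'_def cbn'_def simp del: run.simps)
                next
                  case False
                  then show ?thesis unfolding s6(3) using to[OF t(1)] g[OF t(1)] by (auto simp: grp'_def cbn'_def simp del: run.simps)
                qed
              qed
              show "(\<Union>t\<in>Al'. grp' t) = {..<K}"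
              proof -
                have "(\<Union>t\<in>Al'. grp' t) = (\<Union>t\<in>Al. grp t)" using up(3-5) by (auto simp: Al'_def grp'_def)
                then show ?thesis using un by simp
              qed
              show "\<forall>t\<in>Al'. \<forall>t'\<in>Al'. t \<noteq> t' \<longrightarrow> RR (grp' t) \<inter> RR (grp' t') \<subseteq> set (bg t) \<inter> set (bg t')"
              proof (intro ballI impI)
                fix t t' assume "t \<in> Al'" "t' \<in> Al'" and ne: "t \<noteq> t'"
                then have t: "t \<in> Al" "t \<noteq> u" "t' \<in> Al" "t' \<noteq> u" by (auto simp: Al'_def)
                show "RR (grp' t) \<inter> RR (grp' t') \<subseteq> set (bg t) \<inter> set (bg t')"
                proof (cases "t = p \<or> t' = p")
                  case True
                  then show ?thesis
                  proof
                    assume "t = p"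
                    then show ?thesis using sepp[OF t(3,4)] ne by (simp add: grp'_def)
                  next
                    assume "t' = p"
                    then show ?thesis using sepp[OF t(1,2)] ne by (simp add: grp'_def Int_commute)
                  qed
                next
                  case False
                  then show ?thesis using sep[OF t(1,3) ne] by (simp add: grp'_def)
                qed
              qed
              show "?s6 vTOP 0 = int (Suc (Suc n) * (v1 * 2 ^ R))" unfolding s6(4) using p5 by blast
              show "unused ?s6 (Suc (Suc n))" using p5 s6(1) unfolding unused_def by metis
              show "connected_on Al' T" unfolding Al'_def by (rule connected_remove_leaf[OF con leaf up(5)])
              show "\<forall>r. connected_on {t \<in> Al'. r \<in> set (bg t)} T"
              proof
                fix r
                have "{t \<in> Al'. r \<in> set (bg t)} = {t \<in> Al. r \<in> set (bg t)} - {u}" by (auto simp: Al'_def)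
                then show "connected_on {t \<in> Al'. r \<in> set (bg t)} T"
                  using connected_remove_leaf[OF conr _ up(5), of r] leaf by simp
              qed
              show "\<exists>rt\<in>Al'. ?s6 vRT 0 = int rt" unfolding s6(6) using up(4,5) by (auto simp: Al'_def)
            qed
            then have "minv (Suc k) ?s6" unfolding minv_def by blast
            then show "wp \<beta> (aAL\<lblot>$vLU\<rblot> :== Const 0 ;; vRT ::= $vLP) (minv (Suc k)) s5" by (rule wp_run[rotated]) simp
          qed
        qed
      qed
    qed
  qed
qed

lemma minv_upd: "a \<notin> {aAL, aCB, aTY, aTU, vTOP, vRT} \<Longrightarrow> minv k s \<Longrightarrow> minv k (s(a := f))"
proof -
  assume a: "a \<notin> {aAL, aCB, aTY, aTU, vTOP, vRT}" and m: "minv k s"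
  have ne: "aAL \<noteq> a" "aCB \<noteq> a" "aTY \<noteq> a" "aTU \<noteq> a" "vTOP \<noteq> a" "vRT \<noteq> a" using a by auto
  have "table (s(a := f)) n G \<longleftrightarrow> table s n G" for n G by (rule table_cong) (use ne in simp_all)
  moreover have "unused (s(a := f)) n \<longleftrightarrow> unused s n" for n using ne by (simp add: unused_def)
  ultimately show ?thesis using m ne unfolding minv_def merged_def by simp
qed

lemma wp_merge:
  assumes e: "dp_env s0" and top: "s0 vTOP 0 = int (K * (v1 * 2 ^ R))" "unused s0 K" and rt: "s0 vRT 0 = 0"
    and t0: "\<forall>t<K. s0 aCB (int t) = int (t * (v1 * 2 ^ R)) \<and> s0 aAL (int t) = 1 \<and> table s0 t (leafs t)" and \<beta>: "bounded \<beta>"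
  shows "wp \<beta> c_merge (\<lambda>s. \<exists>n. table s n {({}, U) | U. U \<in> solutions} \<and> s vNB 0 = int (n * (v1 * 2 ^ R))) s0"
proof -
  have K: "0 < K" using tree by (auto simp: is_tree_def)
  have wrs: "\<not> wr (c_leaf ;; vVQ ::= $vLP ;; c_mark ;; vVT ::= $vLU ;; c_forget ;; vVQ ::= $vLU ;; c_mark ;; vVT ::= $vLP ;; c_join ;;
      aAL\<lblot>$vLU\<rblot> :== Const 0 ;; vRT ::= $vLP) a \<and> a \<noteq> ls"
    if "a \<in> {''input'', vNR, vNK, vNE, vV1, vST, vFL, vSA, vSB, vEO, aBO, aBL, aBG, aWX, aWY, aPW, aP2, aHV, aX, aXB, aHM}" for a
    using that by (elim insertE emptyE; simp add: c_leaf_def c_mark_def c_forget_def c_decode_def c_join_def)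
  show ?thesis unfolding c_merge_def
  proof (rule wp_seq, rule wp_for[where h = "K - 1" and Inv = minv], goal_cases)
    case 1
    then show ?case by (simp add: c_leaf_def c_mark_def c_forget_def c_decode_def c_join_def)
  next
    case 2
    have "K \<le> \<beta> ls" using \<beta> by (simp add: bounded_def)
    then show ?case by linarith
  next
    case (3 s)
    have "dp_env s" by (rule dp_env_frame[OF e], rule 3) (use wrs in blast)+
    then show ?case using K dp_envD(10) by (simp add: of_nat_diff)
  next
    case 4
    show ?case unfolding minv_def merged_def
    proof (intro exI[of _ "{..<K}"] exI[of _ "\<lambda>t. {t}"] exI[of _ "\<lambda>t. t"] exI[of _ K] conjI)
      show "connected_on {..<K} T" using tree by (simp add: is_tree_def)
      show "\<forall>r. connected_on {t \<in> {..<K}. r \<in> set (bg t)} T" using conn by blast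
      \<comment> \<open>With a single bag no merge happens and \<open>vRT\<close> keeps its initial
        value \<open>0\<close>, which is then the right node.\<close>
      show "\<exists>r\<in>{..<K}. s0 vRT 0 = int r" using rt K by (intro bexI[of _ 0]) auto
    qed (use t0 top leafs_fam in \<open>auto simp: RR_def\<close>)
  next
    case (5 k s)
    have "dp_env s" by (rule dp_env_frame[OF e], rule 5) (use wrs in blast)+
    then show ?case by (rule wp_merge_step[OF _ 5(4,1) \<beta>])
  next
    case (6 k s f)
    then show ?case by (intro minv_upd) simp_all
  next
    case (7 s)
    have e1: "dp_env s" by (rule dp_env_frame[OF e], rule 7) (use wrs in blast)+
    obtain Al grp cbn n where m: "merged (K - 1) s Al grp cbn n" using 7(2) unfolding minv_def by blast
    note Al = mergedD(1,2)[OF m] and g = mergedD(4)[OF m] and un = mergedD(5)[OF m] and tp = mergedD(7,8)[OF m]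
    obtain t where t: "t \<in> Al" "s vRT 0 = int t" using mergedD(11)[OF m] by blast
    have "card Al = 1" using Al(2) K by simp
    then have "Al = {t}" using t(1) by (auto simp: card_1_singleton_iff)
    then have gt: "grp t = {..<K}" using un by simp
    have tK: "t < K" using t Al by auto
    show ?case
    proof (rule wp_seq, rule wp_for[where h = R and Inv = "\<lambda>k s. \<forall>r<k. s aMK (int r) = 0"], goal_cases)
      case (5 k s)
      then show ?case by (intro wp_run) (auto simp: less_Suc_eq)
    next
      case (7 s1)
      let ?s1 = "run (vVT ::= $vRT) s1"
      have e2: "dp_env ?s1" by (rule dp_env_frame[OF e1]) (auto simp: 7(1))
      have s1: "?s1 aTY = s aTY" "?s1 aTU = s aTU" "?s1 aCB = s aCB" "?s1 vTOP = s vTOP" "?s1 vVT 0 = int t"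
        using 7(1) t(2) by simp_all
      have m: "marked ?s1 {}" using 7(2) by (simp add: marked_def)
      have tb: "table ?s1 (cbn t) (fam {..<K} t)" using g[OF t(1)] table_cong[OF s1(1,2)] gt by metis
      have cb: "?s1 aCB (int t) = int (cbn t * (v1 * 2 ^ R))" "cbn t < n" using g[OF t(1)] s1(3) by auto
      have un1: "unused ?s1 n" using tp(2) s1(1) unfolding unused_def by metis
      have top1: "?s1 vTOP 0 = int (n * (v1 * 2 ^ R))" using tp(1) s1(4) by simp
      have "wp \<beta> c_forget (\<lambda>s. table s n (fgt {} (fam {..<K} t)) \<and> same_below ?s1 s n \<and> unused s (Suc n) \<and>
        s vTOP 0 = int (Suc n * (v1 * 2 ^ R)) \<and> s vNB 0 = int (n * (v1 * 2 ^ R))) ?s1"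
        by (rule wp_forget[OF e2 s1(5) tK cb tb fam_sub[OF order_refl tK] m top1 un1 \<beta>])
      then have "wp \<beta> c_forget (\<lambda>s. \<exists>n. table s n {({}, U) | U. U \<in> solutions} \<and> s vNB 0 = int (n * (v1 * 2 ^ R))) ?s1"
        by (rule wp_conseq) (auto simp: fgt_all)
      then show ?case by (rule wp_seq_run[rotated]) simp
    qed (use \<beta> dp_envD(9)[OF e1] in \<open>simp_all add: bounded_def\<close>)
  qed
qed

end

section \<open>Output\<close>

lemma set_encode_Suc:
  "set_encode (U \<inter> {..<Suc i}) = (if i \<in> U then 2 ^ i else 0) + set_encode (U \<inter> {..<i})"
proof -
  have "U \<inter> {..<Suc i} = (if i \<in> U then insert i (U \<inter> {..<i}) else U \<inter> {..<i})" by (auto simp: less_Suc_eq)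
  then show ?thesis by (simp add: set_encode_insert)
qed

context solving
begin

text \<open>The digits of \<open>vBU\<close> below \<open>i\<close> amount to less than
  \<open>v * 2 ^ i\<close>, so a comparison decides whether rotation \<open>i\<close> is selected.
  \<open>x k\<close> is the maximum of \<open>best\<close> and the selected rotations among the last
  \<open>k\<close>.\<close>

lemma wp_output:
  assumes e: "env s0" and nr: "s0 vNR 0 = int (length rl)" and r0: "row s0 0 best"
    and rows: "\<forall>r<length rl. s0 aXB (int r) = int (Suc r) * int nm \<and> row s0 (int (Suc r) * int nm) (clr (rl ! r))"
    and pw: "\<forall>r<length rl. s0 aPW (int r) = int (v * 2 ^ r)" and v: "0 < v"
    and bu: "s0 vBU 0 = int (v * set_encode U)" and U: "U \<subseteq> {..<length rl}"
    and out: "s0 ''output'' = (\<lambda>_. 0)" and st: "valid (joinv ((!) rl ` U))"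
    and \<beta>: "nm \<le> \<beta> lm" "length rl \<le> \<beta> lr"
  shows "wp \<beta> c_output (\<lambda>s. output_matching I s = mat (joinv ((!) rl ` U))) s0"
  unfolding c_output_def
proof (rule wp_seq, rule wp_for[where h = nm and Inv = "\<lambda>k s. \<forall>m<k. s aO (int m) = int (best m)"], goal_cases)
  case (5 k s)
  then show ?case using r0 by (intro wp_run) (auto simp: less_Suc_eq row_def)
next
  case (7 s1)
  let ?n = "length rl"
  define x where "x k m = Max (insert (best m) ((\<lambda>r. clr (rl ! r) m) ` (U \<inter> {?n - k..<?n})))" for k m
  have x0: "x 0 m = best m" for m by (simp add: x_def)
  have xS: "x (Suc k) m = (if ?n - Suc k \<in> U then max (clr (rl ! (?n - Suc k)) m) (x k m) else x k m)" if "k < ?n" for k m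
  proof -
    have "{?n - Suc k..<?n} = insert (?n - Suc k) {?n - k..<?n}" using that by auto
    then have "insert (best m) ((\<lambda>r. clr (rl ! r) m) ` (U \<inter> {?n - Suc k..<?n})) =
      (if ?n - Suc k \<in> U then insert (clr (rl ! (?n - Suc k)) m) (insert (best m) ((\<lambda>r. clr (rl ! r) m) ` (U \<inter> {?n - k..<?n})))
       else insert (best m) ((\<lambda>r. clr (rl ! r) m) ` (U \<inter> {?n - k..<?n})))" by auto
    then show ?thesis by (simp add: x_def)
  qed
  have xn: "x ?n m = joinv ((!) rl ` U) m" for m
    using U by (simp add: x_def joinv_def image_image Int_absorb2 lessThan_atLeast0)
  have e1: "env s1" by (rule env_frame[OF e]) (auto simp: 7(1))
  have s1: "s1 vNR 0 = int ?n" "s1 vBU 0 = int (v * set_encode U)" "s1 aXB = s0 aXB" "s1 aX = s0 aX" "s1 aPW = s0 aPW" "s1 ''output'' = (\<lambda>_. 0)"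
    using 7(1) nr bu out by simp_all
  show ?case
  proof (rule wp_seq_run, simp, rule wp_seq, rule wp_for[where h = ?n and Inv = "\<lambda>k s. s vLD 0 = int (?n - k) \<and>
      s vBU 0 = int (v * set_encode (U \<inter> {..<?n - k})) \<and> (\<forall>m<nm. s aO (int m) = int (x k m))"], goal_cases)
    case 4
    then show ?case using 7(2) s1 U x0 by (simp add: Int_absorb2)
  next
    case (5 k s)
    note o = this
    define i where "i = ?n - Suc k"
    have i: "i < ?n" "?n - k = Suc i" "int (?n - k) - 1 = int i" using o(1) by (auto simp: i_def)
    have e2: "env s" by (rule env_frame[OF e1]) (auto simp: o(2))
    have s2: "s aPW (int i) = int (v * 2 ^ i)" "s aXB (int i) = int (Suc i) * int nm" "row s (int (Suc i) * int nm) (clr (rl ! i))"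
      using o(2) s1 pw rows i(1) by (simp_all add: row_def)
    let ?E = "set_encode (U \<inter> {..<i})"
    have El: "?E < 2 ^ i" by (rule set_encode_less) auto
    have bu2: "s vBU 0 = int (v * ((if i \<in> U then 2 ^ i else 0) + ?E))" using o(4) i(2) set_encode_Suc[of U i] by simp
    let ?c = "vLD ::= $vLD \<ominus> Const 1 ;;
      Cond ($vBU \<prec> aPW\<lblot>$vLD\<rblot>) (vSE ::= Const 0) (vBU ::= $vBU \<ominus> aPW\<lblot>$vLD\<rblot> ;; vSE ::= Const 1)"
    let ?s = "run ?c s"
    have "v * ?E < v * 2 ^ i" using El v by simp
    then have lt: "int (v * ?E) < int (v * 2 ^ i)" by (simp only: of_nat_less_iff)
    have s3: "?s vLD 0 = int i" "?s vBU 0 = int (v * ?E)" "?s vSE 0 = (if i \<in> U then 1 else 0)"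
      "?s aO = s aO" "?s aX = s aX" "?s aXB = s aXB"
    proof -
      have ld: "s vLD 0 - 1 = int i" using o(4) i(3) by simp
      have b: "s vBU 0 = (if i \<in> U then int (v * 2 ^ i) else 0) + int (v * ?E)" using bu2 by (simp add: distrib_left)
      have "s vBU 0 < s aPW (int i) \<longleftrightarrow> i \<notin> U" using b lt s2(1) by (auto simp del: of_nat_mult of_nat_power)
      then show "?s vLD 0 = int i" "?s vBU 0 = int (v * ?E)" "?s vSE 0 = (if i \<in> U then 1 else 0)"
        "?s aO = s aO" "?s aX = s aX" "?s aXB = s aXB"
        using ld b s2(1) by (auto simp del: of_nat_mult of_nat_power)
    qed
    have e3: "env ?s" by (rule env_frame[OF e2]) auto
    have rw: "row ?s (int (Suc i) * int nm) (clr (rl ! i))" "?s aXB (int i) = int (Suc i) * int nm"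
      using s2(2,3) s3(5,6) by (simp_all add: row_def del: run.simps)
    have "wp \<beta> (For lm $vNM (
        Cond (Conj (Const 0 \<prec> $vSE) (aO\<lblot>$lm\<rblot> \<prec> aX\<lblot>aXB\<lblot>$vLD\<rblot> \<oplus> $lm\<rblot>))
          (aO\<lblot>$lm\<rblot> :== aX\<lblot>aXB\<lblot>$vLD\<rblot> \<oplus> $lm\<rblot>) Skip)) (\<lambda>s. s vLD 0 = int (?n - Suc k) \<and>
      s vBU 0 = int (v * set_encode (U \<inter> {..<?n - Suc k})) \<and> (\<forall>m<nm. s aO (int m) = int (x (Suc k) m))) ?s"
    proof (rule wp_for[where h = nm and Inv = "\<lambda>j s. \<forall>m<nm. s aO (int m) = int (if m < j then x (Suc k) m else x k m)"], goal_cases)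
      case 3
      then show ?case using e3 by (simp add: env_def del: run.simps)
    next
      case 4
      then show ?case using o(4) s3(4) by simp
    next
      case (5 j s')
      have "s' vLD 0 = int i" "s' vSE 0 = (if i \<in> U then 1 else 0)" "s' aX (int (Suc i) * int nm + int j) = int (clr (rl ! i) j)"
        "s' aXB (int i) = int (Suc i) * int nm"
        using 5(1,2) s3 rw by (simp_all add: row_def del: run.simps)
      then show ?case using 5(1,3,4) xS[OF o(1), of j, folded i_def] by (intro wp_run) (auto simp: less_Suc_eq max_def)
    next
      case (7 s')
      then show ?case using s3 by (simp add: i_def del: run.simps)
    qed (use \<beta> in simp_all)
    note close = this[unfolded run.simps(3)]
    show ?case by (rule wp_seq_run, simp, rule wp_seq_run, simp) (rule close)
  next
    case (7 s2)
    have ao: "\<forall>m<nm. s2 aO (int m) = int (joinv ((!) rl ` U) m)" using 7(2) xn by simp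
    have e2: "env s2" by (rule env_frame[OF e1]) (auto simp: 7(1))
    have o2: "s2 ''output'' = (\<lambda>_. 0)" using 7(1) s1 by simp
    let ?x = "joinv ((!) rl ` U)"
    define pr where "pr m = (if ?x m \<le> len m then int (mprefs I ! m ! (?x m - 1)) + 1 else 0)" for m
    show ?case
    proof (rule wp_for[where h = nm and Inv = "\<lambda>k s. \<forall>m<nm. s ''output'' (int m) = (if m < k then pr m else 0)"], goal_cases)
      case (5 k s)
      have "env s" by (rule env_frame[OF e2]) (auto simp: 5(2))
      moreover have "s aO (int k) = int (?x k)" using ao 5(1,2) by simp
      moreover have "1 \<le> ?x k" using st 5(1) by (simp add: valid_def)
      ultimately show ?case using 5(1,3,4) xi_woman[OF 5(1), of "?x k"]
        by (intro wp_run) (auto simp: env_def xi_men pr_def less_Suc_eq)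
    next
      case (7 s)
      show ?case
      proof (intro set_eqI iffI)
        fix p assume "p \<in> output_matching I s"
        then obtain m w where p: "p = (m, w)" "m < nm" "s ''output'' (int m) = int w + 1" by (auto simp: output_matching_def)
        then have "?x m \<le> len m" "w = mprefs I ! m ! (?x m - 1)" using 7(2) by (auto simp: pr_def split: if_splits)
        then show "p \<in> mat ?x" using woman_at[OF p(2), of "?x m"] st p by (auto simp: mat_def valid_def)
      next
        fix p assume "p \<in> mat ?x"
        then obtain m w where p: "p = (m, w)" "acc m w" "?x m = mpos I m w" by (auto simp: mat_def)
        have m: "m < nm" using p(2) by (simp add: acc_iff)
        have l: "1 \<le> ?x m" "?x m \<le> len m" using p mpos_bounds[OF p(2)] by simp_all
        then have "w = mprefs I ! m ! (?x m - 1)" using woman_at[OF m l] p mpos_inject by metis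
        then show "p \<in> output_matching I s" using 7(2) m l p(1) by (simp add: output_matching_def pr_def)
      qed
    qed (use e2 o2 \<beta> in \<open>simp_all add: env_def\<close>)
  qed (use s1 \<beta> in simp_all)
qed (use e \<beta> in \<open>simp_all add: env_def\<close>)

end

section \<open>The size of a program\<close>

text \<open>The order of magnitude of \<open>tb\<close>: sums become maxima and the sizes of
  expressions are dropped, leaving products of loop bounds.\<close>

fun sz :: "(string \<Rightarrow> nat) \<Rightarrow> com \<Rightarrow> nat" where
  "sz \<beta> (Seq c d) = max (sz \<beta> c) (sz \<beta> d)"
| "sz \<beta> (Cond b c d) = max (sz \<beta> c) (sz \<beta> d)"
| "sz \<beta> (While b c) = \<beta> (loop_var b) * sz \<beta> c"
| "sz \<beta> _ = 1"

lemma sz_For [simp]: "sz \<beta> (For i hi c) = max 1 (\<beta> i * max (sz \<beta> c) 1)"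
  by (simp add: For_def)

lemma sz_pos: "(\<And>i. 1 \<le> \<beta> i) \<Longrightarrow> 1 \<le> sz \<beta> c"
proof (induction c)
  case (While b c)
  then have "1 * 1 \<le> \<beta> (loop_var b) * sz \<beta> c" by (intro mult_le_mono) auto
  then show ?case by simp
qed (auto simp: le_max_iff_disj)

text \<open>The constant hidden in the running time depends on the program only.\<close>

lemma tb_le_sz: "\<exists>k. \<forall>\<beta>. (\<forall>i. 1 \<le> \<beta> i) \<longrightarrow> tb \<beta> c \<le> k * sz \<beta> c"
proof (induction c)
  case (Assign a i x)
  show ?case by (rule exI[of _ "1 + acost i + acost x"]) simp
next
  case (Seq c d)
  then obtain k l where k: "\<And>\<beta>. (\<forall>i. 1 \<le> \<beta> i) \<Longrightarrow> tb \<beta> c \<le> k * sz \<beta> c" and l: "\<And>\<beta>. (\<forall>i. 1 \<le> \<beta> i) \<Longrightarrow> tb \<beta> d \<le> l * sz \<beta> d" by blast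
  have "tb \<beta> (c ;; d) \<le> (k + l) * sz \<beta> (c ;; d)" if "\<forall>i. 1 \<le> \<beta> i" for \<beta>
  proof -
    have "k * sz \<beta> c \<le> k * max (sz \<beta> c) (sz \<beta> d)" "l * sz \<beta> d \<le> l * max (sz \<beta> c) (sz \<beta> d)" by simp_all
    then show ?thesis using k[OF that] l[OF that] unfolding sz.simps tb.simps add_mult_distrib by linarith
  qed
  then show ?case by blast
next
  case (Cond b c d)
  then obtain k l where k: "\<And>\<beta>. (\<forall>i. 1 \<le> \<beta> i) \<Longrightarrow> tb \<beta> c \<le> k * sz \<beta> c" and l: "\<And>\<beta>. (\<forall>i. 1 \<le> \<beta> i) \<Longrightarrow> tb \<beta> d \<le> l * sz \<beta> d" by blast
  have "tb \<beta> (Cond b c d) \<le> (1 + bcost b + k + l) * sz \<beta> (Cond b c d)" if "\<forall>i. 1 \<le> \<beta> i" for \<beta>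
  proof -
    have "k * sz \<beta> c \<le> k * max (sz \<beta> c) (sz \<beta> d)" "l * sz \<beta> d \<le> l * max (sz \<beta> c) (sz \<beta> d)" by simp_all
    moreover have "1 + bcost b \<le> (1 + bcost b) * max (sz \<beta> c) (sz \<beta> d)"
      using sz_pos[of \<beta> "Cond b c d"] that by (metis mult.right_neutral mult_le_mono2 sz.simps(2))
    ultimately show ?thesis using k[OF that] l[OF that] unfolding sz.simps tb.simps add_mult_distrib by linarith
  qed
  then show ?case by blast
next
  case (While b c)
  then obtain k where k: "\<And>\<beta>. (\<forall>i. 1 \<le> \<beta> i) \<Longrightarrow> tb \<beta> c \<le> k * sz \<beta> c" by blast
  have "tb \<beta> (While b c) \<le> (2 * (1 + bcost b + k)) * sz \<beta> (While b c)" if "\<forall>i. 1 \<le> \<beta> i" for \<beta>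
  proof -
    have s: "1 \<le> sz \<beta> c" using sz_pos that by blast
    have "1 + bcost b + tb \<beta> c \<le> (1 + bcost b) * sz \<beta> c + k * sz \<beta> c"
      using k[OF that] mult_le_mono2[OF s, of "1 + bcost b"] by simp
    also have "\<dots> = (1 + bcost b + k) * sz \<beta> c" by (simp add: add_mult_distrib)
    finally have "(\<beta> (loop_var b) + 1) * (1 + bcost b + tb \<beta> c) \<le> (2 * \<beta> (loop_var b)) * ((1 + bcost b + k) * sz \<beta> c)"
      using that by (intro mult_le_mono) (auto simp: Suc_le_eq)
    then show ?thesis by (simp add: algebra_simps)
  qed
  then show ?case by blast
qed (auto intro: exI[of _ 1])

section \<open>Correctness of the program\<close>

context solving
begin

abbreviation "T \<equiv> (\<lambda>(u, v). {u, v}) ` set (tree_edges X)"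

lemma decomp: "tree_decomposition (rotations I) (underlying_edges D) {..<nk} T (\<lambda>t. set (bag t))"
  "distinct (map (\<lambda>(u, v). {u, v}) (tree_edges X))"
  using decomposition by (auto simp: given_decomposition_def)

lemma tree: "is_tree {..<nk} T"
  using decomp(1) by (simp add: tree_decomposition_def)

lemma nk_pos: "0 < nk"
  using tree by (auto simp: is_tree_def)

text \<open>Bags consist of rotations. So the loops over a bag may be counted by the number of
  agents, and the treewidth enters only through the number of subsets.\<close>

lemma B_le: "B \<le> nm * nw"
proof -
  have "rotation_tw I D = int (MAX t \<in> {..<nk}. card (set (bag t))) - 1"
    using decomposition by (simp add: given_decomposition_def width_def)
  then have "B = (MAX t \<in> {..<nk}. card (set (bag t)))" by (simp add: B_def)
  also have "\<dots> \<le> nm * nw"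
  proof (rule Max.boundedI)
    fix a assume "a \<in> (\<lambda>t. card (set (bag t))) ` {..<nk}"
    then obtain t where t: "t < nk" "a = card (set (bag t))" by blast
    have "set (bag t) \<subseteq> rotations I" using Union_bags t(1) by blast
    then have "card (set (bag t)) \<le> card (rotations I)" by (rule card_mono[OF rots_finite])
    then show "a \<le> nm * nw" using card_rotations t(2) by simp
  qed (use nk_pos in auto)
  finally show ?thesis .
qed

text \<open>Counting pairs of nodes is cruder than the exact number of tree edges, but one search
  for a leaf per merge still costs only \<open>d ^ 3 * n ^ 6\<close> altogether.\<close>

lemma ne_le: "ne \<le> nk * nk"
proof -
  have "ne = card T" using distinct_card[OF decomp(2)] by simp
  also have "\<dots> \<le> card ((\<lambda>(x, y). {x, y}) ` ({..<nk} \<times> {..<nk}))"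
    by (rule card_mono) (use tree in \<open>force simp: is_tree_def\<close>)+
  also have "\<dots> \<le> card ({..<nk} \<times> {..<nk})" by (rule card_image_le) simp
  finally show ?thesis by simp
qed

end

locale numbered = solving +
  fixes rl :: "rotation list" and fl :: int
  assumes distinct_rl: "distinct rl" and set_rl: "set rl = rotations I"
begin

definition idr :: "rotation \<Rightarrow> nat" where
  "idr \<rho> = (THE r. r < length rl \<and> rl ! r = \<rho>)"

lemma idr_nth: "r < length rl \<Longrightarrow> idr (rl ! r) = r"
  unfolding idr_def using distinct_rl by (intro the_equality) (auto simp: nth_eq_iff_index_eq)

lemma nth_idr: "\<rho> \<in> rotations I \<Longrightarrow> idr \<rho> < length rl \<and> rl ! idr \<rho> = \<rho>"
  using set_rl idr_nth by (metis in_set_conv_nth)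

lemma nth_rotation: "r < length rl \<Longrightarrow> rl ! r \<in> rotations I"
  using set_rl nth_mem by blast

lemma wx_nonneg: "\<rho> \<in> rotations I \<Longrightarrow> 0 \<le> wx fl \<rho>" and wy_nonneg: "\<rho> \<in> rotations I \<Longrightarrow> 0 \<le> wy fl \<rho>"
  using dM_nonneg dW_nonneg by (simp_all add: wx_def wy_def)

lemma sum_rl: "sum h (rotations I) = (\<Sum>r<length rl. h (rl ! r))" for h :: "rotation \<Rightarrow> int"
  using sum.reindex_bij_betw[OF bij_betw_nth[OF distinct_rl refl refl], of h] set_rl by simp

abbreviation "bgr t \<equiv> map idr (bag t)"
abbreviation "reqr r' r \<equiv> past (clr (rl ! r')) (rl ! r)"

lemma in_bgr: "t < nk \<Longrightarrow> r < length rl \<Longrightarrow> r \<in> set (bgr t) \<longleftrightarrow> rl ! r \<in> set (bag t)"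
  using Union_bags nth_idr idr_nth by force

sublocale P: dp_tree "length rl" nk bgr boo "\<lambda>r. nat (wx fl (rl ! r))" "\<lambda>r. nat (wy fl (rl ! r))" "v1 fl"
  reqr "tree_edges X" fl "int (sat_M I (mat best))" "int (sat_W I (mat best))" T
proof
  fix t assume t: "t < nk"
  have sub: "set (bag t) \<subseteq> rotations I" using Union_bags t by blast
  then show "set (bgr t) \<subseteq> {..<length rl}" using nth_idr by fastforce
  have "inj_on idr (set (bag t))" by (rule inj_on_inverseI[where g = "(!) rl"]) (use sub nth_idr in blast)
  then show "distinct (bgr t)" using bag_distinct[OF t] by (simp add: distinct_map)
next
  have "int (\<Sum>r<length rl. nat (wx fl (rl ! r))) = (\<Sum>r<length rl. wx fl (rl ! r))"
    unfolding of_nat_sum by (rule sum.cong) (use wx_nonneg nth_rotation in auto)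
  then show "(\<Sum>r<length rl. nat (wx fl (rl ! r))) < v1 fl" unfolding v1_def sum_rl by linarith
next
  fix r
  show "connected_on {t \<in> {..<nk}. r \<in> set (bgr t)} T"
  proof (cases "r < length rl")
    case True
    then have "{t \<in> {..<nk}. r \<in> set (bgr t)} = {t \<in> {..<nk}. rl ! r \<in> set (bag t)}" using in_bgr by auto
    moreover have "connected_on {t \<in> {..<nk}. rl ! r \<in> set (bag t)} T"
      using decomp(1) nth_rotation[OF True] unfolding tree_decomposition_def by blast
    ultimately show ?thesis by simp
  next
    case False
    have "r \<notin> set (bgr t)" if "t < nk" for t
    proof
      assume "r \<in> set (bgr t)"
      then obtain \<rho> where "\<rho> \<in> set (bag t)" "r = idr \<rho>" by auto
      then show False using False nth_idr Union_bags that by blast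
    qed
    then have "{t \<in> {..<nk}. r \<in> set (bgr t)} = {}" by blast
    note z = this
    show ?thesis unfolding z connected_on_def by simp
  qed
qed (use tree decomp in auto)

lemma image_subset: "U \<subseteq> {..<length rl} \<Longrightarrow> (!) rl ` U \<subseteq> rotations I"
  using nth_rotation by auto

lemma mem_image: "U \<subseteq> {..<length rl} \<Longrightarrow> r < length rl \<Longrightarrow> rl ! r \<in> (!) rl ` U \<longleftrightarrow> r \<in> U"
  using distinct_rl by (auto simp: nth_eq_iff_index_eq subset_iff)

text \<open>Each edge of \<open>D\<close> lies in some bag, so closedness in every bag gives
  closedness along \<open>D\<close>, whose transitive closure is the whole precedence
  relation.\<close>

lemma solution_stv:
  assumes U: "U \<in> P.solutions"
  shows "stv (joinv ((!) rl ` U))" "rots (joinv ((!) rl ` U)) = (!) rl ` U"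
proof -
  have sub: "U \<subseteq> {..<length rl}" using P.solutions_sub[OF U] .
  have Dp: "D\<^sup>+ = precedence I" "D \<subseteq> rotations I \<times> rotations I"
    using digraph by (auto simp: rotation_digraph_def is_arg_min_def)
  have "\<rho> \<in> (!) rl ` U" if d: "(\<rho>, \<rho>') \<in> D" and u: "\<rho>' \<in> (!) rl ` U" for \<rho> \<rho>'
  proof -
    have "{\<rho>, \<rho>'} \<in> underlying_edges D" using d by (auto simp: underlying_edges_def)
    then obtain t where t: "t < nk" "{\<rho>, \<rho>'} \<subseteq> set (bag t)"
      using decomp(1) unfolding tree_decomposition_def by blast
    have r: "\<rho> \<in> rotations I" "\<rho>' \<in> rotations I" using d Dp by auto
    have "past (clr \<rho>') \<rho>" using precedence_past d Dp(1) by (metis r_into_trancl)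
    moreover have "P.closed_in t U" using U t(1) by (simp add: P.solutions_def)
    moreover have "idr \<rho> \<in> set (bgr t)" "idr \<rho>' \<in> set (bgr t)" using t by auto
    moreover have "idr \<rho>' \<in> U" using u mem_image[OF sub] nth_idr[OF r(2)] by metis
    ultimately have "idr \<rho> \<in> U" unfolding P.closed_in_def using nth_idr r by metis
    then show ?thesis using nth_idr[OF r(1)] by (metis imageI)
  qed
  then show "stv (joinv ((!) rl ` U))" "rots (joinv ((!) rl ` U)) = (!) rl ` U"
    using closed_set_joinv[OF Dp(1) image_subset[OF sub]] by blast+
qed

text \<open>The rotations behind a stable matching are closed under all of precedence, in particular
  within each bag, so no stable matching is missed by the tables.\<close>

lemma stv_solution:
  assumes x: "stv x"
  obtains U where "U \<in> P.solutions" "rots x = (!) rl ` U"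
proof -
  define U where "U = {r. r < length rl \<and> rl ! r \<in> rots x}"
  have sub: "U \<subseteq> {..<length rl}" by (auto simp: U_def)
  have "rots x \<subseteq> rotations I" by (auto simp: rots_def)
  then have im: "rots x = (!) rl ` U" unfolding U_def using nth_idr by (force simp: image_iff)
  have "U \<subseteq> P.RR {..<nk}"
  proof
    fix r assume "r \<in> U"
    then have r: "r < length rl" using sub by auto
    then obtain t where "t < nk" "rl ! r \<in> set (bag t)" using Union_bags nth_rotation by blast
    then show "r \<in> P.RR {..<nk}" using in_bgr[OF _ r] unfolding P.RR_def by blast
  qed
  moreover have "P.closed_in t U" if t: "t < nk" for t
    unfolding P.closed_in_def
  proof (intro ballI impI)
    fix r r' assume a: "r \<in> set (bgr t)" "r' \<in> set (bgr t)" "r' \<in> U" "reqr r' r"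
    have r: "r < length rl" using a(1) P.bag_sub[OF t] by blast
    then have "rl ! r \<in> rots x"
      using rots_closed[OF x _ nth_rotation[OF r] a(4)] a(3) by (simp add: U_def)
    then show "r \<in> U" using r by (simp add: U_def)
  qed
  ultimately have "U \<in> P.solutions" by (simp add: P.solutions_def)
  then show ?thesis using im by (rule that)
qed

definition costf :: "matching \<Rightarrow> int" where
  "costf = (if 0 < fl then sesm_cost I else bsm_cost I)"

lemma cost_eq:
  assumes x: "stv x" and U: "U \<subseteq> {..<length rl}" and r: "rots x = (!) rl ` U"
  shows "P.cost U = costf (mat x)"
proof -
  have inj: "inj_on ((!) rl) U" using distinct_rl U by (auto simp: inj_on_def nth_eq_iff_index_eq subset_iff)
  have W: "int (\<Sum>r\<in>U. nat (wx fl (rl ! r))) = sum (wx fl) (rots x)" "int (\<Sum>r\<in>U. nat (wy fl (rl ! r))) = sum (wy fl) (rots x)"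
    unfolding r sum.reindex[OF inj] of_nat_sum
    using wx_nonneg wy_nonneg nth_rotation U by (auto intro!: sum.cong)
  show ?thesis
  proof (cases "0 < fl")
    case True
    then have "sum (wx fl) (rots x) = sum dM (rots x) + sum dW (rots x)" by (simp add: wx_def sum.distrib)
    then show ?thesis unfolding P.cost_def W costf_def sesm_cost_def using sat_rots[OF x] True by simp
  next
    case False
    then have "sum (wx fl) (rots x) = sum dM (rots x)" "sum (wy fl) (rots x) = sum dW (rots x)" by (simp_all add: wx_def wy_def)
    then show ?thesis unfolding P.cost_def W costf_def bsm_cost_def using sat_rots[OF x] False by simp
  qed
qed

lemma optimal_solution:
  assumes U: "U \<in> P.solutions" and best: "\<forall>U'\<in>P.solutions. P.cost U \<le> P.cost U'"
  shows "is_arg_min costf (stable I) (mat (joinv ((!) rl ` U)))"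
proof -
  note s = solution_stv[OF U]
  have "costf (mat (joinv ((!) rl ` U))) \<le> costf \<mu>" if st: "stable I \<mu>" for \<mu>
  proof -
    obtain U' where U': "U' \<in> P.solutions" "rots (vec \<mu>) = (!) rl ` U'" using stv_solution[OF stv_vec[OF st]] .
    have "P.cost U' = costf \<mu>"
      using cost_eq[OF stv_vec[OF st] P.solutions_sub[OF U'(1)] U'(2)] mat_vec[OF st] by simp
    moreover have "P.cost U = costf (mat (joinv ((!) rl ` U)))"
      by (rule cost_eq[OF s(1) P.solutions_sub[OF U] s(2)])
    ultimately show ?thesis using best U'(1) by metis
  qed
  then show ?thesis using stable_mat[OF s(1)] by (auto simp: is_arg_min_def not_less)
qed

lemma wp_solve:
  assumes e: "env s0" and n: "numbering rl s0" and tb: "\<forall>t<nk. tables rl s0 t" and f: "s0 vFL 0 = fl"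
    and z: "\<And>a. a \<in> {vXB, vHM, vSV, vSA, vSB, vTOP, aMK, aTY, vRT, vBF, ''output''} \<Longrightarrow> s0 a = (\<lambda>_. 0)"
    and \<beta>: "nm \<le> \<beta> lm" "nm \<le> \<beta> lm2" "moff nm \<le> \<beta> lp" "nm \<le> \<beta> li" "length rl \<le> \<beta> lr" and bnd: "P.bounded \<beta>"
  shows "wp \<beta> (c_rots ;; c_pow ;; c_sat ;; c_init ;; c_merge ;; c_select ;; c_output)
    (\<lambda>s. is_arg_min costf (stable I) (output_matching I s)) s0"
proof (rule wp_seq_conseq[OF wp_rots[OF e n set_rl f _ _ _ \<beta>]])
  show "s0 vXB 0 = 0" "s0 vHM 0 = 0" "s0 vSV 0 = 0" by (simp_all add: z)
next
  fix s1 assume f1: "\<And>a. \<not> wr c_rots a \<Longrightarrow> s1 a = s0 a"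
    and q1: "s1 vSV 0 = (\<Sum>r<length rl. wx fl (rl ! r)) \<and> row s1 0 best \<and> (\<forall>r<length rl. rot_data rl fl s1 r)"
  have g1: "s1 a = s0 a" if "a \<in> {''input'', vNM, vNP, vNW, vNE, vEO, vNK, aMO, aRow, aMP, aWP, vNR, aBO, aBL, aBG, vFL,
      vSA, vSB, vTOP, aMK, aTY, vRT, vBF, ''output''}" for a
    using that by (intro f1) (elim insertE emptyE; simp add: c_rots_def c_close_def)
  have e1: "env s1" by (rule env_frame[OF e]) (auto simp: g1)
  have "0 \<le> (\<Sum>r<length rl. wx fl (rl ! r))" using wx_nonneg nth_rotation by (intro sum_nonneg) simp
  then have sv: "s1 vSV 0 = int (nat (\<Sum>r<length rl. wx fl (rl ! r)))" using q1 by simp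
  have v1: "Suc (nat (\<Sum>r<length rl. wx fl (rl ! r))) = v1 fl" by (simp add: v1_def sum_rl)
  have nr1: "s1 vNR 0 = int (length rl)" using n g1 by (simp add: numbering_def)
  show "wp \<beta> (c_pow ;; c_sat ;; c_init ;; c_merge ;; c_select ;; c_output) (\<lambda>s. is_arg_min costf (stable I) (output_matching I s)) s1"
  proof (rule wp_seq_conseq[OF wp_pow[where ?s0.0 = s1 and \<beta> = \<beta> and nr = "length rl" and v = "nat (\<Sum>r<length rl. wx fl (rl ! r))", OF nr1 sv \<beta>(5), unfolded v1]])
    fix s2 assume f2: "\<And>a. \<not> wr c_pow a \<Longrightarrow> s2 a = s1 a"
      and q2: "s2 vV1 0 = int (v1 fl) \<and> s2 vST 0 = int (v1 fl * 2 ^ length rl) \<and>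
        (\<forall>r<length rl. s2 aPW (int r) = int (v1 fl * 2 ^ r)) \<and> (\<forall>i\<le>length rl. s2 aP2 (int i) = int (2 ^ i))"
    have g2: "s2 a = s1 a" if "a \<notin> {vV1, vZ, aPW, vST, aP2, lr}" for a using that by (intro f2) (simp add: c_pow_def)
    have e2: "env s2" by (rule env_frame[OF e1]) (auto simp: g2)
    have r2: "row s2 0 best" using q1 g2 by (simp add: row_def)
    have sa: "s2 vSA 0 = 0" "s2 vSB 0 = 0" by (simp_all add: g2 g1 z)
    show "wp \<beta> (c_sat ;; c_init ;; c_merge ;; c_select ;; c_output) (\<lambda>s. is_arg_min costf (stable I) (output_matching I s)) s2"
    proof (rule wp_seq_conseq[OF wp_sat[where ?s0.0 = s2 and \<beta> = \<beta>, OF e2 r2 sa \<beta>(1)]])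
      fix s3 assume f3: "\<And>a. \<not> wr c_sat a \<Longrightarrow> s3 a = s2 a"
        and q3: "s3 vSA 0 = int (sat_M I (mat best)) \<and> s3 vSB 0 = int (sat_W I (mat best))"
      have g3: "s3 a = s2 a" if "a \<notin> {vSA, vSB, lm}" for a using that by (intro f3) (simp add: c_sat_def)
      have g13: "s3 a = s1 a" if "a \<notin> {vSA, vSB, lm, vV1, vZ, aPW, vST, aP2, lr}" for a using that by (simp add: g3 g2)
      have e3: "env s3" by (rule env_frame[OF e2]) (auto simp: g3)
      have rd3: "rot_data rl fl s3 r" if "r < length rl" for r
        by (rule rot_data_frame[of rl fl s1 r s3]) (use q1 that in \<open>auto simp: g13\<close>)
      have tb3: "tables rl s3 t" if "t < nk" for t
        by (rule tables_frame[of rl s0 t s3]) (use tb that in \<open>auto simp: g13 g1\<close>)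
      have d3: "P.dp_env s3" unfolding P.dp_env_def
      proof (intro conjI allI impI)
        show "s3 vNR 0 = int (length rl)" using nr1 by (simp add: g13)
        show "s3 vNK 0 = int nk" "s3 vNE 0 = int ne" using e3 by (simp_all add: env_def)
        show "s3 vV1 0 = int (v1 fl)" "s3 vST 0 = int (v1 fl * 2 ^ length rl)" using q2 by (simp_all add: g3)
        show "s3 vFL 0 = fl" using f by (simp add: g13 g1)
        show "s3 vSA 0 = int (sat_M I (mat best))" "s3 vSB 0 = int (sat_W I (mat best))" using q3 by auto
      next
        fix i assume i: "i < ne"
        have "s3 ''input'' = \<xi>" "s3 vEO 0 = int eoff" using e3 by (simp_all add: env_def)
        then show "s3 ''input'' (s3 vEO 0 + int i + int i) = int (fst (tree_edges X ! i))"
          "s3 ''input'' (s3 vEO 0 + int i + int i + 1) = int (snd (tree_edges X ! i))" using xi_edges(3,4)[OF i] by simp_all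
      next
        fix t assume t: "t < nk"
        show "s3 aBO (int t) = int (boo t)" "s3 aBL (int t) = int (length (bgr t))" using tb3[OF t] by (simp_all add: tables_def)
        fix i assume i: "i < length (bgr t)"
        then have "entry rl s3 t i" using tb3[OF t] by (simp add: tables_def)
        then obtain r where r: "r < length rl" "rl ! r = bag t ! i" "s3 aBG (int (boo t) + int i) = int r" by (auto simp: entry_def)
        have "idr (bag t ! i) = r" using idr_nth[OF r(1)] r(2) by simp
        then show "s3 aBG (int (boo t) + int i) = int (bgr t ! i)" using i r(3) by simp
      next
        fix r assume r: "r < length rl"
        show "s3 aWX (int r) = int (nat (wx fl (rl ! r)))" "s3 aWY (int r) = int (nat (wy fl (rl ! r)))"
          using rd3[OF r] wx_nonneg[OF nth_rotation[OF r]] wy_nonneg[OF nth_rotation[OF r]] by (simp_all add: rot_data_def)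
        show "s3 aPW (int r) = int (v1 fl * 2 ^ r)" using q2 r by (simp add: g3)
      next
        fix i assume "i \<le> length rl"
        then show "s3 aP2 (int i) = int (2 ^ i)" using q2 by (simp add: g3)
      next
        fix r r' assume r: "r < length rl" "r' < length rl"
        let ?h = "hd (rl ! r)"
        have h: "fst ?h < nm" using hd_rotation[OF nth_rotation[OF r(1)]] by blast
        have "s3 aX (s3 aXB (int r') + s3 aHM (int r)) = int (clr (rl ! r') (fst ?h))"
          using rd3[OF r(1)] rd3[OF r(2)] h by (simp add: rot_data_def row_def)
        then show "s3 aHV (int r) \<le> s3 aX (s3 aXB (int r') + s3 aHM (int r)) \<longleftrightarrow> reqr r' r"
          using rd3[OF r(1)] past_iff_hd[OF nth_rotation[OF r(1)] stv_clr[OF nth_rotation[OF r(2)]]]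
          by (auto simp: rot_data_def)
      qed
      have z3: "s3 vTOP 0 = 0" "s3 aMK = (\<lambda>_. 0)" "s3 aTY = (\<lambda>_. 0)" by (simp_all add: g13 g1 z)
      show "wp \<beta> (c_init ;; c_merge ;; c_select ;; c_output) (\<lambda>s. is_arg_min costf (stable I) (output_matching I s)) s3"
      proof (rule wp_seq_conseq[OF P.wp_init[where ?s0.0 = s3 and \<beta> = \<beta>, OF d3 z3 bnd]])
        fix s4 assume f4: "\<And>a. \<not> wr c_init a \<Longrightarrow> s4 a = s3 a"
          and q4: "s4 vTOP 0 = int (nk * (v1 fl * 2 ^ length rl)) \<and> P.unused s4 nk \<and>
            (\<forall>t<nk. s4 aCB (int t) = int (t * (v1 fl * 2 ^ length rl)) \<and> s4 aAL (int t) = 1 \<and> P.table s4 t (P.leafs t))"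
        have d4: "P.dp_env s4" by (rule P.dp_env_frame[OF d3]) (auto simp: f4 c_init_def c_decode_def)
        have rt4: "s4 vRT 0 = 0" by (simp add: f4 c_init_def c_decode_def g13 g1 z)
        show "wp \<beta> (c_merge ;; c_select ;; c_output) (\<lambda>s. is_arg_min costf (stable I) (output_matching I s)) s4"
        proof (rule wp_seq_conseq[OF P.wp_merge[where ?s0.0 = s4 and \<beta> = \<beta>, OF d4 _ _ rt4 _ bnd]])
          show "s4 vTOP 0 = int (nk * (v1 fl * 2 ^ length rl))" "P.unused s4 nk"
            "\<forall>t<nk. s4 aCB (int t) = int (t * (v1 fl * 2 ^ length rl)) \<and> s4 aAL (int t) = 1 \<and> P.table s4 t (P.leafs t)"
            using q4 by blast+
        next
          fix s5 assume f5: "\<And>a. \<not> wr c_merge a \<Longrightarrow> s5 a = s4 a"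
            and "\<exists>n. P.table s5 n {({}, U) | U. U \<in> P.solutions} \<and> s5 vNB 0 = int (n * (v1 fl * 2 ^ length rl))"
          then obtain n where q5: "P.table s5 n {({}, U) | U. U \<in> P.solutions}" "s5 vNB 0 = int (n * (v1 fl * 2 ^ length rl))" by blast
          have g5: "s5 a = s3 a" if "a \<in> {''input'', vNM, vNP, vNW, vNE, vEO, vNK, aMO, aRow, aMP, aWP, vNR, vV1, vST, vFL, vSA, vSB,
              aBO, aBL, aBG, aWX, aWY, aPW, aP2, aHV, aX, aXB, aHM, vBF, ''output''}" for a
            using that by (elim insertE emptyE; simp add: f5 f4 c_init_def c_merge_def c_leaf_def c_mark_def c_forget_def c_join_def c_decode_def)
          have d5: "P.dp_env s5" by (rule P.dp_env_frame[OF d3]) (auto simp: g5)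
          have bf5: "s5 vBF 0 = 0" by (simp add: g5 g13 g1 z)
          show "wp \<beta> (c_select ;; c_output) (\<lambda>s. is_arg_min costf (stable I) (output_matching I s)) s5"
          proof (rule wp_seq_conseq[OF P.wp_select[where ?s0.0 = s5 and \<beta> = \<beta>, OF d5 q5 bf5 bnd]])
            fix s6 assume f6: "\<And>a. \<not> wr c_select a \<Longrightarrow> s6 a = s5 a"
              and "\<exists>U\<in>P.solutions. s6 vBU 0 = P.key U \<and> (\<forall>U'\<in>P.solutions. P.cost U \<le> P.cost U')"
            then obtain U where U: "U \<in> P.solutions" "s6 vBU 0 = P.key U" "\<forall>U'\<in>P.solutions. P.cost U \<le> P.cost U'" by blast
            have g6: "s6 a = s3 a" if "a \<in> {''input'', vNM, vNP, vNW, vNE, vEO, vNK, aMO, aRow, aMP, aWP, vNR, aPW, aX, aXB, ''output''}" for a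
              using that by (elim insertE emptyE; simp add: f6 c_select_def g5)
            have e6: "env s6" by (rule env_frame[OF e3]) (auto simp: g6)
            have pos: "0 < v1 fl" by (simp add: v1_def)
            have row6: "\<forall>r<length rl. s6 aXB (int r) = int (Suc r) * int nm \<and> row s6 (int (Suc r) * int nm) (clr (rl ! r))"
              using rd3 by (simp add: rot_data_def row_def g6)
            have b6: "row s6 0 best" "\<forall>r<length rl. s6 aPW (int r) = int (v1 fl * 2 ^ r)" "s6 vNR 0 = int (length rl)"
              using r2 q2 nr1 by (simp_all add: g6 row_def g3 g2)
            have o6: "s6 ''output'' = (\<lambda>_. 0)" by (simp add: g6 g13 g1 z)
            have vj: "valid (joinv ((!) rl ` U))" using solution_stv(1)[OF U(1)] by (simp add: stv_def)
            have "wp \<beta> c_output (\<lambda>s. output_matching I s = mat (joinv ((!) rl ` U))) s6"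
              by (rule wp_output[where ?s0.0 = s6 and \<beta> = \<beta>, OF e6 b6(3,1) row6 b6(2) pos U(2)[unfolded P.key_def] P.solutions_sub[OF U(1)] o6 vj \<beta>(1,5)])
            then show "wp \<beta> c_output (\<lambda>s. is_arg_min costf (stable I) (output_matching I s)) s6"
              by (rule wp_conseq) (simp add: optimal_solution[OF U(1,3)])
          qed
        qed
      qed
    qed
  qed
qed

end

section \<open>Running time\<close>

text \<open>\<open>p\<close> stands for the number of subsets of a bag. \<open>3 * n\<^sup>2\<close>
  bounds both the rounds of closing, by \<open>moff_le\<close>, and the range of weights, by
  \<open>v1_bound\<close>. The value \<open>1\<close> for all other names meets the requirement of
  \<open>tb_le_sz\<close>.\<close>

definition bounds :: "nat \<Rightarrow> nat \<Rightarrow> nat \<Rightarrow> string \<Rightarrow> nat" where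
  "bounds n d p a = (if a \<in> {lm, lm2, lk, lw, li} then n else if a \<in> {lt, ls} then d * n\<^sup>2
    else if a = le then d\<^sup>2 * n ^ 4 else if a \<in> {lp, lv, lv2} then 3 * n\<^sup>2 else if a = lj then p
    else if a \<in> {lr, lb, lb2} then n\<^sup>2 else 1)"

lemma bounds_pos: "1 \<le> n \<Longrightarrow> 1 \<le> d \<Longrightarrow> 1 \<le> p \<Longrightarrow> 1 \<le> bounds n d p a"
  by (simp add: bounds_def)

lemma sz_For_pos: "(\<And>i. 1 \<le> \<beta> i) \<Longrightarrow> sz \<beta> (For i hi c) = \<beta> i * sz \<beta> c"
proof -
  assume \<beta>: "\<And>i. 1 \<le> \<beta> i"
  then have "1 \<le> sz \<beta> c" "1 * 1 \<le> \<beta> i * sz \<beta> c" using sz_pos[of \<beta> c] by (auto intro!: mult_le_mono simp del: mult_1)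
  then show ?thesis by (simp add: max_def)
qed

text \<open>Four nests of loops attain \<open>n ^ 6\<close>: the closures of all rotations, the
  closedness tests for all subsets of bags, the searches for leaves, whence \<open>d ^ 3\<close>,
  and the joins, whose two weight loops give the largest coefficient \<open>9\<close>;
  \<open>27\<close> leaves slack. The exponent in \<open>p ^ 1\<close> gives the bound the shape of
  the monomials in \<open>F\<close>.\<close>

lemma sz_program:
  assumes n: "1 \<le> n" and d: "1 \<le> d" and p: "1 \<le> p"
  shows "sz (bounds n d p) (program fl) \<le> 27 * (d ^ 3 * p ^ 1 * n ^ 6)"
proof -
  let ?\<beta> = "bounds n d p"
  define M where "M = 27 * (d ^ 3 * p ^ 1 * n ^ 6)"
  have F: "k * (d ^ a * p ^ b * n ^ e) \<le> M" if "k \<le> 27" "a \<le> 3" "b \<le> 1" "e \<le> 6" for k a b e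
    unfolding M_def by (intro mult_le_mono power_increasing that n d p)
  note facts = F[of 1 0 0 0] F[of 1 0 0 1] F[of 1 0 0 2] F[of 1 1 0 2] F[of 1 2 0 4] F[of 3 0 0 2] F[of 3 0 0 4]
    F[of 1 0 0 3] F[of 1 1 0 4] F[of 3 0 0 6] F[of 1 1 1 6] F[of 1 1 1 4] F[of 1 3 0 6] F[of 3 1 1 4] F[of 9 1 1 6]
    F[of 1 0 1 0] F[of 1 1 1 2] F[of 3 0 1 2]
  have \<beta>: "?\<beta> lm = n" "?\<beta> lm2 = n" "?\<beta> lk = n" "?\<beta> lw = n" "?\<beta> li = n" "?\<beta> lt = d * n\<^sup>2" "?\<beta> ls = d * n\<^sup>2"
    "?\<beta> le = d\<^sup>2 * n ^ 4" "?\<beta> lp = 3 * n\<^sup>2" "?\<beta> lv = 3 * n\<^sup>2" "?\<beta> lv2 = 3 * n\<^sup>2" "?\<beta> lj = p" "?\<beta> lr = n\<^sup>2"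
    "?\<beta> lb = n\<^sup>2" "?\<beta> lb2 = n\<^sup>2"
    by (simp_all add: bounds_def)
  note sz = sz.simps sz_For_pos[of ?\<beta>, OF bounds_pos[OF n d p]] \<beta> mult_1_right max.idem
  have close: "sz ?\<beta> c_close = max n (max 1 (3 * n\<^sup>2 * (n * n)))" by (simp only: sz c_close_def)
  have decode: "sz ?\<beta> c_decode = max 1 (n\<^sup>2)" unfolding c_decode_def sz by (simp add: max.assoc max.commute max.left_commute)
  have mark: "sz ?\<beta> c_mark = n\<^sup>2" by (simp only: sz c_mark_def)
  have leaf: "sz ?\<beta> c_leaf = max (d * n\<^sup>2) (d\<^sup>2 * n ^ 4)" by (simp only: sz c_leaf_def)
  have forget: "sz ?\<beta> c_forget = max 1 (p * max (max 1 (n\<^sup>2)) (3 * n\<^sup>2))" unfolding c_forget_def sz decode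
    by (simp add: max.assoc max.commute max.left_commute)
  have join: "sz ?\<beta> c_join = max 1 (p * max (max 1 (n\<^sup>2)) (3 * n\<^sup>2 * (3 * n\<^sup>2)))" unfolding c_join_def sz decode
    by (simp add: max.assoc max.commute max.left_commute)
  have "sz ?\<beta> c_parse \<le> M" "sz ?\<beta> c_bags \<le> M" "sz ?\<beta> c_rots \<le> M" "sz ?\<beta> c_pow \<le> M" "sz ?\<beta> c_sat \<le> M" "sz ?\<beta> c_init \<le> M"
    "sz ?\<beta> c_merge \<le> M" "sz ?\<beta> c_select \<le> M" "sz ?\<beta> c_output \<le> M"
    unfolding c_parse_def c_bags_def c_rots_def c_pow_def c_sat_def c_init_def c_merge_def c_select_def c_output_def
      sz close decode mark leaf forget join nat_mult_max_right max.bounded_iff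
    using facts by (simp_all add: eval_nat_numeral algebra_simps)
  moreover have "1 \<le> M" using F[of 1 0 0 0] by simp
  ultimately show ?thesis unfolding program_def sz M_def[symmetric] by (simp only: max.bounded_iff simp_thms)
qed

abbreviation cost :: "int \<Rightarrow> sm \<Rightarrow> matching \<Rightarrow> int" where
  "cost fl \<equiv> if 0 < fl then sesm_cost else bsm_cost"

context solving
begin

lemma n_pos: "length (bags X) \<le> d * (num_agents I)\<^sup>2 \<Longrightarrow> 1 \<le> num_agents I"
  using nk_pos by (cases "num_agents I") auto

lemma num_pairs_le: "nm * nw \<le> (num_agents I)\<^sup>2"
  unfolding power2_eq_square by (intro mult_le_mono) (simp_all add: num_agents_def)

lemma moff_le:
  assumes n: "1 \<le> num_agents I"
  shows "moff nm \<le> 3 * (num_agents I)\<^sup>2"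
proof -
  have "(\<Sum>m<nm. len m + 1) \<le> (\<Sum>m<nm. nw + 1)" by (intro sum_mono) (simp add: len_le)
  then have "moff nm \<le> 1 + nm * (nw + 1)" by (simp add: moff_sum)
  also have "\<dots> = 1 + (nm * nw + nm)" by (simp add: algebra_simps)
  also have "nm * nw + nm \<le> 2 * (num_agents I)\<^sup>2"
    using num_pairs_le self_le_power[of "num_agents I" 2] n by (simp add: num_agents_def)
  also have "1 \<le> (num_agents I)\<^sup>2" using n by simp
  finally show ?thesis by simp
qed

lemma ne_bound:
  assumes "length (bags X) \<le> d * (num_agents I)\<^sup>2"
  shows "ne \<le> d\<^sup>2 * num_agents I ^ 4"
proof -
  have "nk * nk \<le> (d * (num_agents I)\<^sup>2) * (d * (num_agents I)\<^sup>2)" by (intro mult_le_mono assms)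
  also have "\<dots> = d\<^sup>2 * num_agents I ^ 4" by (simp add: power2_eq_square eval_nat_numeral algebra_simps)
  finally show ?thesis using ne_le by simp
qed

end

context numbered
begin

lemma v1_bound:
  assumes "1 \<le> num_agents I"
  shows "v1 fl \<le> 3 * (num_agents I)\<^sup>2"
proof -
  have "sum (wx fl) (rotations I) \<le> sum dM (rotations I) + sum dW (rotations I)"
    unfolding sum.distrib[symmetric] wx_def using dW_nonneg by (intro sum_mono) auto
  also have "\<dots> \<le> int (nm * nw) + int (nm * nm)" using sum_dM_le sum_dW_le by (rule add_mono)
  also have "\<dots> = int (nm * (nm + nw))" by (simp add: algebra_simps)
  also have "\<dots> \<le> int ((num_agents I)\<^sup>2)"
    unfolding of_nat_le_iff power2_eq_square num_agents_def by (intro mult_le_mono) auto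
  finally have "v1 fl \<le> Suc ((num_agents I)\<^sup>2)" by (simp add: v1_def nat_le_iff)
  moreover have "1 \<le> (num_agents I)\<^sup>2" using assms by simp
  ultimately show ?thesis by linarith
qed

lemma wp_optimal:
  assumes e: "env s0" and n: "numbering rl s0" and tb: "\<forall>t<nk. tables rl s0 t" and f: "s0 vFL 0 = fl"
    and z: "\<And>a. a \<in> {vXB, vHM, vSV, vSA, vSB, vTOP, aMK, aTY, vRT, vBF, ''output''} \<Longrightarrow> s0 a = (\<lambda>_. 0)"
    and d: "length (bags X) \<le> d * (num_agents I)\<^sup>2"
  shows "wp (bounds (num_agents I) d (2 ^ B)) (c_rots ;; c_pow ;; c_sat ;; c_init ;; c_merge ;; c_select ;; c_output)
    (\<lambda>s. optimal (cost fl) I (output_matching I s)) s0"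
proof (rule wp_conseq)
  let ?\<beta> = "bounds (num_agents I) d (2 ^ B)"
  note n1 = n_pos[OF d]
  have lrl: "length rl \<le> (num_agents I)\<^sup>2" using distinct_card[OF distinct_rl] set_rl card_rotations num_pairs_le by simp
  have bd: "P.bounded ?\<beta>" unfolding P.bounded_def
  proof (intro conjI allI impI)
    fix t assume t: "t < nk"
    have "length (bgr t) \<le> B" using length_bag[OF t] by simp
    then show "length (bgr t) \<le> ?\<beta> lb" "length (bgr t) \<le> ?\<beta> lb2" "2 ^ length (bgr t) \<le> ?\<beta> lj"
      using B_le num_pairs_le by (simp_all add: bounds_def)
  qed (use v1_bound[OF n1] lrl d ne_bound[OF d] in \<open>simp_all add: bounds_def\<close>)
  show "wp ?\<beta> (c_rots ;; c_pow ;; c_sat ;; c_init ;; c_merge ;; c_select ;; c_output)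
    (\<lambda>s. is_arg_min costf (stable I) (output_matching I s)) s0"
    by (rule wp_solve[OF e n tb f z _ _ _ _ _ bd])
      (use moff_le[OF n1] lrl in \<open>simp_all add: bounds_def num_agents_def\<close>)
qed (simp add: optimal_def costf_def split: if_splits)

end

context solving
begin

lemma wp_program:
  assumes input: "\<xi> = init_state (encode I X) ''input''" and d: "length (bags X) \<le> d * (num_agents I)\<^sup>2"
  shows "wp (bounds (num_agents I) d (2 ^ B)) (program fl) (\<lambda>s. optimal (cost fl) I (output_matching I s))
    (init_state (encode I X))"
  unfolding program_def
proof (rule wp_seq_conseq[OF wp_parse])
  let ?\<beta> = "bounds (num_agents I) d (2 ^ B)" and ?s0 = "init_state (encode I X)"
  have z0: "?s0 a = (\<lambda>_. 0)" if "a \<noteq> ''input''" for a using that by (simp add: init_state_def)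
  then show "?s0 (V i) = (\<lambda>_. 0)" for i by simp
  show "?s0 ''input'' = \<xi>" by (simp add: input)
  fix s1 assume f1: "\<And>a. \<not> wr c_parse a \<Longrightarrow> s1 a = ?s0 a" and q1: "env s1 \<and> s1 vP 0 = int (koff + 1)"
  define s2 where "s2 = run (vFL ::= Const fl) s1"
  have s2: "s2 a = s1 a" if "a \<noteq> vFL" for a using that by (simp add: s2_def)
  have g1: "s2 a = (\<lambda>_. 0)" if "a \<in> {vQ, vNR, aID, vXB, vHM, vSV, vSA, vSB, vTOP, aMK, aTY, vRT, vBF, ''output''}" for a
  proof -
    have "\<not> wr c_parse a" "a \<noteq> vFL" "a \<noteq> ''input''" using that by (elim insertE emptyE; simp add: c_parse_def)+
    then show ?thesis using s2 f1 z0 by simp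
  qed
  have e1: "env s2" by (rule env_frame[of s1]) (use q1 s2 in auto)
  have fl1: "s2 vFL 0 = fl" by (simp add: s2_def)
  have p1: "s2 vP 0 = int (koff + 1)" using q1 s2[of vP] by simp
  have z1: "s2 vQ 0 = 0" "s2 vNR 0 = 0" "s2 aID = (\<lambda>_. 0)" by (simp_all add: g1)
  have b1: "nk \<le> ?\<beta> lt" "B \<le> ?\<beta> lb" using d B_le num_pairs_le by (simp_all add: bounds_def)
  have "wp ?\<beta> (c_bags ;; c_rots ;; c_pow ;; c_sat ;; c_init ;; c_merge ;; c_select ;; c_output)
    (\<lambda>s. optimal (cost fl) I (output_matching I s)) s2"
  proof (rule wp_seq_conseq[OF wp_bags[OF e1 p1 z1 b1]])
    fix s3 assume f2: "\<And>a. \<not> wr c_bags a \<Longrightarrow> s3 a = s2 a"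
      and "\<exists>rl. set rl = rotations I \<and> distinct rl \<and> numbering rl s3 \<and> (\<forall>t<nk. tables rl s3 t)"
    then obtain rl where rl: "set rl = rotations I" "distinct rl" "numbering rl s3" "\<forall>t<nk. tables rl s3 t" by blast
    have "numbered I X \<xi> D rl"
      by (intro numbered.intro solving_axioms numbered_axioms.intro rl)
    then show "wp ?\<beta> (c_rots ;; c_pow ;; c_sat ;; c_init ;; c_merge ;; c_select ;; c_output)
      (\<lambda>s. optimal (cost fl) I (output_matching I s)) s3"
    proof (rule numbered.wp_optimal[OF _ _ rl(3,4) _ _ d])
      show "env s3" by (rule env_frame[OF e1]) (auto simp: f2 c_bags_def)
      show "s3 vFL 0 = fl" using fl1 by (simp add: f2 c_bags_def)
      fix a assume a: "a \<in> {vXB, vHM, vSV, vSA, vSB, vTOP, aMK, aTY, vRT, vBF, ''output''}"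
      then have "\<not> wr c_bags a" by (elim insertE emptyE; simp add: c_bags_def)
      then have "s3 a = s2 a" by (rule f2)
      also have "\<dots> = (\<lambda>_. 0)" by (rule g1) (use a in blast)
      finally show "s3 a = (\<lambda>_. 0)" .
    qed
  qed
  then show "wp ?\<beta> (vFL ::= Const fl ;; c_bags ;; c_rots ;; c_pow ;; c_sat ;; c_init ;; c_merge ;; c_select ;; c_output)
    (\<lambda>s. optimal (cost fl) I (output_matching I s)) s1"
    unfolding s2_def by (rule wp_seq_run[rotated]) simp
qed (simp_all add: bounds_def num_agents_def)

text \<open>Bags have up to \<open>tw + 1\<close> members, so the number of subsets carries an
  additional factor \<open>2\<close>. The exponent is an integer since the width is
  \<open>-1\<close> if there are no rotations.\<close>

lemma power_B: "(2::real) ^ B = 2 * 2 powi rotation_tw I D"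
proof -
  have "(2::real) ^ B = 2 powi (rotation_tw I D + 1)" by (simp flip: B_eq add: power_int_of_nat)
  then show ?thesis by (simp add: power_int_add)
qed

end

lemma solvable: "solvable_in_time (cost fl) (\<lambda>tw n. 2 powi tw * real n ^ 6)"
  unfolding solvable_in_time_def
proof (intro exI[of _ "program fl"] allI)
  fix d :: nat
  obtain k where k: "\<And>\<beta>. (\<forall>i. 1 \<le> \<beta> i) \<Longrightarrow> tb \<beta> (program fl) \<le> k * sz \<beta> (program fl)"
    using tb_le_sz[of "program fl"] by blast
  have "\<exists>t s. exec (program fl) (init_state (encode I X)) t s \<and>
      real t \<le> real (k * (54 * Suc d ^ 3)) * (2 powi rotation_tw I D * real (num_agents I) ^ 6) \<and>
      optimal (cost fl) I (output_matching I s)"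
    if sm: "sm_instance I" and dig: "rotation_digraph I D" and dec: "given_decomposition I D X"
      and small: "length (bags X) \<le> d * (num_agents I)\<^sup>2" for I D X
  proof -
    define \<xi> where xi_def: "\<xi> = init_state (encode I X) ''input''"
    interpret solving I X \<xi> D
    proof
      show "holds \<xi> 0 (encode I X)" by (simp add: xi_def holds_def init_state_def)
    qed (use sm dig dec in auto)
    \<comment> \<open>\<open>sz_program\<close> asks for a positive coefficient, hence
      \<open>Suc d\<close> in place of \<open>d\<close>.\<close>
    let ?\<beta> = "bounds (num_agents I) (Suc d) (2 ^ B)" and ?n = "num_agents I"
    have small': "length (bags X) \<le> Suc d * ?n\<^sup>2" using small by simp
    have n1: "1 \<le> ?n" using small by (rule n_pos)
    obtain t s where t: "exec (program fl) (init_state (encode I X)) t s" "t \<le> tb ?\<beta> (program fl)"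
      "optimal (cost fl) I (output_matching I s)"
      using wp_program[OF xi_def small', of fl] unfolding wp_def by blast
    have "1 \<le> ?\<beta> i" for i by (rule bounds_pos[OF n1]) simp_all
    then have "tb ?\<beta> (program fl) \<le> k * sz ?\<beta> (program fl)" by (intro k) simp
    then have "t \<le> k * sz ?\<beta> (program fl)" using t(2) by (rule order_trans[rotated])
    also have "\<dots> \<le> k * (27 * (Suc d ^ 3 * (2 ^ B) ^ 1 * ?n ^ 6))"
      by (intro mult_le_mono2 sz_program n1) simp_all
    finally have "real t \<le> real (k * (27 * (Suc d ^ 3 * (2 ^ B) ^ 1 * ?n ^ 6)))" by (simp only: of_nat_le_iff)
    also have "\<dots> = real k * (27 * (real (Suc d) ^ 3 * 2 ^ B * real ?n ^ 6))" by simp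
    \<comment> \<open>\<open>54\<close> is \<open>27\<close> times the factor \<open>2\<close> of
      \<open>power_B\<close>.\<close>
    also have "\<dots> = real (k * (54 * Suc d ^ 3)) * (2 powi rotation_tw I D * real ?n ^ 6)"
      unfolding power_B by simp
    finally show ?thesis using t by blast
  qed
  then show "\<exists>c. \<forall>I D X. sm_instance I \<longrightarrow> rotation_digraph I D \<longrightarrow> given_decomposition I D X \<longrightarrow>
      length (bags X) \<le> d * num_agents I ^ 2 \<longrightarrow>
      (\<exists>t s. exec (program fl) (init_state (encode I X)) t s \<and>
        real t \<le> c * (2 powi rotation_tw I D * real (num_agents I) ^ 6) \<and>
        optimal (cost fl) I (output_matching I s))"
    by blast
qed

theorem theorem3:
  "solvable_in_time sesm_cost (\<lambda>tw n. 2 powi tw * real n ^ 6) \<and>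
   solvable_in_time bsm_cost (\<lambda>tw n. 2 powi tw * real n ^ 6)"
  using solvable[of 1] solvable[of 0] by simp

end
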